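(* Suppose $n\ge 3$ and let $\eta:[0,\infty)\to[0,\infty)$ be a homeomorphism. Then for every $\eta$-quasisymmetric map $F:F^n_{\mathbb R}\to F^n_{\mathbb R}$ (with respect to the homogeneous distance $d$) there is a constant $C>0$ such that $F$ is a $(2\eta(1)^4,C)$-quasi-similarity.
   Context: For $n\ge 2$, $\mathcal F^n_{\mathbb R}$ is the real Lie algebra with basis $e_1,\dots,e_{n+1}$ whose only nontrivial bracket relations are $[e_1,e_j]=e_{j+1}$, $2\le j\le n$. $F^n_{\mathbb R}$ is the simply connected Lie group with this Lie algebra, identified with $\mathcal F^n_{\mathbb R}$ via the exponential map; the group operation is denoted $*$ (Baker–Campbell–Hausdorff), so the inverse of $g$ is $-g$. The homogeneous distance is $d(g,h)=\|(-g)*h\|$ where $\|\sum_{i=1}^{n+1}x_ie_i\|=(x_1^2+x_2^2)^{1/2}+\sum_{i=3}^{n+1}|x_i|^{\frac1{i-1}}$; it is biLipschitz equivalent to the Carnot metric. A homeomorphism $F:X\to Y$ is $\eta$-quasisymmetric if $\frac{d(F(x),F(y))}{d(F(x),F(z))}\le\eta\left(\frac{d(x,y)}{d(x,z)}\right)$ for all distinct $x,y,z\in X$. For $K\ge1$, $C>0$, a bijection $F:X\to Y$ is a $(K,C)$-quasi-similarity if $\frac CK d(x,y)\le d(F(x),F(y))\le CK\,d(x,y)$ for all $x,y\in X$. *)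

theory Defs
  imports "HOL-Analysis.Analysis"
begin

text \<open>
  The vector \<open>\<Sum>i=1..n+1. x\<^sub>i e\<^sub>i\<close> is represented by the function \<open>i \<mapsto> x\<^sub>i\<close> on \<open>nat\<close>, which is
  \<open>0\<close> outside \<open>{1..n+1}\<close>.  On this set the product topology of \<open>nat \<Rightarrow> real\<close> is
  the usual topology of \<open>\<real>\<^bsup>n+1\<^esup>\<close>, that is, the manifold topology of the group.
\<close>

definition filiform :: "nat \<Rightarrow> (nat \<Rightarrow> real) set" where
  "filiform n = {x. \<forall>i. i \<notin> {1..n+1} \<longrightarrow> x i = 0}"

definition basis_vec :: "nat \<Rightarrow> nat \<Rightarrow> real" where
  "basis_vec i = (\<lambda>k. if k = i then 1 else 0)"

definition basis_bracket :: "nat \<Rightarrow> nat \<Rightarrow> nat \<Rightarrow> nat \<Rightarrow> real" where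
  "basis_bracket n i j =
     (if i = 1 \<and> j \<in> {2..n} then basis_vec (j + 1)
      else if j = 1 \<and> i \<in> {2..n} then (\<lambda>k. - basis_vec (i + 1) k)
      else (\<lambda>k. 0))"

definition bracket :: "nat \<Rightarrow> (nat \<Rightarrow> real) \<Rightarrow> (nat \<Rightarrow> real) \<Rightarrow> nat \<Rightarrow> real" where
  "bracket n x y = (\<lambda>k. \<Sum>i=1..n+1. \<Sum>j=1..n+1. x i * y j * basis_bracket n i j k)"

text \<open>
  The Baker--Campbell--Hausdorff product in Dynkin's form: the sum over all \<open>k\<close> and all
  \<open>(r\<^sub>1,s\<^sub>1), \<dots>, (r\<^sub>k,s\<^sub>k)\<close> with \<open>r\<^sub>i + s\<^sub>i > 0\<close> and total degree \<open>m = \<Sum>i. (r\<^sub>i + s\<^sub>i)\<close> of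
  \<open>(-1)\<^bsup>k-1\<^esup> / (k m \<Prod>i. r\<^sub>i! s\<^sub>i!)\<close> times the right-nested bracket of the word
  \<open>x\<^bsup>r\<^sub>1\<^esup> y\<^bsup>s\<^sub>1\<^esup> \<dots> x\<^bsup>r\<^sub>k\<^esup> y\<^bsup>s\<^sub>k\<^esup>\<close>.  The algebra is nilpotent of step \<open>n\<close>, so that only
  the degrees \<open>m \<le> n\<close> contribute (\<open>nested_bracket_eq_0\<close> below).
\<close>

fun nested_bracket :: "nat \<Rightarrow> (nat \<Rightarrow> real) list \<Rightarrow> nat \<Rightarrow> real" where
  "nested_bracket n [] = (\<lambda>k. 0)"
| "nested_bracket n [x] = x"
| "nested_bracket n (x # y # zs) = bracket n x (nested_bracket n (y # zs))"

definition dynkin_word :: "'a \<Rightarrow> 'a \<Rightarrow> (nat \<times> nat) list \<Rightarrow> 'a list" where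
  "dynkin_word x y ps = concat (map (\<lambda>(r, s). replicate r x @ replicate s y) ps)"

definition dynkin_indices :: "nat \<Rightarrow> nat \<Rightarrow> (nat \<times> nat) list set" where
  "dynkin_indices k m =
     {ps. length ps = k \<and> (\<forall>(r, s)\<in>set ps. r + s > 0) \<and> (\<Sum>(r, s)\<leftarrow>ps. r + s) = m}"

definition bch :: "nat \<Rightarrow> (nat \<Rightarrow> real) \<Rightarrow> (nat \<Rightarrow> real) \<Rightarrow> nat \<Rightarrow> real" where
  "bch n x y = (\<lambda>i. \<Sum>m=1..n. \<Sum>k=1..m. \<Sum>ps\<in>dynkin_indices k m.
     (- 1) ^ (k - 1) / (real k * real m * (\<Prod>(r, s)\<leftarrow>ps. fact r * fact s))
       * nested_bracket n (dynkin_word x y ps) i)"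

definition hom_norm :: "nat \<Rightarrow> (nat \<Rightarrow> real) \<Rightarrow> real" where
  "hom_norm n x = sqrt ((x 1)\<^sup>2 + (x 2)\<^sup>2) + (\<Sum>i=3..n+1. \<bar>x i\<bar> powr (1 / (real i - 1)))"

definition hom_dist :: "nat \<Rightarrow> (nat \<Rightarrow> real) \<Rightarrow> (nat \<Rightarrow> real) \<Rightarrow> real" where
  "hom_dist n g h = hom_norm n (bch n (\<lambda>i. - g i) h)"

text \<open>
  The distances are explicit arguments, since the homogeneous distance is only a quasi-metric:
  it satisfies the triangle inequality up to a multiplicative constant.
\<close>

definition quasisymmetric ::
    "(real \<Rightarrow> real) \<Rightarrow> 'a::topological_space set \<Rightarrow> ('a \<Rightarrow> 'a \<Rightarrow> real) \<Rightarrow>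
     'b::topological_space set \<Rightarrow> ('b \<Rightarrow> 'b \<Rightarrow> real) \<Rightarrow> ('a \<Rightarrow> 'b) \<Rightarrow> bool" where
  "quasisymmetric \<eta> X dX Y dY F \<longleftrightarrow>
     (\<exists>G. homeomorphism X Y F G) \<and>
     (\<forall>x\<in>X. \<forall>y\<in>X. \<forall>z\<in>X. x \<noteq> y \<longrightarrow> y \<noteq> z \<longrightarrow> x \<noteq> z \<longrightarrow>
        dY (F x) (F y) / dY (F x) (F z) \<le> \<eta> (dX x y / dX x z))"

definition quasi_similarity ::
    "real \<Rightarrow> real \<Rightarrow> 'a set \<Rightarrow> ('a \<Rightarrow> 'a \<Rightarrow> real) \<Rightarrow>
     'b set \<Rightarrow> ('b \<Rightarrow> 'b \<Rightarrow> real) \<Rightarrow> ('a \<Rightarrow> 'b) \<Rightarrow> bool" where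
  "quasi_similarity K C X dX Y dY F \<longleftrightarrow>
     K \<ge> 1 \<and> C > 0 \<and> bij_betw F X Y \<and>
     (\<forall>x\<in>X. \<forall>y\<in>X. C / K * dX x y \<le> dY (F x) (F y) \<and> dY (F x) (F y) \<le> C * K * dX x y)"

lemma finite_dynkin_indices: "finite (dynkin_indices k m)"
proof (rule finite_subset)
  show "dynkin_indices k m \<subseteq> {ps. set ps \<subseteq> {..m} \<times> {..m} \<and> length ps = k}"
  proof
    fix ps assume ps: "ps \<in> dynkin_indices k m"
    have "r + s \<le> m" if "(r, s) \<in> set ps" for r s
    proof -
      have "r + s \<in> set (map (\<lambda>(r, s). r + s) ps)"
        using that by force
      then have "r + s \<le> (\<Sum>(r, s)\<leftarrow>ps. r + s)"
        by (rule member_le_sum_list) simp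
      then show ?thesis
        using ps by (simp add: dynkin_indices_def)
    qed
    then show "ps \<in> {ps. set ps \<subseteq> {..m} \<times> {..m} \<and> length ps = k}"
      using ps by (force simp: dynkin_indices_def)
  qed
  show "finite {ps. set ps \<subseteq> {..m} \<times> {..m} \<and> length ps = k}"
    by (rule finite_lists_length_eq) simp
qed

lemma bracket_coord:
  "bracket n x y k = (if k \<in> {3..n+1} then x 1 * y (k - 1) - x (k - 1) * y 1 else 0)"
proof -
  define K where "K = (k \<in> {3..n+1})"
  have eq: "x i * y j * basis_bracket n i j k =
      (if j = k - 1 then if i = 1 then if K then x 1 * y (k - 1) else 0 else 0 else 0)
    - (if j = 1 then if i = k - 1 then if K then x (k - 1) * y 1 else 0 else 0 else 0)"
    for i j
  proof (cases "i = 1")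
    case True
    then show ?thesis by (auto simp: basis_bracket_def basis_vec_def K_def)
  next
    case False
    then show ?thesis by (cases "j = 1") (auto simp: basis_bracket_def basis_vec_def K_def)
  qed
  show ?thesis
  proof (cases K)
    case True
    then have "k - 1 \<in> {1..n+1}" "(1::nat) \<in> {1..n+1}" by (auto simp: K_def)
    then show ?thesis
      using True unfolding bracket_def eq sum_subtractf
      by (simp add: sum.delta K_def[symmetric] del: atLeastAtMost_iff One_nat_def)
  next
    case False
    then show ?thesis
      unfolding bracket_def eq K_def[symmetric] by (simp only: if_False if_cancel diff_self sum.neutral_const)
  qed
qed

lemma nested_bracket_eq_0:
  assumes "set w \<subseteq> filiform n" "length w > n" "n \<ge> 1"
  shows "nested_bracket n w = (\<lambda>k. 0)"
proof -
  have low: "nested_bracket n w i = 0" if "length w \<ge> 2" "i \<le> length w" for w i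
    using that
  proof (induction n w arbitrary: i rule: nested_bracket.induct)
    case (3 n x y zs)
    show ?case
    proof (cases zs)
      case Nil
      then show ?thesis using 3 by (auto simp: bracket_coord)
    next
      case (Cons a list)
      then show ?thesis using 3 by (auto simp: bracket_coord)
    qed
  qed auto
  have high: "nested_bracket n w i = 0" if "i > n + 1" for i
    using assms that by (cases "(n, w)" rule: nested_bracket.cases) (auto simp: bracket_coord)
  show ?thesis
  proof
    fix i
    show "nested_bracket n w i = 0"
      using low[of w i] high[of i] assms(2,3) by (cases "i \<le> length w") auto
  qed
qed

end

theory Submission
  imports Defs "HOL-Library.Diagonal_Subsequence"
begin

text \<open>
  In coordinates the group is the set of pairs \<open>(a, P)\<close> of a real number and a polynomial modulo
  \<open>z\<^sup>n\<close>, with \<open>(a, P) (b, Q) = (a + b, P + e\<^bsup>az\<^esup> Q)\<close>; the exponential chart multiplies \<open>P\<close> by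
  \<open>(e\<^bsup>az\<^esup> - 1) / (az)\<close>.  Call the cosets of the one-parameter group of \<open>e\<^sub>2\<close> lines.

  \<^emph>\<open>Lines go to lines.\<close>  Counting lattice points in the target bounds the mean, over the lines of a
  fine grid, of the \<open>Q\<close>-th power of the difference quotients of \<open>F\<close>, where \<open>Q\<close> is the homogeneous
  dimension.  The horizontal coordinates of \<open>F\<close> along lines thus give martingales of bounded energy,
  and most of them are nearly constant at some scale.  If the first coordinate of \<open>F\<close> were
  not constant on lines, then rescaling \<open>F\<close> at such a scale would give in the limit a quasisymmetric map
  of a family of parallel lines, at the distances \<open>j\<^bsup>1/(n-1)\<^esup>\<close>, onto horizontal lines that are not parallel
  to \<open>e\<^sub>2\<close>.  Such lines stay at bounded distance only if they differ by a central element, so the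
  images would be at the distances \<open>O(j\<^bsup>1/n\<^esup>)\<close>, a contradiction for \<open>n \<ge> 3\<close>.  The remaining coordinates
  along a line are at least quadratic in the steps, so that they are constant as well.  The same holds
  for the inverse map; hence \<open>F\<close> maps lines onto lines.

  \<^emph>\<open>Common speed.\<close>  Let \<open>H = \<eta>(1)\<close>.  A line and its translate by a central element of norm \<open>r\<close> have
  parallel images.  If \<open>D\<close> is the distance of the images, then \<open>F\<close> moves points of the line at distance
  \<open>r\<close> to points at a distance between \<open>D / H\<close> and \<open>H\<^sup>2 D\<close>.  Two lines diverge sublinearly, so the
  asymptotic speed \<open>s\<close> is the same for all lines, and \<open>D / H \<le> s r \<le> H\<^sup>2 D\<close>.  Thus \<open>F\<close> stretches
  distances on lines by factors between \<open>s / H\<^sup>3\<close> and \<open>s H\<^sup>3\<close>, and every pair of points can be compared with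
  a pair on a line at the cost of another \<open>H\<close>.
\<close>

section \<open>The Baker--Campbell--Hausdorff product\<close>

unbundle no vec_syntax
unbundle fps_syntax

text \<open>No differential of \<open>F\<close> is ever formed. A blow-up at one finite scale
  replaces it, and the limit of the blow-ups is taken only at the countably many points
  \<open>wpt n j t\<close> with natural j and t. The obstacle is that more and more neighbouring
  lines must be nearly affine at one common scale while the slope of one of them stays away from 0
  and the blow-ups stay bounded; hence the penalties of \<open>good_line\<close>, with constants
  independent of the number of lines. The neighbours are taken in the direction z^(n-2), the
  noncentral direction of highest weight. Central translates would give no contradiction, because
  parallel horizontal lines may well differ by a central element. The power in the energy is
  dictated by scaling: the lines of the grid form a family of dimension one less than the
  homogeneous dimension Q, and for the power Q the mean over lines is bounded independently of the
  scale. Series are not truncated, so points are compared by \<open>gdist n\<close> being 0 instead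
  of by equality. The locale \<open>qs_map\<close> is stable under translations, dilations and
  inversion of the map, so many statements are needed only for the unit segment at the
  identity.\<close>

definition phi :: "real \<Rightarrow> real fps" where
  "phi a = Abs_fps (\<lambda>i. a ^ i / fact (Suc i))"

lemma phi_nth [simp]: "phi a $ i = a ^ i / fact (Suc i)"
  by (simp add: phi_def)

lemma phi_nonzero [simp]: "phi a \<noteq> 0"
proof -
  have "phi a $ 0 = 1" by simp
  then show ?thesis by (metis fps_zero_nth zero_neq_one)
qed

lemma phi_0 [simp]: "phi 0 = 1"
  by (rule fps_ext) simp

lemma X_phi: "fps_X * fps_const a * phi a = fps_exp a - 1"
proof (rule fps_ext)
  fix i show "(fps_X * fps_const a * phi a) $ i = (fps_exp a - 1) $ i"
    by (cases i) (simp_all add: mult.assoc del: fact_Suc)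
qed

text \<open>Equivalent to the fact that z \<open>phi a\<close>, which is (e^(az) - 1)/a for nonzero
  a, has derivative e^(az). The operator z d/dz counts degrees, as the factor 1/m of Dynkin's
  formula demands.\<close>

lemma X_deriv_phi:
  "fps_X * fps_deriv (phi a) = fps_exp a - phi a"
proof (rule fps_ext)
  fix i show "(fps_X * fps_deriv (phi a)) $ i = (fps_exp a - phi a) $ i"
  proof (cases i)
    case (Suc m)
    have "real (Suc m) * x / fact (Suc (Suc m)) = x / fact (Suc m) - x / fact (Suc (Suc m))" for x :: real
      by (simp add: fact_Suc[of "Suc m"] divide_simps del: fact_Suc) (simp add: algebra_simps)
    then show ?thesis using Suc by (simp del: fact_Suc)
  qed simp
qed

text \<open>
  For letters \<open>s\<^sub>i e\<^sub>1 + v\<^sub>i e\<^sub>2\<close> the right-nested bracket of a word of length \<open>m \<ge> 2\<close> is \<open>wcoef\<close> times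
  \<open>e\<^bsub>m+1\<^esub>\<close>; \<open>lcoef\<close> drops the second term of the innermost bracket.
\<close>

fun lcoef :: "(real \<times> real) list \<Rightarrow> real" where
  "lcoef [] = 0"
| "lcoef [(s, v)] = v"
| "lcoef ((s, v) # z # zs) = s * lcoef (z # zs)"

fun wcoef :: "(real \<times> real) list \<Rightarrow> real" where
  "wcoef [] = 0"
| "wcoef [(s, v)] = v"
| "wcoef ((s, v) # (s', v') # zs) = s * wcoef ((s', v') # zs) - (if zs = [] then s' * v else 0)"

text \<open>Once the innermost bracket is formed, the element is a multiple of some e_i with i >= 3,
  on which e_2 acts trivially; every further letter contributes only its e_1 coefficient.\<close>

lemma wcoef_append:
  assumes "length w \<ge> 2"
  shows "wcoef (u @ w) = prod_list (map fst u) * wcoef w"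
proof (induction u)
  case (Cons p u)
  obtain s v where p: "p = (s, v)" by force
  obtain q w' where q: "u @ w = q # w'" "w' \<noteq> []"
    using assms by (cases "u @ w"; cases u; cases w; cases "tl w") auto
  obtain s' v' where "q = (s', v')" by force
  then show ?case using Cons q p by simp
qed simp

lemma lcoef_append: "w \<noteq> [] \<Longrightarrow> lcoef (u @ w) = prod_list (map fst u) * lcoef w"
proof (induction u)
  case (Cons p u)
  obtain s v where p: "p = (s, v)" by force
  obtain q w' where q: "u @ w = q # w'"
    using Cons.prems by (cases "u @ w") auto
  then show ?case using Cons p by simp
qed simp

text \<open>The exceptional case of \<open>wcoef_append\<close>: with a single last letter the
  innermost bracket is still open, and its antisymmetry produces a second term. This term is the
  source of the correction in \<open>dynkin_fps_Suc\<close>.\<close>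

lemma wcoef_snoc:
  "wcoef (u @ [(s, v)]) = prod_list (map fst u) * v - s * lcoef u"
proof (induction u rule: lcoef.induct)
  case (2 s' v')
  then show ?case by simp
next
  case (3 s' v' z zs)
  obtain s'' v'' where z: "z = (s'', v'')" by force
  have "wcoef (((s', v') # z # zs) @ [(s, v)]) = s' * wcoef ((z # zs) @ [(s, v)])"
    by (simp add: z)
  then show ?case unfolding 3 by (simp add: algebra_simps)
qed simp

lemma wcoef_swap: "wcoef (u @ [p, p]) = 0"
  by (cases p) (simp add: wcoef_append)

section \<open>Summation of Dynkin's series\<close>

lemma dynkin_word_simps [simp]:
  "dynkin_word x y [] = []"
  "dynkin_word x y ((r, s) # ps) = (replicate r x @ replicate s y) @ dynkin_word x y ps"
  by (simp_all add: dynkin_word_def)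

lemma map_dynkin_word: "map f (dynkin_word x y ps) = dynkin_word (f x) (f y) ps"
  by (induction ps) (auto simp: )

lemma length_dynkin_word: "length (dynkin_word x y ps) = (\<Sum>(r, s)\<leftarrow>ps. r + s)"
  by (induction ps) auto

lemma dynkin_indices_0: "dynkin_indices 0 m = (if m = 0 then {[]} else {})"
  by (auto simp: dynkin_indices_def)

lemma sum_dynkin_indices_Suc:
  fixes f :: "(nat \<times> nat) list \<Rightarrow> real"
  shows "(\<Sum>ps\<in>dynkin_indices (Suc k) m. f ps) =
    (\<Sum>i=1..m. \<Sum>r\<le>i. \<Sum>ps\<in>dynkin_indices k (m - i). f ((r, i - r) # ps))"
proof -
  have "(\<Sum>i=1..m. \<Sum>r\<le>i. \<Sum>ps\<in>dynkin_indices k (m - i). f ((r, i - r) # ps)) =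
      (\<Sum>(i, r, ps)\<in>(SIGMA i:{1..m}. SIGMA r:{..i}. dynkin_indices k (m - i)). f ((r, i - r) # ps))"
    by (simp add: sum.Sigma finite_dynkin_indices)
  also have "\<dots> = (\<Sum>ps\<in>dynkin_indices (Suc k) m. f ps)"
    by (rule sum.reindex_bij_witness[where i = "\<lambda>ps. (fst (hd ps) + snd (hd ps), fst (hd ps), tl ps)"
          and j = "\<lambda>(i, r, ps). (r, i - r) # ps"])
      (auto simp: dynkin_indices_def length_Suc_conv)
  finally show ?thesis ..
qed

text \<open>This is log(1 + (e^(cz) - 1)) = cz. The truncation at K is exact up to the coefficient K
  because e^(cz) - 1 starts with z. Differentiation turns the sum into a geometric one with a
  remainder of order K.\<close>

lemma log_exp_trunc:
  assumes "m \<le> K"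
  shows "((\<Sum>k=1..K. fps_const ((- 1) ^ (k - 1) / real k) * (fps_exp c - 1) ^ k) $ m)
    = (fps_X * fps_const c) $ m"
proof (cases m)
  case (Suc m')
  let ?E = "fps_exp c - 1 :: real fps"
  let ?S = "\<Sum>k=1..K. fps_const ((- 1) ^ (k - 1) / real k) * ?E ^ k"
  have dE: "fps_deriv ?E = fps_const c * (1 + ?E)" by simp
  have "fps_deriv ?S = (\<Sum>k=1..K. fps_const c * (1 + ?E) * (- ?E) ^ (k - 1))"
    unfolding fps_deriv_sum
  proof (rule sum.cong[OF refl])
    fix k assume k: "k \<in> {1..K}"
    then have e: "(- ?E) ^ (k - 1) = fps_const ((- 1) ^ (k - 1)) * ?E ^ (k - 1)"
      unfolding power_minus[of ?E] by (metis fps_const_power fps_const_neg fps_const_1_eq_1)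
    have "fps_deriv (fps_const ((- 1) ^ (k - 1) / real k) * ?E ^ k)
      = fps_const ((- 1) ^ (k - 1) / real k) * (fps_const (real k) * fps_deriv ?E * ?E ^ (k - 1))"
      by (simp only: fps_deriv_mult_const_left fps_deriv_power)
    also have "\<dots> = fps_const ((- 1) ^ (k - 1) / real k * real k) * (fps_deriv ?E * ?E ^ (k - 1))"
    proof -
      have "x * (y * z * w) = x * y * (z * w)" for x y z w :: "real fps" by (simp only: mult.assoc)
      then show ?thesis by (simp only: fps_const_mult)
    qed
    finally have d: "fps_deriv (fps_const ((- 1) ^ (k - 1) / real k) * ?E ^ k)
      = fps_const ((- 1) ^ (k - 1) / real k * real k) * (fps_deriv ?E * ?E ^ (k - 1))" .
    show "fps_deriv (fps_const ((- 1) ^ (k - 1) / real k) * ?E ^ k)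
      = fps_const c * (1 + ?E) * (- ?E) ^ (k - 1)"
    proof -
      have "(- 1) ^ (k - 1) / real k * real k = (- 1) ^ (k - 1)" using k by simp
      moreover have "x * (y * z * w) = y * z * (x * w)" for x y z w :: "real fps"
        by (simp only: mult_ac)
      ultimately show ?thesis unfolding d e dE by (simp only:)
    qed
  qed
  also have "\<dots> = fps_const c * ((1 - (- ?E)) * (\<Sum>k<K. (- ?E) ^ k))"
    unfolding One_nat_def sum.atLeast1_atMost_eq
    by (simp only: sum_distrib_left[symmetric] diff_Suc_Suc diff_zero mult.assoc minus_minus diff_minus_eq_add)
  also have "(1 - (- ?E)) * (\<Sum>k<K. (- ?E) ^ k) = 1 - (- ?E) ^ K"
    by (rule one_diff_power_eq[symmetric])
  finally have d: "fps_deriv ?S = fps_const c * (1 - (- ?E) ^ K)" .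
  have "((- ?E) ^ K) $ m' = 0"
  proof (rule startsby_zero_power_prefix[rule_format])
    show "(- ?E) $ 0 = 0" by simp
    show "m' < K" using assms Suc by simp
  qed
  then have "fps_deriv ?S $ m' = (fps_const c * 1) $ m'"
    unfolding d fps_mult_left_const_nth fps_sub_nth by simp
  moreover have "fps_deriv (fps_X * fps_const c) $ m' = (fps_const c * 1) $ m'" by simp
  ultimately have "fps_deriv ?S $ m' = fps_deriv (fps_X * fps_const c) $ m'" by (simp only:)
  then have "of_nat (m' + 1) * ?S $ (m' + 1) = of_nat (m' + 1) * (fps_X * fps_const c) $ (m' + 1)"
    by (simp only: fps_deriv_nth)
  then have "?S $ (m' + 1) = (fps_X * fps_const c) $ (m' + 1)"
    by (rule mult_left_cancel[THEN iffD1, rotated]) simp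
  then show ?thesis unfolding Suc Suc_eq_plus1 .
next
  case 0
  have "(\<Sum>k=1..K. fps_const ((- 1) ^ (k - 1) / real k) * (fps_exp c - 1) ^ k) $ 0 = (0 :: real)"
    unfolding fps_sum_nth
  proof (rule sum.neutral, rule ballI)
    fix k assume "k \<in> {1..K}"
    then show "(fps_const ((- 1) ^ (k - 1) / real k) * (fps_exp c - 1) ^ k) $ 0 = (0 :: real)"
      by (simp only: fps_mult_nth_0 fps_power_zeroth) simp
  qed
  then show ?thesis using 0 by simp
qed

text \<open>\<open>log_exp_trunc\<close> divided by cz; this lowers the index of the coefficient by
  one and makes \<open>c = 0\<close> a separate case.\<close>

lemma log_exp_phi_trunc:
  assumes "m < K"
  shows "((\<Sum>k=1..K. fps_const ((- 1) ^ (k - 1) / real k) * (fps_exp c - 1) ^ (k - 1)) * phi c) $ m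
    = (1 :: real fps) $ m"
proof (cases "c = 0")
  case True
  have "(\<Sum>k=1..K. fps_const ((- 1) ^ (k - 1) / real k) * (0 :: real fps) ^ (k - 1)) = 1"
  proof -
    have "(\<Sum>k=1..K. fps_const ((- 1) ^ (k - 1) / real k) * (0 :: real fps) ^ (k - 1))
      = (\<Sum>k\<in>{1}. fps_const ((- 1) ^ (k - 1) / real k) * (0 :: real fps) ^ (k - 1))"
      using assms by (intro sum.mono_neutral_right) auto
    then show ?thesis by simp
  qed
  then show ?thesis using True by simp
next
  case False
  let ?S = "\<Sum>k=1..K. fps_const ((- 1) ^ (k - 1) / real k) * (fps_exp c - 1) ^ (k - 1) :: real fps"
  have "fps_X * fps_const c * (?S * phi c) = (fps_exp c - 1) * ?S"
    unfolding X_phi[symmetric] by (simp only: mult_ac)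
  also have "\<dots> = (\<Sum>k=1..K. fps_const ((- 1) ^ (k - 1) / real k) * (fps_exp c - 1) ^ k)"
    unfolding sum_distrib_left
  proof (rule sum.cong[OF refl])
    fix k assume "k \<in> {1..K}"
    then obtain j where "k = Suc j" by (cases k) auto
    then show "(fps_exp c - 1) * (fps_const ((- 1) ^ (k - 1) / real k) * (fps_exp c - 1) ^ (k - 1))
      = fps_const ((- 1) ^ (k - 1) / real k) * (fps_exp c - 1) ^ k"
      by (simp only: diff_Suc_1 power_Suc mult.left_commute)
  qed
  finally have "(fps_X * fps_const c * (?S * phi c)) $ Suc m = (fps_X * fps_const c) $ Suc m"
    using log_exp_trunc[of "Suc m" K c] assms by simp
  then show ?thesis using False by (cases m) (simp_all add: mult.assoc)
qed

context
  fixes a b vx vy :: real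
begin

definition block_weight :: "(nat \<times> nat) list \<Rightarrow> real" where
  "block_weight ps = (\<Prod>(r, s)\<leftarrow>ps. fact r * fact s)"

text \<open>The variable of the series marks the degree m, while the number k of blocks is fixed;
  splitting off a block then becomes a multiplication of series.\<close>

definition dynkin_fps :: "nat \<Rightarrow> real fps" where
  "dynkin_fps k = Abs_fps (\<lambda>m. \<Sum>ps\<in>dynkin_indices k m.
     wcoef (dynkin_word (a, vx) (b, vy) ps) / block_weight ps)"

text \<open>The second component of the product of (a, \<open>phi a\<close> vx) and (b,
  \<open>phi b\<close> vy) in the model group, that is, of exp x exp y.\<close>

definition exp_prod_fps :: "real fps" where
  "exp_prod_fps = phi a * fps_const vx + fps_exp a * phi b * fps_const vy"

text \<open>The word x^r y^s has \<open>lcoef\<close> equal to a^r b^(s-1) vy if s > 0 and to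
  a^(r-1) vx if s = 0 < r. The missing factor b or a explains both the series \<open>phi\<close> in
  place of an exponential and the extra z.\<close>

lemma lcoef_block:
  "(\<Sum>r\<le>m. lcoef (replicate r (a, vx) @ replicate (m - r) (b, vy)) / (fact r * fact (m - r))) =
    (fps_X * exp_prod_fps) $ m"
proof (cases m)
  case (Suc m')
  have rep: "lcoef (replicate (Suc i) (s, v)) = s ^ i * v" for i s v
    by (induction i) auto
  have "(\<Sum>r\<le>m. lcoef (replicate r (a, vx) @ replicate (m - r) (b, vy)) / (fact r * fact (m - r)))
     = (\<Sum>r\<le>m'. a ^ r / fact r * (b ^ (m' - r) / fact (Suc (m' - r))) * vy) + a ^ m' * vx / fact m"
    unfolding Suc sum.atMost_Suc
  proof (rule arg_cong2[of _ _ _ _ "(+)"])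
    show "(\<Sum>r\<le>m'. lcoef (replicate r (a, vx) @ replicate (Suc m' - r) (b, vy)) / (fact r * fact (Suc m' - r)))
      = (\<Sum>r\<le>m'. a ^ r / fact r * (b ^ (m' - r) / fact (Suc (m' - r))) * vy)"
    proof (rule sum.cong[OF refl])
      fix r assume "r \<in> {..m'}"
      then have e: "Suc m' - r = Suc (m' - r)" by auto
      show "lcoef (replicate r (a, vx) @ replicate (Suc m' - r) (b, vy)) / (fact r * fact (Suc m' - r))
        = a ^ r / fact r * (b ^ (m' - r) / fact (Suc (m' - r))) * vy"
        unfolding e by (subst lcoef_append) (simp_all add: rep del: replicate.simps fact_Suc)
    qed
    show "lcoef (replicate (Suc m') (a, vx) @ replicate (Suc m' - Suc m') (b, vy)) /
        (fact (Suc m') * fact (Suc m' - Suc m')) = a ^ m' * vx / fact (Suc m')"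
      by (simp add: rep del: replicate_Suc fact_Suc)
  qed
  also have "\<dots> = (fps_X * exp_prod_fps) $ m"
    by (simp add: Suc exp_prod_fps_def fps_mult_nth[of "fps_exp a"] atLeast0AtMost
        sum_distrib_right sum_distrib_left del: fact_Suc)
  finally show ?thesis .
qed simp

text \<open>In a single block x^r y^s of at least two letters the last two letters are equal unless
  s = 1 and r > 0, so \<open>wcoef_swap\<close> leaves one word in every degree m >= 2.\<close>

lemma dynkin_fps_1:
  "dynkin_fps 1 = fps_X * (fps_const vx + fps_exp a * fps_const vy
     - fps_X * fps_const b * phi a * fps_const vx)"
proof (rule fps_ext)
  fix m
  have D: "dynkin_indices (Suc 0) m = (if m = 0 then {} else (\<lambda>r. [(r, m - r)]) ` {..m})"
    by (auto simp: dynkin_indices_def length_Suc_conv image_iff)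
  have inj: "inj_on (\<lambda>r. [(r, m - r)]) {..m}"
    by (auto simp: inj_on_def)
  have repl: "lcoef (replicate (Suc i) (s, v)) = s ^ i * v" for i s v
    by (induction i) auto
  have repw: "wcoef (replicate (Suc i) (s, v)) = (if i = 0 then v else 0)" for i s v
  proof (cases i)
    case (Suc i')
    then have "replicate (Suc i) (s, v) = replicate i' (s, v) @ [(s, v), (s, v)]"
      by (simp add: replicate_append_same[symmetric])
    then show ?thesis using Suc wcoef_swap by simp
  qed auto
  show "dynkin_fps 1 $ m = (fps_X * (fps_const vx + fps_exp a * fps_const vy
     - fps_X * fps_const b * phi a * fps_const vx)) $ m"
  proof (cases m)
    case 0
    then show ?thesis using D by (simp add: dynkin_fps_def)
  next
    case (Suc m')
    let ?w = "\<lambda>r. wcoef (replicate r (a, vx) @ replicate (m - r) (b, vy)) / (fact r * fact (m - r))"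
    have "dynkin_fps 1 $ m = (\<Sum>r\<le>m. ?w r)"
    proof -
      have D': "dynkin_indices (Suc 0) m = (\<lambda>r. [(r, m - r)]) ` {..m}"
        using D Suc by simp
      show ?thesis
        unfolding dynkin_fps_def fps_nth_Abs_fps One_nat_def D' sum.reindex[OF inj]
        by (simp add: block_weight_def o_def del: sum.atMost_Suc)
    qed
    also have "\<dots> = (\<Sum>r\<in>{m', m}. ?w r)"
    proof (rule sum.mono_neutral_right)
      show "\<forall>r\<in>{..m} - {m', m}. ?w r = 0"
      proof
        fix r assume "r \<in> {..m} - {m', m}"
        then have "m - r = Suc (Suc (m - r - 2))"
          using \<open>m = Suc m'\<close> by auto
        then have "replicate r (a, vx) @ replicate (m - r) (b, vy) =
            (replicate r (a, vx) @ replicate (m - r - 2) (b, vy)) @ [(b, vy), (b, vy)]"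
          by (metis append.assoc append_Cons append_Nil replicate_Suc replicate_append_same)
        then show "?w r = 0" by (simp only: wcoef_swap div_0)
      qed
    qed (auto simp: Suc)
    also have "\<dots> = ?w m + ?w m'" using Suc by simp
    also have "\<dots> = (fps_X * (fps_const vx + fps_exp a * fps_const vy
     - fps_X * fps_const b * phi a * fps_const vx)) $ m"
    proof (cases m')
      case 0
      then show ?thesis using Suc by simp
    next
      case (Suc m'')
      have "?w m = 0" unfolding \<open>m = Suc m'\<close> Suc
        by (simp only: diff_self_eq_0 replicate_0 append_Nil2 repw) simp
      moreover have "?w m' = (a ^ m' * vy - b * (a ^ m'' * vx)) / fact m'"
      proof -
        have "m - m' = Suc 0" using \<open>m = Suc m'\<close> by simp
        then show ?thesis
          by (simp only: replicate_Suc[of 0] replicate_0 wcoef_snoc) (simp only: Suc repl, simp)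
      qed
      ultimately show ?thesis
        unfolding \<open>m = Suc m'\<close> Suc by (simp add: mult.assoc[of fps_X] diff_divide_distrib del: fact_Suc)
    qed
    finally show ?thesis .
  qed
qed

lemma binomial_exp_nth:
  "(\<Sum>r\<le>i. a ^ r * b ^ (i - r) / (fact r * fact (i - r))) = fps_exp (a + b) $ i"
  by (simp only: fps_exp_add_mult fps_mult_nth atLeast0AtMost fps_exp_nth of_nat_fact times_divide_times_eq)

lemma dynkin_indices_1:
  "k \<ge> 1 \<Longrightarrow> dynkin_indices k 0 = {}"
  "dynkin_indices 1 1 = {[(1, 0)], [(0, 1)]}"
  "k \<ge> 2 \<Longrightarrow> dynkin_indices k 1 = {}"
proof -
  show "k \<ge> 1 \<Longrightarrow> dynkin_indices k 0 = {}"
    by (cases k) (auto simp: dynkin_indices_def length_Suc_conv)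
  show "dynkin_indices 1 1 = {[(1, 0)], [(0, 1)]}"
    by (auto simp: dynkin_indices_def length_Suc_conv)
  show "k \<ge> 2 \<Longrightarrow> dynkin_indices k 1 = {}"
    by (cases k; cases "k - 1") (auto simp: dynkin_indices_def length_Suc_conv)
qed

text \<open>
  Splitting off the first block of a Dynkin word multiplies by \<open>e\<^bsup>(a+b)z\<^esup> - 1\<close>, so that the sum over the
  number of blocks becomes a logarithmic series.
\<close>

lemma dynkin_fps_Suc:
  assumes "k \<ge> 1"
  shows "dynkin_fps (Suc k) = (fps_exp (a + b) - 1) * dynkin_fps k
    - (if k = 1 then fps_X * fps_const (a + b) * (fps_X * exp_prod_fps) else 0)"
proof (rule fps_ext)
  fix m
  define X Y where "X = (a, vx)" and "Y = (b, vy)"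
  define g where "g ps = wcoef (dynkin_word X Y ps) / block_weight ps" for ps
  define c where "c r i = a ^ r * b ^ (i - r) / (fact r * fact (i - r))" for r i :: nat
  define lc where "lc r i = lcoef (replicate r X @ replicate (i - r) Y) / (fact r * fact (i - r))"
    for r i :: nat
  \<comment> \<open>Correction for a remainder that is a single letter, which occurs only for
    \<open>k = 1\<close> and \<open>i = m - 1\<close>; there \<open>wcoef_snoc\<close> takes the
    place of \<open>wcoef_append\<close>.\<close>
  define cor where "cor i = (if k = 1 \<and> Suc i = m then (a + b) * (fps_X * exp_prod_fps) $ i else 0)" for i
  have prodl: "prod_list (map fst (replicate r X @ replicate s Y)) = a ^ r * b ^ s" for r s
    by (simp add: X_def Y_def)
  have inner: "(\<Sum>r\<le>i. \<Sum>ps\<in>dynkin_indices k (m - i).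
        wcoef (dynkin_word X Y ((r, i - r) # ps)) / block_weight ((r, i - r) # ps))
      = fps_exp (a + b) $ i * dynkin_fps k $ (m - i) - cor i" if "i \<in> {1..m}" for i
  proof -
    consider "m - i = 0" | "m - i = 1" "k = 1" | "m - i = 1" "k \<ge> 2" | "m - i \<ge> 2"
      using assms by linarith
    then show ?thesis
    proof cases
      case 1
      then show ?thesis using dynkin_indices_1(1)[OF assms] that by (simp add: dynkin_fps_def cor_def)
    next
      case 2
      have m: "m = Suc i" using 2(1) by simp
      have w1: "wcoef (dynkin_word X Y ((r, i - r) # ps)) / block_weight ((r, i - r) # ps)
          = c r i * g ps - s * lc r i"
        if "ps = [(1, 0)] \<and> s = a \<or> ps = [(0, 1)] \<and> s = b" for r ps s
        using that wcoef_snoc[of "replicate r X @ replicate (i - r) Y" a vx]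
          wcoef_snoc[of "replicate r X @ replicate (i - r) Y" b vy]
        by (auto simp: g_def c_def lc_def block_weight_def X_def Y_def diff_divide_distrib)
      have "(\<Sum>r\<le>i. \<Sum>ps\<in>dynkin_indices k (m - i).
        wcoef (dynkin_word X Y ((r, i - r) # ps)) / block_weight ((r, i - r) # ps))
        = (\<Sum>r\<le>i. c r i * (g [(1, 0)] + g [(0, 1)]) - (a + b) * lc r i)"
        unfolding 2 dynkin_indices_1(2)
      proof (rule sum.cong[OF refl])
        fix r
        have two: "(\<Sum>ps\<in>{[(1, 0)], [(0, 1)]}. h ps) = h [(1, 0)] + h [(0, 1)]"
          for h :: "(nat \<times> nat) list \<Rightarrow> real" by simp
        show "(\<Sum>ps\<in>{[(1, 0)], [(0, 1)]}. wcoef (dynkin_word X Y ((r, i - r) # ps)) / block_weight ((r, i - r) # ps))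
          = c r i * (g [(1, 0)] + g [(0, 1)]) - (a + b) * lc r i"
          unfolding two w1[of "[(1, 0)]" a r, OF disjI1[OF conjI[OF refl refl]]]
            w1[of "[(0, 1)]" b r, OF disjI2[OF conjI[OF refl refl]]]
          by (simp only: algebra_simps)
      qed
      also have "\<dots> = (\<Sum>r\<le>i. c r i) * (g [(1, 0)] + g [(0, 1)]) - (a + b) * (\<Sum>r\<le>i. lc r i)"
        by (simp add: sum_subtractf sum_distrib_right sum_distrib_left)
      also have "(\<Sum>r\<le>i. c r i) = fps_exp (a + b) $ i"
        unfolding c_def by (rule binomial_exp_nth)
      also have "(\<Sum>r\<le>i. lc r i) = (fps_X * exp_prod_fps) $ i"
        unfolding lc_def X_def Y_def by (rule lcoef_block)
      also have "g [(1, 0)] + g [(0, 1)] = dynkin_fps k $ (m - i)"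
        unfolding 2 by (simp add: dynkin_fps_def dynkin_indices_1(2)[simplified] g_def X_def Y_def)
      finally show ?thesis using m 2 by (simp add: cor_def)
    next
      case 3
      then show ?thesis using dynkin_indices_1(3)[of k] by (simp add: dynkin_fps_def cor_def)
    next
      case 4
      have "(\<Sum>r\<le>i. \<Sum>ps\<in>dynkin_indices k (m - i).
        wcoef (dynkin_word X Y ((r, i - r) # ps)) / block_weight ((r, i - r) # ps))
        = (\<Sum>r\<le>i. \<Sum>ps\<in>dynkin_indices k (m - i). c r i * g ps)"
      proof (intro sum.cong refl)
        fix r ps assume "ps \<in> dynkin_indices k (m - i)"
        then have "length (dynkin_word X Y ps) \<ge> 2"
          using 4 by (simp add: length_dynkin_word dynkin_indices_def)
        then show "wcoef (dynkin_word X Y ((r, i - r) # ps)) / block_weight ((r, i - r) # ps) = c r i * g ps"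
          unfolding dynkin_word_simps by (subst wcoef_append) (simp_all only: prodl, simp add: c_def g_def block_weight_def)
      qed
      also have "\<dots> = (\<Sum>r\<le>i. c r i) * (\<Sum>ps\<in>dynkin_indices k (m - i). g ps)"
        by (simp add: sum_product)
      also have "(\<Sum>r\<le>i. c r i) = fps_exp (a + b) $ i"
        unfolding c_def by (rule binomial_exp_nth)
      also have "(\<Sum>ps\<in>dynkin_indices k (m - i). g ps) = dynkin_fps k $ (m - i)"
        by (simp add: dynkin_fps_def g_def X_def Y_def)
      finally show ?thesis
      proof -
        have "cor i = 0" using 4 by (auto simp: cor_def)
        moreover assume "(\<Sum>r\<le>i. \<Sum>ps\<in>dynkin_indices k (m - i).
            wcoef (dynkin_word X Y ((r, i - r) # ps)) / block_weight ((r, i - r) # ps))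
          = fps_exp (a + b) $ i * dynkin_fps k $ (m - i)"
        ultimately show ?thesis by linarith
      qed
    qed
  qed
  have "dynkin_fps (Suc k) $ m = (\<Sum>i=1..m. fps_exp (a + b) $ i * dynkin_fps k $ (m - i) - cor i)"
    unfolding dynkin_fps_def fps_nth_Abs_fps X_def[symmetric] Y_def[symmetric] sum_dynkin_indices_Suc
    using inner unfolding dynkin_fps_def fps_nth_Abs_fps X_def[symmetric] Y_def[symmetric]
    by (intro sum.cong) auto
  also have "\<dots> = (\<Sum>i=1..m. fps_exp (a + b) $ i * dynkin_fps k $ (m - i)) - (\<Sum>i=1..m. cor i)"
    by (rule sum_subtractf)
  also have "(\<Sum>i=1..m. fps_exp (a + b) $ i * dynkin_fps k $ (m - i)) =
      ((fps_exp (a + b) - 1) * dynkin_fps k) $ m"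
    by (simp add: fps_mult_nth sum.atLeast_Suc_atMost[of 0 m])
  also have "(\<Sum>i=1..m. cor i) =
      (if k = 1 then fps_X * fps_const (a + b) * (fps_X * exp_prod_fps) else 0) $ m"
  proof (cases "k = 1 \<and> m \<ge> 2")
    case True
    then obtain m' where m: "m = Suc (Suc m')" by (metis add_2_eq_Suc le_Suc_ex)
    have "(\<Sum>i=1..m. cor i) = (\<Sum>i\<in>{Suc m'}. cor i)"
      by (rule sum.mono_neutral_right) (auto simp: cor_def m)
    then show ?thesis using True m by (simp add: cor_def mult.assoc)
  next
    case False
    then have "(\<Sum>i=1..m. cor i) = 0"
      by (intro sum.neutral) (auto simp: cor_def)
    moreover have "k = 1 \<Longrightarrow> m = 0 \<or> m = 1" using False by linarith
    ultimately show ?thesis by (auto simp: mult.assoc)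
  qed
  finally show "dynkin_fps (Suc k) $ m = ((fps_exp (a + b) - 1) * dynkin_fps k
    - (if k = 1 then fps_X * fps_const (a + b) * (fps_X * exp_prod_fps) else 0)) $ m"
    by simp
qed

text \<open>\<open>l\<close> is the expected logarithm of exp x exp y. Apart from the summand z
  \<open>l\<close> for k = 1, the terms are powers of e^(cz) - 1 times the common factor
  \<open>phi c * G\<close>, and \<open>log_exp_phi_trunc\<close> collapses their sum to
  \<open>G\<close>. The operator z d/dz on the right records the degree, by which Dynkin's formula
  still divides.\<close>

lemma dynkin_fps_sum:
  assumes "m \<le> K" "K \<ge> 1"
  shows "(\<Sum>k=1..K. (- 1) ^ (k - 1) / real k * dynkin_fps k $ m)
    = (fps_X * fps_deriv (fps_X * (inverse (phi (a + b)) * exp_prod_fps))) $ m"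
proof -
  define c where "c = a + b"
  define q where "q = exp_prod_fps"
  define l where "l = inverse (phi c) * q"
  define G where "G = fps_X * (fps_deriv (fps_X * l) - l)"
  let ?E = "fps_exp c - 1 :: real fps"
  have ql: "q = phi c * l" unfolding l_def by (simp add: mult.assoc[symmetric] inverse_mult_eq_1')
  \<comment> \<open>The derivative of z \<open>q\<close> is computed twice, from the definition of
    \<open>q\<close> and from \<open>q = phi c * l\<close>; comparing the results gives the
    identity.\<close>
  have N1: "dynkin_fps 1 = phi c * G + fps_X * l"
  proof -
    have "fps_deriv (fps_X * q) = q + fps_X * fps_deriv q"
      by (simp add: algebra_simps)
    also have "fps_X * fps_deriv q = (fps_exp a - phi a) * fps_const vx
        + fps_const vy * (fps_X * fps_const a * fps_exp a * phi b + fps_exp a * (fps_exp b - phi b))"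
      unfolding q_def exp_prod_fps_def X_deriv_phi[symmetric] by (simp add: algebra_simps)
    also have "q + \<dots> = (fps_const vx + fps_exp a * fps_const vy
       - fps_X * fps_const b * phi a * fps_const vx) + fps_X * fps_const c * q"
    proof -
      have ea: "fps_exp a = 1 + fps_X * fps_const a * phi a" and eb: "fps_exp b = 1 + fps_X * fps_const b * phi b"
        by (simp_all add: X_phi)
      have "(pa * vx + (1 + x * a * pa) * pb * vy) + ((1 + x * a * pa - pa) * vx
          + vy * (x * a * (1 + x * a * pa) * pb + (1 + x * a * pa) * (1 + x * b * pb - pb)))
        = (vx + (1 + x * a * pa) * vy - x * b * pa * vx)
          + x * (a + b) * (pa * vx + (1 + x * a * pa) * pb * vy)"
        for pa pb vx vy x a b :: "real fps" by (simp add: algebra_simps)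
      then show ?thesis unfolding q_def exp_prod_fps_def c_def ea eb fps_const_add[symmetric] .
    qed
    finally have A: "fps_deriv (fps_X * q) = (fps_const vx + fps_exp a * fps_const vy
       - fps_X * fps_const b * phi a * fps_const vx) + fps_X * fps_const c * q" .
    have "fps_deriv (fps_X * q) = fps_deriv (fps_X * l) * phi c + l * (fps_X * fps_deriv (phi c))"
      unfolding ql by (simp add: algebra_simps)
    also have "\<dots> = fps_deriv (fps_X * l) * phi c + l * (1 + fps_X * fps_const c * phi c - phi c)"
      unfolding X_deriv_phi X_phi by simp
    finally have B: "fps_deriv (fps_X * q) = fps_deriv (fps_X * l) * phi c + l * (1 + fps_X * fps_const c * phi c - phi c)" .
    have "fps_const vx + fps_exp a * fps_const vy
       - fps_X * fps_const b * phi a * fps_const vx = fps_deriv (fps_X * q) - fps_X * fps_const c * q"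
      unfolding A by (simp only: add_diff_cancel_right')
    also have "\<dots> = phi c * (fps_deriv (fps_X * l) - l) + l"
    proof -
      have "D * p + l * (1 + x * c * p - p) - x * c * (p * l) = p * (D - l) + l"
        for D p l x c :: "real fps" by (simp add: algebra_simps)
      then show ?thesis unfolding B unfolding ql .
    qed
    finally show ?thesis unfolding dynkin_fps_1 G_def by (simp add: algebra_simps)
  qed
  have N: "dynkin_fps (Suc (Suc k)) = ?E ^ Suc k * phi c * G" for k
  proof (induction k)
    case 0
    have "dynkin_fps (Suc 1) = ?E * (phi c * G + fps_X * l) - fps_X * fps_const c * (fps_X * q)"
      using dynkin_fps_Suc[of 1] N1 by (simp add: c_def q_def)
    also have "\<dots> = ?E * phi c * G"
    proof -
      have "x * c * p * (p * G + x * l) - x * c * (x * (p * l)) = x * c * p * p * G"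
        for x c p G l :: "real fps" by (simp add: algebra_simps)
      then show ?thesis unfolding ql X_phi[symmetric] .
    qed
    finally show ?case by simp
  next
    case (Suc k)
    have "dynkin_fps (Suc (Suc (Suc k))) = ?E * dynkin_fps (Suc (Suc k))"
      using dynkin_fps_Suc[of "Suc (Suc k)"] by (simp add: c_def)
    then show ?case unfolding Suc by (simp only: power_Suc mult_ac)
  qed
  have Nk: "dynkin_fps k = ?E ^ (k - 1) * phi c * G + (if k = 1 then fps_X * l else 0)" if "k \<ge> 1" for k
  proof (cases "k = 1")
    case False
    then have k: "k = Suc (Suc (k - 2))" using that by linarith
    have "k - 1 = Suc (k - 2)" using k by linarith
    then show ?thesis using N[of "k - 2"] False k by (simp only: if_False add_0_right)
  next
    case True
    then show ?thesis by (simp only: N1 diff_self_eq_0 power_0 mult_1_left if_True refl)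
  qed
  let ?S = "\<Sum>k=1..K. fps_const ((- 1) ^ (k - 1) / real k) * ?E ^ (k - 1)"
  have "(\<Sum>k=1..K. (- 1) ^ (k - 1) / real k * dynkin_fps k $ m)
    = (\<Sum>k=1..K. fps_const ((- 1) ^ (k - 1) / real k) * dynkin_fps k) $ m"
    by (simp add: fps_sum_nth)
  also have "(\<Sum>k=1..K. fps_const ((- 1) ^ (k - 1) / real k) * dynkin_fps k)
    = (\<Sum>k=1..K. fps_const ((- 1) ^ (k - 1) / real k) * ?E ^ (k - 1) * (phi c * G)
      + (if k = 1 then fps_X * l else 0))"
  proof (rule sum.cong[OF refl])
    fix k assume "k \<in> {1..K}"
    then have N: "dynkin_fps k = ?E ^ (k - 1) * phi c * G + (if k = 1 then fps_X * l else 0)"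
      by (intro Nk) simp
    show "fps_const ((- 1) ^ (k - 1) / real k) * dynkin_fps k
      = fps_const ((- 1) ^ (k - 1) / real k) * ?E ^ (k - 1) * (phi c * G)
      + (if k = 1 then fps_X * l else 0)"
      unfolding N by (cases "k = 1") (simp_all add: mult.assoc)
  qed
  also have "\<dots> = ?S * phi c * G + fps_X * l"
  proof -
    have "(\<Sum>k=1..K. if k = 1 then fps_X * l else 0) = fps_X * l"
      using assms(2) by simp
    then show ?thesis
      unfolding sum.distrib sum_distrib_right[symmetric] by (simp only: mult.assoc)
  qed
  also have "(?S * phi c * G + fps_X * l) $ m = (1 * G + fps_X * l) $ m"
  proof -
    have "(?S * phi c * G) $ m = (1 * G) $ m"
    proof (cases m)
      case 0
      then show ?thesis by (simp only: G_def fps_mult_nth_0 fps_X_nth) simp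
    next
      case (Suc m')
      let ?H = "fps_deriv (fps_X * l) - l"
      have "(?S * phi c * G) $ m = (?S * phi c * ?H) $ m'"
        unfolding Suc G_def mult.left_commute[of "?S * phi c" fps_X] fps_X_mult_nth by simp
      also have "\<dots> = (1 * ?H) $ m'"
        unfolding fps_mult_nth[of "?S * phi c"] fps_mult_nth[of 1]
      proof (rule sum.cong[OF refl])
        fix i assume "i \<in> {0..m'}"
        then have "(?S * phi c) $ i = 1 $ i"
          using assms Suc by (intro log_exp_phi_trunc) simp
        then show "(?S * phi c) $ i * ?H $ (m' - i) = 1 $ i * ?H $ (m' - i)" by (rule arg_cong)
      qed
      also have "\<dots> = (1 * G) $ m" unfolding Suc G_def mult_1_left fps_X_mult_nth by simp
      finally show ?thesis .
    qed
    then show ?thesis by (simp only: fps_add_nth)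
  qed
  also have "1 * G + fps_X * l = fps_X * fps_deriv (fps_X * l)"
    unfolding G_def by (simp only: mult_1_left right_diff_distrib diff_add_cancel)
  finally show ?thesis unfolding l_def c_def q_def .
qed

end

section \<open>Coordinates of the Baker--Campbell--Hausdorff product\<close>

definition vec_fps :: "nat \<Rightarrow> (nat \<Rightarrow> real) \<Rightarrow> real fps" where
  "vec_fps n x = Abs_fps (\<lambda>k. if k < n then x (k + 2) else 0)"

lemma vec_fps_nth [simp]: "vec_fps n x $ k = (if k < n then x (k + 2) else 0)"
  by (simp add: vec_fps_def)

text \<open>An outer letter multiplies by its first coordinate and shifts the index by one. The
  result is linear in the other coordinates, so those of x and of y are followed separately: the e_2
  coefficient of one letter is set to 1 and that of the other to 0.\<close>

lemma nested_bracket_word: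
  fixes x y :: "nat \<Rightarrow> real" and cs :: "bool list" and v :: "bool \<Rightarrow> nat \<Rightarrow> real"
  assumes v: "v = (\<lambda>c. if c then x else y)"
    and "cs \<noteq> []"
  shows "(length cs \<ge> 2 \<longrightarrow> nested_bracket n (map v cs) 1 = 0) \<and>
    (\<forall>j<n. nested_bracket n (map v cs) (j + 2) =
      (if length cs \<le> Suc j
       then wcoef (map (\<lambda>c. (v c 1, if c then 1 else 0)) cs) * x (j + 3 - length cs)
          + wcoef (map (\<lambda>c. (v c 1, if c then 0 else 1)) cs) * y (j + 3 - length cs) else 0))"
  using assms(2)
proof (induction cs rule: induct_list012)
  case (2 c)
  then show ?case by (auto simp: v numeral_eq_Suc)
next
  case (3 c d cs)
  have "nested_bracket n (map v (c # d # cs)) 1 = 0"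
    by (simp add: bracket_coord)
  moreover have "nested_bracket n (map v (c # d # cs)) (j + 2) =
      (if length (c # d # cs) \<le> Suc j
       then wcoef (map (\<lambda>c. (v c 1, if c then 1 else 0)) (c # d # cs)) * x (j + 3 - length (c # d # cs))
          + wcoef (map (\<lambda>c. (v c 1, if c then 0 else 1)) (c # d # cs)) * y (j + 3 - length (c # d # cs)) else 0)"
    if "j < n" for j
  proof (cases j)
    case 0
    then show ?thesis by (simp add: bracket_coord)
  next
    case (Suc i)
    then have "i < n" using that by simp
    have b: "nested_bracket n (map v (c # d # cs)) (j + 2) =
        v c 1 * nested_bracket n (map v (d # cs)) (i + 2) - v c (i + 2) * nested_bracket n (map v (d # cs)) 1"
      using that Suc by (simp add: bracket_coord)
    show ?thesis
    proof (cases "cs = []")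
      case True
      show ?thesis unfolding b unfolding True Suc by (simp add: v numeral_eq_Suc algebra_simps)
    next
      case False
      then have l: "2 \<le> length (d # cs)" by (cases cs) auto
      then have n1: "nested_bracket n (map v (d # cs)) 1 = 0"
        using "3.IH"(2) by blast
      have "nested_bracket n (map v (d # cs)) (i + 2) =
        (if length (d # cs) \<le> Suc i
         then wcoef (map (\<lambda>c. (v c 1, if c then 1 else 0)) (d # cs)) * x (i + 3 - length (d # cs))
            + wcoef (map (\<lambda>c. (v c 1, if c then 0 else 1)) (d # cs)) * y (i + 3 - length (d # cs)) else 0)"
        using "3.IH"(2) \<open>i < n\<close> by blast
      then show ?thesis unfolding b n1 using False Suc
        by (simp add: distrib_left mult.assoc)
    qed
  qed
  ultimately show ?case by blast
qed simp

lemma dynkin_word_map_bool: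
  "dynkin_word x y ps = map (\<lambda>c. if c then x else y) (dynkin_word True False ps)"
  by (simp add: map_dynkin_word)

lemma nested_bracket_dynkin_word:
  assumes ps: "ps \<in> dynkin_indices k m" and "m \<ge> 1"
  shows "\<not> (m = 1 \<and> k = 1) \<Longrightarrow> nested_bracket n (dynkin_word x y ps) 1 = 0"
    and "j < n \<Longrightarrow> nested_bracket n (dynkin_word x y ps) (j + 2) =
      (if m \<le> Suc j then wcoef (dynkin_word (x 1, 1) (y 1, 0) ps) * x (j + 3 - m)
        + wcoef (dynkin_word (x 1, 0) (y 1, 1) ps) * y (j + 3 - m) else 0)"
proof -
  let ?cs = "dynkin_word True False ps"
  let ?v = "\<lambda>c. if c then x else y"
  have len: "length ?cs = m"
    using ps by (simp add: length_dynkin_word dynkin_indices_def)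
  then have ne: "?cs \<noteq> []" using assms(2) by auto
  have m1: "map (\<lambda>c. (?v c 1, if c then 1 else 0)) ?cs = dynkin_word (x 1, 1) (y 1, 0) ps"
    "map (\<lambda>c. (?v c 1, if c then 0 else 1)) ?cs = dynkin_word (x 1, 0) (y 1, 1) ps"
    by (simp_all only: map_dynkin_word) auto
  note * = nested_bracket_word[OF refl ne, of n x y, unfolded len m1, folded dynkin_word_map_bool]
  show "j < n \<Longrightarrow> nested_bracket n (dynkin_word x y ps) (j + 2) =
      (if m \<le> Suc j then wcoef (dynkin_word (x 1, 1) (y 1, 0) ps) * x (j + 3 - m)
        + wcoef (dynkin_word (x 1, 0) (y 1, 1) ps) * y (j + 3 - m) else 0)"
    using * by blast
  have "k \<ge> 1" using ps assms(2) by (cases k) (auto simp: dynkin_indices_0)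
  show "\<not> (m = 1 \<and> k = 1) \<Longrightarrow> nested_bracket n (dynkin_word x y ps) 1 = 0"
  proof -
    assume nk: "\<not> (m = 1 \<and> k = 1)"
    have "m \<ge> 2"
    proof (rule ccontr)
      assume "\<not> m \<ge> 2"
      then have "m = 1" using assms(2) by simp
      then show False using ps nk dynkin_indices_1(3)[of k] \<open>k \<ge> 1\<close> by (cases "k = 1") auto
    qed
    then show ?thesis using * by simp
  qed
qed

lemma bch_coord_1:
  assumes "n \<ge> 1"
  shows "bch n x y 1 = x 1 + y 1"
proof -
  let ?t = "\<lambda>m k ps. (- 1) ^ (k - 1) / (real k * real m * (\<Prod>(r, s)\<leftarrow>ps. fact r * fact s))
       * nested_bracket n (dynkin_word x y ps) 1"
  have z: "?t m k ps = 0" if "m \<ge> 1" "ps \<in> dynkin_indices k m" "\<not> (m = 1 \<and> k = 1)" for m k ps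
    by (simp only: nested_bracket_dynkin_word(1)[OF that(2,1,3)] mult_zero_right)
  have "bch n x y 1 = (\<Sum>m\<in>{1}. \<Sum>k=1..m. \<Sum>ps\<in>dynkin_indices k m. ?t m k ps)"
    unfolding bch_def
  proof (rule sum.mono_neutral_right)
    show "\<forall>m\<in>{1..n} - {1}. (\<Sum>k=1..m. \<Sum>ps\<in>dynkin_indices k m. ?t m k ps) = 0"
    proof
      fix m assume "m \<in> {1..n} - {1}"
      then show "(\<Sum>k=1..m. \<Sum>ps\<in>dynkin_indices k m. ?t m k ps) = 0"
        by (intro sum.neutral ballI z) auto
    qed
  qed (use assms in auto)
  also have "\<dots> = (\<Sum>ps\<in>dynkin_indices 1 1. ?t 1 1 ps)" by simp
  also have "\<dots> = x 1 + y 1" unfolding dynkin_indices_1(2) by simp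
  finally show ?thesis .
qed

text \<open>The right-hand side is the chart applied to the product in the model group. The division
  of the m-th coefficient by m undoes the operator z d/dz of \<open>dynkin_fps_sum\<close>.\<close>

lemma bch_coord:
  assumes "j < n"
  shows "bch n x y (j + 2) = (inverse (phi (x 1 + y 1)) *
    (phi (x 1) * vec_fps n x + fps_exp (x 1) * (phi (y 1) * vec_fps n y))) $ j"
proof -
  define a b where "a = x 1" and "b = y 1"
  define lx where "lx = inverse (phi (a + b)) * exp_prod_fps a b 1 0"
  define ly where "ly = inverse (phi (a + b)) * exp_prod_fps a b 0 1"
  have coef: "(\<Sum>k=1..m. (- 1) ^ (k - 1) / (real k * real m) * dynkin_fps a b vx vy k $ m)
      = (inverse (phi (a + b)) * exp_prod_fps a b vx vy) $ (m - 1)"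
    if m1: "m \<ge> 1" for m vx vy
  proof -
    obtain m' where m: "m = Suc m'" using m1 by (cases m) auto
    have "(\<Sum>k=1..m. (- 1) ^ (k - 1) / (real k * real m) * dynkin_fps a b vx vy k $ m)
      = (\<Sum>k=1..m. (- 1) ^ (k - 1) / real k * dynkin_fps a b vx vy k $ m) / real m"
      unfolding sum_divide_distrib by (intro sum.cong) auto
    also have "\<dots> = (fps_X * fps_deriv (fps_X * (inverse (phi (a + b)) * exp_prod_fps a b vx vy))) $ m / real m"
      by (subst dynkin_fps_sum) (use that in auto)
    also have "\<dots> = (inverse (phi (a + b)) * exp_prod_fps a b vx vy) $ (m - 1)"
      unfolding m fps_X_mult_nth fps_deriv_nth by simp
    finally show ?thesis .
  qed
  have "bch n x y (j + 2) = (\<Sum>m=1..n. if m \<le> Suc j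
      then lx $ (m - 1) * x (j + 3 - m) + ly $ (m - 1) * y (j + 3 - m) else 0)"
    unfolding bch_def
  proof (rule sum.cong[OF refl])
    fix m assume m: "m \<in> {1..n}"
    let ?L = "(\<Sum>k=1..m. \<Sum>ps\<in>dynkin_indices k m. (- 1) ^ (k - 1) /
       (real k * real m * (\<Prod>(r, s)\<leftarrow>ps. fact r * fact s)) * nested_bracket n (dynkin_word x y ps) (j + 2))"
    show "?L = (if m \<le> Suc j
      then lx $ (m - 1) * x (j + 3 - m) + ly $ (m - 1) * y (j + 3 - m) else 0)"
    proof (cases "m \<le> Suc j")
      case True
      have "?L = (\<Sum>k=1..m. (- 1) ^ (k - 1) / (real k * real m) *
          (dynkin_fps a b 1 0 k $ m * x (j + 3 - m) + dynkin_fps a b 0 1 k $ m * y (j + 3 - m)))"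
      proof (rule sum.cong[OF refl])
        fix k
        have "(\<Sum>ps\<in>dynkin_indices k m. (- 1) ^ (k - 1) /
           (real k * real m * (\<Prod>(r, s)\<leftarrow>ps. fact r * fact s)) * nested_bracket n (dynkin_word x y ps) (j + 2))
          = (\<Sum>ps\<in>dynkin_indices k m. (- 1) ^ (k - 1) / (real k * real m) *
            (wcoef (dynkin_word (a, 1) (b, 0) ps) / block_weight ps * x (j + 3 - m)
            + wcoef (dynkin_word (a, 0) (b, 1) ps) / block_weight ps * y (j + 3 - m)))"
        proof (rule sum.cong[OF refl])
          fix ps assume "ps \<in> dynkin_indices k m"
          then have "nested_bracket n (dynkin_word x y ps) (j + 2)
            = wcoef (dynkin_word (a, 1) (b, 0) ps) * x (j + 3 - m)
            + wcoef (dynkin_word (a, 0) (b, 1) ps) * y (j + 3 - m)"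
            using nested_bracket_dynkin_word(2)[of ps k m j n x y] m True assms by (simp add: a_def b_def)
          moreover have "d / (u * p) * (c * s + e * t) = d / u * (c / p * s + e / p * t)"
            for d u p c s e t :: real
            by (simp add: divide_inverse algebra_simps)
          ultimately show "(- 1) ^ (k - 1) /
           (real k * real m * (\<Prod>(r, s)\<leftarrow>ps. fact r * fact s)) * nested_bracket n (dynkin_word x y ps) (j + 2)
            = (- 1) ^ (k - 1) / (real k * real m) *
            (wcoef (dynkin_word (a, 1) (b, 0) ps) / block_weight ps * x (j + 3 - m)
            + wcoef (dynkin_word (a, 0) (b, 1) ps) / block_weight ps * y (j + 3 - m))"
            by (simp only: block_weight_def)
        qed
        then show "(\<Sum>ps\<in>dynkin_indices k m. (- 1) ^ (k - 1) /
           (real k * real m * (\<Prod>(r, s)\<leftarrow>ps. fact r * fact s)) * nested_bracket n (dynkin_word x y ps) (j + 2))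
          = (- 1) ^ (k - 1) / (real k * real m) *
          (dynkin_fps a b 1 0 k $ m * x (j + 3 - m) + dynkin_fps a b 0 1 k $ m * y (j + 3 - m))"
          by (simp only: dynkin_fps_def fps_nth_Abs_fps sum_distrib_left sum_distrib_right sum.distrib distrib_left)
      qed
      also have "\<dots> = (\<Sum>k=1..m. (- 1) ^ (k - 1) / (real k * real m) * dynkin_fps a b 1 0 k $ m) * x (j + 3 - m)
          + (\<Sum>k=1..m. (- 1) ^ (k - 1) / (real k * real m) * dynkin_fps a b 0 1 k $ m) * y (j + 3 - m)"
        by (simp only: distrib_left sum.distrib sum_distrib_right mult.assoc)
      also have "\<dots> = lx $ (m - 1) * x (j + 3 - m) + ly $ (m - 1) * y (j + 3 - m)"
        using coef[of m 1 0] coef[of m 0 1] m unfolding lx_def ly_def by simp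
      finally show ?thesis using True by simp
    next
      case False
      have "?L = 0"
      proof (intro sum.neutral ballI)
        fix k ps assume "ps \<in> dynkin_indices k m"
        then have "nested_bracket n (dynkin_word x y ps) (j + 2) = 0"
          using nested_bracket_dynkin_word(2)[of ps k m j n x y] m False assms by simp
        then show "(- 1) ^ (k - 1) /
           (real k * real m * (\<Prod>(r, s)\<leftarrow>ps. fact r * fact s)) * nested_bracket n (dynkin_word x y ps) (j + 2) = 0"
          by simp
      qed
      then show ?thesis using False by simp
    qed
  qed
  also have "\<dots> = (\<Sum>m=1..Suc j. lx $ (m - 1) * x (j + 3 - m) + ly $ (m - 1) * y (j + 3 - m))"
    using assms by (intro sum.mono_neutral_cong_right) auto
  also have "\<dots> = (\<Sum>i=0..j. lx $ i * vec_fps n x $ (j - i) + ly $ i * vec_fps n y $ (j - i))"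
  proof (rule sum.reindex_bij_witness[where i = Suc and j = "\<lambda>m. m - 1"])
    fix m assume m: "m \<in> {1..Suc j}"
    then have "j + 3 - m = j - (m - 1) + 2" by auto
    then show "lx $ (m - 1) * vec_fps n x $ (j - (m - 1)) + ly $ (m - 1) * vec_fps n y $ (j - (m - 1)) =
         lx $ (m - 1) * x (j + 3 - m) + ly $ (m - 1) * y (j + 3 - m)"
      using assms by simp
  qed auto
  also have "\<dots> = (lx * vec_fps n x + ly * vec_fps n y) $ j"
    by (simp only: fps_add_nth fps_mult_nth sum.distrib)
  also have "lx * vec_fps n x + ly * vec_fps n y = inverse (phi (a + b)) *
    (phi a * vec_fps n x + fps_exp a * (phi b * vec_fps n y))"
    by (simp add: lx_def ly_def exp_prod_fps_def distrib_left mult.assoc)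
  finally show ?thesis by (simp only: a_def b_def)
qed

section \<open>The model group\<close>

text \<open>
  Only the coefficients below \<open>n\<close> count: \<open>gdist n\<close> vanishes exactly on the pairs that agree modulo \<open>z\<^sup>n\<close>.
\<close>

type_synonym model = "real \<times> real fps"

definition gmul :: "model \<Rightarrow> model \<Rightarrow> model" (infixl "\<odot>" 70) where
  "g \<odot> h = (fst g + fst h, snd g + fps_exp (fst g) * snd h)"

definition ginv :: "model \<Rightarrow> model" where
  "ginv g = (- fst g, - (fps_exp (- fst g) * snd g))"

definition gone :: model where
  "gone = (0, 0)"

lemma fst_gmul [simp]: "fst (g \<odot> h) = fst g + fst h"
  and snd_gmul: "snd (g \<odot> h) = snd g + fps_exp (fst g) * snd h"
  by (simp_all add: gmul_def)

lemma fst_ginv [simp]: "fst (ginv g) = - fst g"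
  and snd_ginv: "snd (ginv g) = - (fps_exp (- fst g) * snd g)"
  by (simp_all add: ginv_def)

lemma fst_gone [simp]: "fst gone = 0" and snd_gone [simp]: "snd gone = 0"
  by (simp_all add: gone_def)

lemma exp_minus_mult [simp]:
  "fps_exp (- a) * fps_exp a = (1 :: real fps)" "fps_exp a * fps_exp (- a) = (1 :: real fps)"
  by (simp_all flip: fps_exp_add_mult)

lemma exp_minus_cancel [simp]:
  "fps_exp (- a) * (fps_exp a * P) = (P :: real fps)" "fps_exp a * (fps_exp (- a) * P) = (P :: real fps)"
  by (simp_all flip: mult.assoc)

lemma gmul_assoc: "(g \<odot> h) \<odot> k = g \<odot> (h \<odot> k)"
  by (simp add: gmul_def fps_exp_add_mult algebra_simps)

lemma gmul_gone [simp]: "gone \<odot> g = g" "g \<odot> gone = g"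
  by (simp_all add: gmul_def gone_def)

lemma gmul_ginv [simp]: "g \<odot> ginv g = gone" "ginv g \<odot> g = gone"
  by (simp_all add: gmul_def ginv_def gone_def)

lemma gmul_ginv_cancel [simp]: "g \<odot> (ginv g \<odot> h) = h" "ginv g \<odot> (g \<odot> h) = h"
  by (simp_all flip: gmul_assoc)

lemma ginv_gmul: "ginv (g \<odot> h) = ginv h \<odot> ginv g"
proof -
  have "(g \<odot> h) \<odot> (ginv h \<odot> ginv g) = gone" by (simp add: gmul_assoc)
  then show ?thesis by (metis gmul_ginv_cancel(2) gmul_gone(2))
qed

lemma ginv_ginv [simp]: "ginv (ginv g) = g"
  by (simp add: ginv_def)

lemma ginv_gone [simp]: "ginv gone = gone"
  by (simp add: ginv_def gone_def)

text \<open>These are B_i / i! with the Bernoulli numbers B_i, since 1 / \<open>phi 1\<close> is z /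
  (e^z - 1).\<close>

definition inv_phi_coeff :: "nat \<Rightarrow> real" where
  "inv_phi_coeff i = inverse (phi 1) $ i"

lemma inverse_phi_nth: "inverse (phi a) $ i = inv_phi_coeff i * a ^ i"
proof -
  let ?B = "Abs_fps (\<lambda>i. inv_phi_coeff i * a ^ i)"
  have "phi a * ?B = 1"
  proof (rule fps_ext)
    fix k
    have "(phi a * ?B) $ k = a ^ k * (phi 1 * inverse (phi 1)) $ k"
      unfolding fps_mult_nth sum_distrib_left
    proof (rule sum.cong[OF refl])
      fix i assume "i \<in> {0..k}"
      then have "a ^ i * a ^ (k - i) = a ^ k" by (simp flip: power_add)
      then show "phi a $ i * ?B $ (k - i) = a ^ k * (phi 1 $ i * inverse (phi 1) $ (k - i))"
        unfolding inv_phi_coeff_def by (simp del: fact_Suc)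
    qed
    also have "phi 1 * inverse (phi 1) = 1"
      by (rule inverse_mult_eq_1') simp
    finally show "(phi a * ?B) $ k = 1 $ k" by (cases k) auto
  qed
  then have "inverse (phi a) = ?B" by (rule fps_inverse_unique)
  then show ?thesis by simp
qed

text \<open>
  The coefficients of \<open>hlog g\<close> are the coordinates \<open>x\<^sub>2, \<dots>, x\<^bsub>n+1\<^esub>\<close> of \<open>g\<close> in the exponential chart.
\<close>

definition hlog :: "model \<Rightarrow> real fps" where
  "hlog g = inverse (phi (fst g)) * snd g"

lemma phi_hlog: "phi (fst g) * hlog g = snd g"
  unfolding hlog_def by (simp add: mult.assoc[symmetric] inverse_mult_eq_1')

lemma hlog_nth_0: "hlog g $ 0 = snd g $ 0"
  by (simp add: hlog_def inverse_phi_nth inv_phi_coeff_def)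

lemma abs_power_div_fact_le: "\<bar>x ^ k / fact m\<bar> \<le> \<bar>x :: real\<bar> ^ k"
proof -
  have "\<bar>x\<bar> ^ k / fact m \<le> \<bar>x\<bar> ^ k / 1"
    by (rule divide_left_mono) auto
  then show ?thesis by (simp add: power_abs)
qed

text \<open>The homogeneous norm read in the chart: the coefficient of z^k is the coordinate
  x_(k+2), of weight k + 1.\<close>

definition gnorm :: "nat \<Rightarrow> model \<Rightarrow> real" where
  "gnorm n g = sqrt ((fst g)\<^sup>2 + (snd g $ 0)\<^sup>2) + (\<Sum>k=1..<n. \<bar>hlog g $ k\<bar> powr (1 / real (Suc k)))"

definition gdist :: "nat \<Rightarrow> model \<Rightarrow> model \<Rightarrow> real" where
  "gdist n g h = gnorm n (ginv g \<odot> h)"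

lemma gnorm_nonneg [simp]: "gnorm n g \<ge> 0"
  by (auto simp: gnorm_def intro!: add_nonneg_nonneg sum_nonneg)

lemma gdist_nonneg [simp]: "gdist n g h \<ge> 0"
  by (simp add: gdist_def)

lemma gnorm_ge_fst: "\<bar>fst g\<bar> \<le> gnorm n g"
  and gnorm_ge_snd_0: "\<bar>snd g $ 0\<bar> \<le> gnorm n g"
proof -
  have "(\<Sum>k=1..<n. \<bar>hlog g $ k\<bar> powr (1 / real (Suc k))) \<ge> 0" by (auto intro: sum_nonneg)
  then show "\<bar>fst g\<bar> \<le> gnorm n g" "\<bar>snd g $ 0\<bar> \<le> gnorm n g"
    unfolding gnorm_def using real_sqrt_ge_abs1[of "fst g" "snd g $ 0"] real_sqrt_ge_abs2[of "snd g $ 0" "fst g"]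
    by linarith+
qed

lemma hlog_nth_le:
  assumes "k < n"
  shows "\<bar>hlog g $ k\<bar> \<le> gnorm n g ^ Suc k"
proof (cases "k = 0")
  case True
  then show ?thesis using gnorm_ge_snd_0[of g n] by (simp add: hlog_nth_0)
next
  case False
  let ?p = "\<lambda>k. \<bar>hlog g $ k\<bar> powr (1 / real (Suc k))"
  have "?p k \<le> (\<Sum>k=1..<n. ?p k)"
    by (rule member_le_sum) (use assms False in auto)
  moreover have "0 \<le> sqrt ((fst g)\<^sup>2 + (snd g $ 0)\<^sup>2)" by simp
  ultimately have "?p k \<le> gnorm n g" unfolding gnorm_def by linarith
  then have "?p k ^ Suc k \<le> gnorm n g ^ Suc k" by (rule power_mono) simp
  moreover have "?p k ^ Suc k = \<bar>hlog g $ k\<bar>"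
  proof (cases "hlog g $ k = 0")
    case False
    have "?p k ^ Suc k = ?p k powr real (Suc k)"
      by (rule powr_realpow[symmetric]) (use False in simp)
    then show ?thesis using False by (simp add: powr_powr)
  qed simp
  ultimately show ?thesis by simp
qed

text \<open>Passing from the chart to the model multiplies by \<open>phi\<close>, whose coefficients
  are at most |a|^i; each of the k + 1 products in the convolution has total weight k + 1.\<close>

lemma gnorm_ge_nth:
  assumes "k < n"
  shows "\<bar>snd g $ k\<bar> \<le> real (Suc k) * gnorm n g ^ Suc k"
proof -
  let ?N = "gnorm n g"
  have "\<bar>snd g $ k\<bar> = \<bar>\<Sum>i=0..k. fst g ^ i / fact (Suc i) * hlog g $ (k - i)\<bar>"
    by (subst phi_hlog[symmetric]) (simp add: fps_mult_nth del: fact_Suc)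
  also have "\<dots> \<le> (\<Sum>i=0..k. \<bar>fst g ^ i / fact (Suc i) * hlog g $ (k - i)\<bar>)" by (rule sum_abs)
  also have "\<dots> \<le> (\<Sum>i=0..k. ?N ^ Suc k)"
  proof (rule sum_mono)
    fix i assume i: "i \<in> {0..k}"
    have "\<bar>fst g ^ i / fact (Suc i)\<bar> \<le> \<bar>fst g\<bar> ^ i"
      by (rule abs_power_div_fact_le)
    also have "\<dots> \<le> ?N ^ i" using gnorm_ge_fst by (intro power_mono) auto
    finally have "\<bar>fst g ^ i / fact (Suc i) * hlog g $ (k - i)\<bar> \<le> ?N ^ i * ?N ^ Suc (k - i)"
      unfolding abs_mult by (intro mult_mono hlog_nth_le) (use assms in auto)
    also have "\<dots> = ?N ^ Suc k" using i by (simp flip: power_add)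
    finally show "\<bar>fst g ^ i / fact (Suc i) * hlog g $ (k - i)\<bar> \<le> ?N ^ Suc k" .
  qed
  finally show ?thesis by simp
qed

text \<open>The ball-box constant of \<open>gnorm_le\<close>: 2 for the horizontal part and, for
  every higher coordinate, one more than the sum of the absolute values of the coefficients of 1 /
  \<open>phi 1\<close> that enter it.\<close>

definition gcon :: "nat \<Rightarrow> real" where
  "gcon n = 2 + (\<Sum>k=1..<n. 1 + (\<Sum>i\<le>k. \<bar>inv_phi_coeff i\<bar>))"

lemma gcon_ge_2: "gcon n \<ge> 2"
  by (auto simp: gcon_def intro!: sum_nonneg add_nonneg_nonneg)

lemma gnorm_le:
  assumes r: "r \<ge> 0" "\<bar>fst g\<bar> \<le> r" "\<And>k. k < n \<Longrightarrow> \<bar>snd g $ k\<bar> \<le> r ^ Suc k" and "n \<ge> 1"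
  shows "gnorm n g \<le> gcon n * r"
proof -
  have "sqrt ((fst g)\<^sup>2 + (snd g $ 0)\<^sup>2) \<le> \<bar>fst g\<bar> + \<bar>snd g $ 0\<bar>"
    by (rule sqrt_sum_squares_le_sum_abs)
  also have "\<dots> \<le> 2 * r" using r(2) r(3)[of 0] assms(4) by simp
  finally have 1: "sqrt ((fst g)\<^sup>2 + (snd g $ 0)\<^sup>2) \<le> 2 * r" .
  have 2: "(\<Sum>k=1..<n. \<bar>hlog g $ k\<bar> powr (1 / real (Suc k))) \<le> (\<Sum>k=1..<n. (1 + (\<Sum>i\<le>k. \<bar>inv_phi_coeff i\<bar>)) * r)"
  proof (rule sum_mono)
    fix k assume k: "k \<in> {1..<n}"
    define c where "c = 1 + (\<Sum>i\<le>k. \<bar>inv_phi_coeff i\<bar>)"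
    have c: "c \<ge> 1" by (auto simp: c_def intro!: sum_nonneg)
    have "\<bar>hlog g $ k\<bar> = \<bar>\<Sum>i=0..k. inv_phi_coeff i * fst g ^ i * snd g $ (k - i)\<bar>"
      by (simp add: hlog_def fps_mult_nth inverse_phi_nth)
    also have "\<dots> \<le> (\<Sum>i=0..k. \<bar>inv_phi_coeff i * fst g ^ i * snd g $ (k - i)\<bar>)" by (rule sum_abs)
    also have "\<dots> \<le> (\<Sum>i=0..k. \<bar>inv_phi_coeff i\<bar> * r ^ Suc k)"
    proof (rule sum_mono)
      fix i assume i: "i \<in> {0..k}"
      have "\<bar>fst g\<bar> ^ i * \<bar>snd g $ (k - i)\<bar> \<le> r ^ i * r ^ Suc (k - i)"
        by (intro mult_mono power_mono r) (use k r in auto)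
      also have "\<dots> = r ^ Suc k" using i by (simp flip: power_add)
      finally show "\<bar>inv_phi_coeff i * fst g ^ i * snd g $ (k - i)\<bar> \<le> \<bar>inv_phi_coeff i\<bar> * r ^ Suc k"
        unfolding abs_mult power_abs mult.assoc by (rule mult_left_mono) simp
    qed
    also have "\<dots> \<le> c * r ^ Suc k"
      unfolding c_def by (simp add: sum_distrib_right[symmetric] atLeast0AtMost distrib_right r)
    \<comment> \<open>As c >= 1, the constant may be raised to the power that the root will
      remove.\<close>
    also have "\<dots> \<le> c ^ Suc k * r ^ Suc k"
      using c r(1) power_increasing[of 1 "Suc k" c] by (intro mult_right_mono) auto
    also have "\<dots> = (c * r) ^ Suc k" by (simp add: power_mult_distrib)
    finally have le: "\<bar>hlog g $ k\<bar> \<le> (c * r) ^ Suc k" .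
    show "\<bar>hlog g $ k\<bar> powr (1 / real (Suc k)) \<le> c * r"
    proof (cases "c * r = 0")
      case True
      then have "hlog g $ k = 0" using le by (simp only: True power_0_Suc)
      then show ?thesis using True by (simp only: abs_zero powr_0)
    next
      case False
      then have pos: "c * r > 0" using c r(1) by (simp add: less_le)
      have "\<bar>hlog g $ k\<bar> powr (1 / real (Suc k)) \<le> ((c * r) ^ Suc k) powr (1 / real (Suc k))"
        by (rule powr_mono2) (use le in auto)
      also have "\<dots> = ((c * r) powr real (Suc k)) powr (1 / real (Suc k))"
        by (simp only: powr_realpow[OF pos])
      also have "\<dots> = c * r" using pos by (simp add: powr_powr)
      finally show ?thesis .
    qed
  qed
  have "gnorm n g \<le> 2 * r + (\<Sum>k=1..<n. (1 + (\<Sum>i\<le>k. \<bar>inv_phi_coeff i\<bar>)) * r)"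
    unfolding gnorm_def using 1 2 by linarith
  also have "\<dots> = gcon n * r"
    by (simp only: gcon_def distrib_right sum_distrib_right)
  finally show ?thesis .
qed

lemma gnorm_cong:
  assumes "fst g = fst h" "\<And>k. k < n \<Longrightarrow> snd g $ k = snd h $ k" "n \<ge> 1"
  shows "gnorm n g = gnorm n h"
proof -
  have "hlog g $ k = hlog h $ k" if "k < n" for k
    unfolding hlog_def fps_mult_nth assms(1) by (intro sum.cong) (use that assms(2) in auto)
  then show ?thesis using assms by (auto simp: gnorm_def)
qed

lemma gnorm_eq_0_iff:
  assumes "n \<ge> 1"
  shows "gnorm n g = 0 \<longleftrightarrow> fst g = 0 \<and> (\<forall>k<n. snd g $ k = 0)"
proof
  assume g: "gnorm n g = 0"
  show "fst g = 0 \<and> (\<forall>k<n. snd g $ k = 0)"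
    using gnorm_ge_fst[of g n] gnorm_ge_nth[of _ n g] g by auto
next
  assume "fst g = 0 \<and> (\<forall>k<n. snd g $ k = 0)"
  then have "gnorm n g \<le> gcon n * 0" using assms by (intro gnorm_le) auto
  then show "gnorm n g = 0" using gnorm_nonneg[of n g] by linarith
qed

lemma phi_minus: "phi (- a) = fps_exp (- a) * phi a"
proof (cases "a = 0")
  case False
  have "fps_X * fps_const a * phi (- a) = - (fps_X * fps_const (- a) * phi (- a))"
    by (simp add: fps_const_neg[symmetric] del: fps_const_neg)
  also have "\<dots> = 1 - fps_exp (- a)" unfolding X_phi by simp
  also have "\<dots> = fps_exp (- a) * (fps_X * fps_const a * phi a)" unfolding X_phi by (simp add: algebra_simps)
  finally have "fps_X * fps_const a * phi (- a) = fps_X * fps_const a * (fps_exp (- a) * phi a)"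
    by (simp only: mult.left_commute)
  then show ?thesis using False by simp
qed simp

lemma gnorm_ginv [simp]: "gnorm n (ginv g) = gnorm n g"
proof -
  have *: "inverse (phi (- a)) = fps_exp a * inverse (phi a)" for a :: real
    by (simp add: phi_minus fps_inverse_mult fps_exp_neg)
  have "hlog (ginv g) = - hlog g"
    unfolding hlog_def fst_ginv snd_ginv * by (simp add: mult_ac)
  then show ?thesis by (simp add: gnorm_def snd_ginv)
qed

lemma gdist_commute: "gdist n g h = gdist n h g"
  unfolding gdist_def using gnorm_ginv[of n "ginv g \<odot> h"] by (simp add: ginv_gmul)

lemma gdist_left [simp]: "gdist n (k \<odot> g) (k \<odot> h) = gdist n g h"
  by (simp add: gdist_def ginv_gmul gmul_assoc)

lemma gdist_self [simp]: "n \<ge> 1 \<Longrightarrow> gdist n g g = 0"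
  by (simp add: gdist_def gnorm_eq_0_iff)

lemma gdist_right [simp]: "gdist n g (g \<odot> h) = gnorm n h" "gdist n (g \<odot> h) g = gnorm n h"
proof -
  show "gdist n g (g \<odot> h) = gnorm n h" by (simp add: gdist_def)
  then show "gdist n (g \<odot> h) g = gnorm n h" by (simp add: gdist_commute)
qed

text \<open>The summand n bounds the factor \<open>Suc k\<close> of \<open>gnorm_ge_nth\<close> for
  the left factor of a product; n^2 does so for the right factor, where the convolution with e^(az)
  has up to n terms.\<close>

definition gtri :: "nat \<Rightarrow> real" where
  "gtri n = gcon n * (real n + real n * real n)"

lemma gtri_ge_1: "n \<ge> 1 \<Longrightarrow> gtri n \<ge> 1"
proof -
  assume "n \<ge> 1"
  then have "real n + real n * real n \<ge> 1 + 0" by (intro add_mono) auto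
  then show ?thesis
    unfolding gtri_def using gcon_ge_2[of n] mult_mono[of 1 "gcon n" 1 "real n + real n * real n"] by simp
qed

lemma gnorm_gmul_le:
  assumes "gnorm n g \<le> r" "gnorm n h \<le> r" "n \<ge> 1"
  shows "gnorm n (g \<odot> h) \<le> gtri n * r"
proof -
  define s where "s = real n + real n * real n"
  have n1: "real n \<ge> 1" using assms(3) by simp
  have s: "s \<ge> 2" unfolding s_def using n1 mult_mono[of 1 "real n" 1 "real n"] by simp
  have r: "r \<ge> 0" using assms(1) gnorm_nonneg[of n g] by linarith
  have "gnorm n (g \<odot> h) \<le> gcon n * (s * r)"
  proof (rule gnorm_le)
    show "0 \<le> s * r" using s r by simp
    have "\<bar>fst (g \<odot> h)\<bar> \<le> r + r"
      using gnorm_ge_fst[of g n] gnorm_ge_fst[of h n] assms by simp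
    also have "\<dots> \<le> s * r" using mult_right_mono[OF s r] by simp
    finally show "\<bar>fst (g \<odot> h)\<bar> \<le> s * r" .
  next
    fix k assume k: "k < n"
    have b: "\<bar>snd x $ i\<bar> \<le> real n * r ^ Suc i" if "i < n" "gnorm n x \<le> r" for x i
    proof -
      have "\<bar>snd x $ i\<bar> \<le> real (Suc i) * gnorm n x ^ Suc i" by (rule gnorm_ge_nth[OF that(1)])
      also have "\<dots> \<le> real n * r ^ Suc i" using that r by (intro mult_mono power_mono) auto
      finally show ?thesis .
    qed
    have a: "\<bar>fst g\<bar> \<le> r" using gnorm_ge_fst[of g n] assms by linarith
    have "\<bar>(fps_exp (fst g) * snd h) $ k\<bar> \<le> (\<Sum>i=0..k. \<bar>fst g ^ i / fact i * snd h $ (k - i)\<bar>)"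
      unfolding fps_mult_nth by (rule order_trans[OF sum_abs]) simp
    also have "\<dots> \<le> (\<Sum>i=0..k. real n * r ^ Suc k)"
    proof (rule sum_mono)
      fix i assume i: "i \<in> {0..k}"
      have "\<bar>fst g ^ i / fact i\<bar> \<le> \<bar>fst g\<bar> ^ i"
        by (rule abs_power_div_fact_le)
      also have "\<dots> \<le> r ^ i" using a by (intro power_mono) auto
      finally have "\<bar>fst g ^ i / fact i * snd h $ (k - i)\<bar> \<le> r ^ i * (real n * r ^ Suc (k - i))"
        unfolding abs_mult by (intro mult_mono b assms) (use k r in auto)
      also have "\<dots> = real n * (r ^ i * r ^ Suc (k - i))" by (simp only: mult_ac)
      also have "r ^ i * r ^ Suc (k - i) = r ^ Suc k" using i by (simp flip: power_add)
      finally show "\<bar>fst g ^ i / fact i * snd h $ (k - i)\<bar> \<le> real n * r ^ Suc k" .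
    qed
    also have "\<dots> = real (Suc k) * (real n * r ^ Suc k)" by simp
    also have "\<dots> \<le> real n * (real n * r ^ Suc k)" using k r by (intro mult_right_mono) auto
    finally have "\<bar>(fps_exp (fst g) * snd h) $ k\<bar> \<le> real n * (real n * r ^ Suc k)" .
    then have "\<bar>snd (g \<odot> h) $ k\<bar> \<le> s * r ^ Suc k"
      using b[OF k assms(1)] unfolding snd_gmul s_def fps_add_nth distrib_right mult.assoc by linarith
    also have "\<dots> \<le> s ^ Suc k * r ^ Suc k"
      using s r power_increasing[of 1 "Suc k" s] by (intro mult_right_mono) auto
    also have "\<dots> = (s * r) ^ Suc k" by (simp add: power_mult_distrib)
    finally show "\<bar>snd (g \<odot> h) $ k\<bar> \<le> (s * r) ^ Suc k" .
  qed fact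
  then show ?thesis by (simp add: gtri_def s_def mult.assoc)
qed

lemma gdist_triangle:
  assumes "gdist n g h \<le> r" "gdist n h k \<le> r" "n \<ge> 1"
  shows "gdist n g k \<le> gtri n * r"
proof -
  have "ginv g \<odot> k = (ginv g \<odot> h) \<odot> (ginv h \<odot> k)" by (simp add: gmul_assoc)
  then show ?thesis using gnorm_gmul_le[OF assms(1,2)[unfolded gdist_def] assms(3)] by (simp add: gdist_def)
qed

lemma gdist_0_trans:
  assumes "gdist n g h = 0" "gdist n h k = 0" "n \<ge> 1"
  shows "gdist n g k = 0"
  using gdist_triangle[of n g h 0 k] assms gdist_nonneg[of n g k] by auto

lemma gdist_0_iff:
  assumes "n \<ge> 1"
  shows "gdist n g h = 0 \<longleftrightarrow> fst g = fst h \<and> (\<forall>k<n. snd g $ k = snd h $ k)"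
proof
  assume "gdist n g h = 0"
  then have *: "- fst g + fst h = 0" "\<And>k. k < n \<Longrightarrow> snd (ginv g \<odot> h) $ k = 0"
    unfolding gdist_def gnorm_eq_0_iff[OF assms] by auto
  have "snd g $ k = snd h $ k" if "k < n" for k
  proof -
    have "snd h = snd g + fps_exp (fst g) * snd (ginv g \<odot> h)"
      by (simp add: snd_gmul snd_ginv algebra_simps)
    moreover have "(fps_exp (fst g) * snd (ginv g \<odot> h)) $ k = 0"
      unfolding fps_mult_nth by (intro sum.neutral) (use that *(2) in auto)
    ultimately show ?thesis by simp
  qed
  then show "fst g = fst h \<and> (\<forall>k<n. snd g $ k = snd h $ k)" using *(1) by auto
next
  assume r: "fst g = fst h \<and> (\<forall>k<n. snd g $ k = snd h $ k)"
  have "(fps_exp (- fst g) * snd g) $ k = (fps_exp (- fst g) * snd h) $ k" if "k < n" for k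
    unfolding fps_mult_nth by (intro sum.cong) (use that r in auto)
  then show "gdist n g h = 0"
    unfolding gdist_def gnorm_eq_0_iff[OF assms] using r by (auto simp: snd_gmul snd_ginv)
qed

text \<open>Points that agree modulo z^n need not be equal as series; this lemma takes the place of
  substitution of equals.\<close>

lemma gdist_cong:
  assumes "gdist n g g' = 0" "gdist n h h' = 0" "n \<ge> 1"
  shows "gdist n g h = gdist n g' h'"
  unfolding gdist_def
proof (rule gnorm_cong)
  note * = assms(1,2)[unfolded gdist_0_iff[OF assms(3)]]
  show "fst (ginv g \<odot> h) = fst (ginv g' \<odot> h')" using * by simp
  fix k assume k: "k < n"
  have "(fps_exp (- fst g) * snd g) $ k = (fps_exp (- fst g') * snd g') $ k"
    "(fps_exp (- fst g) * snd h) $ k = (fps_exp (- fst g') * snd h') $ k"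
    unfolding fps_mult_nth using * k by (auto intro!: sum.cong)
  then show "snd (ginv g \<odot> h) $ k = snd (ginv g' \<odot> h') $ k"
    by (simp add: snd_gmul snd_ginv)
qed fact

section \<open>Dilations\<close>

definition dil :: "real \<Rightarrow> model \<Rightarrow> model" where
  "dil c g = (c * fst g, Abs_fps (\<lambda>k. c ^ Suc k * snd g $ k))"

lemma fst_dil [simp]: "fst (dil c g) = c * fst g"
  and snd_dil_nth [simp]: "snd (dil c g) $ k = c ^ Suc k * snd g $ k"
  by (simp_all add: dil_def)

text \<open>In degree i the series \<open>A\<close> has weight i and \<open>P\<close> has weight i +
  1, so their product is homogeneous like \<open>P\<close>. Applied to e^(az) and to 1 /
  \<open>phi\<close>.\<close>

lemma dil_mult_nth:
  fixes A A' P P' :: "real fps"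
  assumes "\<And>i. A' $ i = c ^ i * A $ i" "\<And>i. P' $ i = c ^ Suc i * P $ i"
  shows "(A' * P') $ k = c ^ Suc k * (A * P) $ k"
  unfolding fps_mult_nth sum_distrib_left
proof (rule sum.cong[OF refl])
  fix i assume "i \<in> {0..k}"
  then have "c ^ i * c ^ Suc (k - i) = c ^ Suc k" by (simp flip: power_add)
  then show "A' $ i * P' $ (k - i) = c ^ Suc k * (A $ i * P $ (k - i))"
    unfolding assms by (metis mult.assoc mult.left_commute)
qed

lemma dil_exp_nth: "(fps_exp (c * a) * snd (dil c g)) $ k = c ^ Suc k * (fps_exp a * snd g) $ k"
  by (rule dil_mult_nth) (simp_all add: power_mult_distrib)

lemma dil_gmul: "dil c (g \<odot> h) = dil c g \<odot> dil c h"
  by (rule prod_eqI) (auto simp: fps_eq_iff snd_gmul dil_exp_nth distrib_left simp del: power_Suc)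

lemma dil_ginv: "dil c (ginv g) = ginv (dil c g)"
proof (rule prod_eqI)
  show "snd (dil c (ginv g)) = snd (ginv (dil c g))"
    using dil_exp_nth[of c "- fst g" g] by (auto simp: fps_eq_iff snd_ginv simp del: power_Suc)
qed simp

lemma dil_dil: "dil c (dil d g) = dil (c * d) g"
  by (rule prod_eqI) (auto simp: fps_eq_iff power_mult_distrib)

lemma dil_1 [simp]: "dil 1 g = g"
  by (rule prod_eqI) (auto simp: fps_eq_iff)

lemma gnorm_dil:
  assumes "c \<ge> 0"
  shows "gnorm n (dil c g) = c * gnorm n g"
proof -
  have h: "hlog (dil c g) $ k = c ^ Suc k * hlog g $ k" for k
    unfolding hlog_def by (rule dil_mult_nth) (simp_all add: inverse_phi_nth power_mult_distrib)
  have p: "\<bar>hlog (dil c g) $ k\<bar> powr (1 / real (Suc k)) = c * \<bar>hlog g $ k\<bar> powr (1 / real (Suc k))" for k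
  proof (cases "c = 0")
    case False
    then have c: "c > 0" using assms by simp
    have "\<bar>hlog (dil c g) $ k\<bar> powr (1 / real (Suc k)) = (c ^ Suc k) powr (1 / real (Suc k)) * \<bar>hlog g $ k\<bar> powr (1 / real (Suc k))"
      unfolding h abs_mult using c by (subst powr_mult) (auto simp: abs_of_pos simp del: power_Suc)
    also have "(c ^ Suc k) powr (1 / real (Suc k)) = c"
      unfolding powr_realpow[OF c, symmetric] using c by (simp add: powr_powr)
    finally show ?thesis .
  next
    case True
    then show ?thesis using h[of k] by simp
  qed
  have "sqrt ((c * fst g)\<^sup>2 + (c * snd g $ 0)\<^sup>2) = c * sqrt ((fst g)\<^sup>2 + (snd g $ 0)\<^sup>2)"
    using assms by (simp add: power_mult_distrib real_sqrt_mult flip: distrib_left)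
  then show ?thesis unfolding gnorm_def p by (simp add: distrib_left sum_distrib_left)
qed

lemma gdist_dil: "c \<ge> 0 \<Longrightarrow> gdist n (dil c g) (dil c h) = c * gdist n g h"
  unfolding gdist_def by (simp flip: dil_ginv dil_gmul add: gnorm_dil)

lemma gnorm_snd: "gnorm n (0, P) = \<bar>P $ 0\<bar> + (\<Sum>k=1..<n. \<bar>P $ k\<bar> powr (1 / real (Suc k)))"
  by (simp add: gnorm_def hlog_def)

lemma gnorm_const [simp]: "gnorm n (0, fps_const t) = \<bar>t\<bar>"
proof -
  have "(\<Sum>k=1..<n. \<bar>fps_const t $ k\<bar> powr (1 / real (Suc k))) = 0"
    by (intro sum.neutral) auto
  then show ?thesis by (simp add: gnorm_snd)
qed

lemma gnorm_01 [simp]: "gnorm n (0, 1) = 1" "gnorm n (0, 0) = 0"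
  using gnorm_const[of n 1] gnorm_const[of n 0] by simp_all

section \<open>Grids and lattice points\<close>

lemma card_int_interval:
  fixes s c w :: real
  assumes "s > 0" "w \<ge> 0"
  shows "finite {v::int. \<bar>s * real_of_int v + c\<bar> \<le> w}"
    and "real (card {v::int. \<bar>s * real_of_int v + c\<bar> \<le> w}) \<le> 2 * w / s + 1"
    and "2 * w / s - 1 \<le> real (card {v::int. \<bar>s * real_of_int v + c\<bar> \<le> w})"
proof -
  define x where "x = (- w - c) / s"
  define y where "y = (w - c) / s"
  have "\<bar>s * real_of_int v + c\<bar> \<le> w \<longleftrightarrow> x \<le> real_of_int v \<and> real_of_int v \<le> y" for v
    unfolding x_def y_def using assms(1) by (auto simp: field_simps abs_le_iff)
  then have eq: "{v::int. \<bar>s * real_of_int v + c\<bar> \<le> w} = {\<lceil>x\<rceil>..\<lfloor>y\<rfloor>}"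
    by (simp only: set_eq_iff mem_Collect_eq atLeastAtMost_iff le_floor_iff ceiling_le_iff) simp
  have yx: "y - x = 2 * w / s" unfolding x_def y_def using assms(1) by (simp add: field_simps)
  then have "y \<ge> x" using assms by (metis diff_ge_0_iff_ge divide_nonneg_pos mult_nonneg_nonneg zero_le_numeral)
  then have "\<lfloor>y\<rfloor> - \<lceil>x\<rceil> + 1 \<ge> 0" by linarith
  then have card: "real (card {\<lceil>x\<rceil>..\<lfloor>y\<rfloor>}) = real_of_int (\<lfloor>y\<rfloor> - \<lceil>x\<rceil> + 1)" by simp
  show "finite {v::int. \<bar>s * real_of_int v + c\<bar> \<le> w}"
    "real (card {v::int. \<bar>s * real_of_int v + c\<bar> \<le> w}) \<le> 2 * w / s + 1"
    "2 * w / s - 1 \<le> real (card {v::int. \<bar>s * real_of_int v + c\<bar> \<le> w})"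
    unfolding eq card yx[symmetric] by (simp, linarith+)
qed

text \<open>Integer points of a triangular region are counted one coordinate at a time, the range of
  each depending on the earlier ones. Translated boxes have this form because e^(az) acts
  unipotently on the coefficients.\<close>

lemma card_tree:
  fixes I :: "nat \<Rightarrow> (nat \<Rightarrow> int) \<Rightarrow> int set" and lo hi :: "nat \<Rightarrow> real"
  assumes dep: "\<And>i f g. (\<And>j. j < i \<Longrightarrow> f j = g j) \<Longrightarrow> I i f = I i g"
    and fin: "\<And>i f. i < m \<Longrightarrow> finite (I i f)"
    and lo: "\<And>i f. i < m \<Longrightarrow> 0 \<le> lo i \<and> lo i \<le> real (card (I i f))"
    and hi: "\<And>i f. i < m \<Longrightarrow> real (card (I i f)) \<le> hi i"
  shows "finite {f. (\<forall>i\<ge>m. f i = 0) \<and> (\<forall>i<m. f i \<in> I i f)} \<and>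
    (\<Prod>i<m. lo i) \<le> real (card {f. (\<forall>i\<ge>m. f i = 0) \<and> (\<forall>i<m. f i \<in> I i f)}) \<and>
    real (card {f. (\<forall>i\<ge>m. f i = 0) \<and> (\<forall>i<m. f i \<in> I i f)}) \<le> (\<Prod>i<m. hi i)"
  using fin lo hi
proof (induction m)
  case 0
  have "{f. \<forall>i. f (i::nat) = (0::int)} = {\<lambda>_. 0}" by auto
  then show ?case by simp
next
  case (Suc m)
  define T where "T m = {f. (\<forall>i\<ge>m. f i = 0) \<and> (\<forall>i<m. f i \<in> I i f)}" for m
  have IH: "finite (T m)" "(\<Prod>i<m. lo i) \<le> real (card (T m))" "real (card (T m)) \<le> (\<Prod>i<m. hi i)"
    unfolding T_def using Suc by auto
  have bij: "bij_betw (\<lambda>(f, v). f(m := v)) (SIGMA f:T m. I m f) (T (Suc m))"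
  proof (rule bij_betw_byWitness[where f' = "\<lambda>f. (f(m := 0), f m)"])
    show "\<forall>a\<in>SIGMA f:T m. I m f. (\<lambda>f. (f(m := 0), f m)) ((\<lambda>(f, v). f(m := v)) a) = a"
      by (auto simp: T_def fun_eq_iff)
    show "\<forall>a'\<in>T (Suc m). (\<lambda>(f, v). f(m := v)) ((\<lambda>f. (f(m := 0), f m)) a') = a'"
      by auto
    have 1: "I i (f(m := v)) = I i f" if "i \<le> m" for i f v
      by (rule dep) (use that in auto)
    show "(\<lambda>(f, v). f(m := v)) ` (SIGMA f:T m. I m f) \<subseteq> T (Suc m)"
      by (auto simp: T_def 1 less_Suc_eq)
    show "(\<lambda>f. (f(m := 0), f m)) ` T (Suc m) \<subseteq> (SIGMA f:T m. I m f)"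
      by (auto simp: T_def 1)
  qed
  have fin: "finite (I m f)" for f using Suc.prems(1) by simp
  have "card (T (Suc m)) = card (SIGMA f:T m. I m f)"
    using bij_betw_same_card[OF bij] by simp
  also have "\<dots> = (\<Sum>f\<in>T m. card (I m f))"
    using IH(1) fin by (simp add: card_SigmaI)
  finally have card: "real (card (T (Suc m))) = (\<Sum>f\<in>T m. real (card (I m f)))" by simp
  have hi0: "0 \<le> hi i" if "i \<le> m" for i
    using Suc.prems(3)[of i "\<lambda>_. 0"] that by (meson le_imp_less_Suc of_nat_0_le_iff order_trans)
  have "(\<Prod>i<m. lo i) * lo m \<le> real (card (T m)) * lo m"
    using IH(2) Suc.prems(2) by (intro mult_right_mono) auto
  also have "\<dots> \<le> real (card (T (Suc m)))"
    unfolding card using Suc.prems(2) by (intro sum_bounded_below) auto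
  finally have L: "(\<Prod>i<Suc m. lo i) \<le> real (card (T (Suc m)))" by simp
  have "real (card (T (Suc m))) \<le> real (card (T m)) * hi m"
    unfolding card using Suc.prems(3) by (intro sum_bounded_above) auto
  also have "\<dots> \<le> (\<Prod>i<m. hi i) * hi m"
    using IH(3) hi0[of m] by (intro mult_right_mono) auto
  finally have H: "real (card (T (Suc m))) \<le> (\<Prod>i<Suc m. hi i)" by simp
  have "finite (T (Suc m))"
    using bij_betw_finite[OF bij] IH(1) fin by auto
  then show ?case using L H unfolding T_def by blast
qed

lemma fps_mult_nth_trunc:
  fixes A P :: "real fps"
  assumes "A $ 0 = 1"
  shows "(A * P) $ k = P $ k + (A * Abs_fps (\<lambda>j. if j < k then P $ j else 0)) $ k"
proof -
  have "(A * P) $ k = A $ 0 * P $ k + (\<Sum>i=1..k. A $ i * P $ (k - i))"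
    unfolding fps_mult_nth by (simp add: sum.atLeast_Suc_atMost)
  moreover have "(A * Abs_fps (\<lambda>j. if j < k then P $ j else 0)) $ k = (\<Sum>i=1..k. A $ i * P $ (k - i))"
    unfolding fps_mult_nth by (simp add: sum.atLeast_Suc_atMost)
  ultimately show ?thesis using assms by simp
qed

text \<open>
  The homogeneous dimension is \<open>Suc (hdim n)\<close>.
\<close>

definition hdim :: "nat \<Rightarrow> nat" where
  "hdim n = (\<Sum>j<n. Suc j)"

lemma prod_power_hdim: "(\<Prod>j<n. x ^ Suc j) = (x :: real) ^ hdim n"
  unfolding hdim_def by (simp only: power_sum)

lemma prod_power_hdim_Suc: "(\<Prod>i<Suc n. x ^ (if i = 0 then 1 else i)) = (x :: real) ^ Suc (hdim n)"
proof -
  have "(\<Prod>i<Suc n. x ^ (if i = 0 then 1 else i)) = x * (\<Prod>j<n. x ^ Suc j)"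
    by (subst prod.lessThan_Suc_shift) simp
  then show ?thesis unfolding prod_power_hdim by simp
qed

text \<open>The mesh follows the weights: slot 0 is the first coordinate and slot k + 1 the
  coefficient of z^k. The points are not meant as a subgroup; what counts is how many of them lie in
  a ball.\<close>

definition lat_pt :: "nat \<Rightarrow> real \<Rightarrow> (nat \<Rightarrow> int) \<Rightarrow> model" where
  "lat_pt n h f = (h * f 0, Abs_fps (\<lambda>k. if k < n then h ^ Suc k * f (Suc k) else 0))"

text \<open>Relative to x each slot has to satisfy an interval condition shifted by the earlier
  slots. It admits at least 2 (\<rho>/h)^e - 1 integers, and this is at least (\<rho>/h)^e because h
  <= \<rho>.\<close>

lemma lat_ball_lower:
  assumes h: "0 < h" "h \<le> \<rho>" and "n \<ge> 1"
  obtains T where "finite T" "\<And>f. f \<in> T \<Longrightarrow> \<forall>i\<ge>Suc n. f i = 0"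
    "\<And>f. f \<in> T \<Longrightarrow> gdist n x (lat_pt n h f) \<le> gcon n * \<rho>"
    "(\<rho> / h) ^ Suc (hdim n) \<le> real (card T)"
proof -
  define A where "A = fps_exp (- fst x)"
  define e where "e i = (if i = 0 then 1 else i)" for i :: nat
  define c where "c i f = (if i = 0 then - fst x else
     (A * (Abs_fps (\<lambda>j. if j < i - 1 then h ^ Suc j * real_of_int (f (Suc j)) else 0) - snd x)) $ (i - 1))"
    for i and f :: "nat \<Rightarrow> int"
  define I where "I i f = {v::int. \<bar>h ^ e i * real_of_int v + c i f\<bar> \<le> \<rho> ^ e i}" for i f
  define T where "T = {f. (\<forall>i\<ge>Suc n. f i = 0) \<and> (\<forall>i<Suc n. f i \<in> I i f)}"
  have hp: "h ^ e i > 0" and rp: "\<rho> ^ e i \<ge> 0" for i using h by auto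
  note ci = card_int_interval[OF hp rp]
  have dep: "I i f = I i g" if "\<And>j. j < i \<Longrightarrow> f j = g j" for i f g
  proof -
    have "Abs_fps (\<lambda>j. if j < i - 1 then h ^ Suc j * real_of_int (f (Suc j)) else 0) =
        Abs_fps (\<lambda>j. if j < i - 1 then h ^ Suc j * real_of_int (g (Suc j)) else 0)"
      by (rule fps_ext) (simp add: that)
    then have "c i f = c i g" by (simp only: c_def)
    then show ?thesis by (simp add: I_def)
  qed
  have lo: "0 \<le> (\<rho> / h) ^ e i \<and> (\<rho> / h) ^ e i \<le> real (card (I i f))" for i f
  proof -
    have "(\<rho> / h) ^ e i \<ge> 1" using h by simp
    moreover have "2 * \<rho> ^ e i / h ^ e i - 1 \<le> real (card (I i f))"
      unfolding I_def by (rule ci)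
    ultimately show ?thesis by (simp add: power_divide)
  qed
  have "finite T \<and> (\<Prod>i<Suc n. (\<rho> / h) ^ e i) \<le> real (card T) \<and>
      real (card T) \<le> (\<Prod>i<Suc n. 2 * \<rho> ^ e i / h ^ e i + 1)"
    unfolding T_def
  proof (rule card_tree)
    show "I i f = I i g" if "\<And>j. j < i \<Longrightarrow> f j = g j" for i f g
      using that by (rule dep)
    show "0 \<le> (\<rho> / h) ^ e i \<and> (\<rho> / h) ^ e i \<le> real (card (I i f))" for i f by (rule lo)
    show "finite (I i f)" for i f unfolding I_def by (rule ci)
    show "real (card (I i f)) \<le> 2 * \<rho> ^ e i / h ^ e i + 1" for i f unfolding I_def by (rule ci)
  qed
  then have T: "finite T" "(\<rho> / h) ^ Suc (hdim n) \<le> real (card T)"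
    unfolding e_def prod_power_hdim_Suc by auto
  have d: "gdist n x (lat_pt n h f) \<le> gcon n * \<rho>" if f: "f \<in> T" for f
    unfolding gdist_def
  proof (rule gnorm_le)
    show "0 \<le> \<rho>" using h by simp
    have I: "f i \<in> I i f" if "i < Suc n" for i using f that unfolding T_def by auto
    show "\<bar>fst (ginv x \<odot> lat_pt n h f)\<bar> \<le> \<rho>"
      using I[of 0] by (simp add: I_def c_def e_def lat_pt_def)
    fix k assume k: "k < n"
    define P where "P = snd (lat_pt n h f)"
    have Pk: "P $ j = h ^ Suc j * f (Suc j)" if "j \<le> k" for j
      using that k by (simp add: P_def lat_pt_def)
    have "(A * P) $ k = h ^ Suc k * f (Suc k) + (A * Abs_fps (\<lambda>j. if j < k then P $ j else 0)) $ k"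
      by (subst fps_mult_nth_trunc) (simp_all add: A_def Pk)
    also have "Abs_fps (\<lambda>j. if j < k then P $ j else 0) =
        Abs_fps (\<lambda>j. if j < k then h ^ Suc j * real_of_int (f (Suc j)) else 0)"
      by (rule fps_ext) (simp add: Pk)
    finally have "snd (ginv x \<odot> lat_pt n h f) $ k = h ^ Suc k * f (Suc k) + c (Suc k) f"
      by (simp add: snd_gmul snd_ginv c_def A_def P_def right_diff_distrib)
    then show "\<bar>snd (ginv x \<odot> lat_pt n h f) $ k\<bar> \<le> \<rho> ^ Suc k"
      using I[of "Suc k"] k by (simp add: I_def e_def)
  qed fact
  show ?thesis by (rule that[OF T(1) _ d T(2)]) (auto simp: T_def)
qed

lemma lat_ball_upper:
  assumes h: "0 < h" "h \<le> R" and "n \<ge> 1"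
  shows "finite {f. (\<forall>i\<ge>Suc n. f i = 0) \<and> gnorm n (lat_pt n h f) \<le> R}"
    and "real (card {f. (\<forall>i\<ge>Suc n. f i = 0) \<and> gnorm n (lat_pt n h f) \<le> R})
      \<le> (3 * real n) ^ Suc n * (R / h) ^ Suc (hdim n)"
proof -
  define e where "e i = (if i = 0 then 1 else i)" for i :: nat
  define I where "I i (f::nat \<Rightarrow> int) = {v::int. \<bar>h ^ e i * real_of_int v + 0\<bar> \<le> real n * R ^ e i}" for i f
  define T where "T = {f. (\<forall>i\<ge>Suc n. f i = 0) \<and> (\<forall>i<Suc n. f i \<in> I i f)}"
  have hp: "h ^ e i > 0" and rp: "real n * R ^ e i \<ge> 0" for i using h by auto
  note ci = card_int_interval[OF hp rp, where c = 0]
  have hi: "real (card (I i f)) \<le> (3 * real n) * (R / h) ^ e i" for i f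
  proof -
    have "(R / h) ^ e i \<ge> 1" using h by simp
    then have "1 * 1 \<le> real n * (R / h) ^ e i" using assms(3) by (intro mult_mono) auto
    moreover have "real (card (I i f)) \<le> 2 * (real n * (R / h) ^ e i) + 1"
    proof -
      have "real (card (I i f)) \<le> 2 * (real n * R ^ e i) / h ^ e i + 1"
        unfolding I_def by (rule ci)
      also have "2 * (real n * R ^ e i) / h ^ e i = 2 * (real n * (R / h) ^ e i)"
        by (simp add: power_divide)
      finally show ?thesis .
    qed
    ultimately show ?thesis by linarith
  qed
  have "finite T \<and> (\<Prod>i<Suc n. 0) \<le> real (card T) \<and>
      real (card T) \<le> (\<Prod>i<Suc n. (3 * real n) * (R / h) ^ e i)"
    unfolding T_def
  proof (rule card_tree)
    show "I i f = I i g" if "\<And>j. j < i \<Longrightarrow> f j = g j" for i f g by (simp add: I_def)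
    show "(0::real) \<le> 0 \<and> 0 \<le> real (card (I i f))" for i f by simp
    show "finite (I i f)" for i f unfolding I_def by (rule ci)
    show "real (card (I i f)) \<le> (3 * real n) * (R / h) ^ e i" for i f by (rule hi)
  qed
  moreover have "(\<Prod>i<Suc n. (3 * real n) * (R / h) ^ e i) = (3 * real n) ^ Suc n * (R / h) ^ Suc (hdim n)"
    unfolding prod.distrib e_def prod_power_hdim_Suc by (simp only: prod_constant card_lessThan power_mult_distrib)
  ultimately have T: "finite T" "real (card T) \<le> (3 * real n) ^ Suc n * (R / h) ^ Suc (hdim n)"
    by simp_all
  have sub: "{f. (\<forall>i\<ge>Suc n. f i = 0) \<and> gnorm n (lat_pt n h f) \<le> R} \<subseteq> T"
  proof
    fix f assume "f \<in> {f. (\<forall>i\<ge>Suc n. f i = 0) \<and> gnorm n (lat_pt n h f) \<le> R}"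
    then have f: "\<forall>i\<ge>Suc n. f i = 0" "gnorm n (lat_pt n h f) \<le> R" by auto
    have "f i \<in> I i f" if i: "i < Suc n" for i
    proof (cases i)
      case 0
      have "\<bar>h * f 0\<bar> \<le> R" using gnorm_ge_fst[of "lat_pt n h f" n] f(2) by (simp add: lat_pt_def)
      also have "R \<le> real n * R" using assms mult_right_mono[of 1 "real n" R] by simp
      finally show ?thesis using 0 by (simp add: I_def e_def)
    next
      case (Suc k)
      then have k: "k < n" using i by simp
      have "\<bar>h ^ Suc k * f (Suc k)\<bar> \<le> real (Suc k) * gnorm n (lat_pt n h f) ^ Suc k"
        using gnorm_ge_nth[OF k, of "lat_pt n h f"] k by (simp add: lat_pt_def del: of_nat_Suc)
      also have "\<dots> \<le> real n * R ^ Suc k"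
        using k f(2) h by (intro mult_mono power_mono) auto
      finally show ?thesis using Suc by (simp add: I_def e_def)
    qed
    then show "f \<in> T" using f(1) by (simp add: T_def)
  qed
  then show "finite {f. (\<forall>i\<ge>Suc n. f i = 0) \<and> gnorm n (lat_pt n h f) \<le> R}"
    using T(1) finite_subset by blast
  show "real (card {f. (\<forall>i\<ge>Suc n. f i = 0) \<and> gnorm n (lat_pt n h f) \<le> R})
      \<le> (3 * real n) ^ Suc n * (R / h) ^ Suc (hdim n)"
    using card_mono[OF T(1) sub] T(2) by linarith
qed

text \<open>
  Starting points of the lines of the grid of mesh \<open>2\<^bsup>-M\<^esup>\<close>.  The value \<open>f 0\<close> belongs to the first coordinate,
  the values \<open>f j\<close> with \<open>1 \<le> j < n\<close> to the coefficient of \<open>z\<^sup>j\<close>; the coefficient of \<open>z\<^sup>0\<close> is the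
  parameter on the line.
\<close>

definition line_base :: "nat \<Rightarrow> nat \<Rightarrow> (nat \<Rightarrow> int) \<Rightarrow> model" where
  "line_base n M f = (f 0 / 2 ^ M, Abs_fps (\<lambda>j. if 1 \<le> j \<and> j < n then f j / 2 ^ (M * Suc j) else 0))"

abbreviation e2 :: "real \<Rightarrow> model" where
  "e2 t \<equiv> (0, fps_const t)"

lemma e2_add: "e2 s \<odot> e2 t = e2 (s + t)"
  by (simp add: gmul_def)

lemma ginv_e2: "ginv (e2 t) = e2 (- t)"
  by (simp add: ginv_def)

text \<open>The space of lines has dimension \<open>hdim n\<close>, one less than the homogeneous
  dimension: the slot of weight 1 belonging to z^0 is the parameter on the line.\<close>

lemma line_ball_upper:
  assumes "k \<le> M" "n \<ge> 1"
  shows "real (card {f. (\<forall>i\<ge>n. f i = 0) \<and> gdist n x (line_base n M f \<odot> e2 t) \<le> 1 / 2 ^ k})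
      \<le> (3 * real n) ^ n * 2 ^ ((M - k) * hdim n)"
    and "finite {f. (\<forall>i\<ge>n. f i = 0) \<and> gdist n x (line_base n M f \<odot> e2 t) \<le> 1 / 2 ^ k}"
proof -
  define A where "A = fps_exp (- fst x)"
  define c where "c i f = (if i = 0 then - fst x else
     (A * (Abs_fps (\<lambda>j. if j < i then snd (line_base n M f) $ j else 0)
        + fps_exp (f 0 / 2 ^ M) * fps_const t - snd x)) $ i)"
    for i and f :: "nat \<Rightarrow> int"
  define s :: "nat \<Rightarrow> real" where "s i = 1 / 2 ^ (M * Suc i)" for i
  define w where "w i = real n * (1 / 2 ^ k) ^ Suc i" for i
  define I where "I i f = {v::int. \<bar>s i * real_of_int v + c i f\<bar> \<le> w i}" for i f
  define T where "T = {f. (\<forall>i\<ge>n. f i = 0) \<and> (\<forall>i<n. f i \<in> I i f)}"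
  have sp: "s i > 0" and wp: "w i \<ge> 0" for i by (auto simp: s_def w_def)
  note ci = card_int_interval[OF sp wp]
  have dep: "I i f = I i g" if fg: "\<And>j. j < i \<Longrightarrow> f j = g j" for i f g
  proof -
    have "c i f = c i g"
    proof (cases "i = 0")
      case False
      have "Abs_fps (\<lambda>j. if j < i then snd (line_base n M f) $ j else 0) =
          Abs_fps (\<lambda>j. if j < i then snd (line_base n M g) $ j else 0)"
        by (rule fps_ext) (simp add: line_base_def fg)
      then show ?thesis using fg[of 0] False by (simp add: c_def)
    qed (simp add: c_def)
    then show ?thesis by (simp add: I_def)
  qed
  have ws: "2 * w i / s i = 2 * real n * (2 ^ (M - k)) ^ Suc i" for i
  proof -
    have "(2::real) ^ (M * Suc i) = (2 ^ (M - k)) ^ Suc i * (2 ^ k) ^ Suc i"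
      using assms(1) by (simp only: power_mult power_add[symmetric] power_mult_distrib[symmetric]) simp
    then show ?thesis by (simp add: s_def w_def power_one_over field_simps del: power_Suc)
  qed
  have hi: "real (card (I i f)) \<le> (3 * real n) * (2 ^ (M - k)) ^ Suc i" for i f
  proof -
    have "1 * 1 \<le> real n * (2 ^ (M - k)) ^ Suc i" using assms(2) by (intro mult_mono) (auto intro!: one_le_power simp del: power_Suc)
    moreover have "real (card (I i f)) \<le> 2 * w i / s i + 1"
      unfolding I_def by (rule ci)
    ultimately show ?thesis unfolding ws by linarith
  qed
  have "finite T \<and> (\<Prod>i<n. 0) \<le> real (card T) \<and>
      real (card T) \<le> (\<Prod>i<n. (3 * real n) * (2 ^ (M - k)) ^ Suc i)"
    unfolding T_def
  proof (rule card_tree)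
    show "I i f = I i g" if "\<And>j. j < i \<Longrightarrow> f j = g j" for i f g using that by (rule dep)
    show "(0::real) \<le> 0 \<and> 0 \<le> real (card (I i f))" for i f by simp
    show "finite (I i f)" for i f unfolding I_def by (rule ci)
    show "real (card (I i f)) \<le> (3 * real n) * (2 ^ (M - k)) ^ Suc i" for i f by (rule hi)
  qed
  moreover have "(\<Prod>i<n. (3 * real n) * (2 ^ (M - k)) ^ Suc i) = (3 * real n) ^ n * 2 ^ ((M - k) * hdim n)"
    unfolding prod.distrib prod_power_hdim power_mult by (simp only: prod_constant card_lessThan power_mult_distrib power_mult)
  ultimately have T: "finite T" "real (card T) \<le> (3 * real n) ^ n * 2 ^ ((M - k) * hdim n)"
    by simp_all
  have sub: "{f. (\<forall>i\<ge>n. f i = 0) \<and> gdist n x (line_base n M f \<odot> e2 t) \<le> 1 / 2 ^ k} \<subseteq> T"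
  proof
    fix f assume "f \<in> {f. (\<forall>i\<ge>n. f i = 0) \<and> gdist n x (line_base n M f \<odot> e2 t) \<le> 1 / 2 ^ k}"
    then have f: "\<forall>i\<ge>n. f i = 0" "gdist n x (line_base n M f \<odot> e2 t) \<le> 1 / 2 ^ k" by auto
    let ?g = "ginv x \<odot> (line_base n M f \<odot> e2 t)"
    have N: "gnorm n ?g \<le> 1 / 2 ^ k" using f(2) by (simp add: gdist_def)
    have "f i \<in> I i f" if i: "i < n" for i
    proof (cases "i = 0")
      case True
      have "\<bar>fst ?g\<bar> \<le> 1 / 2 ^ k" using gnorm_ge_fst[of ?g n] N by linarith
      also have "\<dots> \<le> real n * (1 / 2 ^ k)" using assms(2) mult_right_mono[of 1 "real n" "1 / 2 ^ k"] by simp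
      finally show ?thesis using True by (simp add: I_def s_def w_def c_def line_base_def)
    next
      case False
      define P where "P = snd (line_base n M f)"
      have "\<bar>snd ?g $ i\<bar> \<le> real (Suc i) * gnorm n ?g ^ Suc i" by (rule gnorm_ge_nth[OF i])
      also have "\<dots> \<le> w i" unfolding w_def
        using i N by (intro mult_mono power_mono) auto
      also have "snd ?g $ i = s i * f i + c i f"
      proof -
        have "snd ?g = A * (P + fps_exp (f 0 / 2 ^ M) * fps_const t) - A * snd x"
          by (simp add: snd_gmul snd_ginv A_def P_def line_base_def)
        then have "snd ?g $ i = (A * P) $ i + (A * (fps_exp (f 0 / 2 ^ M) * fps_const t - snd x)) $ i"
          by (simp only: right_diff_distrib distrib_left fps_add_nth fps_sub_nth add_diff_eq)
        also have "(A * P) $ i = P $ i + (A * Abs_fps (\<lambda>j. if j < i then P $ j else 0)) $ i"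
          by (rule fps_mult_nth_trunc) (simp add: A_def)
        also have "P $ i = s i * f i" using False i by (simp add: P_def line_base_def s_def)
        finally show ?thesis using False
          by (simp only: c_def P_def if_False right_diff_distrib distrib_left fps_add_nth fps_sub_nth)
      qed
      finally show ?thesis by (simp add: I_def)
    qed
    then show "f \<in> T" using f(1) by (simp add: T_def)
  qed
  then show "finite {f. (\<forall>i\<ge>n. f i = 0) \<and> gdist n x (line_base n M f \<odot> e2 t) \<le> 1 / 2 ^ k}"
    using T(1) finite_subset by blast
  show "real (card {f. (\<forall>i\<ge>n. f i = 0) \<and> gdist n x (line_base n M f \<odot> e2 t) \<le> 1 / 2 ^ k})
      \<le> (3 * real n) ^ n * 2 ^ ((M - k) * hdim n)"
    using card_mono[OF T(1) sub] T(2) by linarith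
qed

section \<open>The energy of quasisymmetric maps along lines\<close>

lemma gdist_ge_fst: "\<bar>fst h - fst g\<bar> \<le> gdist n g h"
  using gnorm_ge_fst[of "ginv g \<odot> h" n] by (simp add: gdist_def)

lemma gdist_ge_snd_0: "\<bar>snd h $ 0 - snd g $ 0\<bar> \<le> gdist n g h"
  using gnorm_ge_snd_0[of "ginv g \<odot> h" n] by (simp add: gdist_def snd_gmul snd_ginv)

lemma gdist_e2: "gdist n (e2 s) (e2 t) = \<bar>t - s\<bar>"
  by (simp add: gdist_def ginv_e2 e2_add)

lemma gdist_gone [simp]: "gdist n gone g = gnorm n g"
  by (simp add: gdist_def)

text \<open>\<open>M\<close> is the level of the mesh and \<open>s\<close> that of the region: for
  \<open>w = 1\<close> and s <= M the starting points fill a box of homogeneous size 2^(-s) at the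
  identity.\<close>

definition line_box :: "nat \<Rightarrow> nat \<Rightarrow> nat \<Rightarrow> real \<Rightarrow> (nat \<Rightarrow> int) set" where
  "line_box n M s w = {f. (\<forall>i\<ge>n. f i = 0) \<and> (\<forall>i<n. \<bar>real_of_int (f i)\<bar> \<le> w * 2 ^ ((M - s) * Suc i))}"

lemma line_box_card:
  assumes "w \<ge> 1"
  shows "finite (line_box n M s w)"
    "real (card (line_box n M s w)) \<le> (3 * w) ^ n * 2 ^ ((M - s) * hdim n)"
    "2 ^ ((M - s) * hdim n) \<le> real (card (line_box n M s w))"
proof -
  define I where "I i (f::nat \<Rightarrow> int) = {v::int. \<bar>1 * real_of_int v + 0\<bar> \<le> w * 2 ^ ((M - s) * Suc i)}" for i f
  have wp: "0 \<le> w * 2 ^ ((M - s) * Suc i)" for i using assms by simp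
  have one: "1 * 1 \<le> w * 2 ^ ((M - s) * Suc i)" for i
    using assms by (intro mult_mono) (auto intro!: one_le_power)
  note ci = card_int_interval[OF zero_less_one wp, where c = 0]
  have eq: "line_box n M s w = {f. (\<forall>i\<ge>n. f i = 0) \<and> (\<forall>i<n. f i \<in> I i f)}"
    by (simp add: line_box_def I_def)
  have "finite (line_box n M s w) \<and> (\<Prod>i<n. 2 ^ ((M - s) * Suc i)) \<le> real (card (line_box n M s w)) \<and>
     real (card (line_box n M s w)) \<le> (\<Prod>i<n. (3 * w) * 2 ^ ((M - s) * Suc i))"
    unfolding eq
  proof (rule card_tree)
    show "I i f = I i g" for i f g by (simp add: I_def)
    show "finite (I i f)" for i f unfolding I_def by (rule ci)
    show "(0::real) \<le> 2 ^ ((M - s) * Suc i) \<and> 2 ^ ((M - s) * Suc i) \<le> real (card (I i f))" for i f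
    proof -
      have "2 * (w * 2 ^ ((M - s) * Suc i)) / 1 - 1 \<le> real (card (I i f))"
        unfolding I_def by (rule ci)
      moreover have "1 * 2 ^ ((M - s) * Suc i) \<le> w * 2 ^ ((M - s) * Suc i)"
        using assms by (intro mult_right_mono) auto
      ultimately have "2 ^ ((M - s) * Suc i) \<le> real (card (I i f))"
        using one[of i] unfolding div_by_1 by linarith
      then show ?thesis by simp
    qed
    show "real (card (I i f)) \<le> (3 * w) * 2 ^ ((M - s) * Suc i)" for i f
    proof -
      have "real (card (I i f)) \<le> 2 * (w * 2 ^ ((M - s) * Suc i)) / 1 + 1"
        unfolding I_def by (rule ci)
      then show ?thesis using one[of i] unfolding div_by_1 by linarith
    qed
  qed
  moreover have "(\<Prod>i<n. (2::real) ^ ((M - s) * Suc i)) = 2 ^ ((M - s) * hdim n)"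
    using prod_power_hdim[of "2 ^ (M - s)" n] by (simp only: power_mult)
  ultimately show "finite (line_box n M s w)"
    "real (card (line_box n M s w)) \<le> (3 * w) ^ n * 2 ^ ((M - s) * hdim n)"
    "2 ^ ((M - s) * hdim n) \<le> real (card (line_box n M s w))"
    by (auto simp: prod.distrib power_mult_distrib simp del: power_Suc mult_Suc_right)
qed

lemma line_base_bound:
  assumes f: "f \<in> line_box n M 0 2" and t: "0 \<le> t" "t \<le> 1" and n: "n \<ge> 1"
  shows "gnorm n (line_base n M f \<odot> e2 t) \<le> gcon n * 4"
proof (rule gnorm_le)
  have fi: "\<bar>f i / 2 ^ (M * Suc i)\<bar> \<le> 2" if "i < n" for i
    using f that by (simp add: line_box_def divide_le_eq del: power_Suc mult_Suc_right)
  have f0: "\<bar>f 0 / 2 ^ M\<bar> \<le> 2" using fi[of 0] n by simp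
  then show "\<bar>fst (line_base n M f \<odot> e2 t)\<bar> \<le> 4" by (simp add: line_base_def)
  fix k assume k: "k < n"
  have "\<bar>(f 0 / 2 ^ M) ^ k / fact k * t\<bar> \<le> 2 ^ k * 1"
  proof -
    have "\<bar>(f 0 / 2 ^ M) ^ k / fact k\<bar> \<le> \<bar>f 0 / 2 ^ M\<bar> ^ k"
      by (rule abs_power_div_fact_le)
    also have "\<dots> \<le> 2 ^ k" using f0 by (intro power_mono) auto
    finally show ?thesis using t unfolding abs_mult by (intro mult_mono) auto
  qed
  moreover have "\<bar>snd (line_base n M f) $ k\<bar> \<le> 2"
    using fi[OF k] k by (simp add: line_base_def del: power_Suc mult_Suc_right)
  moreover have "(2::real) ^ k + 2 \<le> 4 ^ Suc k"
  proof -
    have "(2::real) ^ k \<le> 4 ^ k" by (rule power_mono) auto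
    moreover have "(1::real) \<le> 4 ^ k" by simp
    ultimately show ?thesis unfolding power_Suc by linarith
  qed
  moreover have "snd (line_base n M f \<odot> e2 t) $ k = snd (line_base n M f) $ k + (f 0 / 2 ^ M) ^ k / fact k * t"
    by (simp add: snd_gmul line_base_def)
  ultimately show "\<bar>snd (line_base n M f \<odot> e2 t) $ k\<bar> \<le> 4 ^ Suc k" by linarith
qed (use n in auto)

text \<open>The assumptions are those that pass to rescalings (\<open>qs_map_comp\<close>) and to
  the inverse (\<open>qs_map_inverse\<close>). Bijectivity is expressed up to distance 0, by
  \<open>pos\<close> and \<open>onto\<close>. In \<open>qs\<close> the point \<open>y\<close> may
  coincide with \<open>x\<close> or \<open>z\<close>, which yields \<open>F_cong\<close> and
  \<open>eta1_ge_1\<close>.\<close>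

locale qs_map =
  fixes n :: nat and \<eta> :: "real \<Rightarrow> real" and F :: "model \<Rightarrow> model"
  assumes n3: "n \<ge> 3"
    and eta_nonneg: "t \<ge> 0 \<Longrightarrow> \<eta> t \<ge> 0"
    and eta_mono: "0 \<le> s \<Longrightarrow> s \<le> t \<Longrightarrow> \<eta> s \<le> \<eta> t"
    and eta_lim: "e > 0 \<Longrightarrow> \<exists>d>0. \<eta> d < e"
    and qs: "gdist n x z > 0 \<Longrightarrow>
      gdist n (F x) (F y) \<le> \<eta> (gdist n x y / gdist n x z) * gdist n (F x) (F z)"
    and pos: "gdist n x z > 0 \<Longrightarrow> gdist n (F x) (F z) > 0"
    and onto: "\<exists>x. gdist n (F x) y = 0"
begin

lemma n1: "n \<ge> 1" using n3 by simp

lemma n1' [simp]: "Suc 0 \<le> n" "0 < n" using n3 by simp_all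

lemma gdist_self' [simp]: "gdist n g g = 0" by (rule gdist_self[OF n1])

lemma qs_le:
  assumes "gdist n x z > 0" "gdist n x y \<le> t * gdist n x z"
  shows "gdist n (F x) (F y) \<le> \<eta> t * gdist n (F x) (F z)"
proof -
  have "gdist n x y / gdist n x z \<le> t" using assms by (simp add: divide_le_eq)
  moreover have "0 \<le> gdist n x y / gdist n x z" by simp
  ultimately have "\<eta> (gdist n x y / gdist n x z) \<le> \<eta> t" by (intro eta_mono) auto
  then have "\<eta> (gdist n x y / gdist n x z) * gdist n (F x) (F z) \<le> \<eta> t * gdist n (F x) (F z)"
    by (rule mult_right_mono) simp
  then show ?thesis using qs[OF assms(1), of y] by linarith
qed

lemma eta1_ge_1: "\<eta> 1 \<ge> 1"
proof -
  have d: "gdist n gone (e2 1) > 0" by simp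
  then have "gdist n (F gone) (F (e2 1)) \<le> \<eta> 1 * gdist n (F gone) (F (e2 1))"
    by (intro qs_le) auto
  then show ?thesis using pos[OF d] by simp
qed

lemma F_cong: "gdist n x y = 0 \<Longrightarrow> gdist n (F x) (F y) = 0"
proof -
  assume xy: "gdist n x y = 0"
  let ?z = "x \<odot> e2 1"
  have xz: "gdist n x ?z > 0" by simp
  have "gdist n (F x) (F y) \<le> \<eta> 0 * gdist n (F x) (F ?z)"
    using xy by (intro qs_le xz) simp
  moreover have "\<eta> 0 = 0"
  proof (rule ccontr)
    assume "\<eta> 0 \<noteq> 0"
    then have "\<eta> 0 > 0" using eta_nonneg[of 0] by simp
    then obtain d where "d > 0" "\<eta> d < \<eta> 0" using eta_lim by blast
    then show False using eta_mono[of 0 d] by simp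
  qed
  ultimately show ?thesis using gdist_nonneg[of n "F x" "F y"] by simp
qed

lemma F_bounded:
  obtains R where "R > 0" "\<And>x. gnorm n x \<le> R0 \<Longrightarrow> gdist n (F gone) (F x) \<le> R"
proof
  let ?D = "gdist n (F gone) (F (e2 1))"
  have d: "gdist n gone (e2 1) > 0" by simp
  show "\<eta> (max R0 1) * ?D > 0"
    using eta1_ge_1 eta_mono[of 1 "max R0 1"] pos[OF d] by (intro mult_pos_pos) auto
  show "gdist n (F gone) (F x) \<le> \<eta> (max R0 1) * ?D" if "gnorm n x \<le> R0" for x
    using that by (intro qs_le[OF d]) simp
qed

definition line_step :: "nat \<Rightarrow> nat \<Rightarrow> (nat \<Rightarrow> int) \<Rightarrow> nat \<Rightarrow> real" where
  "line_step M k f i = gdist n (F (line_base n M f \<odot> e2 (real i / 2 ^ k))) (F (line_base n M f \<odot> e2 (real (Suc i) / 2 ^ k)))"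

lemma line_step_pos: "line_step M k f i > 0"
  unfolding line_step_def by (rule pos) (simp add: gdist_e2 field_simps)

lemma line_step_nonneg [simp]: "line_step M k f i \<ge> 0"
  by (simp add: line_step_def)

text \<open>Were \<open>x\<close> farther than 2^(-k) from the start of the segment, quasisymmetry
  would bound the step by \<eta>(1) times the distance of the images, hence by half of
  itself.\<close>

lemma near_preimage:
  assumes "gdist n (F (line_base n M f \<odot> e2 (real i / 2 ^ k))) (F x) \<le> line_step M k f i / (2 * \<eta> 1)"
  shows "gdist n x (line_base n M f \<odot> e2 (real i / 2 ^ k)) \<le> 1 / 2 ^ k"
proof (rule ccontr)
  let ?p = "line_base n M f \<odot> e2 (real i / 2 ^ k)"
  let ?q = "line_base n M f \<odot> e2 (real (Suc i) / 2 ^ k)"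
  assume "\<not> ?thesis"
  then have far: "gdist n ?p x > 1 / 2 ^ k" by (simp add: gdist_commute)
  have pq: "gdist n ?p ?q = 1 / 2 ^ k" by (simp add: gdist_e2 field_simps)
  have far0: "gdist n ?p x > 0" by (rule less_trans[OF _ far]) simp
  have "line_step M k f i \<le> \<eta> 1 * gdist n (F ?p) (F x)"
    unfolding line_step_def by (rule qs_le[OF far0]) (use far pq in simp)
  also have "\<dots> \<le> \<eta> 1 * (line_step M k f i / (2 * \<eta> 1))"
    using eta1_ge_1 assms by (intro mult_left_mono) auto
  also have "\<dots> = line_step M k f i / 2" using eta1_ge_1 by simp
  finally show False using line_step_pos[of M k f i] by simp
qed

text \<open>The coefficient of z^0 of a point on a grid line is its parameter, so at most 3 indices
  i are possible; for each of them \<open>line_ball_upper\<close> counts the lines.\<close>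

lemma card_near_line_pts:
  assumes "k \<le> M"
  shows "finite {(f, i). (\<forall>j\<ge>n. f j = 0) \<and> gdist n x (line_base n M f \<odot> e2 (real i / 2 ^ k)) \<le> 1 / 2 ^ k}"
    "real (card {(f, i). (\<forall>j\<ge>n. f j = 0) \<and> gdist n x (line_base n M f \<odot> e2 (real i / 2 ^ k)) \<le> 1 / 2 ^ k})
      \<le> 3 * ((3 * real n) ^ n * 2 ^ ((M - k) * hdim n))"
proof -
  define A where "A i = {f. (\<forall>j\<ge>n. f j = 0) \<and> gdist n x (line_base n M f \<odot> e2 (real i / 2 ^ k)) \<le> 1 / 2 ^ k}"
    for i :: nat
  define J where "J = {i::nat. \<bar>1 / 2 ^ k * real_of_int (int i) + (- snd x $ 0)\<bar> \<le> 1 / 2 ^ k}"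
  have p: "(0::real) < 1 / 2 ^ k" "(0::real) \<le> 1 / 2 ^ k" by auto
  note ci = card_int_interval[OF p, of "- snd x $ 0"]
  have sub: "int ` J \<subseteq> {v. \<bar>1 / 2 ^ k * real_of_int v + (- snd x $ 0)\<bar> \<le> 1 / 2 ^ k}"
    by (auto simp: J_def)
  have finJ: "finite J" using finite_subset[OF sub ci(1)] by (rule finite_imageD) simp
  have "real (card J) = real (card (int ` J))" by (simp add: card_image)
  also have "\<dots> \<le> real (card {v. \<bar>1 / 2 ^ k * real_of_int v + (- snd x $ 0)\<bar> \<le> 1 / 2 ^ k})"
    using card_mono[OF ci(1) sub] by simp
  also have "\<dots> \<le> 3" using ci(2) by simp
  finally have cardJ: "real (card J) \<le> 3" .
  let ?S = "{(f, i). (\<forall>j\<ge>n. f j = 0) \<and> gdist n x (line_base n M f \<odot> e2 (real i / 2 ^ k)) \<le> 1 / 2 ^ k}"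
  have S: "?S \<subseteq> (\<Union>i\<in>J. (\<lambda>f. (f, i)) ` A i)"
  proof
    fix z assume "z \<in> ?S"
    then obtain f i where z: "z = (f, i)" and
      f: "\<forall>j\<ge>n. f j = 0" "gdist n x (line_base n M f \<odot> (e2 (real i / 2 ^ k))) \<le> 1 / 2 ^ k"
      by auto
    have "snd (line_base n M f \<odot> (e2 (real i / 2 ^ k))) $ 0 = real i / 2 ^ k"
      by (simp add: snd_gmul line_base_def)
    then have "\<bar>real i / 2 ^ k - snd x $ 0\<bar> \<le> 1 / 2 ^ k"
      using gdist_ge_snd_0[of "line_base n M f \<odot> (e2 (real i / 2 ^ k))" x n] f(2) by simp
    then have "i \<in> J" by (simp add: J_def)
    then show "z \<in> (\<Union>i\<in>J. (\<lambda>f. (f, i)) ` A i)"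
      using f unfolding z by (auto simp: A_def)
  qed
  have finA: "finite (A i)" and cardA: "real (card (A i)) \<le> (3 * real n) ^ n * 2 ^ ((M - k) * hdim n)" for i
    unfolding A_def using line_ball_upper[OF assms n1] by auto
  have finU: "finite (\<Union>i\<in>J. (\<lambda>f. (f, i)) ` A i)" using finJ finA by auto
  show "finite ?S" using finite_subset[OF S finU] .
  have "card ?S \<le> card (\<Union>i\<in>J. (\<lambda>f. (f, i)) ` A i)" by (rule card_mono[OF finU S])
  also have "\<dots> \<le> (\<Sum>i\<in>J. card ((\<lambda>f. (f, i)) ` A i))" by (rule card_UN_le[OF finJ])
  finally have "real (card ?S) \<le> real (\<Sum>i\<in>J. card ((\<lambda>f. (f, i)) ` A i))" by (rule of_nat_mono)
  also have "\<dots> = (\<Sum>i\<in>J. real (card (A i)))"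
    by (simp add: card_image inj_on_def)
  also have "\<dots> \<le> real (card J) * ((3 * real n) ^ n * 2 ^ ((M - k) * hdim n))"
    by (intro sum_bounded_above cardA)
  also have "\<dots> \<le> 3 * ((3 * real n) ^ n * 2 ^ ((M - k) * hdim n))"
    using cardJ by (intro mult_right_mono) auto
  finally show "real (card ?S) \<le> 3 * ((3 * real n) ^ n * 2 ^ ((M - k) * hdim n))" .
qed

text \<open>
  Each grid segment gets the points of a fine lattice in a ball around its image whose radius is a small
  multiple of the length of the image.  By quasisymmetry a lattice point is used only by segments near its
  preimage.
\<close>

lemma line_energy:
  obtains C where "C > 0"
    "\<And>M k. k \<le> M \<Longrightarrow> (\<Sum>f\<in>line_box n M 0 2. \<Sum>i<2 ^ k. line_step M k f i ^ Suc (hdim n)) \<le> C * 2 ^ ((M - k) * hdim n)"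
proof -
  let ?Q = "Suc (hdim n)"
  obtain R where R: "R > 0" "\<And>x. gnorm n x \<le> gcon n * 4 \<Longrightarrow> gdist n (F gone) (F x) \<le> R"
    using F_bounded by blast
  define m where "m = max (gnorm n (F gone)) (gtri n * R)"
  define R1 where "R1 = gtri n * (gtri n * m)"
  have g1: "gtri n \<ge> 1" by (rule gtri_ge_1) simp
  have m: "m > 0" "m \<le> gtri n * m" "R \<le> m"
    using R g1 mult_right_mono[of 1 "gtri n" R] mult_right_mono[of 1 "gtri n" m]
    by (auto simp: m_def less_max_iff_disj le_max_iff_disj)
  have R1: "R1 > 0" unfolding R1_def using m g1 by (intro mult_pos_pos) auto
  define c where "c = 1 / (2 * \<eta> 1)"
  have c: "c > 0" "c \<le> 1" unfolding c_def using eta1_ge_1 by auto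
  define q where "q = c / gcon n"
  have gc: "gcon n \<ge> 2" by (rule gcon_ge_2)
  have q: "q > 0" "gcon n * q = c" unfolding q_def using c gc by auto
  define K where "K = 3 * ((3 * real n) ^ n)"
  define C where "C = (1 / q) ^ ?Q * ((3 * real n) ^ Suc n * R1 ^ ?Q * K)"
  show ?thesis
  proof (rule that)
    show "C > 0" unfolding C_def K_def using q R1 n1 by (intro mult_pos_pos zero_less_power) auto
    fix M k :: nat assume kM: "k \<le> M"
    define G where "G = line_box n M 0 2 \<times> {..<(2::nat) ^ k}"
    define pt where "pt g = line_base n M (fst g) \<odot> e2 (real (snd g) / 2 ^ k)" for g :: "(nat \<Rightarrow> int) \<times> nat"
    define st where "st g = line_step M k (fst g) (snd g)" for g
    have finG: "finite G" unfolding G_def using line_box_card(1) by simp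
    have st: "st g > 0" for g unfolding st_def by (rule line_step_pos)
    have st_le: "st g \<le> gtri n * R" and pt_le: "gdist n (F gone) (F (pt g)) \<le> R" if "g \<in> G" for g
    proof -
      obtain f i where g: "g = (f, i)" by force
      then have fi: "f \<in> line_box n M 0 2" "i < 2 ^ k" using that by (auto simp: G_def)
      have "real (Suc i) \<le> 2 ^ k" using fi(2) by (metis Suc_leI of_nat_mono of_nat_numeral of_nat_power)
      then have t: "real i / 2 ^ k \<le> 1" "real (Suc i) / 2 ^ k \<le> 1" using fi(2) by (auto simp: divide_le_eq)
      have 1: "gdist n (F gone) (F (line_base n M f \<odot> e2 (real i / 2 ^ k))) \<le> R"
        and 2: "gdist n (F gone) (F (line_base n M f \<odot> e2 (real (Suc i) / 2 ^ k))) \<le> R"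
        using t by (auto intro!: R(2) line_base_bound[OF fi(1)] simp del: of_nat_Suc)
      show "gdist n (F gone) (F (pt g)) \<le> R" using 1 by (simp add: pt_def g)
      show "st g \<le> gtri n * R" unfolding st_def g line_step_def fst_conv snd_conv
        by (rule gdist_triangle[where h = "F gone"]) (use 1 2 in \<open>auto simp: gdist_commute\<close>)
    qed
    \<comment> \<open>One mesh fine enough for all segments of the finite grid; it cancels when the
      sum is multiplied by (h/q)^Q at the end.\<close>
    obtain h where h: "h > 0" "h \<le> R1" "\<And>g. g \<in> G \<Longrightarrow> h \<le> q * st g"
    proof
      let ?A = "insert R1 ((\<lambda>g. q * st g) ` G)"
      have A: "finite ?A" "?A \<noteq> {}" using finG by auto
      show "0 < Min ?A" using A q st R1 by (subst Min_gr_iff) auto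
      show "Min ?A \<le> R1" by (rule Min_le[OF A(1)]) simp
      show "Min ?A \<le> q * st g" if "g \<in> G" for g by (rule Min_le[OF A(1)]) (use that in blast)
    qed
    define Y where "Y = {f. (\<forall>i\<ge>Suc n. f i = 0) \<and> gnorm n (lat_pt n h f) \<le> R1}"
    have Y: "finite Y" "real (card Y) \<le> (3 * real n) ^ Suc n * (R1 / h) ^ ?Q"
      unfolding Y_def using lat_ball_upper[OF h(1,2) n1] by auto
    have "\<exists>T. finite T \<and> T \<subseteq> Y \<and> (\<forall>y\<in>T. gdist n (F (pt g)) (lat_pt n h y) \<le> c * st g) \<and>
        (q * st g / h) ^ ?Q \<le> real (card T)" if g: "g \<in> G" for g
    proof -
      obtain T where T: "finite T" "\<And>f. f \<in> T \<Longrightarrow> \<forall>i\<ge>Suc n. f i = 0"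
        "\<And>f. f \<in> T \<Longrightarrow> gdist n (F (pt g)) (lat_pt n h f) \<le> gcon n * (q * st g)"
        "(q * st g / h) ^ ?Q \<le> real (card T)"
        using lat_ball_lower[OF h(1) h(3)[OF g] n1] by blast
      have d: "gdist n (F (pt g)) (lat_pt n h y) \<le> c * st g" if "y \<in> T" for y
        using T(3)[OF that] q(2) by (simp add: mult.assoc[symmetric])
      have "gnorm n (lat_pt n h y) \<le> R1" if "y \<in> T" for y
      proof -
        have "c * st g \<le> 1 * st g" using c(2) st[of g] by (intro mult_right_mono) auto
        also have "\<dots> \<le> m" using st_le[OF g] by (simp add: m_def)
        finally have "c * st g \<le> m" .
        then have 1: "gdist n (F (pt g)) (lat_pt n h y) \<le> m" using d[OF that] by linarith
        have 2: "gdist n (F gone) (F (pt g)) \<le> m" using pt_le[OF g] m by linarith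
        have 3: "gdist n gone (F gone) \<le> gtri n * m"
          using m(2) by (simp add: m_def)
        have "gdist n gone (lat_pt n h y) \<le> R1" unfolding R1_def
          by (rule gdist_triangle[OF 3 gdist_triangle[OF 2 1 n1] n1])
        then show ?thesis by simp
      qed
      then show ?thesis using T d by (intro exI[of _ T]) (auto simp: Y_def)
    qed
    then obtain T where T: "\<And>g. g \<in> G \<Longrightarrow> finite (T g) \<and> T g \<subseteq> Y \<and>
        (\<forall>y\<in>T g. gdist n (F (pt g)) (lat_pt n h y) \<le> c * st g) \<and> (q * st g / h) ^ ?Q \<le> real (card (T g))"
      by metis
    define X where "X y = (SOME x. gdist n (F x) (lat_pt n h y) = 0)" for y
    have X: "gdist n (F (X y)) (lat_pt n h y) = 0" for y
      unfolding X_def by (rule someI_ex) (rule onto)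
    have near: "gdist n (X y) (pt g) \<le> 1 / 2 ^ k" if "g \<in> G" "y \<in> T g" for g y
    proof -
      have "gdist n (F (pt g)) (F (X y)) = gdist n (F (pt g)) (lat_pt n h y)"
        by (rule gdist_cong[OF _ X n1]) simp
      also have "\<dots> \<le> c * st g" using T that by blast
      finally show ?thesis unfolding pt_def st_def c_def by (intro near_preimage) simp
    qed
    have cnt: "real (card {g \<in> G. y \<in> T g}) \<le> K * 2 ^ ((M - k) * hdim n)" for y
    proof -
      let ?S = "{(f, i). (\<forall>j\<ge>n. f j = 0) \<and> gdist n (X y) (line_base n M f \<odot> e2 (real i / 2 ^ k)) \<le> 1 / 2 ^ k}"
      have "{g \<in> G. y \<in> T g} \<subseteq> ?S"
        using near[of _ y] by (auto simp: G_def line_box_def pt_def)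
      then have "card {g \<in> G. y \<in> T g} \<le> card ?S"
        by (intro card_mono card_near_line_pts kM)
      then show ?thesis using card_near_line_pts(2)[OF kM, of "X y"] unfolding K_def by linarith
    qed
    have "(\<Sum>g\<in>G. (q * st g / h) ^ ?Q) \<le> (\<Sum>g\<in>G. real (card (T g)))"
      using T by (intro sum_mono) auto
    also have "\<dots> = (\<Sum>g\<in>G. \<Sum>y\<in>Y. if y \<in> T g then 1 else 0)"
    proof (rule sum.cong[OF refl])
      fix g assume "g \<in> G"
      then have "Y \<inter> T g = T g" using T by blast
      then show "real (card (T g)) = (\<Sum>y\<in>Y. if y \<in> T g then 1 else 0)"
        using Y(1) by (simp add: sum.inter_restrict[symmetric] flip: sum.inter_filter)
    qed
    also have "\<dots> = (\<Sum>y\<in>Y. \<Sum>g\<in>G. if y \<in> T g then 1 else 0)" by (rule sum.swap)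
    also have "\<dots> = (\<Sum>y\<in>Y. real (card {g \<in> G. y \<in> T g}))"
      using finG by (simp flip: sum.inter_filter)
    also have "\<dots> \<le> real (card Y) * (K * 2 ^ ((M - k) * hdim n))"
      by (intro sum_bounded_above cnt)
    also have "\<dots> \<le> ((3 * real n) ^ Suc n * (R1 / h) ^ ?Q) * (K * 2 ^ ((M - k) * hdim n))"
      using Y(2) by (intro mult_right_mono) (auto simp: K_def)
    finally have "(\<Sum>g\<in>G. (q * st g / h) ^ ?Q) \<le> ((3 * real n) ^ Suc n * (R1 / h) ^ ?Q) * (K * 2 ^ ((M - k) * hdim n))" .
    then have "(h / q) ^ ?Q * (\<Sum>g\<in>G. (q * st g / h) ^ ?Q)
        \<le> (h / q) ^ ?Q * (((3 * real n) ^ Suc n * (R1 / h) ^ ?Q) * (K * 2 ^ ((M - k) * hdim n)))"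
      using h q by (intro mult_left_mono) auto
    moreover have "(h / q) ^ ?Q * (\<Sum>g\<in>G. (q * st g / h) ^ ?Q) = (\<Sum>g\<in>G. st g ^ ?Q)"
      unfolding sum_distrib_left power_mult_distrib[symmetric] using h q by simp
    moreover have "(h / q) ^ ?Q * (((3 * real n) ^ Suc n * (R1 / h) ^ ?Q) * (K * 2 ^ ((M - k) * hdim n)))
        = C * 2 ^ ((M - k) * hdim n)"
    proof -
      have "(h / q) ^ ?Q * (R1 / h) ^ ?Q = (1 / q) ^ ?Q * R1 ^ ?Q"
        unfolding power_mult_distrib[symmetric] using h q by simp
      then have "((h / q) ^ ?Q * (R1 / h) ^ ?Q) * ((3 * real n) ^ Suc n * (K * 2 ^ ((M - k) * hdim n)))
         = ((1 / q) ^ ?Q * R1 ^ ?Q) * ((3 * real n) ^ Suc n * (K * 2 ^ ((M - k) * hdim n)))" by simp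
      then show ?thesis unfolding C_def by (simp only: mult_ac)
    qed
    ultimately have "(\<Sum>g\<in>G. st g ^ ?Q) \<le> C * 2 ^ ((M - k) * hdim n)" by linarith
    then show "(\<Sum>f\<in>line_box n M 0 2. \<Sum>i<2 ^ k. line_step M k f i ^ ?Q) \<le> C * 2 ^ ((M - k) * hdim n)"
      unfolding G_def sum.cartesian_product st_def by (simp add: case_prod_beta)
  qed
qed

end

section \<open>Dyadic martingales and neighbouring lines of the grid\<close>

text \<open>
  For fixed \<open>x\<close> the dyadic difference quotients \<open>dquot j\<close> form a martingale, and \<open>denergy j\<close> are its
  second moments.
\<close>

definition dquot :: "nat \<Rightarrow> nat \<Rightarrow> (real \<Rightarrow> real) \<Rightarrow> real" where
  "dquot j i x = 2 ^ j * (x (real (Suc i) / 2 ^ j) - x (real i / 2 ^ j))"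

lemma sum_dyadic_group:
  fixes g :: "nat \<Rightarrow> real"
  shows "(\<Sum>i<2 ^ c. \<Sum>s<2 ^ m. g (i * 2 ^ m + s)) = (\<Sum>k<2 ^ (c + m). g k)"
proof -
  have "(\<Sum>s<2 ^ m. g (i * 2 ^ m + s)) = sum g {i * 2 ^ m..<i * 2 ^ m + 2 ^ m}" for i
    by (rule sum.reindex_bij_witness[where i = "\<lambda>k. k - i * 2 ^ m" and j = "\<lambda>s. i * 2 ^ m + s"]) auto
  then show ?thesis by (simp add: sum.nat_group power_add)
qed

lemma dquot_mean: "(\<Sum>s<2 ^ m. dquot (c + m) (i * 2 ^ m + s) x) = 2 ^ m * dquot c i x"
proof -
  define y where "y s = x (real (i * 2 ^ m + s) / 2 ^ (c + m))" for s
  have "(\<Sum>s<2 ^ m. dquot (c + m) (i * 2 ^ m + s) x) = 2 ^ (c + m) * (\<Sum>s<2 ^ m. y (Suc s) - y s)"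
    unfolding dquot_def y_def sum_distrib_left by simp
  also have "(\<Sum>s<2 ^ m. y (Suc s) - y s) = y (2 ^ m) - y 0"
    by (rule sum_lessThan_telescope)
  also have "y (2 ^ m) = x (real (Suc i) / 2 ^ c)"
    unfolding y_def by (simp add: power_add add_divide_distrib distrib_right add.commute)
  also have "y 0 = x (real i / 2 ^ c)"
    unfolding y_def by (simp add: power_add)
  finally show ?thesis by (simp add: dquot_def power_add)
qed

lemma sum_variance:
  fixes d :: "nat \<Rightarrow> real"
  assumes "(\<Sum>s<N. d s) = real N * \<mu>"
  shows "(\<Sum>s<N. (d s - \<mu>)\<^sup>2) = (\<Sum>s<N. (d s)\<^sup>2) - real N * \<mu>\<^sup>2"
proof -
  have "(\<Sum>s<N. (d s - \<mu>)\<^sup>2) = (\<Sum>s<N. (d s)\<^sup>2) - 2 * \<mu> * (\<Sum>s<N. d s) + real N * \<mu>\<^sup>2"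
    by (simp add: power2_diff sum.distrib sum_subtractf sum_distrib_left mult_ac)
  then show ?thesis unfolding assms by (simp add: power2_eq_square algebra_simps)
qed

definition denergy :: "nat \<Rightarrow> (real \<Rightarrow> real) \<Rightarrow> real" where
  "denergy j x = (\<Sum>i<2 ^ j. (dquot j i x)\<^sup>2) / 2 ^ j"

text \<open>The conditional variance of the martingale at level \<open>c + m\<close> on the i-th
  interval of level \<open>c\<close>.\<close>

definition dvar :: "nat \<Rightarrow> nat \<Rightarrow> nat \<Rightarrow> (real \<Rightarrow> real) \<Rightarrow> real" where
  "dvar c m i x = (\<Sum>s<2 ^ m. (dquot (c + m) (i * 2 ^ m + s) x - dquot c i x)\<^sup>2) / 2 ^ m"

lemma dvar_nonneg [simp]: "dvar c m i x \<ge> 0"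
  by (simp add: dvar_def sum_nonneg)

text \<open>Orthogonality of martingale increments: by \<open>dquot_mean\<close> the coarse quotient
  is the mean of the fine ones.\<close>

lemma denergy_diff: "(\<Sum>i<2 ^ c. dvar c m i x) / 2 ^ c = denergy (c + m) x - denergy c x"
proof -
  have "(\<Sum>i<2 ^ c. dvar c m i x) = (\<Sum>i<2 ^ c. (\<Sum>s<2 ^ m. (dquot (c + m) (i * 2 ^ m + s) x)\<^sup>2) / 2 ^ m - (dquot c i x)\<^sup>2)"
  proof (rule sum.cong[OF refl])
    fix i
    have "(\<Sum>s<2 ^ m. (dquot (c + m) (i * 2 ^ m + s) x - dquot c i x)\<^sup>2) =
      (\<Sum>s<2 ^ m. (dquot (c + m) (i * 2 ^ m + s) x)\<^sup>2) - real (2 ^ m) * (dquot c i x)\<^sup>2"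
      by (rule sum_variance) (simp add: dquot_mean)
    then show "dvar c m i x = (\<Sum>s<2 ^ m. (dquot (c + m) (i * 2 ^ m + s) x)\<^sup>2) / 2 ^ m - (dquot c i x)\<^sup>2"
      by (simp add: dvar_def diff_divide_distrib)
  qed
  also have "\<dots> = (\<Sum>k<2 ^ (c + m). (dquot (c + m) k x)\<^sup>2) / 2 ^ m - (\<Sum>i<2 ^ c. (dquot c i x)\<^sup>2)"
    by (simp add: sum_subtractf sum_dyadic_group[symmetric] flip: sum_divide_distrib)
  finally show ?thesis by (simp add: denergy_def diff_divide_distrib power_add mult.commute)
qed

lemma sum_dquot_ge: "\<bar>x 1 - x 0\<bar> \<le> (\<Sum>i<2 ^ c. \<bar>dquot c i x\<bar>) / 2 ^ c"
proof -
  have "(\<Sum>s<2 ^ c. dquot (0 + c) (0 * 2 ^ c + s) x) = 2 ^ c * dquot 0 0 x"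
    by (rule dquot_mean)
  then have "x 1 - x 0 = (\<Sum>s<2 ^ c. dquot c s x) / 2 ^ c"
    by (simp add: dquot_def[of 0])
  then show ?thesis by (simp add: divide_right_mono)
qed

text \<open>
  Right translation by \<open>j 2\<^bsup>-k(n-1)\<^esup> z\<^bsup>n-2\<^esup>\<close>; the change of \<open>f (n - 1)\<close> comes from the linear term
  of \<open>e\<^bsup>az\<^esup>\<close>.
\<close>

definition line_shift :: "nat \<Rightarrow> nat \<Rightarrow> nat \<Rightarrow> nat \<Rightarrow> (nat \<Rightarrow> int) \<Rightarrow> nat \<Rightarrow> int" where
  "line_shift n M k j f = f(n - 2 := f (n - 2) + int j * 2 ^ ((M - k) * (n - 1)),
     n - 1 := f (n - 1) + f 0 * int j * 2 ^ ((M - k) * (n - 1)))"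

lemma inj_line_shift:
  assumes "n \<ge> 3"
  shows "inj (line_shift n M k j)"
proof (rule injI)
  fix f g assume eq: "line_shift n M k j f = line_shift n M k j g"
  have *: "f i = g i" if "i \<noteq> n - 2" "i \<noteq> n - 1" for i
    using fun_cong[OF eq, of i] that by (simp add: line_shift_def)
  have f0: "f 0 = g 0" by (rule *) (use assms in auto)
  have "f (n - 2) = g (n - 2)" "f (n - 1) = g (n - 1)"
    using fun_cong[OF eq, of "n - 2"] fun_cong[OF eq, of "n - 1"] assms f0
    by (auto simp: line_shift_def split: if_splits)
  then show "f = g" using * by (metis ext)
qed

text \<open>Because j <= 2^k the shift has size at most 1, and so has \<open>f 0\<close> / 2^M,
  which multiplies it in the last slot; doubling the unit box makes room for both.\<close>

lemma line_shift_box: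
  assumes f: "f \<in> line_box n M s 1" and "n \<ge> 3" "j \<le> 2 ^ k" "k \<le> M"
  shows "line_shift n M k j f \<in> line_box n M 0 2"
proof -
  have f0: "\<forall>i\<ge>n. f i = 0" using f by (simp add: line_box_def)
  have fi: "\<bar>real_of_int (f i)\<bar> \<le> 2 ^ (M * Suc i)" if "i < n" for i
  proof -
    have "\<bar>real_of_int (f i)\<bar> \<le> 2 ^ ((M - s) * Suc i)" using f that by (simp add: line_box_def)
    also have "\<dots> \<le> 2 ^ (M * Suc i)" by (intro power_increasing mult_le_mono) auto
    finally show ?thesis .
  qed
  define w where "w = real j * 2 ^ ((M - k) * (n - 1))"
  have w: "w \<le> 2 ^ (M * (n - 1))" "w \<ge> 0"
  proof -
    have "real j \<le> 2 ^ k" using assms(3) by (metis of_nat_le_iff of_nat_numeral of_nat_power)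
    also have "\<dots> \<le> 2 ^ (k * (n - 1))" using assms(2) by (intro power_increasing) auto
    finally have "w \<le> 2 ^ (k * (n - 1)) * 2 ^ ((M - k) * (n - 1))"
      unfolding w_def by (intro mult_right_mono) auto
    also have "\<dots> = 2 ^ (M * (n - 1))"
      using assms(4) by (simp flip: power_add add: diff_mult_distrib)
    finally show "w \<le> 2 ^ (M * (n - 1))" .
    show "w \<ge> 0" by (simp add: w_def)
  qed
  have "\<bar>real_of_int (line_shift n M k j f i)\<bar> \<le> 2 * 2 ^ (M * Suc i)" if i: "i < n" for i
  proof -
    consider "i \<noteq> n - 2" "i \<noteq> n - 1" | "i = n - 2" | "i = n - 1" by blast
    then show ?thesis
    proof cases
      case 1
      then have "\<bar>real_of_int (line_shift n M k j f i)\<bar> \<le> 2 ^ (M * Suc i)"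
        using fi[OF i] by (simp add: line_shift_def)
      moreover have "(0::real) < 2 ^ (M * Suc i)" by (rule zero_less_power) simp
      ultimately show ?thesis by linarith
    next
      case 2
      then have "real_of_int (line_shift n M k j f i) = f i + w" and "Suc i = n - 1"
        using assms(2) by (auto simp: line_shift_def w_def)
      then show ?thesis using fi[OF i] w by (simp only:)
    next
      case 3
      then have e: "real_of_int (line_shift n M k j f i) = f i + f 0 * w" and Si: "Suc i = n"
        using assms(2) by (auto simp: line_shift_def w_def)
      have "\<bar>f 0 * w\<bar> \<le> 2 ^ M * 2 ^ (M * (n - 1))"
        unfolding abs_mult using fi[of 0] w assms(2) by (intro mult_mono) auto
      also have "\<dots> = 2 ^ (M * n)"
        using assms(2) by (simp flip: power_add mult_Suc_right)
      finally show ?thesis unfolding e using fi[OF i] unfolding Si by linarith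
    qed
  qed
  moreover have "\<forall>i\<ge>n. line_shift n M k j f i = 0"
    using f0 assms(2) by (auto simp: line_shift_def)
  ultimately show ?thesis by (simp add: line_box_def)
qed

text \<open>The translated line is again a line of the grid, exactly: the additional term a z^(n-1)
  with a = \<open>f 0\<close> / 2^M fits into the last slot because the mesh there is finer by the
  factor 2^M.\<close>

lemma line_shift_point:
  assumes "n \<ge> 3" "k \<le> M"
  shows "gdist n (line_base n M (line_shift n M k j f) \<odot> e2 t)
    (line_base n M f \<odot> e2 t \<odot> dil (1 / 2 ^ k) (0, fps_const (real j) * fps_X ^ (n - 2))) = 0"
proof -
  let ?f = "line_shift n M k j f"
  let ?a = "f 0 / 2 ^ M"
  let ?w = "real j * 2 ^ ((M - k) * (n - 1))"
  have f0: "?f 0 = f 0" using assms(1) by (simp add: line_shift_def)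
  have w: "?w / 2 ^ (M * (n - 1)) = real j / 2 ^ (k * (n - 1))"
  proof -
    have "(2::real) ^ (M * (n - 1)) = 2 ^ ((M - k) * (n - 1)) * 2 ^ (k * (n - 1))"
      using assms(2) by (simp flip: power_add add: diff_mult_distrib)
    then show ?thesis by simp
  qed
  have w': "?w / 2 ^ (M * n) = real j / 2 ^ (k * (n - 1)) / 2 ^ M"
  proof -
    have "(2::real) ^ (M * n) = 2 ^ (M * (n - 1)) * 2 ^ M"
      using assms(1) by (simp flip: power_add mult_Suc_right add: add.commute)
    then have "?w / 2 ^ (M * n) = ?w / 2 ^ (M * (n - 1)) / 2 ^ M"
      by (simp only: divide_divide_eq_left)
    then show ?thesis by (simp only: w)
  qed
  have "snd (line_base n M ?f) $ i = snd (line_base n M f) $ i +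
      (fps_exp ?a * snd (dil (1 / 2 ^ k) (0, fps_const (real j) * fps_X ^ (n - 2)))) $ i" if i: "i < n" for i
  proof -
    let ?e = "real j / 2 ^ (k * (n - 1))"
    have S: "Suc (n - 2) = n - 1" using assms(1) by simp
    have "snd (dil (1 / 2 ^ k) (0, fps_const (real j) * fps_X ^ (n - 2))) = fps_const ?e * fps_X ^ (n - 2)"
      by (rule fps_ext) (auto simp: fps_X_power_nth S power_one_over power_mult simp del: power_Suc)
    then have val: "(fps_exp ?a * snd (dil (1 / 2 ^ k) (0, fps_const (real j) * fps_X ^ (n - 2)))) $ i =
        (if i < n - 2 then 0 else ?e * (?a ^ (i - (n - 2)) / fact (i - (n - 2))))"
      by (simp add: mult.left_commute[of "fps_exp _"] fps_X_power_mult_right_nth)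
    consider "i < n - 2" | "i = n - 2" | "i = n - 1" using i by linarith
    then show ?thesis
    proof cases
      case 1
      then show ?thesis using val by (simp add: line_base_def line_shift_def)
    next
      case 2
      have "real_of_int (?f i) / 2 ^ (M * Suc i) = f i / 2 ^ (M * Suc i) + ?w / 2 ^ (M * (n - 1))"
        using 2 assms(1) S by (simp add: line_shift_def add_divide_distrib del: power_Suc mult_Suc_right)
      moreover have "1 \<le> n - 2" "n - 2 < n" using assms(1) by auto
      ultimately show ?thesis using val 2 unfolding w
        by (simp add: line_base_def del: power_Suc mult_Suc_right)
    next
      case 3
      have Si: "Suc i = n" using 3 assms(1) by simp
      have "real_of_int (?f i) / 2 ^ (M * Suc i) = f i / 2 ^ (M * Suc i) + f 0 * (?w / 2 ^ (M * n))"
        unfolding Si using 3 assms(1) by (simp add: line_shift_def add_divide_distrib mult.assoc del: power_Suc mult_Suc_right)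
      moreover have "i - (n - 2) = 1" "\<not> i < n - 2" "1 \<le> i" using 3 assms(1) by auto
      ultimately show ?thesis using val i unfolding w'
        by (simp add: line_base_def del: power_Suc mult_Suc_right)
    qed
  qed
  moreover have "fst (line_base n M ?f) = ?a" "fst (line_base n M f) = ?a"
    using f0 by (simp_all add: line_base_def)
  moreover have "n \<ge> 1" using assms(1) by simp
  ultimately show ?thesis unfolding gdist_0_iff[OF \<open>n \<ge> 1\<close>] by (simp add: snd_gmul)
qed

section \<open>Choice of a scale and of a line\<close>

context qs_map
begin

definition line_u :: "nat \<Rightarrow> (nat \<Rightarrow> int) \<Rightarrow> real \<Rightarrow> real" where
  "line_u M f t = fst (F (line_base n M f \<odot> e2 t))"

definition line_v :: "nat \<Rightarrow> (nat \<Rightarrow> int) \<Rightarrow> real \<Rightarrow> real" where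
  "line_v M f t = snd (F (line_base n M f \<odot> e2 t)) $ 0"

definition mean_step :: "nat \<Rightarrow> nat \<Rightarrow> nat \<Rightarrow> (nat \<Rightarrow> int) \<Rightarrow> nat \<Rightarrow> real" where
  "mean_step M c m f i = (\<Sum>s<2 ^ m. (2 ^ (c + m) * line_step M (c + m) f (i * 2 ^ m + s))\<^sup>2) / 2 ^ m"

lemma mean_step_nonneg [simp]: "mean_step M c m f i \<ge> 0"
  by (simp add: mean_step_def sum_nonneg)

lemma dquot_le_step:
  "\<bar>dquot k i (line_u M f)\<bar> \<le> 2 ^ k * line_step M k f i"
  "\<bar>dquot k i (line_v M f)\<bar> \<le> 2 ^ k * line_step M k f i"
  unfolding dquot_def line_u_def line_v_def line_step_def abs_mult
  by (auto intro!: mult_left_mono gdist_ge_fst gdist_ge_snd_0)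

lemma sum_mean_step:
  "(\<Sum>i<2 ^ c. mean_step M c m f i) / 2 ^ c = (\<Sum>i<2 ^ (c + m). (2 ^ (c + m) * line_step M (c + m) f i)\<^sup>2) / 2 ^ (c + m)"
  unfolding mean_step_def sum_divide_distrib[symmetric]
    sum_dyadic_group[of "\<lambda>k. (2 ^ (c + m) * line_step M (c + m) f k)\<^sup>2" m c]
  by (simp add: power_add mult.commute)

lemma power2_le_1_power: "x \<ge> 0 \<Longrightarrow> (x::real)\<^sup>2 \<le> 1 + x ^ Suc (hdim n)"
proof -
  assume x: "x \<ge> 0"
  have h: "hdim n \<ge> 1"
  proof -
    have "(\<Sum>j\<in>{0}. Suc j) \<le> hdim n"
      unfolding hdim_def by (rule sum_mono2) (use n3 in auto)
    then show ?thesis by simp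
  qed
  show ?thesis
  proof (cases "x \<le> 1")
    case True
    then have "x\<^sup>2 \<le> 1" using x by (simp add: power_le_one)
    moreover have "0 \<le> x ^ Suc (hdim n)" using x by (rule zero_le_power)
    ultimately show ?thesis by linarith
  next
    case False
    then have "x ^ 2 \<le> x ^ Suc (hdim n)" using h by (intro power_increasing) auto
    then show ?thesis by simp
  qed
qed

text \<open>The normalisation contributes (2^k)^(hdim n), which cancels the k in
  \<open>line_energy\<close>, and 2^(M hdim n) is the order of the number of lines. Thus the mean
  moment of the speed is bounded independently of the scale, which is what singles out the exponent
  \<open>Suc (hdim n)\<close>.\<close>

lemma line_step_moment:
  obtains A where "A > 0"
    "\<And>M k. k \<le> M \<Longrightarrow> (\<Sum>f\<in>line_box n M 0 2. (\<Sum>i<2 ^ k. (2 ^ k * line_step M k f i) ^ Suc (hdim n)) / 2 ^ k) \<le> A * 2 ^ (M * hdim n)"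
    "\<And>M. real (card (line_box n M 0 2)) \<le> A * 2 ^ (M * hdim n)"
    "\<And>M k. k \<le> M \<Longrightarrow> (\<Sum>f\<in>line_box n M 0 2. (\<Sum>i<2 ^ k. (2 ^ k * line_step M k f i)\<^sup>2) / 2 ^ k) \<le> A * 2 ^ (M * hdim n)"
proof -
  let ?Q = "Suc (hdim n)"
  obtain C where C: "C > 0" "\<And>M k. k \<le> M \<Longrightarrow>
      (\<Sum>f\<in>line_box n M 0 2. \<Sum>i<2 ^ k. line_step M k f i ^ ?Q) \<le> C * 2 ^ ((M - k) * hdim n)"
    by (rule line_energy) blast
  define A where "A = 6 ^ n + C"
  have mom: "(\<Sum>f\<in>line_box n M 0 2. (\<Sum>i<2 ^ k. (2 ^ k * line_step M k f i) ^ ?Q) / 2 ^ k) \<le> C * 2 ^ (M * hdim n)"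
    if kM: "k \<le> M" for M k
  proof -
    have "(\<Sum>f\<in>line_box n M 0 2. (\<Sum>i<2 ^ k. (2 ^ k * line_step M k f i) ^ ?Q) / 2 ^ k)
      = (2 ^ k) ^ hdim n * (\<Sum>f\<in>line_box n M 0 2. \<Sum>i<2 ^ k. line_step M k f i ^ ?Q)"
      unfolding sum_distrib_left by (simp add: power_mult_distrib sum_divide_distrib mult_ac)
    also have "\<dots> \<le> (2 ^ k) ^ hdim n * (C * 2 ^ ((M - k) * hdim n))"
      using C(2)[OF kM] by (intro mult_left_mono) auto
    also have "\<dots> = C * 2 ^ (M * hdim n)"
    proof -
      have "(2::real) ^ (M * hdim n) = 2 ^ (k * hdim n) * 2 ^ ((M - k) * hdim n)"
        using kM by (simp flip: power_add add: diff_mult_distrib)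
      then show ?thesis by (simp add: power_mult)
    qed
    finally show ?thesis .
  qed
  have crd: "real (card (line_box n M 0 2)) \<le> 6 ^ n * 2 ^ (M * hdim n)" for M
    using line_box_card(2)[of 2 n M 0] by simp
  show ?thesis
  proof (rule that[of A])
    show "A > 0" unfolding A_def using C(1) by (intro add_pos_pos) auto
    show "(\<Sum>f\<in>line_box n M 0 2. (\<Sum>i<2 ^ k. (2 ^ k * line_step M k f i) ^ ?Q) / 2 ^ k) \<le> A * 2 ^ (M * hdim n)"
      if "k \<le> M" for M k
    proof -
      have "0 \<le> (6::real) ^ n * 2 ^ (M * hdim n)" by simp
      then show ?thesis using mom[OF that] unfolding A_def distrib_right by linarith
    qed
    show "real (card (line_box n M 0 2)) \<le> A * 2 ^ (M * hdim n)" for M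
    proof -
      have "0 \<le> C * 2 ^ (M * hdim n)" using C(1) by simp
      then show ?thesis using crd[of M] unfolding A_def distrib_right by linarith
    qed
    show "(\<Sum>f\<in>line_box n M 0 2. (\<Sum>i<2 ^ k. (2 ^ k * line_step M k f i)\<^sup>2) / 2 ^ k) \<le> A * 2 ^ (M * hdim n)"
      if kM: "k \<le> M" for M k
    proof -
      have "(\<Sum>f\<in>line_box n M 0 2. (\<Sum>i<2 ^ k. (2 ^ k * line_step M k f i)\<^sup>2) / 2 ^ k)
        \<le> (\<Sum>f\<in>line_box n M 0 2. (\<Sum>i<2 ^ k. 1 + (2 ^ k * line_step M k f i) ^ ?Q) / 2 ^ k)"
        by (intro sum_mono divide_right_mono power2_le_1_power) auto
      also have "\<dots> = real (card (line_box n M 0 2))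
          + (\<Sum>f\<in>line_box n M 0 2. (\<Sum>i<2 ^ k. (2 ^ k * line_step M k f i) ^ ?Q) / 2 ^ k)"
        by (simp add: sum.distrib add_divide_distrib)
      also have "\<dots> \<le> A * 2 ^ (M * hdim n)"
        using crd[of M] mom[OF kM] by (simp add: A_def distrib_right)
      finally show ?thesis .
    qed
  qed
qed

lemma sum_line_shift_le:
  assumes "\<And>f. g f \<ge> (0::real)" "j \<le> 2 ^ k" "k \<le> M"
  shows "(\<Sum>f\<in>line_box n M s 1. g (line_shift n M k j f)) \<le> (\<Sum>f\<in>line_box n M 0 2. g f)"
proof -
  have inj: "inj_on (line_shift n M k j) (line_box n M s 1)"
    using inj_line_shift[OF n3] by (rule inj_on_subset) simp
  have "(\<Sum>f\<in>line_box n M s 1. g (line_shift n M k j f)) = sum g (line_shift n M k j ` line_box n M s 1)"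
    by (simp add: sum.reindex[OF inj])
  also have "\<dots> \<le> (\<Sum>f\<in>line_box n M 0 2. g f)"
    using line_shift_box[OF _ n3 assms(2,3)] line_box_card(1)[of 2] assms(1) by (intro sum_mono2) auto
  finally show ?thesis .
qed

lemma line_shift_0 [simp]: "line_shift n M k 0 f = f"
  by (simp add: line_shift_def)

text \<open>Pigeonhole over disjoint windows of 4q levels: divided by 2^(M hdim n), the energy of
  all lines lies between 0 and 2A, so it cannot rise by more than \<tau> in each of N > 2A / \<tau>
  consecutive windows.\<close>

lemma good_scale:
  obtains A where "A > 0" "\<And>M k. k \<le> M \<Longrightarrow>
      (\<Sum>f\<in>line_box n M 0 2. (\<Sum>i<2 ^ k. (2 ^ k * line_step M k f i)\<^sup>2) / 2 ^ k) \<le> A * 2 ^ (M * hdim n)"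
    "\<And>M. real (card (line_box n M 0 2)) \<le> A * 2 ^ (M * hdim n)"
    "\<And>q s \<tau>. \<tau> > 0 \<Longrightarrow> \<exists>M c. s \<le> M \<and> c + 4 * q \<le> M \<and>
      (\<Sum>f\<in>line_box n M 0 2. (denergy (c + 4 * q) (line_u M f) - denergy c (line_u M f))
         + (denergy (c + 4 * q) (line_v M f) - denergy c (line_v M f))) \<le> \<tau> * 2 ^ (M * hdim n)"
proof -
  obtain A where A: "A > 0"
    "\<And>M. real (card (line_box n M 0 2)) \<le> A * 2 ^ (M * hdim n)"
    "\<And>M k. k \<le> M \<Longrightarrow> (\<Sum>f\<in>line_box n M 0 2. (\<Sum>i<2 ^ k. (2 ^ k * line_step M k f i)\<^sup>2) / 2 ^ k) \<le> A * 2 ^ (M * hdim n)"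
    by (rule line_step_moment) blast
  have den: "denergy k (line_u M f) + denergy k (line_v M f) \<le> 2 * ((\<Sum>i<2 ^ k. (2 ^ k * line_step M k f i)\<^sup>2) / 2 ^ k)"
    for k M f
  proof -
    have "(dquot k i (line_u M f))\<^sup>2 \<le> (2 ^ k * line_step M k f i)\<^sup>2"
      "(dquot k i (line_v M f))\<^sup>2 \<le> (2 ^ k * line_step M k f i)\<^sup>2" for i
      using dquot_le_step[of k i M f] by (auto simp: abs_le_square_iff[symmetric])
    then have "denergy k (line_u M f) \<le> (\<Sum>i<2 ^ k. (2 ^ k * line_step M k f i)\<^sup>2) / 2 ^ k"
      "denergy k (line_v M f) \<le> (\<Sum>i<2 ^ k. (2 ^ k * line_step M k f i)\<^sup>2) / 2 ^ k"
      unfolding denergy_def by (auto intro!: divide_right_mono sum_mono)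
    then show ?thesis by simp
  qed
  have "\<exists>M c. s \<le> M \<and> c + 4 * q \<le> M \<and>
      (\<Sum>f\<in>line_box n M 0 2. (denergy (c + 4 * q) (line_u M f) - denergy c (line_u M f))
         + (denergy (c + 4 * q) (line_v M f) - denergy c (line_v M f))) \<le> \<tau> * 2 ^ (M * hdim n)"
    if \<tau>: "\<tau> > 0" for q s \<tau>
  proof (rule ccontr)
    assume neg: "\<not> ?thesis"
    obtain N where N: "2 * A / \<tau> < real N" using reals_Archimedean2 by blast
    define M where "M = s + 4 * q * N"
    define en where "en j = (\<Sum>f\<in>line_box n M 0 2. denergy j (line_u M f) + denergy j (line_v M f))" for j
    have inc: "\<tau> * 2 ^ (M * hdim n) \<le> en (4 * q * Suc i) - en (4 * q * i)" if "i < N" for i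
    proof -
      have "4 * q * Suc i \<le> 4 * q * N" using that by (intro mult_le_mono2) simp
      then have "4 * q * i + 4 * q \<le> M" by (simp add: M_def)
      moreover have "s \<le> M" by (simp add: M_def)
      ultimately have "\<tau> * 2 ^ (M * hdim n) <
        (\<Sum>f\<in>line_box n M 0 2. (denergy (4 * q * i + 4 * q) (line_u M f) - denergy (4 * q * i) (line_u M f))
         + (denergy (4 * q * i + 4 * q) (line_v M f) - denergy (4 * q * i) (line_v M f)))"
        using neg by (meson not_le)
      also have "\<dots> = en (4 * q * Suc i) - en (4 * q * i)"
        unfolding en_def sum_subtractf[symmetric] by (intro sum.cong) (auto simp: add.commute)
      finally show ?thesis by simp
    qed
    have "real N * (\<tau> * 2 ^ (M * hdim n)) \<le> (\<Sum>i<N. en (4 * q * Suc i) - en (4 * q * i))"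
      using sum_bounded_below[of "{..<N}" "\<tau> * 2 ^ (M * hdim n)"] inc by simp
    also have "\<dots> = en (4 * q * N) - en (4 * q * 0)"
      by (rule sum_lessThan_telescope)
    also have "\<dots> \<le> en (4 * q * N)"
      by (auto simp: en_def denergy_def intro!: sum_nonneg add_nonneg_nonneg divide_nonneg_nonneg)
    also have "\<dots> \<le> (\<Sum>f\<in>line_box n M 0 2. 2 * ((\<Sum>i<2 ^ (4 * q * N). (2 ^ (4 * q * N) * line_step M (4 * q * N) f i)\<^sup>2) / 2 ^ (4 * q * N)))"
      unfolding en_def by (rule sum_mono) (rule den)
    also have "\<dots> \<le> 2 * (A * 2 ^ (M * hdim n))"
      unfolding sum_distrib_left[symmetric] by (intro mult_left_mono A(3)) (auto simp: M_def)
    finally have "real N * \<tau> \<le> 2 * A" by (simp add: mult.assoc[symmetric])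
    then show False using N \<tau> by (simp add: divide_less_eq)
  qed
  then show ?thesis using A that by blast
qed

text \<open>If every line and every interval failed, averaging would push the mean of |u(1) - u(0)|
  below its lower bound. The order of quantifiers matters: \<open>c1\<close> and \<open>c2\<close>
  do not depend on \<open>q\<close> and \<open>K\<close>, which keeps the blow-ups uniformly
  bounded, whereas \<open>K\<close> may be taken as large as \<open>q\<close> requires.\<close>

lemma good_line:
  assumes c0: "c0 > 0"
    and nonconst: "\<And>M f. s \<le> M \<Longrightarrow> f \<in> line_box n M s 1 \<Longrightarrow> c0 \<le> \<bar>line_u M f 1 - line_u M f 0\<bar>"
  obtains c1 c2 where "c1 > 0" "c2 > 0"
    "\<And>q K. K > 0 \<Longrightarrow> \<exists>M k f i. q \<le> k \<and> k + 3 * q \<le> M \<and> f \<in> line_box n M s 1 \<and> i < 2 ^ (k - q) \<and>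
      \<bar>dquot (k - q) i (line_u M f)\<bar> > c1 * (1 + mean_step M (k - q) q f i)
        + (\<Sum>j\<le>q. K * (dvar (k - q) (4 * q) i (line_u M (line_shift n M k j f))
                    + dvar (k - q) (4 * q) i (line_v M (line_shift n M k j f)))
             + c2 / (real q + 1) * mean_step M (k - q) (4 * q) (line_shift n M k j f) i)"
proof -
  obtain A where A: "A > 0" "\<And>M k. k \<le> M \<Longrightarrow>
      (\<Sum>f\<in>line_box n M 0 2. (\<Sum>i<2 ^ k. (2 ^ k * line_step M k f i)\<^sup>2) / 2 ^ k) \<le> A * 2 ^ (M * hdim n)"
    "\<And>M. real (card (line_box n M 0 2)) \<le> A * 2 ^ (M * hdim n)"
    "\<And>q s \<tau>. \<tau> > 0 \<Longrightarrow> \<exists>M c. s \<le> M \<and> c + 4 * q \<le> M \<and>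
      (\<Sum>f\<in>line_box n M 0 2. (denergy (c + 4 * q) (line_u M f) - denergy c (line_u M f))
         + (denergy (c + 4 * q) (line_v M f) - denergy c (line_v M f))) \<le> \<tau> * 2 ^ (M * hdim n)"
    by (rule good_scale) blast
  \<comment> \<open>Lower bound, in units of 2^(M hdim n), for the sum of |u(1) - u(0)| over the
    small box. \<open>c1\<close>, \<open>c2\<close> and the later \<tau> make three groups of terms
    contribute b/4 each, so that at most 3b/4 is reached.\<close>
  define b where "b = c0 / 2 ^ (s * hdim n)"
  have b: "b > 0" using c0 by (simp add: b_def)
  define c1 where "c1 = b / (8 * A)"
  define c2 where "c2 = b / (4 * A)"
  have c12: "c1 > 0" "c2 > 0" using b A(1) by (auto simp: c1_def c2_def)
  have main: "\<exists>M k f i. q \<le> k \<and> k + 3 * q \<le> M \<and> f \<in> line_box n M s 1 \<and> i < 2 ^ (k - q) \<and>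
      \<bar>dquot (k - q) i (line_u M f)\<bar> > c1 * (1 + mean_step M (k - q) q f i)
        + (\<Sum>j\<le>q. K * (dvar (k - q) (4 * q) i (line_u M (line_shift n M k j f))
                    + dvar (k - q) (4 * q) i (line_v M (line_shift n M k j f)))
             + c2 / (real q + 1) * mean_step M (k - q) (4 * q) (line_shift n M k j f) i)"
    if K: "K > 0" for q K
  proof (rule ccontr)
    assume neg: "\<not> ?thesis"
    define \<tau> where "\<tau> = b / (4 * K * (real q + 1))"
    have \<tau>: "\<tau> > 0" using b K by (simp add: \<tau>_def)
    obtain M c where Mc: "s \<le> M" "c + 4 * q \<le> M" "(\<Sum>f\<in>line_box n M 0 2.
         (denergy (c + 4 * q) (line_u M f) - denergy c (line_u M f))
         + (denergy (c + 4 * q) (line_v M f) - denergy c (line_v M f))) \<le> \<tau> * 2 ^ (M * hdim n)"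
      using A(4)[OF \<tau>] by blast
    define k where "k = c + q"
    have k: "q \<le> k" "k + 3 * q \<le> M" "k - q = c" "k \<le> M" using Mc by (auto simp: k_def)
    have q2k: "j \<le> 2 ^ k" if "j \<le> q" for j
      using that k(1) less_exp[of k] by linarith
    let ?B = "line_box n M s 1"
    let ?L = "line_box n M 0 2"
    let ?W = "(2::real) ^ (M * hdim n)"
    define sh where "sh j = line_shift n M k j" for j
    define vr where "vr f i = dvar c (4 * q) i (line_u M f) + dvar c (4 * q) i (line_v M f)" for f i
    define ms where "ms m f i = mean_step M c m f i" for m f i
    have le: "\<bar>dquot c i (line_u M f)\<bar> \<le> c1 * (1 + ms q f i)
        + (\<Sum>j\<le>q. K * vr (sh j f) i + c2 / (real q + 1) * ms (4 * q) (sh j f) i)"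
      if "f \<in> ?B" "i < 2 ^ c" for f i
      using neg that k unfolding vr_def ms_def sh_def by (meson not_le)
    have MS: "(\<Sum>f\<in>?L. (\<Sum>i<2 ^ c. ms m f i) / 2 ^ c) \<le> A * ?W" if "c + m \<le> M" for m
      unfolding ms_def sum_mean_step using A(2)[OF that] .
    have VR: "(\<Sum>f\<in>?L. (\<Sum>i<2 ^ c. vr f i) / 2 ^ c) \<le> \<tau> * ?W"
      unfolding vr_def sum.distrib add_divide_distrib denergy_diff using Mc(3) by (simp add: sum.distrib)
    have shl: "(\<Sum>f\<in>?B. g (sh j f)) \<le> (\<Sum>f\<in>?L. g f)" if "j \<le> q" "\<And>f. g f \<ge> (0::real)" for g j
      unfolding sh_def using that q2k k by (intro sum_line_shift_le) auto
    have vrn: "vr f i \<ge> 0" and msn: "ms m f i \<ge> 0" for f i m by (auto simp: vr_def ms_def)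
    have T1: "(\<Sum>f\<in>?B. (\<Sum>i<2 ^ c. c1 * (1 + ms q f i)) / 2 ^ c) \<le> c1 * (2 * A * ?W)"
    proof -
      have "(\<Sum>f\<in>?B. (\<Sum>i<2 ^ c. c1 * (1 + ms q f i)) / 2 ^ c)
        = c1 * (\<Sum>f\<in>?B. (\<lambda>f. 1 + (\<Sum>i<2 ^ c. ms q f i) / 2 ^ c) (sh 0 f))"
        by (simp add: sum_distrib_left[symmetric] sum.distrib add_divide_distrib sh_def distrib_left)
           (simp add: sum_distrib_left)
      also have "\<dots> \<le> c1 * (\<Sum>f\<in>?L. 1 + (\<Sum>i<2 ^ c. ms q f i) / 2 ^ c)"
        using c12 msn by (intro mult_left_mono shl add_nonneg_nonneg divide_nonneg_nonneg sum_nonneg) auto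
      also have "\<dots> \<le> c1 * (2 * A * ?W)"
        using c12 A(3)[of M] MS[of q] k(4) by (intro mult_left_mono) (auto simp: sum.distrib k_def add.commute)
      finally show ?thesis .
    qed
    have T2: "(\<Sum>f\<in>?B. (\<Sum>i<2 ^ c. K * vr (sh j f) i + c2 / (real q + 1) * ms (4 * q) (sh j f) i) / 2 ^ c)
        \<le> (K * \<tau> + c2 / (real q + 1) * A) * ?W" if j: "j \<le> q" for j
    proof -
      have "(\<Sum>f\<in>?B. (\<Sum>i<2 ^ c. K * vr (sh j f) i + c2 / (real q + 1) * ms (4 * q) (sh j f) i) / 2 ^ c)
        = K * (\<Sum>f\<in>?B. (\<lambda>f. (\<Sum>i<2 ^ c. vr f i) / 2 ^ c) (sh j f))
          + c2 / (real q + 1) * (\<Sum>f\<in>?B. (\<lambda>f. (\<Sum>i<2 ^ c. ms (4 * q) f i) / 2 ^ c) (sh j f))"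
        unfolding sum.distrib add_divide_distrib
        by (simp only: times_divide_eq_right sum_distrib_left)
      also have "\<dots> \<le> K * (\<Sum>f\<in>?L. (\<Sum>i<2 ^ c. vr f i) / 2 ^ c)
          + c2 / (real q + 1) * (\<Sum>f\<in>?L. (\<Sum>i<2 ^ c. ms (4 * q) f i) / 2 ^ c)"
        using K c12 vrn msn by (intro add_mono mult_left_mono shl j divide_nonneg_nonneg sum_nonneg) auto
      also have "\<dots> \<le> K * (\<tau> * ?W) + c2 / (real q + 1) * (A * ?W)"
        using K c12 VR MS[of "4 * q"] Mc(2) by (intro add_mono mult_left_mono) auto
      finally show ?thesis by (simp only: distrib_right mult.assoc)
    qed
    have "c0 * 2 ^ ((M - s) * hdim n) \<le> c0 * real (card ?B)"
      using c0 line_box_card(3)[of 1 M s n] by (intro mult_left_mono) auto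
    also have "\<dots> \<le> (\<Sum>f\<in>?B. \<bar>line_u M f 1 - line_u M f 0\<bar>)"
      using sum_bounded_below[of ?B c0] nonconst[OF Mc(1)] by (simp add: mult.commute)
    also have "\<dots> \<le> (\<Sum>f\<in>?B. (\<Sum>i<2 ^ c. \<bar>dquot c i (line_u M f)\<bar>) / 2 ^ c)"
      by (intro sum_mono sum_dquot_ge)
    also have "\<dots> \<le> (\<Sum>f\<in>?B. (\<Sum>i<2 ^ c. c1 * (1 + ms q f i)
        + (\<Sum>j\<le>q. K * vr (sh j f) i + c2 / (real q + 1) * ms (4 * q) (sh j f) i)) / 2 ^ c)"
      by (intro sum_mono divide_right_mono le) auto
    also have "\<dots> = (\<Sum>f\<in>?B. (\<Sum>i<2 ^ c. c1 * (1 + ms q f i)) / 2 ^ c)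
        + (\<Sum>f\<in>?B. (\<Sum>i<2 ^ c. \<Sum>j\<le>q. K * vr (sh j f) i + c2 / (real q + 1) * ms (4 * q) (sh j f) i) / 2 ^ c)"
      unfolding sum.distrib[symmetric] add_divide_distrib[symmetric] ..
    also have "(\<Sum>f\<in>?B. (\<Sum>i<2 ^ c. \<Sum>j\<le>q. K * vr (sh j f) i + c2 / (real q + 1) * ms (4 * q) (sh j f) i) / 2 ^ c)
       = (\<Sum>j\<le>q. \<Sum>f\<in>?B. (\<Sum>i<2 ^ c. K * vr (sh j f) i + c2 / (real q + 1) * ms (4 * q) (sh j f) i) / 2 ^ c)"
      by (subst sum.swap, subst sum.swap[of _ _ "{..<2 ^ c}"]) (simp only: sum_divide_distrib)
    also have "(\<Sum>f\<in>?B. (\<Sum>i<2 ^ c. c1 * (1 + ms q f i)) / 2 ^ c) + \<dots>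
      \<le> c1 * (2 * A * ?W) + (\<Sum>j\<le>q. (K * \<tau> + c2 / (real q + 1) * A) * ?W)"
      by (intro add_mono T1 sum_mono T2) auto
    also have "\<dots> = (c1 * 2 * A + (real q + 1) * (K * \<tau> + c2 / (real q + 1) * A)) * ?W"
      by (simp add: algebra_simps)
    also have "c1 * 2 * A = b / 4" using A(1) by (simp add: c1_def)
    also have "(real q + 1) * (K * \<tau> + c2 / (real q + 1) * A) = b / 4 + b / 4"
    proof -
      have "r * (K * (b / (4 * K * r)) + b / (4 * A) / r * A) = b / 4 + b / 4" if "r > 0" for r
        using that A(1) K by (simp add: field_simps)
      then show ?thesis unfolding \<tau>_def c2_def by simp
    qed
    finally have "c0 * 2 ^ ((M - s) * hdim n) \<le> (b / 4 + (b / 4 + b / 4)) * ?W" .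
    moreover have "c0 * 2 ^ ((M - s) * hdim n) = b * ?W"
    proof -
      have "?W = 2 ^ ((M - s) * hdim n) * 2 ^ (s * hdim n)"
        using Mc(1) by (simp flip: power_add add: diff_mult_distrib)
      then show ?thesis by (simp add: b_def)
    qed
    ultimately have "b * ?W \<le> (3 / 4 * b) * ?W" by simp
    then have "b \<le> 3 / 4 * b" by (rule mult_right_le_imp_le) simp
    then show False using b by simp
  qed
  show ?thesis by (rule that[OF c12 main])
qed

end

section \<open>Blow-ups\<close>

lemma gmul_snd_commute: "(0, P) \<odot> (0, Q) = (0, Q) \<odot> (0, P)"
  by (simp add: gmul_def add.commute)

lemma dil_e2: "dil c (e2 t) = e2 (c * t)"
  by (rule prod_eqI) (auto simp: fps_eq_iff)

lemma dil_gone: "dil c gone = gone"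
  by (rule prod_eqI) (auto simp: fps_eq_iff)

text \<open>The direction z^(n-2) commutes with \<open>e2\<close> and has weight n - 1; hence the
  lines have constant mutual distances |j - i|^(1/(n-1)). For n >= 3 it differs from the direction
  of the lines.\<close>

definition wpt :: "nat \<Rightarrow> nat \<Rightarrow> real \<Rightarrow> model" where
  "wpt n j t = (0, fps_const (real j) * fps_X ^ (n - 2)) \<odot> e2 t"

text \<open>
  The rescaled maps are nearly affine, at the scale \<open>8\<^bsup>-q\<^esup>\<close>, in the horizontal coordinates along the lines
  \<open>wpt n j\<close> with \<open>j \<le> q\<close>.  The last condition makes the other coordinates follow the horizontal ones.
\<close>

context qs_map
begin

definition is_blowup :: "real \<Rightarrow> nat \<Rightarrow> (model \<Rightarrow> model) \<Rightarrow> (nat \<Rightarrow> real) \<Rightarrow> (nat \<Rightarrow> real) \<Rightarrow> bool" where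
  "is_blowup \<Lambda> q G b b' \<longleftrightarrow>
     (\<forall>x y z. gdist n x z > 0 \<longrightarrow> gdist n (G x) (G y) \<le> \<eta> (gdist n x y / gdist n x z) * gdist n (G x) (G z)) \<and>
     G gone = gone \<and> gnorm n (G (e2 1)) \<le> \<Lambda> \<and> \<bar>b 0\<bar> = 1 \<and>
     (\<forall>j\<le>q. \<forall>m<2 ^ (q - 1) * 2 ^ (3 * q).
        \<bar>fst (G (wpt n j (real (Suc m) / 2 ^ (3 * q)))) - fst (G (wpt n j (real m / 2 ^ (3 * q)))) - b j / 2 ^ (3 * q)\<bar>
          \<le> 1 / 2 ^ q / 2 ^ (3 * q) \<and>
        \<bar>snd (G (wpt n j (real (Suc m) / 2 ^ (3 * q)))) $ 0 - snd (G (wpt n j (real m / 2 ^ (3 * q)))) $ 0 - b' j / 2 ^ (3 * q)\<bar>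
          \<le> 1 / 2 ^ q / 2 ^ (3 * q)) \<and>
     (\<forall>j\<le>q. (\<Sum>m<2 ^ (q - 1) * 2 ^ (3 * q).
        (gdist n (G (wpt n j (real m / 2 ^ (3 * q)))) (G (wpt n j (real (Suc m) / 2 ^ (3 * q)))))\<^sup>2) \<le> \<Lambda> / 2 ^ q)"

text \<open>The source is magnified by 2^k and the target by 2^k / X, where X is the large
  difference quotient of \<open>good_line\<close>; this gives the line j = 0 a slope of modulus 1.
  In the new unit the chosen interval of level k - q has length 2^q and the fine steps have length
  2^(-3q).\<close>

lemma blowups:
  assumes c0: "c0 > 0"
    and nonconst: "\<And>M f. s \<le> M \<Longrightarrow> f \<in> line_box n M s 1 \<Longrightarrow> c0 \<le> \<bar>line_u M f 1 - line_u M f 0\<bar>"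
  obtains \<Lambda> where "\<Lambda> > 0" "\<And>q. q \<ge> 1 \<Longrightarrow> \<exists>G b b'. is_blowup \<Lambda> q G b b'"
proof -
  obtain c1 c2 where c: "c1 > 0" "c2 > 0" and
    good: "\<And>q K. K > 0 \<Longrightarrow> \<exists>M k f i. q \<le> k \<and> k + 3 * q \<le> M \<and> f \<in> line_box n M s 1 \<and> i < 2 ^ (k - q) \<and>
      \<bar>dquot (k - q) i (line_u M f)\<bar> > c1 * (1 + mean_step M (k - q) q f i)
        + (\<Sum>j\<le>q. K * (dvar (k - q) (4 * q) i (line_u M (line_shift n M k j f))
                    + dvar (k - q) (4 * q) i (line_v M (line_shift n M k j f)))
             + c2 / (real q + 1) * mean_step M (k - q) (4 * q) (line_shift n M k j f) i)"
    by (rule good_line[OF c0, of s]) (use nonconst in blast, rule that, assumption+)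
  \<comment> \<open>2 / c1 bounds the image of the first unit step, and 1 / (c1 c2) the sums of the
    squared fine steps.\<close>
  define \<Lambda> where "\<Lambda> = max (2 / c1) (1 / (c1 * c2))"
  have \<Lambda>: "\<Lambda> > 0" "2 / c1 \<le> \<Lambda>" "1 / (c1 * c2) \<le> \<Lambda>" using c by (auto simp: \<Lambda>_def less_max_iff_disj)
  have "\<exists>G b b'. is_blowup \<Lambda> q G b b'"
    if q: "q \<ge> 1" for q
  proof -
    \<comment> \<open>Makes even a single one of the 2^(4q) fine quotients deviate by at most X /
      2^q from the coarse one; the factor 1 / c1 is absorbed by X > c1.\<close>
    define K where "K = 2 ^ (6 * q) / c1"
    have K: "K > 0" using c by (simp add: K_def)
    obtain M k f i where g: "q \<le> k" "k + 3 * q \<le> M" "f \<in> line_box n M s 1" "i < 2 ^ (k - q)" and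
      big: "\<bar>dquot (k - q) i (line_u M f)\<bar> > c1 * (1 + mean_step M (k - q) q f i)
        + (\<Sum>j\<le>q. K * (dvar (k - q) (4 * q) i (line_u M (line_shift n M k j f))
                    + dvar (k - q) (4 * q) i (line_v M (line_shift n M k j f)))
             + c2 / (real q + 1) * mean_step M (k - q) (4 * q) (line_shift n M k j f) i)"
      using good[OF K, of q] by auto
    define c where "c = k - q"
    define X where "X = \<bar>dquot c i (line_u M f)\<bar>"
    define sh where "sh j = line_shift n M k j f" for j
    define pen where "pen j = K * (dvar c (4 * q) i (line_u M (sh j)) + dvar c (4 * q) i (line_v M (sh j)))
        + c2 / (real q + 1) * mean_step M c (4 * q) (sh j) i" for j
    have pen0: "pen j \<ge> 0" for j unfolding pen_def using K c by (auto intro!: add_nonneg_nonneg)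
    have big': "X > c1 * (1 + mean_step M c q f i) + (\<Sum>j\<le>q. pen j)"
      using big unfolding X_def pen_def sh_def c_def by simp
    have sump: "(\<Sum>j\<le>q. pen j) \<ge> 0" using pen0 by (intro sum_nonneg) auto
    have msX: "c1 * mean_step M c q f i < X" and Xc1: "X > c1"
    proof -
      have "0 \<le> c1 * mean_step M c q f i" using \<open>c1 > 0\<close> by simp
      then show "c1 * mean_step M c q f i < X" "X > c1"
        using big' sump \<open>c1 > 0\<close> unfolding distrib_left by linarith+
    qed
    have X0: "X > 0" using Xc1 \<open>c1 > 0\<close> by linarith
    have penX: "pen j \<le> X" if "j \<le> q" for j
    proof -
      have "pen j \<le> (\<Sum>j\<le>q. pen j)" using that pen0 by (intro member_le_sum) auto
      moreover have "0 \<le> c1 * (1 + mean_step M c q f i)" using \<open>c1 > 0\<close> by simp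
      ultimately show ?thesis using big' by linarith
    qed
    have ck: "c + q = k" "c + 4 * q = k + 3 * q" using g by (auto simp: c_def)
    have kM: "k \<le> M" using g by simp
    \<comment> \<open>Some unit step in the first half of the interval has at most twice the mean
      square speed. Starting in the first half leaves 2^(q-1) units of the interval to the
      right.\<close>
    obtain r where r: "r < 2 ^ (q - 1)"
      "(2 ^ k * line_step M k f (i * 2 ^ q + r))\<^sup>2 \<le> 2 * mean_step M c q f i"
    proof (rule ccontr)
      assume "\<not> thesis"
      then have *: "2 * mean_step M c q f i < (2 ^ k * line_step M k f (i * 2 ^ q + r))\<^sup>2" if "r < 2 ^ (q - 1)" for r
        using \<open>\<And>r. _ \<Longrightarrow> _ \<Longrightarrow> thesis\<close> that by (meson not_le)
      have "2 ^ q * mean_step M c q f i = real (card {..<(2::nat) ^ (q - 1)}) * (2 * mean_step M c q f i)"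
        using q by (cases q) auto
      also have "\<dots> < (\<Sum>r<2 ^ (q - 1). (2 ^ k * line_step M k f (i * 2 ^ q + r))\<^sup>2)"
        unfolding sum_constant[symmetric] by (rule sum_strict_mono) (use * in \<open>auto simp: lessThan_empty_iff\<close>)
      also have "\<dots> \<le> (\<Sum>r<2 ^ q. (2 ^ k * line_step M k f (i * 2 ^ q + r))\<^sup>2)"
        by (rule sum_mono2) (auto intro: less_le_trans)
      also have "\<dots> = 2 ^ q * mean_step M c q f i"
        by (simp add: mean_step_def ck)
      finally show False by simp
    qed
    define t0 where "t0 = real (i * 2 ^ q + r) / 2 ^ k"
    define \<epsilon> where "\<epsilon> = (1::real) / 2 ^ k"
    define x0 where "x0 = line_base n M f \<odot> e2 t0"
    define lam where "lam = 2 ^ k / X"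
    have lam: "lam > 0" using X0 by (simp add: lam_def)
    have eps: "\<epsilon> > 0" by (simp add: \<epsilon>_def)
    define G where "G x = dil lam (ginv (F x0) \<odot> F (x0 \<odot> dil \<epsilon> x))" for x
    have Gd: "gdist n (G x) (G y) = lam * gdist n (F (x0 \<odot> dil \<epsilon> x)) (F (x0 \<odot> dil \<epsilon> y))" for x y
      unfolding G_def using lam by (simp add: gdist_dil)
    have qsG: "gdist n (G x) (G y) \<le> \<eta> (gdist n x y / gdist n x z) * gdist n (G x) (G z)"
      if "gdist n x z > 0" for x y z
    proof -
      have d: "gdist n (x0 \<odot> dil \<epsilon> x) (x0 \<odot> dil \<epsilon> y) = \<epsilon> * gdist n x y" for x y
        using eps by (simp add: gdist_dil)
      have "gdist n (F (x0 \<odot> dil \<epsilon> x)) (F (x0 \<odot> dil \<epsilon> y)) \<le>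
         \<eta> (gdist n x y / gdist n x z) * gdist n (F (x0 \<odot> dil \<epsilon> x)) (F (x0 \<odot> dil \<epsilon> z))"
        using qs[of "x0 \<odot> dil \<epsilon> x" "x0 \<odot> dil \<epsilon> z" "x0 \<odot> dil \<epsilon> y", unfolded d] that eps by simp
      then show ?thesis unfolding Gd using lam by (simp add: mult.left_commute)
    qed
    have pt: "gdist n (F (x0 \<odot> dil \<epsilon> (wpt n j t))) (F (line_base n M (sh j) \<odot> e2 (t0 + \<epsilon> * t))) = 0" for j t
    proof -
      let ?w = "(0, fps_const (real j) * fps_X ^ (n - 2)) :: model"
      have "x0 \<odot> dil \<epsilon> (wpt n j t) = line_base n M f \<odot> (e2 t0 \<odot> (dil \<epsilon> ?w \<odot> e2 (\<epsilon> * t)))"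
        by (simp add: x0_def wpt_def dil_gmul dil_e2 gmul_assoc)
      also have "dil \<epsilon> ?w \<odot> e2 (\<epsilon> * t) = e2 (\<epsilon> * t) \<odot> dil \<epsilon> ?w"
        unfolding dil_def by (simp add: gmul_snd_commute)
      also have "line_base n M f \<odot> (e2 t0 \<odot> (e2 (\<epsilon> * t) \<odot> dil \<epsilon> ?w)) = line_base n M f \<odot> e2 (t0 + \<epsilon> * t) \<odot> dil \<epsilon> ?w"
        by (simp add: gmul_assoc flip: e2_add)
      finally have "x0 \<odot> dil \<epsilon> (wpt n j t) = line_base n M f \<odot> e2 (t0 + \<epsilon> * t) \<odot> dil \<epsilon> ?w" .
      then show ?thesis
        using F_cong line_shift_point[OF n3 kM, of j f "t0 + \<epsilon> * t"] gdist_commute unfolding sh_def \<epsilon>_def by metis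
    qed
    have Gfst: "fst (G (wpt n j t)) = lam * (line_u M (sh j) (t0 + \<epsilon> * t) - fst (F x0))"
      and Gsnd: "snd (G (wpt n j t)) $ 0 = lam * (line_v M (sh j) (t0 + \<epsilon> * t) - snd (F x0) $ 0)" for j t
      using pt[of j t] unfolding gdist_0_iff[OF n1] line_u_def line_v_def
      by (auto simp: G_def snd_gmul snd_ginv)
    have tm: "t0 + \<epsilon> * (real m / 2 ^ (3 * q)) = real (i * 2 ^ (4 * q) + (r * 2 ^ (3 * q) + m)) / 2 ^ (c + 4 * q)" for m
    proof -
      have e: "(2::real) ^ (4 * q) = 2 ^ q * 2 ^ (3 * q)" by (simp flip: power_add)
      have "t0 + \<epsilon> * (real m / 2 ^ (3 * q)) = (real (i * 2 ^ q + r) * 2 ^ (3 * q) + real m) / (2 ^ k * 2 ^ (3 * q))"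
        by (simp add: t0_def \<epsilon>_def add_divide_distrib)
      also have "real (i * 2 ^ q + r) * 2 ^ (3 * q) + real m = real (i * 2 ^ (4 * q) + (r * 2 ^ (3 * q) + m))"
        by (simp add: e distrib_right)
      finally show ?thesis unfolding ck by (simp add: power_add)
    qed
    have idx: "r * 2 ^ (3 * q) + m < 2 ^ (4 * q)" if "m < 2 ^ (q - 1) * 2 ^ (3 * q)" for m
    proof -
      have "r * 2 ^ (3 * q) + m < 2 ^ (q - 1) * 2 ^ (3 * q) + 2 ^ (q - 1) * 2 ^ (3 * q)"
        using r(1) that by (intro add_le_less_mono mult_le_mono1) auto
      also have "\<dots> = (2 ^ (q - 1) + 2 ^ (q - 1)) * 2 ^ (3 * q)" by (simp only: distrib_right)
      also have "(2::nat) ^ (q - 1) + 2 ^ (q - 1) = 2 ^ q" using q by (cases q) auto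
      also have "(2::nat) ^ q * 2 ^ (3 * q) = 2 ^ (4 * q)" by (simp flip: power_add)
      finally show ?thesis .
    qed
    define b where "b j = dquot c i (line_u M (sh j)) / X" for j
    define b' where "b' j = dquot c i (line_v M (sh j)) / X" for j
    have slope: "\<bar>lam * (w (real (Suc (i * 2 ^ (4 * q) + p)) / 2 ^ (c + 4 * q)) - w (real (i * 2 ^ (4 * q) + p) / 2 ^ (c + 4 * q)))
         - dquot c i w / X / 2 ^ (3 * q)\<bar> \<le> 1 / 2 ^ q / 2 ^ (3 * q)"
      if w: "K * dvar c (4 * q) i w \<le> X" and p: "p < 2 ^ (4 * q)" for w p
    proof -
      let ?d = "dquot (c + 4 * q) (i * 2 ^ (4 * q) + p) w - dquot c i w"
      have "?d\<^sup>2 \<le> (\<Sum>s<2 ^ (4 * q). (dquot (c + 4 * q) (i * 2 ^ (4 * q) + s) w - dquot c i w)\<^sup>2)"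
        by (rule member_le_sum) (use p in auto)
      also have "\<dots> = 2 ^ (4 * q) * dvar c (4 * q) i w" by (simp add: dvar_def)
      also have "\<dots> \<le> 2 ^ (4 * q) * (X / K)"
        using w K by (intro mult_left_mono) (auto simp: field_simps)
      also have "\<dots> = X * c1 / (2 ^ q)\<^sup>2"
      proof -
        have "(2::real) ^ (6 * q) = 2 ^ (4 * q) * (2 ^ q)\<^sup>2" by (simp flip: power_add power_mult)
        then show ?thesis by (simp add: K_def)
      qed
      also have "\<dots> \<le> X * X / (2 ^ q)\<^sup>2"
        using X0 Xc1 by (intro divide_right_mono mult_left_mono) auto
      also have "\<dots> = (X / 2 ^ q)\<^sup>2" by (simp add: power2_eq_square)
      finally have d: "\<bar>?d\<bar> \<le> X / 2 ^ q"
        using X0 by (simp add: abs_le_square_iff[symmetric])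
      have "lam * (w (real (Suc (i * 2 ^ (4 * q) + p)) / 2 ^ (c + 4 * q)) - w (real (i * 2 ^ (4 * q) + p) / 2 ^ (c + 4 * q)))
         = dquot (c + 4 * q) (i * 2 ^ (4 * q) + p) w / X / 2 ^ (3 * q)"
        unfolding dquot_def lam_def ck power_add by simp
      then have "lam * (w (real (Suc (i * 2 ^ (4 * q) + p)) / 2 ^ (c + 4 * q)) - w (real (i * 2 ^ (4 * q) + p) / 2 ^ (c + 4 * q)))
         - dquot c i w / X / 2 ^ (3 * q) = ?d / X / 2 ^ (3 * q)"
        by (simp only: diff_divide_distrib)
      then have "\<bar>lam * (w (real (Suc (i * 2 ^ (4 * q) + p)) / 2 ^ (c + 4 * q)) - w (real (i * 2 ^ (4 * q) + p) / 2 ^ (c + 4 * q)))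
         - dquot c i w / X / 2 ^ (3 * q)\<bar> = \<bar>?d\<bar> / X / 2 ^ (3 * q)"
        using X0 by (simp only: abs_divide) simp
      also have "\<dots> \<le> (X / 2 ^ q) / X / 2 ^ (3 * q)"
        using d X0 by (intro divide_right_mono) auto
      finally show ?thesis using X0 by simp
    qed
    have penu: "K * dvar c (4 * q) i (line_u M (sh j)) \<le> X"
      and penv: "K * dvar c (4 * q) i (line_v M (sh j)) \<le> X"
      and penm: "c2 / (real q + 1) * mean_step M c (4 * q) (sh j) i \<le> X" if "j \<le> q" for j
    proof -
      have "0 \<le> K * dvar c (4 * q) i (line_u M (sh j))" "0 \<le> K * dvar c (4 * q) i (line_v M (sh j))"
        "0 \<le> c2 / (real q + 1) * mean_step M c (4 * q) (sh j) i" using K \<open>c2 > 0\<close> by auto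
      then show "K * dvar c (4 * q) i (line_u M (sh j)) \<le> X" "K * dvar c (4 * q) i (line_v M (sh j)) \<le> X"
        "c2 / (real q + 1) * mean_step M c (4 * q) (sh j) i \<le> X"
        using penX[OF that] unfolding pen_def distrib_left by linarith+
    qed
    have A1: "\<forall>j\<le>q. \<forall>m<2 ^ (q - 1) * 2 ^ (3 * q).
        \<bar>fst (G (wpt n j (real (Suc m) / 2 ^ (3 * q)))) - fst (G (wpt n j (real m / 2 ^ (3 * q)))) - b j / 2 ^ (3 * q)\<bar>
          \<le> 1 / 2 ^ q / 2 ^ (3 * q) \<and>
        \<bar>snd (G (wpt n j (real (Suc m) / 2 ^ (3 * q)))) $ 0 - snd (G (wpt n j (real m / 2 ^ (3 * q)))) $ 0 - b' j / 2 ^ (3 * q)\<bar>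
          \<le> 1 / 2 ^ q / 2 ^ (3 * q)"
    proof (intro allI impI)
      fix j m :: nat assume j: "j \<le> q" and m: "m < 2 ^ (q - 1) * 2 ^ (3 * q)"
      have S: "i * 2 ^ (4 * q) + (r * 2 ^ (3 * q) + Suc m) = Suc (i * 2 ^ (4 * q) + (r * 2 ^ (3 * q) + m))" by simp
      show "\<bar>fst (G (wpt n j (real (Suc m) / 2 ^ (3 * q)))) - fst (G (wpt n j (real m / 2 ^ (3 * q)))) - b j / 2 ^ (3 * q)\<bar>
          \<le> 1 / 2 ^ q / 2 ^ (3 * q) \<and>
        \<bar>snd (G (wpt n j (real (Suc m) / 2 ^ (3 * q)))) $ 0 - snd (G (wpt n j (real m / 2 ^ (3 * q)))) $ 0 - b' j / 2 ^ (3 * q)\<bar>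
          \<le> 1 / 2 ^ q / 2 ^ (3 * q)"
        unfolding Gfst Gsnd tm S b_def b'_def right_diff_distrib[symmetric]
        using slope[OF penu[OF j] idx[OF m]] slope[OF penv[OF j] idx[OF m]] by (simp add: algebra_simps)
    qed
    have A2: "\<forall>j\<le>q. (\<Sum>m<2 ^ (q - 1) * 2 ^ (3 * q).
        (gdist n (G (wpt n j (real m / 2 ^ (3 * q)))) (G (wpt n j (real (Suc m) / 2 ^ (3 * q)))))\<^sup>2) \<le> \<Lambda> / 2 ^ q"
    proof (intro allI impI)
      fix j assume j: "j \<le> q"
      let ?st = "\<lambda>p. line_step M (c + 4 * q) (sh j) (i * 2 ^ (4 * q) + p)"
      have e: "gdist n (G (wpt n j (real m / 2 ^ (3 * q)))) (G (wpt n j (real (Suc m) / 2 ^ (3 * q))))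
          = lam * ?st (r * 2 ^ (3 * q) + m)" for m
      proof -
        have S: "i * 2 ^ (4 * q) + (r * 2 ^ (3 * q) + Suc m) = Suc (i * 2 ^ (4 * q) + (r * 2 ^ (3 * q) + m))" by simp
        show ?thesis unfolding Gd line_step_def gdist_cong[OF pt pt n1] tm S ..
      qed
      have "(\<Sum>m<2 ^ (q - 1) * 2 ^ (3 * q).
        (gdist n (G (wpt n j (real m / 2 ^ (3 * q)))) (G (wpt n j (real (Suc m) / 2 ^ (3 * q)))))\<^sup>2)
        = (\<Sum>p\<in>(\<lambda>m. r * 2 ^ (3 * q) + m) ` {..<2 ^ (q - 1) * 2 ^ (3 * q)}. (lam * ?st p)\<^sup>2)"
        unfolding e by (simp add: sum.reindex)
      also have "\<dots> \<le> (\<Sum>p<2 ^ (4 * q). (lam * ?st p)\<^sup>2)"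
        by (rule sum_mono2) (use idx in auto)
      also have "\<dots> = (\<Sum>p<2 ^ (4 * q). (1 / (2 ^ (3 * q) * X))\<^sup>2 * (2 ^ (c + 4 * q) * ?st p)\<^sup>2)"
        unfolding power_mult_distrib[symmetric] lam_def ck power_add by simp
      also have "\<dots> = (1 / (2 ^ (3 * q) * X))\<^sup>2 * (2 ^ (4 * q) * mean_step M c (4 * q) (sh j) i)"
        unfolding sum_distrib_left[symmetric] by (simp add: mean_step_def)
      also have "\<dots> \<le> (1 / (2 ^ (3 * q) * X))\<^sup>2 * (2 ^ (4 * q) * (X * (real q + 1) / c2))"
        using penm[OF j] \<open>c2 > 0\<close> by (intro mult_left_mono) (auto simp: field_simps)
      also have "\<dots> = (real q + 1) / 2 ^ q * (1 / (X * c2)) / 2 ^ q"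
      proof -
        have "((2::real) ^ (3 * q))\<^sup>2 = 2 ^ (4 * q) * 2 ^ q * 2 ^ q" by (simp flip: power_add power_mult)
        moreover have "(1 / (Y * X))\<^sup>2 * (W * (X * z / c2)) = W * z / (Y\<^sup>2 * (X * c2))" for Y W z
          using X0 by (simp add: power2_eq_square)
        ultimately show ?thesis by simp
      qed
      also have "\<dots> \<le> 1 * (1 / (c1 * c2)) / 2 ^ q"
      proof (intro divide_right_mono mult_mono)
        have "Suc q \<le> 2 ^ q" by (rule Suc_leI) (rule less_exp)
        then have "real (Suc q) \<le> 2 ^ q" by (metis of_nat_le_iff of_nat_numeral of_nat_power)
        then show "(real q + 1) / 2 ^ q \<le> 1" by (simp add: divide_le_eq)
        show "1 / (X * c2) \<le> 1 / (c1 * c2)"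
          using Xc1 c \<open>c1 > 0\<close> \<open>c2 > 0\<close> by (intro divide_left_mono mult_right_mono mult_pos_pos) auto
      qed (use X0 \<open>c2 > 0\<close> in auto)
      also have "\<dots> \<le> \<Lambda> / 2 ^ q" unfolding mult_1_left by (rule divide_right_mono[OF \<Lambda>(3)]) simp
      finally show "(\<Sum>m<2 ^ (q - 1) * 2 ^ (3 * q).
        (gdist n (G (wpt n j (real m / 2 ^ (3 * q)))) (G (wpt n j (real (Suc m) / 2 ^ (3 * q)))))\<^sup>2) \<le> \<Lambda> / 2 ^ q" .
    qed
    have A3: "gnorm n (G (e2 1)) \<le> \<Lambda>"
    proof -
      have "G (e2 1) = dil lam (ginv (F x0) \<odot> F (x0 \<odot> e2 \<epsilon>))"
        by (simp add: G_def dil_e2[of \<epsilon> 1, simplified])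
      then have "gnorm n (G (e2 1)) = lam * gdist n (F x0) (F (x0 \<odot> e2 \<epsilon>))"
        using lam by (simp add: gnorm_dil gdist_def)
      also have "x0 \<odot> e2 \<epsilon> = line_base n M f \<odot> e2 (real (Suc (i * 2 ^ q + r)) / 2 ^ k)"
        unfolding x0_def gmul_assoc e2_add by (simp add: t0_def \<epsilon>_def add_divide_distrib add.commute)
      finally have e: "gnorm n (G (e2 1)) = (2 ^ k * line_step M k f (i * 2 ^ q + r)) / X"
        by (simp add: x0_def t0_def line_step_def lam_def)
      have "(2 ^ k * line_step M k f (i * 2 ^ q + r))\<^sup>2 \<le> 2 * (X / c1)"
      proof -
        have "mean_step M c q f i \<le> X / c1"
          using msX \<open>c1 > 0\<close> by (simp add: pos_le_divide_eq mult.commute)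
        then show ?thesis using r(2) by linarith
      qed
      also have "\<dots> \<le> (2 * X / c1)\<^sup>2"
      proof -
        have "1 * X \<le> 2 * (X / c1) * X"
          using X0 Xc1 \<open>c1 > 0\<close> by (intro mult_right_mono) (auto simp: field_simps)
        then have "X * (2 / c1) \<le> 2 * (X / c1) * X * (2 / c1)"
          using \<open>c1 > 0\<close> by (intro mult_right_mono) auto
        then show ?thesis by (simp add: power2_eq_square mult_ac)
      qed
      finally have "2 ^ k * line_step M k f (i * 2 ^ q + r) \<le> 2 * X / c1"
        by (rule power2_le_imp_le) (use X0 \<open>c1 > 0\<close> in auto)
      then have "gnorm n (G (e2 1)) \<le> (2 * X / c1) / X"
        unfolding e using X0 by (intro divide_right_mono) auto
      also have "\<dots> = 2 / c1" using X0 by simp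
      finally show ?thesis using \<Lambda> by linarith
    qed
    have A4: "G gone = gone"
      by (simp add: G_def dil_gone)
    have A5: "\<bar>b 0\<bar> = 1" using X0 by (simp add: b_def sh_def X_def)
    show ?thesis unfolding is_blowup_def using qsG A1 A2 A3 A4 A5 by blast
  qed
  then show ?thesis using that[OF \<Lambda>(1)] by blast
qed

end

section \<open>One-parameter groups and parallel horizontal lines\<close>

text \<open>
  The one-parameter group of \<open>b e\<^sub>1 + b' e\<^sub>2\<close>.
\<close>

definition hexp :: "real \<Rightarrow> real \<Rightarrow> real \<Rightarrow> model" where
  "hexp b b' t = (b * t, fps_const (b' * t) * phi (b * t))"

lemma fst_hexp [simp]: "fst (hexp b b' t) = b * t"
  by (simp add: hexp_def)

lemma snd_hexp_nth: "snd (hexp b b' t) $ k = b' * t * (b * t) ^ k / fact (Suc k)"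
  by (simp add: hexp_def del: fact_Suc)

lemma hexp_0 [simp]: "hexp b b' 0 = gone"
  by (simp add: hexp_def gone_def)

text \<open>Multiplication by bz trades \<open>phi\<close> for exponentials; identities are proved
  in this form and bz is cancelled afterwards.\<close>

lemma X_snd_hexp: "fps_X * fps_const b * snd (hexp b b' t) = fps_const b' * (fps_exp (b * t) - 1)"
  unfolding X_phi[symmetric] by (simp add: hexp_def mult_ac flip: fps_const_mult)

lemma hexp_add: "hexp b b' s \<odot> hexp b b' t = hexp b b' (s + t)"
proof (rule prod_eqI)
  show "snd (hexp b b' s \<odot> hexp b b' t) = snd (hexp b b' (s + t))"
  proof (cases "b = 0")
    case True
    then show ?thesis by (simp add: snd_gmul hexp_def distrib_left flip: fps_const_add)
  next
    case False
    have "fps_X * fps_const b * snd (hexp b b' s \<odot> hexp b b' t) =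
        fps_X * fps_const b * snd (hexp b b' s) + fps_exp (b * s) * (fps_X * fps_const b * snd (hexp b b' t))"
      by (simp add: snd_gmul algebra_simps)
    also have "\<dots> = fps_X * fps_const b * snd (hexp b b' (s + t))"
      unfolding X_snd_hexp by (simp add: distrib_left fps_exp_add_mult algebra_simps)
    finally show ?thesis using False by (simp add: mult.assoc)
  qed
qed (simp add: distrib_left)

lemma ginv_hexp: "ginv (hexp b b' t) = hexp b b' (- t)"
proof -
  have "hexp b b' t \<odot> hexp b b' (- t) = gone" by (simp add: hexp_add)
  then show ?thesis by (metis gmul_ginv_cancel(2) gmul_gone(2))
qed

text \<open>In the exponential chart a one-parameter group is a straight line, here in the
  horizontal plane, so all higher terms of the norm vanish.\<close>

lemma gnorm_hexp: "gnorm n (hexp b b' t) = sqrt (b\<^sup>2 + b'\<^sup>2) * \<bar>t\<bar>"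
proof -
  have "hlog (hexp b b' t) = fps_const (b' * t) * (inverse (phi (b * t)) * phi (b * t))"
    by (simp add: hlog_def hexp_def mult_ac)
  also have "inverse (phi (b * t)) * phi (b * t) = 1" by (rule inverse_mult_eq_1) simp
  finally have h: "hlog (hexp b b' t) $ k = (if k = 0 then b' * t else 0)" for k by simp
  have "(\<Sum>k=1..<n. \<bar>hlog (hexp b b' t) $ k\<bar> powr (1 / real (Suc k))) = 0"
    by (intro sum.neutral) (auto simp: h)
  moreover have "snd (hexp b b' t) $ 0 = b' * t" by (simp add: snd_hexp_nth)
  moreover have "(b * t)\<^sup>2 + (b' * t)\<^sup>2 = (b\<^sup>2 + b'\<^sup>2) * t\<^sup>2" by (simp add: power_mult_distrib distrib_right)
  ultimately show ?thesis by (simp add: gnorm_def real_sqrt_mult)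
qed

lemma bounded_poly_nat:
  fixes c :: "nat \<Rightarrow> real"
  assumes "\<And>t::nat. \<bar>\<Sum>i\<le>N. c i * real t ^ i\<bar> \<le> B" "1 \<le> k" "k \<le> N"
  shows "c k = 0"
proof (rule ccontr)
  assume "c k \<noteq> 0"
  then have "eventually (\<lambda>z. norm (\<Sum>i\<le>N. c i * z ^ i) \<ge> B + 1) at_infinity"
    using assms by (intro polyfun_extremal exI[of _ k]) auto
  then obtain b where b: "\<And>z. norm z \<ge> b \<Longrightarrow> norm (\<Sum>i\<le>N. c i * z ^ i) \<ge> B + 1"
    unfolding eventually_at_infinity by blast
  obtain t :: nat where "real t \<ge> b" using real_arch_simple by blast
  then have "norm (\<Sum>i\<le>N. c i * real t ^ i) \<ge> B + 1" by (intro b) simp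
  then show False using assms(1)[of t] by simp
qed

abbreviation cpt :: "nat \<Rightarrow> real \<Rightarrow> model" where
  "cpt n y \<equiv> (0, fps_const y * fps_X ^ (n - 1))"

lemma gnorm_cpt: "n \<ge> 2 \<Longrightarrow> gnorm n (cpt n y) = \<bar>y\<bar> powr (1 / real n)"
proof -
  assume n: "n \<ge> 2"
  have "(\<Sum>k=1..<n. \<bar>(fps_const y * fps_X ^ (n - 1)) $ k\<bar> powr (1 / real (Suc k)))
      = (\<Sum>k\<in>{n - 1}. \<bar>(fps_const y * fps_X ^ (n - 1)) $ k\<bar> powr (1 / real (Suc k)))"
    by (rule sum.mono_neutral_right) (use n in \<open>auto simp: fps_X_power_nth\<close>)
  also have "\<dots> = \<bar>y\<bar> powr (1 / real n)" using n by (simp add: fps_X_power_nth)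
  finally show ?thesis unfolding gnorm_snd using n by (simp add: fps_X_power_nth)
qed

lemma cpt_central_nth: "k < n \<Longrightarrow> (fps_exp (a :: real) * (fps_const y * fps_X ^ (n - 1))) $ k = (if k = n - 1 then y else 0)"
  unfolding mult.left_commute[of "fps_exp a"] by (auto simp: fps_X_power_mult_right_nth)

text \<open>Multiplied by bz, the second component of the difference is a series independent of t
  plus e^(-btz) \<open>U\<close>. Its coefficient of z^n is a polynomial in t and must stay bounded,
  so all coefficients of \<open>U\<close> below n vanish. This says that \<open>h\<close> lies on
  the one-parameter group up to its coefficient of z^(n-1), which enters only the unconstrained
  coefficient of z^n in \<open>U\<close>: the central ambiguity.\<close>

lemma parallel_horizontal:
  assumes n: "n \<ge> 1" and b: "b \<noteq> 0"
    and bd: "\<And>t::nat. gnorm n (ginv (hexp b b' (real t)) \<odot> (h \<odot> hexp c c' (real t))) \<le> C"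
  shows "c = b \<and> c' = b' \<and> (\<exists>s y. gdist n h (hexp b b' s \<odot> cpt n y) = 0)"
proof -
  let ?k = "\<lambda>t. ginv (hexp b b' (real t)) \<odot> (h \<odot> hexp c c' (real t))"
  define a where "a = fst h"
  have "\<bar>\<Sum>i\<le>1. (if i = 0 then a else c - b) * real t ^ i\<bar> \<le> C" for t :: nat
    using gnorm_ge_fst[of "?k t" n] bd[of t] by (simp add: a_def algebra_simps)
  then have cb: "c = b" using bounded_poly_nat[where c = "\<lambda>i. if i = 0 then a else c - b" and N = 1 and B = C and k = 1] by simp
  define U where "U = fps_X * fps_const b * snd h - (fps_const c' * fps_exp a - fps_const b')"
  have k: "fps_X * fps_const b * snd (?k t) = (fps_const c' * fps_exp a - fps_const b') + fps_exp (- (b * real t)) * U" for t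
  proof -
    let ?e = "fps_exp (b * real t)" and ?e' = "fps_exp (- (b * real t)) :: real fps"
    have S: "snd (?k t) = - (?e' * snd (hexp b b' (real t))) + ?e' * (snd h + fps_exp a * snd (hexp b c' (real t)))"
      by (simp add: snd_gmul snd_ginv a_def cb)
    have "x * (- (e * p) + e * (h' + E * r)) = - (e * (x * p)) + e * (x * h' + E * (x * r))"
      for x e p h' E r :: "real fps" by (simp add: algebra_simps)
    then have "fps_X * fps_const b * snd (?k t) = - (?e' * (fps_X * fps_const b * snd (hexp b b' (real t))))
       + ?e' * (fps_X * fps_const b * snd h + fps_exp a * (fps_X * fps_const b * snd (hexp b c' (real t))))"
      unfolding S .
    also have "\<dots> = (?e' * ?e) * (fps_const c' * fps_exp a - fps_const b') + ?e' * U"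
      unfolding X_snd_hexp U_def by (simp add: algebra_simps)
    finally show ?thesis by simp
  qed
  have kn: "b * snd (?k t) $ (n - 1) = (fps_const c' * fps_exp a - fps_const b') $ n + (\<Sum>i\<le>n. ((- b) ^ i / fact i * U $ (n - i)) * real t ^ i)" for t
  proof -
    have "b * snd (?k t) $ (n - 1) = (fps_X * fps_const b * snd (?k t)) $ n"
      using n by (simp add: mult.assoc)
    also have "\<dots> = (fps_const c' * fps_exp a - fps_const b') $ n + (fps_exp (- (b * real t)) * U) $ n"
      unfolding k by simp
    also have "(fps_exp (- (b * real t)) * U) $ n = (\<Sum>i\<le>n. ((- b) ^ i / fact i * U $ (n - i)) * real t ^ i)"
      unfolding fps_mult_nth atLeast0AtMost
    proof (rule sum.cong[OF refl])
      fix i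
      have "(- (b * real t)) ^ i = (- b) ^ i * real t ^ i"
        by (simp only: mult_minus_left[symmetric] power_mult_distrib)
      then show "fps_exp (- (b * real t)) $ i * U $ (n - i) = ((- b) ^ i / fact i * U $ (n - i)) * real t ^ i"
        unfolding fps_exp_nth by simp
    qed
    finally show ?thesis .
  qed
  have C0: "C \<ge> 0" using bd[of 0] gnorm_nonneg order_trans by blast
  have bound: "\<bar>\<Sum>i\<le>n. ((- b) ^ i / fact i * U $ (n - i)) * real t ^ i\<bar>
      \<le> \<bar>b\<bar> * (real n * C ^ n) + \<bar>(fps_const c' * fps_exp a - fps_const b') $ n\<bar>" for t
  proof -
    have "\<bar>snd (?k t) $ (n - 1)\<bar> \<le> real (Suc (n - 1)) * gnorm n (?k t) ^ Suc (n - 1)"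
      by (rule gnorm_ge_nth) (use n in simp)
    also have "\<dots> \<le> real n * C ^ n"
      using n bd[of t] by (auto intro!: mult_left_mono power_mono)
    finally have "\<bar>b * snd (?k t) $ (n - 1)\<bar> \<le> \<bar>b\<bar> * (real n * C ^ n)"
      unfolding abs_mult by (rule mult_left_mono) simp
    then show ?thesis unfolding kn by linarith
  qed
  have U0: "U $ m = 0" if "m < n" for m
  proof -
    have "(- b) ^ (n - m) / fact (n - m) * U $ (n - (n - m)) = 0"
      by (rule bounded_poly_nat[OF bound]) (use that in auto)
    then show ?thesis using b that by simp
  qed
  have cb': "c' = b'" using U0[of 0] n by (simp add: U_def mult.assoc)
  define s where "s = a / b"
  define y where "y = snd h $ (n - 1) - snd (hexp b b' s) $ (n - 1)"
  have hk: "snd h $ k = snd (hexp b b' s) $ k" if "Suc k < n" for k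
  proof -
    have "b * snd h $ k = b' * a ^ Suc k / fact (Suc k)"
      using U0[OF that] by (simp add: U_def mult.assoc cb' del: fact_Suc power_Suc)
    then have "b * snd h $ k = b * snd (hexp b b' s) $ k"
      using b by (simp add: snd_hexp_nth s_def del: fact_Suc)
    then show ?thesis using b by simp
  qed
  have "gdist n h (hexp b b' s \<odot> cpt n y) = 0"
    unfolding gdist_0_iff[OF n]
  proof (intro conjI allI impI)
    show "fst h = fst (hexp b b' s \<odot> cpt n y)" using b by (simp add: s_def a_def)
    fix k assume k: "k < n"
    show "snd h $ k = snd (hexp b b' s \<odot> cpt n y) $ k"
      unfolding snd_gmul snd_conv fps_add_nth cpt_central_nth[OF k]
      using hk[of k] k by (cases "k = n - 1") (auto simp: y_def)
  qed
  then show ?thesis using cb cb' by blast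
qed

lemma wpt_dist:
  assumes "n \<ge> 3"
  shows "gdist n (wpt n i s) (wpt n j t) = \<bar>t - s\<bar> + \<bar>real j - real i\<bar> powr (1 / real (n - 1))"
proof -
  have e: "ginv (wpt n i s) \<odot> wpt n j t = (0, fps_const (t - s) + fps_const (real j - real i) * fps_X ^ (n - 2))"
    by (simp add: wpt_def gmul_def ginv_def algebra_simps flip: fps_const_sub)
  have "(\<Sum>k=1..<n. \<bar>(fps_const (t - s) + fps_const (real j - real i) * fps_X ^ (n - 2)) $ k\<bar> powr (1 / real (Suc k)))
      = (\<Sum>k\<in>{n - 2}. \<bar>(fps_const (t - s) + fps_const (real j - real i) * fps_X ^ (n - 2)) $ k\<bar> powr (1 / real (Suc k)))"
    by (rule sum.mono_neutral_right) (use assms in \<open>auto simp: fps_X_power_nth\<close>)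
  also have "\<dots> = \<bar>real j - real i\<bar> powr (1 / real (n - 1))"
  proof -
    have "Suc (n - 2) = n - 1" "n - 2 \<noteq> 0" using assms by auto
    then show ?thesis by (simp add: fps_X_power_nth)
  qed
  finally show ?thesis unfolding gdist_def e gnorm_snd using assms by (simp add: fps_X_power_nth)
qed

context qs_map
begin

text \<open>Consecutive lines have distance 1 in the source, which bounds the change of the central
  offset \<open>y\<close> from one image line to the next. So \<open>y j\<close> grows at most
  linearly and adds O(j^(1/n)) to a norm, against the distance j^(1/(n-1)) in the source. All
  parameters are natural numbers because the limit map is known only there.\<close>

lemma no_horizontal_blowup:
  fixes \<Phi> :: "nat \<Rightarrow> nat \<Rightarrow> model"
  assumes qs\<Phi>: "\<And>i j k s t r. gdist n (wpt n i (real s)) (wpt n k (real r)) > 0 \<Longrightarrow>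
      gdist n (\<Phi> i s) (\<Phi> j t) \<le> \<eta> (gdist n (wpt n i (real s)) (wpt n j (real t)) / gdist n (wpt n i (real s)) (wpt n k (real r)))
        * gdist n (\<Phi> i s) (\<Phi> k r)"
    and hor: "\<And>j t. gdist n (\<Phi> j t) (\<Phi> j 0 \<odot> hexp (b j) (b' j) (real t)) = 0"
    and b0: "b 0 \<noteq> 0"
  shows False
proof -
  define Y where "Y = sqrt ((b 0)\<^sup>2 + (b' 0)\<^sup>2)"
  have Y: "Y > 0" using b0 by (simp add: Y_def sum_power2_gt_zero_iff)
  define g where "g = \<Phi> 0 0"
  let ?h = "hexp (b 0) (b' 0)"
  have qs1: "gdist n (\<Phi> i s) (\<Phi> j t) \<le> \<eta> c * gdist n (\<Phi> i s) (\<Phi> k r)"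
    if "gdist n (wpt n i (real s)) (wpt n k (real r)) > 0"
      "gdist n (wpt n i (real s)) (wpt n j (real t)) \<le> c * gdist n (wpt n i (real s)) (wpt n k (real r))"
    for i j k s t r c
  proof -
    have "\<eta> (gdist n (wpt n i (real s)) (wpt n j (real t)) / gdist n (wpt n i (real s)) (wpt n k (real r))) \<le> \<eta> c"
      using that by (intro eta_mono) (auto simp: divide_le_eq)
    then have "\<eta> (gdist n (wpt n i (real s)) (wpt n j (real t)) / gdist n (wpt n i (real s)) (wpt n k (real r)))
        * gdist n (\<Phi> i s) (\<Phi> k r) \<le> \<eta> c * gdist n (\<Phi> i s) (\<Phi> k r)"
      by (rule mult_right_mono) simp
    then show ?thesis using qs\<Phi>[OF that(1), of j t] by linarith
  qed
  have step: "gdist n (\<Phi> 0 s) (\<Phi> 0 t) = Y * \<bar>real t - real s\<bar>" for s t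
  proof -
    have "gdist n (\<Phi> 0 s) (\<Phi> 0 t) = gdist n (?h (real s)) (?h (real t))"
      using gdist_cong[OF hor hor n1, of 0 s 0 t] by simp
    also have "\<dots> = gnorm n (?h (real t - real s))"
      by (simp add: gdist_def ginv_hexp hexp_add)
    finally show ?thesis by (simp add: gnorm_hexp Y_def)
  qed
  have par: "b j = b 0 \<and> b' j = b' 0 \<and> (\<exists>s y. gdist n (ginv g \<odot> \<Phi> j 0) (?h s \<odot> cpt n y) = 0)" for j
  proof (rule parallel_horizontal[OF n1 b0])
    fix t :: nat
    let ?c = "real j powr (1 / real (n - 1))"
    have "gdist n (\<Phi> 0 t) (\<Phi> j t) \<le> \<eta> ?c * gdist n (\<Phi> 0 t) (\<Phi> 0 (Suc t))"
      by (rule qs1) (auto simp: wpt_dist[OF n3])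
    also have "gdist n (\<Phi> 0 t) (\<Phi> 0 (Suc t)) = Y" by (simp add: step)
    also have "gdist n (\<Phi> 0 t) (\<Phi> j t) = gdist n (g \<odot> ?h (real t)) (\<Phi> j 0 \<odot> hexp (b j) (b' j) (real t))"
      unfolding g_def by (rule gdist_cong[OF hor hor n1])
    also have "\<dots> = gnorm n (ginv (?h (real t)) \<odot> ((ginv g \<odot> \<Phi> j 0) \<odot> hexp (b j) (b' j) (real t)))"
      by (simp add: gdist_def ginv_gmul gmul_assoc)
    finally show "\<dots> \<le> \<eta> ?c * Y" .
  qed
  then have "\<forall>j. \<exists>s y. gdist n (ginv g \<odot> \<Phi> j 0) (?h s \<odot> cpt n y) = 0" by blast
  then obtain \<sigma> y where sy: "\<And>j. gdist n (ginv g \<odot> \<Phi> j 0) (?h (\<sigma> j) \<odot> cpt n (y j)) = 0" by metis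
  have pos: "gdist n (\<Phi> j t) (g \<odot> (?h (\<sigma> j + real t) \<odot> cpt n (y j))) = 0" for j t
  proof -
    have 1: "gdist n (\<Phi> j t) (\<Phi> j 0 \<odot> ?h (real t)) = 0" using hor[of j t] par[of j] by simp
    have e: "fst (\<Phi> j 0) = fst g + b 0 * \<sigma> j" and
      e': "k < n \<Longrightarrow> snd (ginv g \<odot> \<Phi> j 0) $ k = snd (?h (\<sigma> j) \<odot> cpt n (y j)) $ k" for k
      using sy[of j] unfolding gdist_0_iff[OF n1] by auto
    have 2: "gdist n (ginv g \<odot> \<Phi> j 0 \<odot> ?h (real t)) (?h (\<sigma> j + real t) \<odot> cpt n (y j)) = 0"
      unfolding gdist_0_iff[OF n1]
    proof (intro conjI allI impI)
      show "fst (ginv g \<odot> \<Phi> j 0 \<odot> ?h (real t)) = fst (?h (\<sigma> j + real t) \<odot> cpt n (y j))"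
        using e by (simp add: distrib_left)
      fix k assume k: "k < n"
      have "snd (ginv g \<odot> \<Phi> j 0 \<odot> ?h (real t)) $ k = snd (?h (\<sigma> j) \<odot> cpt n (y j)) $ k
          + (fps_exp (b 0 * \<sigma> j) * snd (?h (real t))) $ k"
        using e'[OF k] e by (simp add: snd_gmul[of "ginv g \<odot> _"])
      also have "\<dots> = snd (?h (\<sigma> j) \<odot> ?h (real t)) $ k + (if k = n - 1 then y j else 0)"
        unfolding snd_gmul[of "?h (\<sigma> j)"] snd_conv fps_add_nth cpt_central_nth[OF k] by simp
      also have "\<dots> = snd (?h (\<sigma> j + real t) \<odot> cpt n (y j)) $ k"
        unfolding hexp_add snd_gmul[of "?h (\<sigma> j + real t)"] snd_conv fps_add_nth cpt_central_nth[OF k] ..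
      finally show "snd (ginv g \<odot> \<Phi> j 0 \<odot> ?h (real t)) $ k = snd (?h (\<sigma> j + real t) \<odot> cpt n (y j)) $ k" .
    qed
    then have "gdist n (g \<odot> (ginv g \<odot> \<Phi> j 0 \<odot> ?h (real t))) (g \<odot> (?h (\<sigma> j + real t) \<odot> cpt n (y j))) = 0"
      by simp
    then have "gdist n (\<Phi> j 0 \<odot> ?h (real t)) (g \<odot> (?h (\<sigma> j + real t) \<odot> cpt n (y j))) = 0"
      by (simp add: gmul_assoc)
    then show ?thesis using gdist_0_trans[OF 1 _ n1] by blast
  qed
  have dist: "gdist n (\<Phi> i s) (\<Phi> j t) = gnorm n (?h (\<sigma> j + real t - (\<sigma> i + real s)) \<odot> cpt n (y j - y i))" for i j s t
  proof -
    have "gdist n (\<Phi> i s) (\<Phi> j t) = gdist n (?h (\<sigma> i + real s) \<odot> cpt n (y i)) (?h (\<sigma> j + real t) \<odot> cpt n (y j))"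
      using gdist_cong[OF pos pos n1, of i s j t] by simp
    also have "\<dots> = gnorm n (ginv (cpt n (y i)) \<odot> (?h (\<sigma> j + real t - (\<sigma> i + real s)) \<odot> cpt n (y j)))"
    proof -
      have "?h (- \<alpha>) \<odot> (?h \<beta> \<odot> c) = ?h (\<beta> - \<alpha>) \<odot> c" for \<alpha> \<beta> c
        unfolding gmul_assoc[symmetric] hexp_add by simp
      then show ?thesis by (simp only: gdist_def ginv_gmul gmul_assoc ginv_hexp)
    qed
    also have "\<dots> = gnorm n (?h (\<sigma> j + real t - (\<sigma> i + real s)) \<odot> cpt n (y j - y i))"
    proof (rule gnorm_cong)
      fix k assume k: "k < n"
      let ?H = "?h (\<sigma> j + real t - (\<sigma> i + real s))"
      have "snd (ginv (cpt n (y i)) \<odot> (?H \<odot> cpt n (y j))) $ k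
        = - (if k = n - 1 then y i else 0) + (snd ?H $ k + (if k = n - 1 then y j else 0))"
      proof -
        have "snd (ginv (cpt n (y i))) $ k = - (if k = n - 1 then y i else 0)"
          unfolding snd_ginv fst_conv snd_conv fps_neg_nth cpt_central_nth[OF k] ..
        then show ?thesis
          unfolding snd_gmul fst_ginv fst_conv snd_conv minus_zero fps_exp_0 mult_1_left fps_add_nth cpt_central_nth[OF k]
          by (simp only:)
      qed
      also have "\<dots> = snd (?H \<odot> cpt n (y j - y i)) $ k"
        unfolding snd_gmul snd_conv fps_add_nth cpt_central_nth[OF k] by simp
      finally show "snd (ginv (cpt n (y i)) \<odot> (?H \<odot> cpt n (y j))) $ k = snd (?H \<odot> cpt n (y j - y i)) $ k" .
    qed (auto simp: n1)
    finally show ?thesis .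
  qed
  define C2 where "C2 = \<eta> 1 * Y"
  define C3 where "C3 = real n * C2 ^ n + \<bar>b' 0 / b 0\<bar> * C2 ^ n"
  have C2: "C2 \<ge> 0" unfolding C2_def using eta1_ge_1 Y by simp
  have ystep: "\<bar>y (Suc j) - y j\<bar> \<le> C3" for j
  proof -
    let ?s = "\<sigma> (Suc j) - \<sigma> j"
    let ?g = "?h ?s \<odot> cpt n (y (Suc j) - y j)"
    have "gdist n (\<Phi> j 0) (\<Phi> (Suc j) 0) \<le> \<eta> 1 * gdist n (\<Phi> j 0) (\<Phi> j 1)"
      by (rule qs1) (auto simp: wpt_dist[OF n3])
    also have "gdist n (\<Phi> j 0) (\<Phi> j 1) = gnorm n (?h 1 \<odot> gone)"
      unfolding dist by (simp add: gone_def)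
    also have "\<dots> = Y" by (simp add: gnorm_hexp Y_def)
    finally have N: "gnorm n ?g \<le> C2" by (simp add: dist C2_def)
    have bs: "\<bar>b 0 * ?s\<bar> \<le> C2" using gnorm_ge_fst[of ?g n] N by simp
    have "\<bar>snd ?g $ (n - 1)\<bar> \<le> real (Suc (n - 1)) * gnorm n ?g ^ Suc (n - 1)"
      by (rule gnorm_ge_nth) simp
    also have "\<dots> \<le> real n * C2 ^ n"
      using N n1 by (auto intro!: mult_left_mono power_mono)
    finally have 1: "\<bar>snd ?g $ (n - 1)\<bar> \<le> real n * C2 ^ n" .
    have 2: "snd ?g $ (n - 1) = snd (?h ?s) $ (n - 1) + (y (Suc j) - y j)"
      unfolding snd_gmul snd_conv fps_add_nth by (subst cpt_central_nth) auto
    have 3: "snd (?h ?s) $ (n - 1) = b' 0 / b 0 * ((b 0 * ?s) ^ n / fact n)"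
    proof -
      obtain m where m: "n = Suc m" using n1 by (cases n) auto
      show ?thesis using b0 unfolding m by (simp add: snd_hexp_nth del: fact_Suc)
    qed
    have "\<bar>snd (?h ?s) $ (n - 1)\<bar> \<le> \<bar>b' 0 / b 0\<bar> * \<bar>b 0 * ?s\<bar> ^ n"
      unfolding 3 abs_mult[of "b' 0 / b 0"] by (rule mult_left_mono[OF abs_power_div_fact_le]) simp
    also have "\<dots> \<le> \<bar>b' 0 / b 0\<bar> * C2 ^ n" using bs by (intro mult_left_mono power_mono) auto
    finally show ?thesis using 1 2 unfolding C3_def by linarith
  qed
  have C3: "C3 \<ge> 0" unfolding C3_def using C2 by simp
  have yj: "\<bar>y j - y 0\<bar> \<le> C3 * real j" for j
  proof (induction j)
    case (Suc j)
    then show ?case using ystep[of j] by (simp add: algebra_simps)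
  qed simp
  define C4 where "C4 = \<eta> 1 * (gtri n * (Y + (C3 + 1)))"
  obtain u :: nat where u: "C4 / Y < real u" "1 \<le> u"
  proof -
    obtain u :: nat where "max (C4 / Y) 1 < real u" using reals_Archimedean2 by blast
    then show ?thesis by (intro that[of u]) auto
  qed
  \<comment> \<open>With j = u^(n(n-1)) both roots are natural numbers, j^(1/(n-1)) = u^n = i and
    j^(1/n) = u^(n-1), so the two bounds differ by the factor u.\<close>
  define i where "i = u ^ n"
  define j where "j = i ^ (n - 1)"
  define \<delta> where "\<delta> = \<sigma> j - \<sigma> 0"
  \<comment> \<open>Natural parameters that compensate, up to 1, the shift of the j-th image line
    along its own direction.\<close>
  obtain s t :: nat where st: "\<bar>\<delta> + real t - real s\<bar> \<le> 1"
  proof (cases "\<delta> \<ge> 0")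
    case True
    have "\<bar>\<delta> + real 0 - real (nat \<lfloor>\<delta>\<rfloor>)\<bar> \<le> 1" using True by simp linarith
    then show ?thesis by (rule that)
  next
    case False
    have "\<bar>\<delta> + real (nat \<lfloor>- \<delta>\<rfloor>) - real 0\<bar> \<le> 1" using False by simp linarith
    then show ?thesis by (rule that)
  qed
  have i0: "i > 0" using u by (simp add: i_def)
  have ji: "real j powr (1 / real (n - 1)) = real i"
  proof -
    have "real j = real i powr real (n - 1)"
      unfolding j_def of_nat_power by (rule powr_realpow[symmetric]) (use i0 in simp)
    moreover have "real (n - 1) * (1 / real (n - 1)) = 1" using n3 by simp
    ultimately show ?thesis using i0 by (simp only: powr_powr) simp
  qed
  have "gdist n (\<Phi> 0 s) (\<Phi> 0 (s + i)) \<le> \<eta> 1 * gdist n (\<Phi> 0 s) (\<Phi> j t)"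
  proof (rule qs1)
    show "0 < gdist n (wpt n 0 (real s)) (wpt n j (real t))"
      using i0 ji by (simp add: wpt_dist[OF n3])
    show "gdist n (wpt n 0 (real s)) (wpt n 0 (real (s + i))) \<le> 1 * gdist n (wpt n 0 (real s)) (wpt n j (real t))"
      using ji by (simp add: wpt_dist[OF n3])
  qed
  then have main: "Y * real i \<le> \<eta> 1 * gdist n (\<Phi> 0 s) (\<Phi> j t)" by (simp add: step)
  have "gdist n (\<Phi> 0 s) (\<Phi> j t) \<le> gtri n * (Y + (C3 + 1) * real u ^ (n - 1))"
    unfolding dist
  proof (rule gnorm_gmul_le[OF _ _ n1])
    have "gnorm n (?h (\<sigma> j + real t - (\<sigma> 0 + real s))) \<le> Y * 1"
      unfolding gnorm_hexp Y_def[symmetric] using st Y by (intro mult_left_mono) (auto simp: \<delta>_def)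
    moreover have "0 \<le> (C3 + 1) * real u ^ (n - 1)" using C3 by simp
    ultimately show "gnorm n (?h (\<sigma> j + real t - (\<sigma> 0 + real s))) \<le> Y + (C3 + 1) * real u ^ (n - 1)" by simp
    have "gnorm n (cpt n (y j - y 0)) = \<bar>y j - y 0\<bar> powr (1 / real n)" using n3 by (intro gnorm_cpt) simp
    also have "\<dots> \<le> ((C3 + 1) * real j) powr (1 / real n)"
    proof (rule powr_mono2)
      have "C3 * real j \<le> (C3 + 1) * real j" by (intro mult_right_mono) auto
      then show "\<bar>y j - y 0\<bar> \<le> (C3 + 1) * real j" using yj[of j] by linarith
    qed auto
    also have "\<dots> = (C3 + 1) powr (1 / real n) * real j powr (1 / real n)"
      using C3 by (simp add: powr_mult)
    also have "real j powr (1 / real n) = real u ^ (n - 1)"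
    proof -
      have "real j = real u powr (real (n * (n - 1)))"
        unfolding j_def i_def of_nat_power power_mult[symmetric]
        by (rule powr_realpow[symmetric]) (use u in simp)
      moreover have "real (n * (n - 1)) * (1 / real n) = real (n - 1)" by simp
      ultimately have "real j powr (1 / real n) = real u powr (real (n - 1))" by (simp only: powr_powr)
      also have "\<dots> = real u ^ (n - 1)" by (rule powr_realpow) (use u in simp)
      finally show ?thesis .
    qed
    also have "(C3 + 1) powr (1 / real n) * real u ^ (n - 1) \<le> (C3 + 1) powr 1 * real u ^ (n - 1)"
      using C3 n1 by (intro mult_right_mono powr_mono) auto
    finally show "gnorm n (cpt n (y j - y 0)) \<le> Y + (C3 + 1) * real u ^ (n - 1)"
      using C3 Y by simp
  qed
  also have "\<dots> \<le> gtri n * ((Y + (C3 + 1)) * real u ^ (n - 1))"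
  proof (rule mult_left_mono)
    have "Y * 1 \<le> Y * real u ^ (n - 1)" using u Y by (intro mult_left_mono one_le_power) auto
    then show "Y + (C3 + 1) * real u ^ (n - 1) \<le> (Y + (C3 + 1)) * real u ^ (n - 1)"
      by (simp add: distrib_right)
  qed (use gtri_ge_1[OF n1] in simp)
  finally have "\<eta> 1 * gdist n (\<Phi> 0 s) (\<Phi> j t) \<le> \<eta> 1 * (gtri n * ((Y + (C3 + 1)) * real u ^ (n - 1)))"
    using eta1_ge_1 by (intro mult_left_mono) auto
  then have "Y * real i \<le> C4 * real u ^ (n - 1)"
    using main unfolding C4_def by (simp add: mult_ac)
  moreover have "real i = real u * real u ^ (n - 1)" unfolding i_def using n1 by (cases n) auto
  ultimately have "(Y * real u) * real u ^ (n - 1) \<le> C4 * real u ^ (n - 1)" by (simp add: mult_ac)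
  then have "Y * real u \<le> C4" using u by (simp add: mult_le_cancel_right)
  then show False using u(1) Y by (simp add: divide_less_eq mult.commute)
qed

end

section \<open>Lines are mapped to lines\<close>

definition mtends :: "nat \<Rightarrow> (nat \<Rightarrow> model) \<Rightarrow> model \<Rightarrow> bool" where
  "mtends n X g \<longleftrightarrow> (\<lambda>q. fst (X q)) \<longlonglongrightarrow> fst g \<and> (\<forall>k<n. (\<lambda>q. snd (X q) $ k) \<longlonglongrightarrow> snd g $ k)"

lemma mtends_mult:
  fixes P :: "nat \<Rightarrow> real fps"
  assumes "a \<longlonglongrightarrow> b" "\<And>k. k < n \<Longrightarrow> (\<lambda>q. P q $ k) \<longlonglongrightarrow> Q $ k" "k < n"
  shows "(\<lambda>q. (fps_exp (a q) * P q) $ k) \<longlonglongrightarrow> (fps_exp b * Q) $ k"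
  unfolding fps_mult_nth fps_exp_nth using assms by (intro tendsto_intros) auto

lemma mtends_ginv: "mtends n X g \<Longrightarrow> mtends n (\<lambda>q. ginv (X q)) (ginv g)"
  unfolding mtends_def by (auto simp: snd_ginv intro!: tendsto_minus mtends_mult[where n = n])

lemma mtends_gmul: "mtends n X g \<Longrightarrow> mtends n Z h \<Longrightarrow> mtends n (\<lambda>q. X q \<odot> Z q) (g \<odot> h)"
  unfolding mtends_def by (auto simp: snd_gmul intro!: tendsto_add mtends_mult[where n = n])

lemma gnorm_tendsto:
  assumes "mtends n X g" "n \<ge> 1"
  shows "(\<lambda>q. gnorm n (X q)) \<longlonglongrightarrow> gnorm n g"
proof -
  have f: "(\<lambda>q. fst (X q)) \<longlonglongrightarrow> fst g" and s: "\<And>k. k < n \<Longrightarrow> (\<lambda>q. snd (X q) $ k) \<longlonglongrightarrow> snd g $ k"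
    using assms by (auto simp: mtends_def)
  have "(\<lambda>q. hlog (X q) $ k) \<longlonglongrightarrow> hlog g $ k" if "k < n" for k
    unfolding hlog_def fps_mult_nth inverse_phi_nth using that by (intro tendsto_sum tendsto_mult tendsto_power tendsto_const f s) auto
  then have "(\<lambda>q. \<bar>hlog (X q) $ k\<bar> powr (1 / real (Suc k))) \<longlonglongrightarrow> \<bar>hlog g $ k\<bar> powr (1 / real (Suc k))" if "k < n" for k
    using that by (intro tendsto_powr' tendsto_rabs tendsto_const) auto
  then show ?thesis unfolding gnorm_def using assms(2)
    by (intro tendsto_add tendsto_real_sqrt tendsto_power tendsto_sum f s) auto
qed

lemma gdist_tendsto:
  assumes "mtends n X g" "mtends n Z h" "n \<ge> 1"
  shows "(\<lambda>q. gdist n (X q) (Z q)) \<longlonglongrightarrow> gdist n g h"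
  unfolding gdist_def by (intro gnorm_tendsto mtends_gmul mtends_ginv assms)

lemma mtends_const: "mtends n (\<lambda>q. g) g"
  by (simp add: mtends_def)

lemma mtends_gdist:
  assumes "(\<lambda>q. gdist n g (X q)) \<longlonglongrightarrow> 0" "n \<ge> 1"
  shows "mtends n X g"
proof -
  have "mtends n (\<lambda>q. ginv g \<odot> X q) gone"
    unfolding mtends_def
  proof (intro conjI allI impI)
    show "(\<lambda>q. fst (ginv g \<odot> X q)) \<longlonglongrightarrow> fst gone"
      unfolding fst_gone
    proof (rule Lim_null_comparison[OF _ assms(1)], rule eventuallyI)
      show "norm (fst (ginv g \<odot> X q)) \<le> gdist n g (X q)" for q
        using gnorm_ge_fst[of "ginv g \<odot> X q" n] by (simp add: gdist_def)
    qed
    fix k assume k: "k < n"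
    have "(\<lambda>q. real (Suc k) * gdist n g (X q) ^ Suc k) \<longlonglongrightarrow> real (Suc k) * 0 ^ Suc k"
      by (intro tendsto_intros assms)
    then have "(\<lambda>q. real (Suc k) * gdist n g (X q) ^ Suc k) \<longlonglongrightarrow> 0" by simp
    then show "(\<lambda>q. snd (ginv g \<odot> X q) $ k) \<longlonglongrightarrow> snd gone $ k"
      unfolding snd_gone fps_zero_nth
    proof (rule Lim_null_comparison[rotated], intro eventuallyI)
      show "norm (snd (ginv g \<odot> X q) $ k) \<le> real (Suc k) * gdist n g (X q) ^ Suc k" for q
        using gnorm_ge_nth[OF k, of "ginv g \<odot> X q"] by (simp add: gdist_def del: of_nat_Suc power_Suc)
    qed
  qed
  from mtends_gmul[OF mtends_const this, of g] show ?thesis by simp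
qed

lemma diagonal_convergence:
  fixes x :: "nat \<Rightarrow> 'i::countable \<Rightarrow> real"
  assumes "\<And>i. \<exists>B. \<forall>q. \<bar>x q i\<bar> \<le> B"
  obtains s where "strict_mono s" "\<And>i. convergent (\<lambda>q. x (s q) i)"
proof -
  interpret subseqs "\<lambda>i s. convergent (\<lambda>q. x (s q) (from_nat i))"
  proof
    fix i :: nat and s :: "nat \<Rightarrow> nat"
    obtain B where B: "\<And>q. \<bar>x q (from_nat i)\<bar> \<le> B" using assms by blast
    have "bounded (range (\<lambda>q. x (s q) (from_nat i)))"
      unfolding bounded_iff using B by auto
    from bounded_imp_convergent_subsequence[OF this] obtain l r where "strict_mono r" "((\<lambda>q. x (s q) (from_nat i)) \<circ> r) \<longlonglongrightarrow> l"
      by blast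
    then show "\<exists>r'. strict_mono r' \<and> convergent (\<lambda>q. x ((s \<circ> r') q) (from_nat i))"
      by (intro exI[of _ r]) (auto simp: convergent_def o_def)
  qed
  have "convergent (\<lambda>q. x (diagseq q) i)" for i
  proof -
    have "convergent (\<lambda>q. x ((diagseq \<circ> (+) (Suc (to_nat i))) q) (from_nat (to_nat i)))"
    proof (rule diagseq_holds)
      fix s r k assume "strict_mono (r :: nat \<Rightarrow> nat)" "convergent (\<lambda>q. x (s q) (from_nat k))"
      then show "convergent (\<lambda>q. x ((s \<circ> r) q) (from_nat k))"
        using convergent_subseq_convergent[of "\<lambda>q. x (s q) (from_nat k)" r] by (simp add: o_def)
    qed
    then have "convergent (\<lambda>q. x (diagseq (q + Suc (to_nat i))) i)" by (simp add: o_def add.commute)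
    then show ?thesis by (rule convergent_ignore_initial_segment[THEN iffD1])
  qed
  then show ?thesis by (rule that[OF subseq_diagseq])
qed

lemma abs_power_diff_le:
  fixes x y :: real
  assumes "\<bar>x\<bar> \<le> R" "\<bar>y\<bar> \<le> R" "R \<ge> 1"
  shows "\<bar>x ^ k - y ^ k\<bar> \<le> real k * R ^ k * \<bar>x - y\<bar>"
proof (induction k)
  case (Suc k)
  have "x ^ Suc k - y ^ Suc k = x * (x ^ k - y ^ k) + (x - y) * y ^ k" by (simp add: algebra_simps)
  then have "\<bar>x ^ Suc k - y ^ Suc k\<bar> \<le> \<bar>x\<bar> * \<bar>x ^ k - y ^ k\<bar> + \<bar>x - y\<bar> * \<bar>y\<bar> ^ k"
    using abs_triangle_ineq[of "x * (x ^ k - y ^ k)" "(x - y) * y ^ k"] by (simp add: abs_mult power_abs)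
  also have "\<dots> \<le> R * (real k * R ^ k * \<bar>x - y\<bar>) + \<bar>x - y\<bar> * R ^ k"
    using assms Suc.IH by (intro add_mono mult_mono power_mono) auto
  also have "\<dots> \<le> R * (real k * R ^ k * \<bar>x - y\<bar>) + \<bar>x - y\<bar> * R ^ Suc k"
    using assms(3) by (intro add_left_mono mult_left_mono power_increasing) auto
  also have "\<dots> = real (Suc k) * R ^ Suc k * \<bar>x - y\<bar>" by (simp add: algebra_simps)
  finally show ?case .
qed simp

text \<open>
  A curve in the group is determined up to a small error by its horizontal components once the sum of
  the squares of its steps is small: the other components of a step are at least quadratic in its length.
\<close>

lemma curve_close:
  fixes g g' :: "nat \<Rightarrow> model"
  assumes R: "R \<ge> 1" "\<tau> \<ge> 0" "\<delta> \<ge> 0" and start: "g 0 = gone" "g' 0 = gone"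
    and A: "\<And>m. m < N \<Longrightarrow> \<bar>fst (g m)\<bar> \<le> R" "\<And>m. m < N \<Longrightarrow> \<bar>fst (g' m)\<bar> \<le> R"
      "\<And>m. m < N \<Longrightarrow> \<bar>fst (g m) - fst (g' m)\<bar> \<le> \<delta>"
    and V: "\<And>m. m < N \<Longrightarrow> \<bar>snd (g' (Suc m)) $ 0 - snd (g' m) $ 0\<bar> \<le> R * \<tau>"
      "\<And>m. m < N \<Longrightarrow> \<bar>(snd (g (Suc m)) $ 0 - snd (g m) $ 0) - (snd (g' (Suc m)) $ 0 - snd (g' m) $ 0)\<bar> \<le> \<delta> * \<tau>"
    and d: "\<And>m. m < N \<Longrightarrow> gdist n (g m) (g (Suc m)) \<le> 1" "\<And>m. m < N \<Longrightarrow> gdist n (g' m) (g' (Suc m)) \<le> 1"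
    and k: "k < n"
  shows "\<bar>snd (g N) $ k - snd (g' N) $ k\<bar> \<le> real N * \<tau> * \<delta> * ((1 + real k * R) * R ^ k)
     + real n * real n * R ^ n * ((\<Sum>m<N. (gdist n (g m) (g (Suc m)))\<^sup>2) + (\<Sum>m<N. (gdist n (g' m) (g' (Suc m)))\<^sup>2))"
proof -
  \<comment> \<open>The first-order part of a step; for a horizontal curve with first coordinate a
    it is the differential equation dx_k = (a^k / k!) dx_0. Every other term contains a coefficient
    of z^i, i >= 1, of the step and is at least quadratic in its length.\<close>
  define main where "main h m = fst (h m) ^ k / fact k * (snd (h (Suc m)) $ 0 - snd (h m) $ 0)" for h :: "nat \<Rightarrow> model" and m
  have step: "\<bar>(snd (h (Suc m)) $ k - snd (h m) $ k) - main h m\<bar> \<le> real n * real n * R ^ n * (gdist n (h m) (h (Suc m)))\<^sup>2"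
    if hR: "\<bar>fst (h m)\<bar> \<le> R" and hd: "gdist n (h m) (h (Suc m)) \<le> 1" for h :: "nat \<Rightarrow> model" and m
  proof -
    let ?y = "ginv (h m) \<odot> h (Suc m)"
    let ?d = "gdist n (h m) (h (Suc m))"
    have "snd (h (Suc m)) = snd (h m) + fps_exp (fst (h m)) * snd ?y"
      by (metis gmul_ginv_cancel(1) snd_gmul)
    then have "snd (h (Suc m)) $ k - snd (h m) $ k = (\<Sum>i=0..k. fst (h m) ^ i / fact i * snd ?y $ (k - i))"
      by (simp add: fps_mult_nth)
    also have "\<dots> = (\<Sum>i<k. fst (h m) ^ i / fact i * snd ?y $ (k - i)) + fst (h m) ^ k / fact k * snd ?y $ 0"
      by (simp add: atLeast0AtMost lessThan_Suc_atMost[symmetric])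
    also have "snd ?y $ 0 = snd (h (Suc m)) $ 0 - snd (h m) $ 0" by (simp add: snd_gmul snd_ginv)
    finally have "(snd (h (Suc m)) $ k - snd (h m) $ k) - main h m = (\<Sum>i<k. fst (h m) ^ i / fact i * snd ?y $ (k - i))"
      by (simp add: main_def)
    also have "\<bar>\<dots>\<bar> \<le> (\<Sum>i<k. \<bar>fst (h m) ^ i / fact i * snd ?y $ (k - i)\<bar>)" by (rule sum_abs)
    also have "\<dots> \<le> (\<Sum>i<k. R ^ n * (real n * ?d\<^sup>2))"
    proof (rule sum_mono)
      fix i assume i: "i \<in> {..<k}"
      have "\<bar>fst (h m) ^ i / fact i\<bar> \<le> \<bar>fst (h m)\<bar> ^ i" by (rule abs_power_div_fact_le)
      also have "\<dots> \<le> R ^ i" using hR by (intro power_mono) auto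
      also have "\<dots> \<le> R ^ n" using R i k by (intro power_increasing) auto
      finally have 1: "\<bar>fst (h m) ^ i / fact i\<bar> \<le> R ^ n" .
      have "\<bar>snd ?y $ (k - i)\<bar> \<le> real (Suc (k - i)) * ?d ^ Suc (k - i)"
        unfolding gdist_def by (rule gnorm_ge_nth) (use k in simp)
      also have "\<dots> \<le> real n * ?d\<^sup>2"
        using k i hd by (intro mult_mono power_decreasing) auto
      finally show "\<bar>fst (h m) ^ i / fact i * snd ?y $ (k - i)\<bar> \<le> R ^ n * (real n * ?d\<^sup>2)"
        unfolding abs_mult using 1 by (intro mult_mono) (use R in auto)
    qed
    also have "\<dots> = real k * (R ^ n * (real n * ?d\<^sup>2))" by simp
    also have "\<dots> \<le> real n * (R ^ n * (real n * ?d\<^sup>2))"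
      using k R by (intro mult_right_mono) auto
    finally show ?thesis by (simp only: mult_ac)
  qed
  have mains: "\<bar>main g m - main g' m\<bar> \<le> \<tau> * \<delta> * ((1 + real k * R) * R ^ k)" if m: "m < N" for m
  proof -
    define v where "v = snd (g (Suc m)) $ 0 - snd (g m) $ 0"
    define v' where "v' = snd (g' (Suc m)) $ 0 - snd (g' m) $ 0"
    have "main g m - main g' m = (fst (g m) ^ k / fact k) * (v - v') + ((fst (g m) ^ k - fst (g' m) ^ k) / fact k) * v'"
      by (simp add: main_def v_def v'_def algebra_simps diff_divide_distrib)
    also have "\<bar>\<dots>\<bar> \<le> \<bar>fst (g m) ^ k / fact k\<bar> * \<bar>v - v'\<bar> + \<bar>(fst (g m) ^ k - fst (g' m) ^ k) / fact k\<bar> * \<bar>v'\<bar>"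
      by (rule order_trans[OF abs_triangle_ineq]) (simp add: abs_mult)
    also have "\<dots> \<le> R ^ k * (\<delta> * \<tau>) + (real k * R ^ k * \<delta>) * (R * \<tau>)"
    proof (intro add_mono mult_mono)
      show "\<bar>fst (g m) ^ k / fact k\<bar> \<le> R ^ k"
        using abs_power_div_fact_le[of "fst (g m)" k k] power_mono[OF A(1)[OF m], of k] by simp
      have "\<bar>(fst (g m) ^ k - fst (g' m) ^ k) / fact k\<bar> \<le> \<bar>fst (g m) ^ k - fst (g' m) ^ k\<bar>"
        using abs_power_div_fact_le[of "fst (g m) ^ k - fst (g' m) ^ k" 1 k] by simp
      also have "\<dots> \<le> real k * R ^ k * \<bar>fst (g m) - fst (g' m)\<bar>"
        using A(1,2)[OF m] R(1) by (rule abs_power_diff_le)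
      also have "\<dots> \<le> real k * R ^ k * \<delta>" using A(3)[OF m] R by (intro mult_left_mono) auto
      finally show "\<bar>(fst (g m) ^ k - fst (g' m) ^ k) / fact k\<bar> \<le> real k * R ^ k * \<delta>" .
    qed (use V[OF m] R in \<open>auto simp: v_def v'_def\<close>)
    also have "\<dots> = \<tau> * \<delta> * ((1 + real k * R) * R ^ k)" by (simp add: algebra_simps)
    finally show ?thesis .
  qed
  have tele: "snd (h N) $ k - snd (h 0) $ k = (\<Sum>m<N. snd (h (Suc m)) $ k - snd (h m) $ k)" for h :: "nat \<Rightarrow> model"
    by (rule sum_lessThan_telescope[symmetric])
  let ?K = "real n * real n * R ^ n"
  have "snd (g N) $ k - snd (g' N) $ k = (\<Sum>m<N. (snd (g (Suc m)) $ k - snd (g m) $ k) - (snd (g' (Suc m)) $ k - snd (g' m) $ k))"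
    using tele[of g] tele[of g'] start by (simp add: sum_subtractf)
  also have "\<bar>\<dots>\<bar> \<le> (\<Sum>m<N. \<bar>(snd (g (Suc m)) $ k - snd (g m) $ k) - (snd (g' (Suc m)) $ k - snd (g' m) $ k)\<bar>)"
    by (rule sum_abs)
  also have "\<dots> \<le> (\<Sum>m<N. \<tau> * \<delta> * ((1 + real k * R) * R ^ k)
      + ?K * ((gdist n (g m) (g (Suc m)))\<^sup>2 + (gdist n (g' m) (g' (Suc m)))\<^sup>2))"
  proof (rule sum_mono)
    fix m assume "m \<in> {..<N}"
    then have m: "m < N" by simp
    show "\<bar>(snd (g (Suc m)) $ k - snd (g m) $ k) - (snd (g' (Suc m)) $ k - snd (g' m) $ k)\<bar>
      \<le> \<tau> * \<delta> * ((1 + real k * R) * R ^ k)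
      + ?K * ((gdist n (g m) (g (Suc m)))\<^sup>2 + (gdist n (g' m) (g' (Suc m)))\<^sup>2)"
      using step[of g m, OF A(1)[OF m] d(1)[OF m]] step[of g' m, OF A(2)[OF m] d(2)[OF m]] mains[OF m]
      unfolding distrib_left[of ?K] by linarith
  qed
  also have "\<dots> = real N * \<tau> * \<delta> * ((1 + real k * R) * R ^ k)
     + ?K * ((\<Sum>m<N. (gdist n (g m) (g (Suc m)))\<^sup>2) + (\<Sum>m<N. (gdist n (g' m) (g' (Suc m)))\<^sup>2))"
    by (simp add: sum.distrib flip: sum_distrib_left)
  finally show ?thesis .
qed

section \<open>Limits of blow-ups\<close>

context qs_map
begin

lemma increments_close:
  fixes u :: "nat \<Rightarrow> real"
  assumes "\<And>m. m < N \<Longrightarrow> \<bar>u (Suc m) - u m - c\<bar> \<le> e" "m \<le> N"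
  shows "\<bar>u m - u 0 - real m * c\<bar> \<le> real m * e"
  using assms(2)
proof (induction m)
  case (Suc m)
  have "u (Suc m) - u 0 - real (Suc m) * c = (u m - u 0 - real m * c) + (u (Suc m) - u m - c)"
    by (simp add: algebra_simps)
  moreover have "\<bar>u (Suc m) - u m - c\<bar> \<le> e" using Suc.prems by (intro assms(1)) simp
  moreover have "\<bar>u m - u 0 - real m * c\<bar> \<le> real m * e" using Suc by simp
  ultimately have "\<bar>u (Suc m) - u 0 - real (Suc m) * c\<bar> \<le> real m * e + e"
    using abs_triangle_ineq[of "u m - u 0 - real m * c" "u (Suc m) - u m - c"] by linarith
  then show ?case by (simp add: algebra_simps)
qed simp

text \<open>\<open>curve_close\<close> compares the image of the j-th line with
  \<open>hexp (b j) (b' j)\<close> over \<open>N\<close> = t 2^(3q) steps of length 2^(-3q). The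
  deviation of the horizontal coordinates and both sums of squared steps are O(2^(-q)) when t and
  the bounds \<open>B\<close>, \<open>B'\<close> on the slopes are fixed.\<close>

lemma blowup_horizontal:
  assumes bl: "is_blowup \<Lambda> q G b b'" and q: "j \<le> q" "t + 1 \<le> q" "\<Lambda> \<le> 2 ^ q" "B + B' \<le> 2 ^ q"
    and B: "\<bar>b j\<bar> \<le> B" "\<bar>b' j\<bar> \<le> B'" and k: "k < n"
  defines "R \<equiv> 1 + (B + 1) * (real t + 1) + B'"
  shows "\<bar>fst (G (wpt n j (real t))) - fst (G (wpt n j 0)) - real t * b j\<bar> \<le> real t / 2 ^ q"
    "\<bar>snd (G (wpt n j (real t))) $ 0 - snd (G (wpt n j 0)) $ 0 - real t * b' j\<bar> \<le> real t / 2 ^ q"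
    "\<bar>snd (ginv (G (wpt n j 0)) \<odot> G (wpt n j (real t))) $ k - snd (hexp (b j) (b' j) (real t)) $ k\<bar>
      \<le> (real t * (real t + 1) * ((1 + real k * R) * R ^ k) + real n * real n * R ^ n * (\<Lambda> + real t * (B\<^sup>2 + B'\<^sup>2))) / 2 ^ q"
proof -
  define \<tau> :: real where "\<tau> = 1 / 2 ^ (3 * q)"
  define N :: nat where "N = t * 2 ^ (3 * q)"
  define p where "p m = G (wpt n j (real m / 2 ^ (3 * q)))" for m
  have \<tau>: "\<tau> > 0" "\<tau> \<le> 1 / 2 ^ q"
    unfolding \<tau>_def by (auto intro!: divide_left_mono power_increasing)
  have N\<tau>: "real N * \<tau> = real t" by (simp add: N_def \<tau>_def)
  have Nle: "N \<le> 2 ^ (q - 1) * 2 ^ (3 * q)"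
  proof -
    have "t \<le> q - 1" using q(2) by simp
    also have "\<dots> \<le> 2 ^ (q - 1)" using less_exp[of "q - 1"] by (rule less_imp_le)
    finally show ?thesis unfolding N_def by (rule mult_le_mono1)
  qed
  have pN: "p N = G (wpt n j (real t))" and p0: "p 0 = G (wpt n j 0)"
    by (simp_all add: p_def N_def)
  have du: "\<bar>fst (p (Suc m)) - fst (p m) - b j * \<tau>\<bar> \<le> 1 / 2 ^ q * \<tau>"
    and dv: "\<bar>snd (p (Suc m)) $ 0 - snd (p m) $ 0 - b' j * \<tau>\<bar> \<le> 1 / 2 ^ q * \<tau>" if "m < N" for m
    using bl q(1) less_le_trans[OF that Nle] unfolding is_blowup_def p_def \<tau>_def by auto
  have sumd: "(\<Sum>m<N. (gdist n (p m) (p (Suc m)))\<^sup>2) \<le> \<Lambda> / 2 ^ q"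
  proof -
    have "(\<Sum>m<N. (gdist n (p m) (p (Suc m)))\<^sup>2) \<le> (\<Sum>m<2 ^ (q - 1) * 2 ^ (3 * q). (gdist n (p m) (p (Suc m)))\<^sup>2)"
      by (rule sum_mono2) (use Nle in auto)
    then show ?thesis using bl q(1) unfolding is_blowup_def p_def by fastforce
  qed
  have u: "\<bar>fst (p m) - fst (p 0) - real m * (b j * \<tau>)\<bar> \<le> real m * (1 / 2 ^ q * \<tau>)" if "m \<le> N" for m
    by (rule increments_close[of N "\<lambda>m. fst (p m)", OF du that])
  have v: "\<bar>snd (p m) $ 0 - snd (p 0) $ 0 - real m * (b' j * \<tau>)\<bar> \<le> real m * (1 / 2 ^ q * \<tau>)" if "m \<le> N" for m
    by (rule increments_close[of N "\<lambda>m. snd (p m) $ 0", OF dv that])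
  have e: "real N * (c * \<tau>) = real t * c" for c using N\<tau> by (simp add: mult.assoc[symmetric] mult.commute)
  show "\<bar>fst (G (wpt n j (real t))) - fst (G (wpt n j 0)) - real t * b j\<bar> \<le> real t / 2 ^ q"
    using u[of N] unfolding e pN p0 by simp
  show "\<bar>snd (G (wpt n j (real t))) $ 0 - snd (G (wpt n j 0)) $ 0 - real t * b' j\<bar> \<le> real t / 2 ^ q"
    using v[of N] unfolding e pN p0 by simp
  define g where "g m = ginv (p 0) \<odot> p m" for m
  define g' where "g' m = hexp (b j) (b' j) (real m * \<tau>)" for m
  \<comment> \<open>Covers both the accumulated deviation t / 2^q of the first coordinate and the
    deviation 1 / 2^q of the slopes.\<close>
  define \<delta> where "\<delta> = (real t + 1) / 2 ^ q"
  have B0: "B \<ge> 0" "B' \<ge> 0" using B by auto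
  have R1: "R \<ge> 1" unfolding R_def using B0 by simp
  have mt: "real m * \<tau> \<le> real t" if "m < N" for m
    using that \<tau>(1) N\<tau> by (metis less_imp_le mult_right_mono of_nat_le_iff)
  have fg: "fst (g m) = fst (p m) - fst (p 0)" and sg: "snd (g (Suc m)) $ 0 - snd (g m) $ 0 = snd (p (Suc m)) $ 0 - snd (p m) $ 0" for m
    by (simp_all add: g_def snd_gmul snd_ginv)
  have fg': "fst (g' m) = real m * \<tau> * b j" and sg': "snd (g' (Suc m)) $ 0 - snd (g' m) $ 0 = b' j * \<tau>" for m
    by (simp_all add: g'_def snd_hexp_nth algebra_simps)
  have dg: "gdist n (g m) (g (Suc m)) = gdist n (p m) (p (Suc m))" for m by (simp add: g_def)
  have dg': "gdist n (g' m) (g' (Suc m)) = sqrt ((b j)\<^sup>2 + (b' j)\<^sup>2) * \<tau>" for m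
    using \<tau>(1) by (simp add: g'_def gdist_def ginv_hexp hexp_add gnorm_hexp algebra_simps)
  have bb: "(b j)\<^sup>2 + (b' j)\<^sup>2 \<le> B\<^sup>2 + B'\<^sup>2"
    using B B0 by (intro add_mono) (auto simp: abs_le_square_iff[symmetric])
  have fg'R: "\<bar>fst (g' m)\<bar> \<le> real t * B" if "m < N" for m
    unfolding fg' abs_mult using mt[OF that] \<tau>(1) B by (intro mult_mono) auto
  have close: "\<bar>fst (g m) - fst (g' m)\<bar> \<le> real t / 2 ^ q" if m: "m < N" for m
  proof -
    have "\<bar>fst (g m) - fst (g' m)\<bar> \<le> (real m * \<tau>) * (1 / 2 ^ q)"
      using u[of m] m unfolding fg fg' by (simp add: mult_ac)
    also have "\<dots> \<le> real t * (1 / 2 ^ q)" using mt[OF m] by (intro mult_right_mono) auto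
    finally show ?thesis by simp
  qed
  have tq: "real t / 2 ^ q \<le> real t + 1"
  proof -
    have "real t / 2 ^ q \<le> real t / 1" by (intro divide_left_mono) auto
    then show ?thesis by simp
  qed
  have "\<bar>snd (g N) $ k - snd (g' N) $ k\<bar> \<le> real N * \<tau> * \<delta> * ((1 + real k * R) * R ^ k)
     + real n * real n * R ^ n * ((\<Sum>m<N. (gdist n (g m) (g (Suc m)))\<^sup>2) + (\<Sum>m<N. (gdist n (g' m) (g' (Suc m)))\<^sup>2))"
  proof (rule curve_close)
    show "1 \<le> R" by fact
    show "0 \<le> \<tau>" "0 \<le> \<delta>" using \<tau> by (auto simp: \<delta>_def)
    show "g 0 = gone" "g' 0 = gone" by (simp_all add: g_def g'_def)
    show "k < n" by fact
    fix m assume m: "m < N"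
    have RR: "real t * B + (real t + 1) \<le> R" "B' \<le> R" unfolding R_def using B0 by (auto simp: algebra_simps)
    show "\<bar>fst (g m)\<bar> \<le> R" "\<bar>fst (g' m)\<bar> \<le> R"
      using close[OF m] fg'R[OF m] RR tq by linarith+
    show "\<bar>fst (g m) - fst (g' m)\<bar> \<le> \<delta>"
      using close[OF m] by (simp add: \<delta>_def add_divide_distrib add_increasing2)
    show "\<bar>snd (g' (Suc m)) $ 0 - snd (g' m) $ 0\<bar> \<le> R * \<tau>"
      unfolding sg' abs_mult using B RR \<tau> by (intro mult_mono) auto
    have "1 / 2 ^ q * \<tau> \<le> \<delta> * \<tau>" using \<tau> by (intro mult_right_mono) (auto simp: \<delta>_def divide_right_mono)
    then show "\<bar>(snd (g (Suc m)) $ 0 - snd (g m) $ 0) - (snd (g' (Suc m)) $ 0 - snd (g' m) $ 0)\<bar> \<le> \<delta> * \<tau>"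
      unfolding sg sg' using dv[OF m] by linarith
    have "(gdist n (p m) (p (Suc m)))\<^sup>2 \<le> (\<Sum>m<N. (gdist n (p m) (p (Suc m)))\<^sup>2)"
      by (rule member_le_sum) (use m in auto)
    also have "\<dots> \<le> 1" using sumd q(3) by (auto intro: order_trans simp: divide_le_eq)
    finally show "gdist n (g m) (g (Suc m)) \<le> 1"
      unfolding dg by (simp add: power_le_one_iff abs_square_le_1)
    have "sqrt ((b j)\<^sup>2 + (b' j)\<^sup>2) \<le> B + B'"
      using sqrt_sum_squares_le_sum_abs[of "b j" "b' j"] B by linarith
    then have "sqrt ((b j)\<^sup>2 + (b' j)\<^sup>2) * \<tau> \<le> 2 ^ q * (1 / 2 ^ q)"
      using \<tau> q(4) by (intro mult_mono) auto
    then show "gdist n (g' m) (g' (Suc m)) \<le> 1" unfolding dg' by simp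
  qed
  also have "\<dots> \<le> real t * \<delta> * ((1 + real k * R) * R ^ k)
     + real n * real n * R ^ n * (\<Lambda> / 2 ^ q + real t * (B\<^sup>2 + B'\<^sup>2) / 2 ^ q)"
  proof (intro add_mono mult_left_mono)
    show "real N * \<tau> * \<delta> * ((1 + real k * R) * R ^ k) \<le> real t * \<delta> * ((1 + real k * R) * R ^ k)"
      unfolding N\<tau> ..
    show "(\<Sum>m<N. (gdist n (g m) (g (Suc m)))\<^sup>2) \<le> \<Lambda> / 2 ^ q" unfolding dg by (rule sumd)
    have "(\<Sum>m<N. (gdist n (g' m) (g' (Suc m)))\<^sup>2) = (real N * \<tau>) * (((b j)\<^sup>2 + (b' j)\<^sup>2) * \<tau>)"
      unfolding dg' by (simp add: power_mult_distrib power2_eq_square[of \<tau>])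
    also have "\<dots> \<le> real t * ((B\<^sup>2 + B'\<^sup>2) * (1 / 2 ^ q))"
      unfolding N\<tau> using bb \<tau> by (intro mult_left_mono mult_mono) auto
    finally show "(\<Sum>m<N. (gdist n (g' m) (g' (Suc m)))\<^sup>2) \<le> real t * (B\<^sup>2 + B'\<^sup>2) / 2 ^ q" by simp
  qed (use R1 in auto)
  also have "\<dots> = (real t * (real t + 1) * ((1 + real k * R) * R ^ k) + real n * real n * R ^ n * (\<Lambda> + real t * (B\<^sup>2 + B'\<^sup>2))) / 2 ^ q"
  proof -
    have "x * (y / z) * w + u * (l / z + v / z) = (x * y * w + u * (l + v)) / z" for x y z w u l v :: real
      by (simp add: add_divide_distrib distrib_left)
    then show ?thesis unfolding \<delta>_def .
  qed
  finally show "\<bar>snd (ginv (G (wpt n j 0)) \<odot> G (wpt n j (real t))) $ k - snd (hexp (b j) (b' j) (real t)) $ k\<bar>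
      \<le> (real t * (real t + 1) * ((1 + real k * R) * R ^ k) + real n * real n * R ^ n * (\<Lambda> + real t * (B\<^sup>2 + B'\<^sup>2))) / 2 ^ q"
    unfolding g_def g'_def pN p0 N\<tau> .
qed

text \<open>Quasisymmetry and the bound on \<open>G (e2 1)\<close> bound the blow-ups at each point,
  so a diagonal subsequence converges at all \<open>wpt n j t\<close> with natural j and t. On every
  line the limit follows a one-parameter group, and for j = 0 its slope in the first coordinate has
  modulus 1, contrary to \<open>no_horizontal_blowup\<close>.\<close>

lemma nonconst_False:
  assumes c0: "c0 > 0"
    and nonconst: "\<And>M f. s0 \<le> M \<Longrightarrow> f \<in> line_box n M s0 1 \<Longrightarrow> c0 \<le> \<bar>line_u M f 1 - line_u M f 0\<bar>"
  shows False
proof -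
  obtain \<Lambda> where \<Lambda>: "\<Lambda> > 0" "\<And>q. q \<ge> 1 \<Longrightarrow> \<exists>G b b'. is_blowup \<Lambda> q G b b'"
    by (rule blowups[OF c0, of s0]) (use nonconst in blast, rule that, assumption+)
  have "\<forall>q. \<exists>H. is_blowup \<Lambda> (Suc q) (fst H) (fst (snd H)) (snd (snd H))"
    using \<Lambda>(2)[of "Suc _"] by simp
  then obtain H where H: "\<And>q. is_blowup \<Lambda> (Suc q) (fst (H q)) (fst (snd (H q))) (snd (snd (H q)))"
    by metis
  define G where "G q = fst (H q)" for q
  define bs where "bs q = fst (snd (H q))" for q
  define bs' where "bs' q = snd (snd (H q))" for q
  have bl: "is_blowup \<Lambda> (Suc q) (G q) (bs q) (bs' q)" for q
    using H[of q] by (simp add: G_def bs_def bs'_def)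
  have Gqs: "gdist n (G q x) (G q y) \<le> \<eta> (gdist n x y / gdist n x z) * gdist n (G q x) (G q z)"
    if "gdist n x z > 0" for q x y z
    using bl[of q] that unfolding is_blowup_def by blast
  have G1: "gnorm n (G q x) \<le> \<eta> (gnorm n x) * \<Lambda>" for q x
  proof -
    have g: "G q gone = gone" "gnorm n (G q (e2 1)) \<le> \<Lambda>" using bl[of q] unfolding is_blowup_def by auto
    have "gdist n (G q gone) (G q x) \<le> \<eta> (gdist n gone x / gdist n gone (e2 1)) * gdist n (G q gone) (G q (e2 1))"
      by (rule Gqs) simp
    then have "gnorm n (G q x) \<le> \<eta> (gnorm n x) * gnorm n (G q (e2 1))" by (simp add: g)
    also have "\<dots> \<le> \<eta> (gnorm n x) * \<Lambda>" using g(2) eta_nonneg by (intro mult_left_mono) auto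
    finally show ?thesis .
  qed
  \<comment> \<open>Slot 0 holds the first coordinate and slot k >= 1 the coefficient of z^(k-1), so
    the index set is countable.\<close>
  define x where "x q i = (case i of (j, t, k) \<Rightarrow> if k = 0 then fst (G q (wpt n j (real t)))
      else if k \<le> n then snd (G q (wpt n j (real t))) $ (k - 1) else 0)" for q :: nat and i :: "nat \<times> nat \<times> nat"
  have "\<exists>B. \<forall>q. \<bar>x q i\<bar> \<le> B" for i
  proof -
    obtain j t k where i: "i = (j, t, k)" by (cases i) auto
    let ?B = "\<eta> (gnorm n (wpt n j (real t))) * \<Lambda>"
    have B: "gnorm n (G q (wpt n j (real t))) \<le> ?B" for q by (rule G1)
    then have B0: "?B \<ge> 0" using gnorm_nonneg order_trans by blast
    have "\<bar>x q i\<bar> \<le> ?B + real k * ?B ^ k" for q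
    proof -
      consider "k = 0" | "1 \<le> k" "k \<le> n" | "k > n" by linarith
      then show ?thesis
      proof cases
        case 1
        then show ?thesis using gnorm_ge_fst[of "G q (wpt n j (real t))" n] B[of q] by (simp add: x_def i)
      next
        case 2
        then have "\<bar>snd (G q (wpt n j (real t))) $ (k - 1)\<bar> \<le> real k * gnorm n (G q (wpt n j (real t))) ^ k"
          using gnorm_ge_nth[of "k - 1" n "G q (wpt n j (real t))"] by simp
        also have "\<dots> \<le> real k * ?B ^ k" using B[of q] by (intro mult_left_mono power_mono) auto
        finally show ?thesis using 2 B0 by (simp add: x_def i)
      next
        case 3
        then show ?thesis using B0 by (simp add: x_def i)
      qed
    qed
    then show ?thesis by blast
  qed
  then obtain s where s: "strict_mono s" "\<And>i. convergent (\<lambda>q. x (s q) i)"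
    using diagonal_convergence[of x] by blast
  define \<Phi> where "\<Phi> j t = (lim (\<lambda>q. x (s q) (j, t, 0)), Abs_fps (\<lambda>k. if k < n then lim (\<lambda>q. x (s q) (j, t, Suc k)) else 0))" for j t
  have conv: "mtends n (\<lambda>q. G (s q) (wpt n j (real t))) (\<Phi> j t)" for j t
    unfolding mtends_def
  proof (intro conjI allI impI)
    show "(\<lambda>q. fst (G (s q) (wpt n j (real t)))) \<longlonglongrightarrow> fst (\<Phi> j t)"
      using s(2)[of "(j, t, 0)"] by (simp add: convergent_LIMSEQ_iff \<Phi>_def x_def)
    show "(\<lambda>q. snd (G (s q) (wpt n j (real t))) $ k) \<longlonglongrightarrow> snd (\<Phi> j t) $ k" if "k < n" for k
      using s(2)[of "(j, t, Suc k)"] that by (simp add: convergent_LIMSEQ_iff \<Phi>_def x_def)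
  qed
  have p2: "(\<lambda>q. c / 2 ^ Suc (s q)) \<longlonglongrightarrow> 0" for c :: real
  proof -
    have "(\<lambda>q. c * (1 / 2) ^ q) \<longlonglongrightarrow> c * 0" by (intro tendsto_mult tendsto_const LIMSEQ_power_zero) simp
    then have "((\<lambda>q. c * (1 / 2) ^ q) \<circ> (\<lambda>q. Suc (s q))) \<longlonglongrightarrow> c * 0"
      by (rule LIMSEQ_subseq_LIMSEQ) (use s(1) in \<open>auto simp: strict_mono_def\<close>)
    then show ?thesis by (simp add: o_def power_one_over)
  qed
  have large: "eventually (\<lambda>q. N \<le> Suc (s q)) sequentially" for N
    using seq_suble[OF s(1)] by (intro eventually_sequentiallyI[of N]) (meson le_SucI order_trans)
  have large2: "eventually (\<lambda>q. c \<le> 2 ^ Suc (s q)) sequentially" for c :: real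
  proof -
    obtain N where "c < 2 ^ N" using real_arch_pow[of 2 c] by auto
    then have *: "c \<le> 2 ^ Suc (s q)" if "N \<le> Suc (s q)" for q
      using power_increasing[OF that, of "2::real"] by linarith
    show ?thesis by (rule eventually_mono[OF large[of N]]) (rule *)
  qed
  define b where "b j = fst (\<Phi> j 1) - fst (\<Phi> j 0)" for j
  define b' where "b' j = snd (\<Phi> j 1) $ 0 - snd (\<Phi> j 0) $ 0" for j
  have slopes: "(\<lambda>q. bs (s q) j) \<longlonglongrightarrow> b j" "(\<lambda>q. bs' (s q) j) \<longlonglongrightarrow> b' j" for j
  proof -
    have c0: "(\<lambda>q. fst (G (s q) (wpt n j 1)) - fst (G (s q) (wpt n j 0))) \<longlonglongrightarrow> b j"
      "(\<lambda>q. snd (G (s q) (wpt n j 1)) $ 0 - snd (G (s q) (wpt n j 0)) $ 0) \<longlonglongrightarrow> b' j"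
      using conv[of j 1] conv[of j 0] unfolding b_def b'_def mtends_def by (auto intro!: tendsto_diff)
    have ev: "eventually (\<lambda>q. \<bar>fst (G (s q) (wpt n j 1)) - fst (G (s q) (wpt n j 0)) - bs (s q) j\<bar> \<le> 1 / 2 ^ Suc (s q) \<and>
       \<bar>snd (G (s q) (wpt n j 1)) $ 0 - snd (G (s q) (wpt n j 0)) $ 0 - bs' (s q) j\<bar> \<le> 1 / 2 ^ Suc (s q)) sequentially"
      using large[of "j + 2"]
    proof (rule eventually_mono)
      fix q assume q: "j + 2 \<le> Suc (s q)"
      have "\<bar>fst (G (s q) (wpt n j (real m / 2 ^ (3 * Suc (s q))))) - fst (G (s q) (wpt n j (real 0 / 2 ^ (3 * Suc (s q)))))
            - real m * (bs (s q) j / 2 ^ (3 * Suc (s q)))\<bar> \<le> real m * (1 / 2 ^ Suc (s q) / 2 ^ (3 * Suc (s q)))"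
        "\<bar>snd (G (s q) (wpt n j (real m / 2 ^ (3 * Suc (s q))))) $ 0 - snd (G (s q) (wpt n j (real 0 / 2 ^ (3 * Suc (s q))))) $ 0
            - real m * (bs' (s q) j / 2 ^ (3 * Suc (s q)))\<bar> \<le> real m * (1 / 2 ^ Suc (s q) / 2 ^ (3 * Suc (s q)))"
        if m: "m \<le> 2 ^ (Suc (s q) - 1) * 2 ^ (3 * Suc (s q))" for m
        using bl[of "s q"] q unfolding is_blowup_def
        by (intro increments_close[OF _ m, of "\<lambda>m. fst (G (s q) (wpt n j (real m / 2 ^ (3 * Suc (s q)))))"]
              increments_close[OF _ m, of "\<lambda>m. snd (G (s q) (wpt n j (real m / 2 ^ (3 * Suc (s q))))) $ 0"]; simp)+
      from this[of "2 ^ (3 * Suc (s q))"]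
      show "\<bar>fst (G (s q) (wpt n j 1)) - fst (G (s q) (wpt n j 0)) - bs (s q) j\<bar> \<le> 1 / 2 ^ Suc (s q) \<and>
       \<bar>snd (G (s q) (wpt n j 1)) $ 0 - snd (G (s q) (wpt n j 0)) $ 0 - bs' (s q) j\<bar> \<le> 1 / 2 ^ Suc (s q)"
        by simp
    qed
    have "(\<lambda>q. fst (G (s q) (wpt n j 1)) - fst (G (s q) (wpt n j 0)) - bs (s q) j) \<longlonglongrightarrow> 0"
      by (rule Lim_null_comparison[OF _ p2[of 1]]) (use ev in \<open>auto elim: eventually_mono\<close>)
    from tendsto_diff[OF c0(1) this] show "(\<lambda>q. bs (s q) j) \<longlonglongrightarrow> b j" by simp
    have "(\<lambda>q. snd (G (s q) (wpt n j 1)) $ 0 - snd (G (s q) (wpt n j 0)) $ 0 - bs' (s q) j) \<longlonglongrightarrow> 0"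
      by (rule Lim_null_comparison[OF _ p2[of 1]]) (use ev in \<open>auto elim: eventually_mono\<close>)
    from tendsto_diff[OF c0(2) this] show "(\<lambda>q. bs' (s q) j) \<longlonglongrightarrow> b' j" by simp
  qed
  have b0: "b 0 \<noteq> 0"
  proof -
    have "(\<lambda>q. \<bar>bs (s q) 0\<bar>) \<longlonglongrightarrow> \<bar>b 0\<bar>" by (intro tendsto_rabs slopes)
    moreover have "\<bar>bs (s q) 0\<bar> = 1" for q using bl[of "s q"] unfolding is_blowup_def by blast
    ultimately have "\<bar>b 0\<bar> = 1" by (simp add: LIMSEQ_const_iff)
    then show ?thesis by auto
  qed
  have hor: "gdist n (\<Phi> j t) (\<Phi> j 0 \<odot> hexp (b j) (b' j) (real t)) = 0" for j t
  proof -
    let ?L = "ginv (\<Phi> j 0) \<odot> \<Phi> j t"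
    let ?X = "\<lambda>q. ginv (G (s q) (wpt n j 0)) \<odot> G (s q) (wpt n j (real t))"
    have XL: "mtends n ?X ?L" using conv[of j 0] conv[of j t] by (intro mtends_gmul mtends_ginv) auto
    obtain B where B: "\<And>q. \<bar>bs (s q) j\<bar> \<le> B"
      using convergent_imp_Bseq[of "\<lambda>q. bs (s q) j"] slopes(1)[of j] unfolding convergent_def Bseq_def by auto
    obtain B' where B': "\<And>q. \<bar>bs' (s q) j\<bar> \<le> B'"
      using convergent_imp_Bseq[of "\<lambda>q. bs' (s q) j"] slopes(2)[of j] unfolding convergent_def Bseq_def by auto
    define R where "R = 1 + (B + 1) * (real t + 1) + B'"
    have ev: "eventually (\<lambda>q. max j (t + 1) \<le> Suc (s q) \<and> max \<Lambda> (B + B') \<le> 2 ^ Suc (s q)) sequentially"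
      by (intro eventually_conj large large2)
    have fstL: "fst ?L = fst (hexp (b j) (b' j) (real t))"
    proof -
      have "(\<lambda>q. fst (G (s q) (wpt n j (real t))) - fst (G (s q) (wpt n j 0)) - real t * bs (s q) j) \<longlonglongrightarrow> 0"
      proof (rule Lim_null_comparison[OF _ p2[of "real t"]], rule eventually_mono[OF ev])
        fix q assume q: "max j (t + 1) \<le> Suc (s q) \<and> max \<Lambda> (B + B') \<le> 2 ^ Suc (s q)"
        show "norm (fst (G (s q) (wpt n j (real t))) - fst (G (s q) (wpt n j 0)) - real t * bs (s q) j) \<le> real t / 2 ^ Suc (s q)"
          using blowup_horizontal(1)[OF bl[of "s q"], of j t B B' 0] q B B' by simp
      qed
      moreover have "(\<lambda>q. fst (G (s q) (wpt n j (real t))) - fst (G (s q) (wpt n j 0)) - real t * bs (s q) j)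
          \<longlonglongrightarrow> fst (\<Phi> j t) - fst (\<Phi> j 0) - real t * b j"
        using conv[of j t] conv[of j 0] slopes(1)[of j] unfolding mtends_def
        by (intro tendsto_diff tendsto_mult tendsto_const) auto
      ultimately have "fst (\<Phi> j t) - fst (\<Phi> j 0) - real t * b j = 0" by (rule LIMSEQ_unique[rotated])
      then show ?thesis by (simp add: mult.commute)
    qed
    have sndL: "snd ?L $ k = snd (hexp (b j) (b' j) (real t)) $ k" if k: "k < n" for k
    proof -
      let ?C = "real t * (real t + 1) * ((1 + real k * R) * R ^ k) + real n * real n * R ^ n * (\<Lambda> + real t * (B\<^sup>2 + B'\<^sup>2))"
      have "(\<lambda>q. snd (?X q) $ k - snd (hexp (bs (s q) j) (bs' (s q) j) (real t)) $ k) \<longlonglongrightarrow> 0"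
      proof (rule Lim_null_comparison[OF _ p2[of ?C]], rule eventually_mono[OF ev])
        fix q assume q: "max j (t + 1) \<le> Suc (s q) \<and> max \<Lambda> (B + B') \<le> 2 ^ Suc (s q)"
        show "norm (snd (?X q) $ k - snd (hexp (bs (s q) j) (bs' (s q) j) (real t)) $ k) \<le> ?C / 2 ^ Suc (s q)"
          unfolding R_def real_norm_def
          by (rule blowup_horizontal(3)[OF bl[of "s q"]]) (use q B B' k in auto)
      qed
      moreover have "(\<lambda>q. snd (?X q) $ k - snd (hexp (bs (s q) j) (bs' (s q) j) (real t)) $ k)
          \<longlonglongrightarrow> snd ?L $ k - snd (hexp (b j) (b' j) (real t)) $ k"
        unfolding snd_hexp_nth
        by (intro tendsto_diff tendsto_divide tendsto_mult tendsto_power tendsto_const slopes)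
          (use XL k in \<open>auto simp: mtends_def\<close>)
      ultimately have "snd ?L $ k - snd (hexp (b j) (b' j) (real t)) $ k = 0" by (rule LIMSEQ_unique[rotated])
      then show ?thesis by simp
    qed
    have "gdist n ?L (hexp (b j) (b' j) (real t)) = 0"
      unfolding gdist_0_iff[OF n1] using fstL sndL by blast
    then have "gdist n (\<Phi> j 0 \<odot> ?L) (\<Phi> j 0 \<odot> hexp (b j) (b' j) (real t)) = 0" by (simp only: gdist_left)
    then show ?thesis unfolding gmul_ginv_cancel .
  qed
  show False
  proof (rule no_horizontal_blowup[where \<Phi> = \<Phi> and b = b and b' = b', OF _ hor b0])
    fix i j k s' t r :: nat
    assume d: "gdist n (wpt n i (real s')) (wpt n k (real r)) > 0"
    have l: "(\<lambda>q. gdist n (G (s q) (wpt n i' (real t'))) (G (s q) (wpt n j' (real r')))) \<longlonglongrightarrow> gdist n (\<Phi> i' t') (\<Phi> j' r')"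
      for i' j' t' r' by (intro gdist_tendsto conv n1)
    show "gdist n (\<Phi> i s') (\<Phi> j t) \<le> \<eta> (gdist n (wpt n i (real s')) (wpt n j (real t)) / gdist n (wpt n i (real s')) (wpt n k (real r)))
        * gdist n (\<Phi> i s') (\<Phi> k r)"
      by (rule LIMSEQ_le[OF l tendsto_mult[OF tendsto_const l]]) (use Gqs[OF d] in blast)
  qed
qed

end

section \<open>Constancy of the other coordinates along lines\<close>

lemma line_base_small:
  assumes n: "n \<ge> 1" and d: "d > 0"
  obtains s where "\<And>M f. s \<le> M \<Longrightarrow> f \<in> line_box n M s 1 \<Longrightarrow>
    gnorm n (line_base n M f) \<le> d \<and> gdist n (e2 1) (line_base n M f \<odot> e2 1) \<le> d"
proof -
  have gc: "gcon n > 0" using gcon_ge_2[of n] by simp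
  obtain p where p: "(1/2::real) ^ p < d / (2 * gcon n)"
    using real_arch_pow_inv[of "d / (2 * gcon n)" "1/2"] d gc by auto
  define r where "r = 2 * (1/2::real) ^ p"
  have r: "r > 0" "gcon n * r \<le> d" using p gc by (auto simp: r_def field_simps)
  \<comment> \<open>The level is 2p and not p: on the line the first coordinate b contributes b^k /
    k! to slot k, to be bounded by a (k+1)-st power, and 2pk >= p(k+1) for k >= 1. The factor 2 in
    \<open>r\<close> leaves room for the sum of two terms.\<close>
  have small: "gnorm n (line_base n M f) \<le> d \<and> gdist n (e2 1) (line_base n M f \<odot> e2 1) \<le> d"
    if M: "2 * p \<le> M" and f: "f \<in> line_box n M (2 * p) 1" for M f
  proof -
    define b where "b i = real_of_int (f i) / 2 ^ (M * Suc i)" for i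
    have b: "\<bar>b i\<bar> \<le> (1/2) ^ (2 * p * Suc i)" if "i < n" for i
    proof -
      have "\<bar>b i\<bar> \<le> 2 ^ ((M - 2 * p) * Suc i) / 2 ^ (M * Suc i)"
        using f that unfolding b_def line_box_def abs_divide by (intro divide_mono) auto
      also have "(2::real) ^ (M * Suc i) = 2 ^ ((M - 2 * p) * Suc i) * 2 ^ (2 * p * Suc i)"
        using M by (simp only: power_add[symmetric] add_mult_distrib[symmetric]) simp
      finally show ?thesis by (simp add: power_one_over del: mult_Suc_right)
    qed
    have pw: "(1/2::real) ^ (2 * p * Suc i) \<le> r ^ Suc i" for i
    proof -
      have "(1/2::real) ^ (2 * p * Suc i) \<le> (1/2) ^ (p * Suc i)"
        by (rule power_decreasing) auto
      also have "\<dots> = ((1/2) ^ p) ^ Suc i" by (simp only: power_mult)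
      also have "\<dots> \<le> r ^ Suc i" unfolding r_def by (intro power_mono) auto
      finally show ?thesis .
    qed
    have a: "fst (line_base n M f) = b 0" by (simp add: line_base_def b_def)
    have a1: "\<bar>b 0\<bar> \<le> (1/2) ^ (2 * p)" using b[of 0] n by simp
    have s: "\<bar>snd (line_base n M f) $ i\<bar> \<le> (1/2) ^ (2 * p * Suc i)" if "i < n" for i
      using b[OF that] that by (simp add: line_base_def b_def del: mult_Suc_right power_Suc)
    have 1: "gnorm n (line_base n M f) \<le> gcon n * r"
    proof (rule gnorm_le)
      show "\<bar>fst (line_base n M f)\<bar> \<le> r" unfolding a using b[of 0] pw[of 0] n by simp
      show "\<bar>snd (line_base n M f) $ k\<bar> \<le> r ^ Suc k" if "k < n" for k
        using s[OF that] pw[of k] by linarith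
    qed (use r n in auto)
    have "gnorm n (ginv (e2 1) \<odot> (line_base n M f \<odot> e2 1)) \<le> gcon n * r"
    proof (rule gnorm_le)
      show "\<bar>fst (ginv (e2 1) \<odot> (line_base n M f \<odot> e2 1))\<bar> \<le> r"
        using b[of 0] pw[of 0] n by (simp add: a)
      fix k assume k: "k < n"
      have "snd (ginv (e2 1) \<odot> (line_base n M f \<odot> e2 1)) $ k
          = snd (line_base n M f) $ k + (if k = 0 then 0 else b 0 ^ k / fact k)"
        by (cases k) (simp_all add: snd_gmul snd_ginv a del: fact_Suc)
      also have "\<bar>\<dots>\<bar> \<le> r ^ Suc k"
      proof (cases k)
        case 0
        then show ?thesis using s[of 0] pw[of 0] k by simp
      next
        case (Suc k')
        have "\<bar>b 0 ^ k / fact k\<bar> \<le> \<bar>b 0\<bar> ^ k" by (rule abs_power_div_fact_le)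
        also have "\<dots> \<le> ((1/2) ^ (2 * p)) ^ k" using a1 by (intro power_mono) auto
        also have "\<dots> = (1/2) ^ (2 * p * k)" by (simp only: power_mult)
        also have "\<dots> \<le> (1/2) ^ (p * Suc k)" using Suc by (intro power_decreasing) auto
        finally have "\<bar>b 0 ^ k / fact k\<bar> \<le> ((1/2) ^ p) ^ Suc k" by (simp only: power_mult)
        moreover have "\<bar>snd (line_base n M f) $ k\<bar> \<le> ((1/2) ^ p) ^ Suc k"
          using s[OF k] power_decreasing[of "p * Suc k" "2 * p * Suc k" "1/2::real"] by (simp only: power_mult) simp
        moreover have "2 * ((1/2::real) ^ p) ^ Suc k \<le> r ^ Suc k"
        proof -
          have "2 ^ 1 * ((1/2::real) ^ p) ^ Suc k \<le> 2 ^ Suc k * ((1/2) ^ p) ^ Suc k"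
            by (intro mult_right_mono power_increasing) auto
          then show ?thesis unfolding r_def power_mult_distrib by simp
        qed
        ultimately have "\<bar>snd (line_base n M f) $ k + b 0 ^ k / fact k\<bar> \<le> r ^ Suc k" by linarith
        moreover have "k \<noteq> 0" using Suc by simp
        ultimately show ?thesis by (simp only: if_False)
      qed
      finally show "\<bar>snd (ginv (e2 1) \<odot> (line_base n M f \<odot> e2 1)) $ k\<bar> \<le> r ^ Suc k" .
    qed (use r n in auto)
    then show ?thesis using 1 r(2) unfolding gdist_def by linarith
  qed
  then show ?thesis by (rule that)
qed

context qs_map
begin

text \<open>Reduces statements about arbitrary segments of lines to the unit segment at the
  identity.\<close>

lemma qs_map_comp:
  assumes c: "c > 0"
  shows "qs_map n \<eta> (\<lambda>x. h \<odot> F (g \<odot> dil c x))"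
proof
  show "n \<ge> 3" by (rule n3)
  show "0 \<le> t \<Longrightarrow> 0 \<le> \<eta> t" "0 \<le> s \<Longrightarrow> s \<le> t \<Longrightarrow> \<eta> s \<le> \<eta> t" "0 < e \<Longrightarrow> \<exists>d>0. \<eta> d < e" for s t e
    using eta_nonneg eta_mono eta_lim by auto
  have d: "gdist n (g \<odot> dil c x) (g \<odot> dil c y) = c * gdist n x y" for x y
    using c by (simp add: gdist_dil)
  show "gdist n (h \<odot> F (g \<odot> dil c x)) (h \<odot> F (g \<odot> dil c y)) \<le>
      \<eta> (gdist n x y / gdist n x z) * gdist n (h \<odot> F (g \<odot> dil c x)) (h \<odot> F (g \<odot> dil c z))"
    if "gdist n x z > 0" for x y z
    using qs[of "g \<odot> dil c x" "g \<odot> dil c z" "g \<odot> dil c y", unfolded d] that c by simp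
  show "0 < gdist n (h \<odot> F (g \<odot> dil c x)) (h \<odot> F (g \<odot> dil c z))" if "gdist n x z > 0" for x z
    using pos[of "g \<odot> dil c x" "g \<odot> dil c z", unfolded d] that c by simp
  show "\<exists>x. gdist n (h \<odot> F (g \<odot> dil c x)) y = 0" for y
  proof -
    obtain x where x: "gdist n (F x) (ginv h \<odot> y) = 0" using onto by blast
    have "g \<odot> dil c (dil (1 / c) (ginv g \<odot> x)) = x" using c by (simp add: dil_dil)
    moreover have "gdist n (h \<odot> F x) (h \<odot> (ginv h \<odot> y)) = 0" using x by (simp only: gdist_left)
    ultimately show ?thesis unfolding gmul_ginv_cancel by metis
  qed
qed

lemma line_image_near:
  assumes e: "e > 0"
  obtains s where "\<And>M f. s \<le> M \<Longrightarrow> f \<in> line_box n M s 1 \<Longrightarrow>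
    gdist n (F gone) (F (line_base n M f)) \<le> e \<and> gdist n (F (e2 1)) (F (line_base n M f \<odot> e2 1)) \<le> e"
proof -
  let ?D = "gdist n (F gone) (F (e2 1))"
  have D: "?D > 0" by (rule pos) simp
  obtain d where d: "d > 0" "\<eta> d < e / ?D" using eta_lim[of "e / ?D"] e D by auto
  then have eD: "\<eta> d * ?D \<le> e" using D by (simp add: pos_less_divide_eq less_imp_le)
  obtain s where s: "\<And>M f. s \<le> M \<Longrightarrow> f \<in> line_box n M s 1 \<Longrightarrow>
    gnorm n (line_base n M f) \<le> d \<and> gdist n (e2 1) (line_base n M f \<odot> e2 1) \<le> d"
    using line_base_small[OF n1 d(1)] by blast
  show ?thesis
  proof (rule that[of s], intro conjI)
    fix M f assume Mf: "s \<le> M" "f \<in> line_box n M s 1"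
    have g1: "gdist n gone (e2 1) > 0" "gdist n (e2 1) gone > 0" by (simp_all add: gdist_commute)
    have "gdist n (F gone) (F (line_base n M f)) \<le> \<eta> d * ?D"
      by (rule qs_le[OF g1(1)]) (use s[OF Mf] in simp)
    then show "gdist n (F gone) (F (line_base n M f)) \<le> e" using eD by linarith
    have "gdist n (F (e2 1)) (F (line_base n M f \<odot> e2 1)) \<le> \<eta> d * gdist n (F (e2 1)) (F gone)"
      by (rule qs_le[OF g1(2)]) (use s[OF Mf] in \<open>simp add: gdist_commute[of n _ gone]\<close>)
    then show "gdist n (F (e2 1)) (F (line_base n M f \<odot> e2 1)) \<le> e" using eD by (simp add: gdist_commute)
  qed
qed

text \<open>By continuity a change along the unit segment persists on all nearby grid lines: each
  end loses at most a third of it, so a third remains, which \<open>nonconst_False\<close>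
  excludes.\<close>

lemma fst_const_unit: "fst (F (e2 1)) = fst (F gone)"
proof (rule ccontr)
  assume ne: "fst (F (e2 1)) \<noteq> fst (F gone)"
  define c0 where "c0 = \<bar>fst (F (e2 1)) - fst (F gone)\<bar> / 3"
  have c0: "c0 > 0" using ne by (simp add: c0_def)
  obtain s where s: "\<And>M f. s \<le> M \<Longrightarrow> f \<in> line_box n M s 1 \<Longrightarrow>
    gdist n (F gone) (F (line_base n M f)) \<le> c0 \<and> gdist n (F (e2 1)) (F (line_base n M f \<odot> e2 1)) \<le> c0"
    by (rule line_image_near[OF c0]) blast
  show False
  proof (rule nonconst_False[OF c0, of s])
    fix M f assume Mf: "s \<le> M" "f \<in> line_box n M s 1"
    have e: "line_base n M f \<odot> e2 0 = line_base n M f"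
      using gmul_gone(2)[of "line_base n M f"] by (simp add: gone_def)
    have tri: "\<bar>x - y\<bar> \<le> \<bar>b - x\<bar> + \<bar>b - a\<bar> + \<bar>a - y\<bar>" for x y a b :: real by linarith
    have c3: "\<bar>fst (F (e2 1)) - fst (F gone)\<bar> = 3 * c0" by (simp add: c0_def)
    show "c0 \<le> \<bar>line_u M f 1 - line_u M f 0\<bar>"
      using tri[of "fst (F (e2 1))" "fst (F gone)" "fst (F (line_base n M f \<odot> e2 1))" "fst (F (line_base n M f))"]
        s[OF Mf, THEN conjunct1] s[OF Mf, THEN conjunct2] gdist_ge_fst[of "F (line_base n M f)" "F gone" n]
        gdist_ge_fst[of "F (line_base n M f \<odot> e2 1)" "F (e2 1)" n]
      unfolding line_u_def e c3 by linarith
  qed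
qed

lemma power_le_1_power: "x \<ge> 0 \<Longrightarrow> l \<le> Suc (hdim n) \<Longrightarrow> (x::real) ^ l \<le> 1 + x ^ Suc (hdim n)"
proof (cases "x \<le> 1")
  case True
  assume x: "x \<ge> 0"
  then have "x ^ l \<le> 1" using True by (simp add: power_le_one)
  moreover have "0 \<le> x ^ Suc (hdim n)" using x by (rule zero_le_power)
  ultimately show ?thesis by linarith
next
  case False
  assume "l \<le> Suc (hdim n)"
  then have "x ^ l \<le> x ^ Suc (hdim n)" using False by (intro power_increasing) auto
  then show ?thesis by simp
qed

lemma le_hdim: "n \<le> hdim n"
proof -
  have "(\<Sum>j<n. 1) \<le> hdim n" unfolding hdim_def by (rule sum_mono) simp
  then show ?thesis by simp
qed

text \<open>Where the first coordinate is constant, all increments carry the same factor e^(-az), so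
  their coefficients of z^l add up. Each is bounded by the (l+1)-st power of a step and l + 1 >= 2;
  by the moment bound the sum over 2^M steps is O(2^(-M)) on average. By continuity it would stay
  above \<open>c0\<close> on a fixed proportion of the lines.\<close>

lemma vertical_const_unit:
  assumes fstc: "\<And>x t. fst (F (x \<odot> e2 t)) = fst (F x)" and l: "1 \<le> l" "l < n"
  shows "snd (ginv (F gone) \<odot> F (e2 1)) $ l = 0"
proof (rule ccontr)
  let ?y = "\<lambda>x. snd (ginv (F x) \<odot> F (x \<odot> e2 1)) $ l"
  assume ne: "snd (ginv (F gone) \<odot> F (e2 1)) $ l \<noteq> 0"
  define c0 where "c0 = \<bar>?y gone\<bar> / 2"
  have c0: "c0 > 0" using ne by (simp add: c0_def)
  obtain s where s: "\<And>M f. s \<le> M \<Longrightarrow> f \<in> line_box n M s 1 \<Longrightarrow> c0 \<le> \<bar>?y (line_base n M f)\<bar>"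
  proof (rule ccontr)
    assume "\<not> thesis"
    then have neg: "\<forall>s. \<exists>M f. s \<le> M \<and> f \<in> line_box n M s 1 \<and> \<bar>?y (line_base n M f)\<bar> < c0"
      using that by (meson not_le)
    have "\<exists>h. gdist n (F gone) (F h) \<le> 1 / real (Suc i) \<and> gdist n (F (e2 1)) (F (h \<odot> e2 1)) \<le> 1 / real (Suc i)
        \<and> \<bar>?y h\<bar> < c0" for i
    proof -
      obtain s where "\<And>M f. s \<le> M \<Longrightarrow> f \<in> line_box n M s 1 \<Longrightarrow>
        gdist n (F gone) (F (line_base n M f)) \<le> 1 / real (Suc i) \<and> gdist n (F (e2 1)) (F (line_base n M f \<odot> e2 1)) \<le> 1 / real (Suc i)"
        by (rule line_image_near[of "1 / real (Suc i)"]) auto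
      then show ?thesis using neg by metis
    qed
    then obtain h where h: "\<And>i. gdist n (F gone) (F (h i)) \<le> 1 / real (Suc i)"
      "\<And>i. gdist n (F (e2 1)) (F (h i \<odot> e2 1)) \<le> 1 / real (Suc i)" "\<And>i. \<bar>?y (h i)\<bar> < c0"
      by metis
    have lim0: "(\<lambda>i. 1 / real (Suc i)) \<longlonglongrightarrow> 0" by (rule lim_1_over_n[THEN LIMSEQ_Suc])
    have "(\<lambda>i. gdist n (F gone) (F (h i))) \<longlonglongrightarrow> 0"
      by (rule Lim_null_comparison[OF _ lim0]) (use h(1) in simp)
    then have m1: "mtends n (\<lambda>i. F (h i)) (F gone)" by (rule mtends_gdist[OF _ n1])
    have "(\<lambda>i. gdist n (F (e2 1)) (F (h i \<odot> e2 1))) \<longlonglongrightarrow> 0"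
      by (rule Lim_null_comparison[OF _ lim0]) (use h(2) in simp)
    then have m2: "mtends n (\<lambda>i. F (h i \<odot> e2 1)) (F (e2 1))" by (rule mtends_gdist[OF _ n1])
    have "(\<lambda>i. ?y (h i)) \<longlonglongrightarrow> ?y gone"
      using mtends_gmul[OF mtends_ginv[OF m1] m2] l by (simp add: mtends_def)
    then have "(\<lambda>i. \<bar>?y (h i)\<bar>) \<longlonglongrightarrow> \<bar>?y gone\<bar>" by (rule tendsto_rabs)
    then have "\<bar>?y gone\<bar> \<le> c0" by (rule LIMSEQ_le_const2) (use h(3) less_imp_le in blast)
    then show False using c0 by (simp add: c0_def)
  qed
  obtain A where A: "A > 0"
    "\<And>M k. k \<le> M \<Longrightarrow> (\<Sum>f\<in>line_box n M 0 2. (\<Sum>i<2 ^ k. (2 ^ k * line_step M k f i) ^ Suc (hdim n)) / 2 ^ k) \<le> A * 2 ^ (M * hdim n)"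
    "\<And>M. real (card (line_box n M 0 2)) \<le> A * 2 ^ (M * hdim n)"
    by (rule line_step_moment) blast
  have bound: "c0 * 2 ^ ((M - s) * hdim n) \<le> real n * (2 * A * 2 ^ (M * hdim n)) / 2 ^ M" if M: "s \<le> M" for M
  proof -
    define S where "S f i = 2 ^ M * line_step M M f i" for f i
    have yS: "\<bar>?y (line_base n M f)\<bar> \<le> real n * (\<Sum>i<2 ^ M. (1 + S f i ^ Suc (hdim n)) / (2 ^ M * 2 ^ M))" for f
    proof -
      define P where "P i = F (line_base n M f \<odot> e2 (real i / 2 ^ M))" for i :: nat
      define a where "a = fst (F (line_base n M f))"
      have fa: "fst (P i) = a" for i unfolding P_def a_def by (rule fstc)
      have y: "snd (ginv (P i) \<odot> P j) = fps_exp (- a) * snd (P j) - fps_exp (- a) * snd (P i)" for i j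
        by (simp add: snd_gmul snd_ginv fa)
      have e0: "line_base n M f \<odot> e2 0 = line_base n M f"
        using gmul_gone(2)[of "line_base n M f"] by (simp add: gone_def)
      have "?y (line_base n M f) = snd (ginv (P 0) \<odot> P (2 ^ M)) $ l"
        unfolding P_def by (simp add: e0[simplified])
      also have "\<dots> = (\<Sum>i<2 ^ M. snd (ginv (P i) \<odot> P (Suc i)) $ l)"
        unfolding y fps_sub_nth by (rule sum_lessThan_telescope[symmetric])
      also have "\<bar>\<dots>\<bar> \<le> (\<Sum>i<2 ^ M. \<bar>snd (ginv (P i) \<odot> P (Suc i)) $ l\<bar>)" by (rule sum_abs)
      also have "\<dots> \<le> (\<Sum>i<2 ^ M. real n * ((1 + S f i ^ Suc (hdim n)) / (2 ^ M * 2 ^ M)))"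
      proof (rule sum_mono)
        fix i
        have st: "gnorm n (ginv (P i) \<odot> P (Suc i)) = S f i / 2 ^ M"
          by (simp add: S_def line_step_def gdist_def P_def)
        have S0: "S f i \<ge> 0" by (simp add: S_def)
        have "\<bar>snd (ginv (P i) \<odot> P (Suc i)) $ l\<bar> \<le> real (Suc l) * (S f i / 2 ^ M) ^ Suc l"
          using gnorm_ge_nth[OF l(2), of "ginv (P i) \<odot> P (Suc i)"] unfolding st .
        also have "\<dots> \<le> real n * ((1 + S f i ^ Suc (hdim n)) / (2 ^ M * 2 ^ M))"
        proof (rule mult_mono)
          have "(S f i / 2 ^ M) ^ Suc l = S f i ^ Suc l / (2 ^ M) ^ Suc l" by (rule power_divide)
          also have "\<dots> \<le> (1 + S f i ^ Suc (hdim n)) / (2 ^ M) ^ 2"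
          proof (rule frac_le)
            show "S f i ^ Suc l \<le> 1 + S f i ^ Suc (hdim n)"
              using S0 l(2) le_hdim by (intro power_le_1_power) auto
            show "((2::real) ^ M) ^ 2 \<le> (2 ^ M) ^ Suc l" using l(1) by (intro power_increasing) auto
          qed (use S0 in auto)
          finally show "(S f i / 2 ^ M) ^ Suc l \<le> (1 + S f i ^ Suc (hdim n)) / (2 ^ M * 2 ^ M)"
            by (simp only: power2_eq_square)
        qed (use l S0 in auto)
        finally show "\<bar>snd (ginv (P i) \<odot> P (Suc i)) $ l\<bar> \<le> real n * ((1 + S f i ^ Suc (hdim n)) / (2 ^ M * 2 ^ M))" .
      qed
      finally show ?thesis by (simp only: sum_distrib_left)
    qed
    have "c0 * 2 ^ ((M - s) * hdim n) \<le> c0 * real (card (line_box n M s 1))"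
      using c0 line_box_card(3)[of 1 M s n] by (intro mult_left_mono) auto
    also have "\<dots> \<le> (\<Sum>f\<in>line_box n M s 1. \<bar>?y (line_base n M f)\<bar>)"
      using sum_bounded_below[of "line_box n M s 1" c0] s[OF M] by (simp add: mult.commute)
    also have "\<dots> \<le> (\<Sum>f\<in>line_box n M s 1. real n * (\<Sum>i<2 ^ M. (1 + S f i ^ Suc (hdim n)) / (2 ^ M * 2 ^ M)))"
      by (intro sum_mono yS)
    also have "\<dots> \<le> (\<Sum>f\<in>line_box n M 0 2. real n * (\<Sum>i<2 ^ M. (1 + S f i ^ Suc (hdim n)) / (2 ^ M * 2 ^ M)))"
    proof (rule sum_mono2)
      show "line_box n M s 1 \<subseteq> line_box n M 0 2"
        using line_shift_box[OF _ n3, of _ M s 0 0] by auto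
      show "0 \<le> real n * (\<Sum>i<2 ^ M. (1 + S f i ^ Suc (hdim n)) / (2 ^ M * 2 ^ M))" for f
        by (intro mult_nonneg_nonneg sum_nonneg divide_nonneg_nonneg add_nonneg_nonneg) (auto simp: S_def)
    qed (use line_box_card(1) in simp)
    also have "\<dots> = real n * ((real (card (line_box n M 0 2)) + (\<Sum>f\<in>line_box n M 0 2. (\<Sum>i<2 ^ M. S f i ^ Suc (hdim n)) / 2 ^ M)) / 2 ^ M)"
    proof -
      have "(\<Sum>i<2 ^ M. (1 + S f i ^ Suc (hdim n)) / (2 ^ M * 2 ^ M)) = (1 + (\<Sum>i<2 ^ M. S f i ^ Suc (hdim n)) / 2 ^ M) / 2 ^ M" for f
        by (simp only: sum_divide_distrib[symmetric] sum.distrib) (simp add: add_divide_distrib)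
      then show ?thesis
        by (simp only: sum_distrib_left[symmetric] sum_divide_distrib[symmetric] sum.distrib) simp
    qed
    also have "\<dots> \<le> real n * ((2 * A * 2 ^ (M * hdim n)) / 2 ^ M)"
      using A(2)[of M M] A(3)[of M] unfolding S_def
      by (intro mult_left_mono divide_right_mono) auto
    finally show ?thesis by simp
  qed
  obtain M0 where M0: "2 * real n * A * 2 ^ (s * hdim n) / c0 < 2 ^ M0"
    using real_arch_pow[of 2] by auto
  define M where "M = M0 + s"
  have "c0 * 2 ^ ((M - s) * hdim n) \<le> real n * (2 * A * 2 ^ (M * hdim n)) / 2 ^ M"
    by (rule bound) (simp add: M_def)
  moreover have "(2::real) ^ (M * hdim n) = 2 ^ ((M - s) * hdim n) * 2 ^ (s * hdim n)"
    by (simp add: M_def flip: power_add add_mult_distrib)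
  ultimately have "c0 * 2 ^ ((M - s) * hdim n) \<le> (2 * real n * A * 2 ^ (s * hdim n) / 2 ^ M) * 2 ^ ((M - s) * hdim n)"
    by (simp add: mult_ac)
  then have "c0 \<le> 2 * real n * A * 2 ^ (s * hdim n) / 2 ^ M" by (rule mult_right_le_imp_le) simp
  then have "2 ^ M \<le> 2 * real n * A * 2 ^ (s * hdim n) / c0" using c0 by (simp add: field_simps)
  moreover have "(2::real) ^ M0 \<le> 2 ^ M" by (rule power_increasing) (auto simp: M_def)
  ultimately show False using M0 by linarith
qed

lemma rescaled:
  assumes "t > 0"
  shows "qs_map n \<eta> (\<lambda>y. F (x \<odot> dil t y))"
  using qs_map_comp[OF assms, of gone x] by simp

lemma fst_const: "fst (F (x \<odot> e2 t)) = fst (F x)"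
proof -
  have pos: "fst (F (x \<odot> e2 t)) = fst (F x)" if t: "t > 0" for x t
    using qs_map.fst_const_unit[OF rescaled[OF t, of x]] by (simp add: dil_gone dil_e2[of t 1, simplified])
  consider "t > 0" | "t = 0" | "t < 0" by linarith
  then show ?thesis
  proof cases
    case 1
    then show ?thesis by (rule pos)
  next
    case 2
    then show ?thesis using gmul_gone(2)[of x] by (simp add: gone_def)
  next
    case 3
    have "x \<odot> e2 t \<odot> e2 (- t) = x" using gmul_gone(2)[of x] by (simp add: gmul_assoc e2_add gone_def)
    then show ?thesis using pos[of "- t" "x \<odot> e2 t"] 3 by simp
  qed
qed

lemma vertical_const:
  assumes l: "1 \<le> l" "l < n"
  shows "snd (ginv (F x) \<odot> F (x \<odot> e2 t)) $ l = 0"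
proof -
  have pos: "snd (ginv (F x) \<odot> F (x \<odot> e2 t)) $ l = 0" if t: "t > 0" for x t
  proof -
    interpret G: qs_map n \<eta> "\<lambda>y. F (x \<odot> dil t y)" by (rule rescaled[OF t])
    have "snd (ginv (F (x \<odot> dil t gone)) \<odot> F (x \<odot> dil t (e2 1))) $ l = 0"
      by (rule G.vertical_const_unit[OF G.fst_const l])
    then show ?thesis by (simp add: dil_gone dil_e2[of t 1, simplified])
  qed
  consider "t > 0" | "t = 0" | "t < 0" by linarith
  then show ?thesis
  proof cases
    case 1
    then show ?thesis by (rule pos)
  next
    case 2
    then show ?thesis using gmul_gone(2)[of x] by (simp add: gone_def[symmetric])
  next
    case 3
    have e: "x \<odot> e2 t \<odot> e2 (- t) = x" using gmul_gone(2)[of x] by (simp add: gmul_assoc e2_add gone_def)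
    have f: "fst (F (x \<odot> e2 t)) = fst (F x)" by (rule fst_const)
    have "snd (ginv (F (x \<odot> e2 t)) \<odot> F x) = - snd (ginv (F x) \<odot> F (x \<odot> e2 t))"
      by (simp add: snd_gmul snd_ginv f)
    then show ?thesis using pos[of "- t" "x \<odot> e2 t"] 3 e by simp
  qed
qed

text \<open>By \<open>line_image\<close> this is the parameter of the image point on the line
  through \<open>F x\<close>. It is signed, since \<open>F\<close> may reverse the orientation of a
  line.\<close>

definition lpos :: "model \<Rightarrow> real \<Rightarrow> real" where
  "lpos x t = snd (F (x \<odot> e2 t)) $ 0 - snd (F x) $ 0"

lemma line_image: "gdist n (F (x \<odot> e2 t)) (F x \<odot> e2 (lpos x t)) = 0"
proof -
  let ?y = "ginv (F x) \<odot> F (x \<odot> e2 t)"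
  have "gdist n ?y (e2 (lpos x t)) = 0"
    unfolding gdist_0_iff[OF n1]
  proof (intro conjI allI impI)
    show "fst ?y = fst (e2 (lpos x t))" using fst_const[of x t] by simp
    fix k assume k: "k < n"
    show "snd ?y $ k = snd (e2 (lpos x t)) $ k"
    proof (cases "k = 0")
      case True
      then show ?thesis by (simp add: lpos_def snd_gmul snd_ginv)
    next
      case False
      then show ?thesis using vertical_const[of k x t] k by simp
    qed
  qed
  then have "gdist n (F x \<odot> ?y) (F x \<odot> e2 (lpos x t)) = 0" by (simp only: gdist_left)
  then show ?thesis unfolding gmul_ginv_cancel .
qed

end

section \<open>The common speed\<close>

text \<open>Conjugation by \<open>e2 t\<close> adds a^k t / k! to the coefficient of z^k for k >= 1,
  where a is the first coordinate of \<open>h\<close>. The weight k + 1 is at least 2, whence the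
  square root.\<close>

lemma conj_bound:
  assumes "n \<ge> 1"
  obtains C where "C > 0" "\<And>t. gnorm n (ginv (e2 t) \<odot> (h \<odot> e2 t)) \<le> C * (1 + sqrt \<bar>t\<bar>)"
proof -
  define \<rho> where "\<rho> = 1 + \<bar>fst h\<bar> + (\<Sum>k<n. \<bar>snd h $ k\<bar>)"
  have \<rho>: "\<rho> \<ge> 1" "\<bar>fst h\<bar> \<le> \<rho>" unfolding \<rho>_def by (auto intro!: sum_nonneg add_nonneg_nonneg)
  have \<rho>k: "\<bar>snd h $ k\<bar> \<le> \<rho>" if "k < n" for k
  proof -
    have "\<bar>snd h $ k\<bar> \<le> (\<Sum>k<n. \<bar>snd h $ k\<bar>)" by (rule member_le_sum) (use that in auto)
    then show ?thesis by (simp add: \<rho>_def)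
  qed
  show ?thesis
  proof (rule that[of "gcon n * (2 * \<rho>)"])
    show "gcon n * (2 * \<rho>) > 0" using gcon_ge_2[of n] \<rho> by simp
    fix t :: real
    define w where "w = 1 + sqrt \<bar>t\<bar>"
    have w: "w \<ge> 1" by (simp add: w_def)
    have "gnorm n (ginv (e2 t) \<odot> (h \<odot> e2 t)) \<le> gcon n * (2 * \<rho> * w)"
    proof (rule gnorm_le)
      show "0 \<le> 2 * \<rho> * w" using \<rho> w by simp
      have "\<rho> * 1 \<le> 2 * \<rho> * w" using \<rho> w by (intro mult_mono) auto
      then show "\<bar>fst (ginv (e2 t) \<odot> (h \<odot> e2 t))\<bar> \<le> 2 * \<rho> * w" using \<rho>(2) by simp
      fix k assume k: "k < n"
      have e: "snd (ginv (e2 t) \<odot> (h \<odot> e2 t)) $ k = snd h $ k + (if k = 0 then 0 else fst h ^ k / fact k * t)"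
        by (cases k) (simp_all add: snd_gmul snd_ginv del: fact_Suc)
      show "\<bar>snd (ginv (e2 t) \<odot> (h \<odot> e2 t)) $ k\<bar> \<le> (2 * \<rho> * w) ^ Suc k"
      proof (cases "k = 0")
        case True
        have "\<rho> * 1 \<le> 2 * \<rho> * w" using \<rho> w by (intro mult_mono) auto
        then show ?thesis unfolding e using \<rho>k[OF k] True by simp
      next
        case False
        have t: "1 + \<bar>t\<bar> \<le> w ^ Suc k"
        proof -
          have "(sqrt \<bar>t\<bar>)\<^sup>2 = \<bar>t\<bar>" by simp
          moreover have "0 \<le> sqrt \<bar>t\<bar>" by simp
          ultimately have "1 + \<bar>t\<bar> \<le> w\<^sup>2" unfolding w_def power2_sum one_power2 by linarith
          also have "\<dots> \<le> w ^ Suc k" using w False by (intro power_increasing) auto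
          finally show ?thesis .
        qed
        have "\<bar>fst h ^ k / fact k * t\<bar> \<le> \<rho> ^ k * \<bar>t\<bar>"
          unfolding abs_mult using abs_power_div_fact_le[of "fst h" k k] power_mono[OF \<rho>(2), of k]
          by (intro mult_right_mono) auto
        also have "\<dots> \<le> \<rho> ^ Suc k * \<bar>t\<bar>"
          using \<rho> by (intro mult_right_mono power_increasing) auto
        finally have 1: "\<bar>fst h ^ k / fact k * t\<bar> \<le> \<rho> ^ Suc k * \<bar>t\<bar>" .
        have "\<rho> ^ 1 \<le> \<rho> ^ Suc k" using \<rho> by (intro power_increasing) auto
        then have 2: "\<bar>snd h $ k\<bar> \<le> \<rho> ^ Suc k" using \<rho>k[OF k] by simp
        have "\<bar>snd h $ k + fst h ^ k / fact k * t\<bar> \<le> \<rho> ^ Suc k + \<rho> ^ Suc k * \<bar>t\<bar>"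
          using 1 2 by linarith
        also have "\<dots> = \<rho> ^ Suc k * (1 + \<bar>t\<bar>)" by (simp add: distrib_left)
        also have "\<dots> \<le> \<rho> ^ Suc k * w ^ Suc k" using t \<rho> by (intro mult_left_mono) auto
        also have "\<dots> \<le> 2 ^ Suc k * (\<rho> ^ Suc k * w ^ Suc k)"
          using mult_right_mono[OF one_le_power[of 2 "Suc k"], of "\<rho> ^ Suc k * w ^ Suc k"] \<rho> w by (simp del: power_Suc)
        also have "\<dots> = (2 * \<rho> * w) ^ Suc k" by (simp only: power_mult_distrib mult.assoc)
        finally show ?thesis unfolding e using False by (simp only: if_False)
      qed
    qed fact
    then show "gnorm n (ginv (e2 t) \<odot> (h \<odot> e2 t)) \<le> gcon n * (2 * \<rho>) * (1 + sqrt \<bar>t\<bar>)"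
      by (simp add: w_def mult_ac)
  qed
qed

lemma e2_0: "x \<odot> e2 0 = x"
  using gmul_gone(2)[of x] by (simp add: gone_def)

text \<open>\<open>line_onto\<close> is the contribution of the inverse map; the argument for
  \<open>F\<close> alone only places the image of a line inside a line.\<close>

locale qs_lines = qs_map +
  assumes line_onto: "\<exists>t. lpos x t = s"
begin

lemma lpos_0 [simp]: "lpos x 0 = 0"
  unfolding lpos_def e2_0 by simp

lemma line_dist: "gdist n (F (x \<odot> e2 s)) (F (x \<odot> e2 t)) = \<bar>lpos x t - lpos x s\<bar>"
  using gdist_cong[OF line_image line_image n1, of x s x t] by (simp add: gdist_e2)

lemma lpos_inj: "lpos x s = lpos x t \<Longrightarrow> s = t"
  using pos[of "x \<odot> e2 s" "x \<odot> e2 t"] line_dist[of x s t] by (auto simp: gdist_e2)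

lemma lpos_cont: "isCont (lpos x) s"
  unfolding isCont_def LIM_eq
proof (intro allI impI)
  fix e :: real assume e: "e > 0"
  let ?D = "\<bar>lpos x (s + 1) - lpos x s\<bar>"
  have D: "?D > 0" using lpos_inj[of x "s + 1" s] by auto
  obtain d where d: "d > 0" "\<eta> d < e / ?D" using eta_lim[of "e / ?D"] e D by auto
  have "\<bar>lpos x t - lpos x s\<bar> < e" if "\<bar>t - s\<bar> < d" for t
  proof -
    have "gdist n (F (x \<odot> e2 s)) (F (x \<odot> e2 t)) \<le> \<eta> d * gdist n (F (x \<odot> e2 s)) (F (x \<odot> e2 (s + 1)))"
      by (rule qs_le) (use that in \<open>auto simp: gdist_e2\<close>)
    also have "\<dots> = \<eta> d * ?D" by (simp only: line_dist)
    also have "\<dots> < e" using d D by (simp add: pos_less_divide_eq)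
    finally show ?thesis by (simp only: line_dist)
  qed
  then show "\<exists>d>0. \<forall>t. t \<noteq> s \<and> norm (t - s) < d \<longrightarrow> norm (lpos x t - lpos x s) < e"
    using d by auto
qed

text \<open>A continuous injective function on an interval is monotone. Absolute values avoid a
  distinction of the two orientations.\<close>

lemma lpos_add:
  assumes "r \<le> s" "s \<le> t"
  shows "\<bar>lpos x t - lpos x r\<bar> = \<bar>lpos x s - lpos x r\<bar> + \<bar>lpos x t - lpos x s\<bar>"
proof (cases "r < s \<and> s < t")
  case True
  have "(lpos x r < lpos x s \<and> lpos x s < lpos x t) \<or> (lpos x t < lpos x s \<and> lpos x s < lpos x r)"
    by (rule continuous_inj_imp_mono)
      (use True lpos_inj in \<open>auto intro!: continuous_at_imp_continuous_on lpos_cont simp: inj_on_def\<close>)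
  then show ?thesis by auto
next
  case False
  then show ?thesis using assms by auto
qed

lemma lpos_mono:
  assumes "r \<le> s" "s \<le> t" "t \<le> u"
  shows "\<bar>lpos x t - lpos x s\<bar> \<le> \<bar>lpos x u - lpos x r\<bar>"
  using lpos_add[of r s u x] lpos_add[of s t u x] assms by linarith

lemma lpos_abs_mono: "0 \<le> s \<Longrightarrow> s \<le> t \<Longrightarrow> \<bar>lpos x s\<bar> \<le> \<bar>lpos x t\<bar>"
  using lpos_mono[of 0 0 s t x] by simp

text \<open>By surjectivity both B and -B are attained; by monotonicity not both at times t <= 0,
  because the position 0 at time 0 lies between them.\<close>

lemma lpos_unbounded: "\<exists>t>0. \<forall>u\<ge>t. C < \<bar>lpos x u\<bar>"
proof -
  define B where "B = \<bar>C\<bar> + 1"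
  obtain t1 t2 where t: "lpos x t1 = B" "lpos x t2 = - B" using line_onto by metis
  have B: "B > 0" by (simp add: B_def)
  have "t1 > 0 \<or> t2 > 0"
  proof (rule ccontr)
    assume "\<not> ?thesis"
    then have neg: "t1 \<le> 0" "t2 \<le> 0" by auto
    show False
    proof (cases "t1 \<le> t2")
      case True
      then show False using lpos_add[of t1 t2 0 x] neg t B by simp
    next
      case False
      then show False using lpos_add[of t2 t1 0 x] neg t B by simp
    qed
  qed
  then obtain t where "t > 0" "\<bar>lpos x t\<bar> = B" using t B by auto
  moreover have "C < B" by (simp add: B_def)
  ultimately show ?thesis using lpos_abs_mono[of t _ x] by (intro exI[of _ t]) fastforce
qed

text \<open>
  The point at time \<open>t\<close> of a line through \<open>x\<close> has distance at least \<open>sqrt t / 2\<close> from the line through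
  \<open>x \<odot> (1, 0)\<close>, because \<open>[e\<^sub>1, t e\<^sub>2] = t e\<^sub>3\<close>, whereas the images of the two lines diverge at most
  like the square root of the position.
\<close>

lemma lpos_step_sqrt:
  obtains C where "C > 0" "\<And>t. t \<ge> 1 \<Longrightarrow> \<bar>lpos x (t + sqrt t / 2) - lpos x t\<bar> \<le> C * (1 + sqrt \<bar>lpos x t\<bar>)"
proof -
  define x' where "x' = x \<odot> (1, 0)"
  obtain C where C: "C > 0" "\<And>t. gnorm n (ginv (e2 t) \<odot> ((ginv (F x) \<odot> F x') \<odot> e2 t)) \<le> C * (1 + sqrt \<bar>t\<bar>)"
    using conj_bound[OF n1] by blast
  show ?thesis
  proof (rule that[of "\<eta> 1 * C"])
    show "\<eta> 1 * C > 0" using C eta1_ge_1 by simp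
    fix t :: real assume t: "t \<ge> 1"
    obtain s where s: "lpos x' s = lpos x t" using line_onto by blast
    have img: "gdist n (F (x \<odot> e2 t)) (F (x' \<odot> e2 s)) \<le> C * (1 + sqrt \<bar>lpos x t\<bar>)"
    proof -
      have "gdist n (F (x \<odot> e2 t)) (F (x' \<odot> e2 s)) = gdist n (F x \<odot> e2 (lpos x t)) (F x' \<odot> e2 (lpos x t))"
        using gdist_cong[OF line_image line_image n1, of x t x' s] s by simp
      also have "\<dots> = gnorm n (ginv (e2 (lpos x t)) \<odot> ((ginv (F x) \<odot> F x') \<odot> e2 (lpos x t)))"
        by (simp add: gdist_def ginv_gmul gmul_assoc)
      finally show ?thesis using C(2) by simp
    qed
    let ?g = "ginv (e2 t) \<odot> ((1, 0) \<odot> e2 s)"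
    let ?N = "gnorm n ?g"
    have dN: "gdist n (x \<odot> e2 t) (x' \<odot> e2 s) = ?N"
      by (simp add: x'_def gdist_def ginv_gmul gmul_assoc)
    have N0: "\<bar>s - t\<bar> \<le> ?N" using gnorm_ge_snd_0[of ?g n] by (simp add: snd_gmul snd_ginv)
    \<comment> \<open>The difference has s as its coefficient of z^1, which has weight 2. So its
      norm is at least of order sqrt t if s is at least t/2, and otherwise the coefficient s - t of
      z^0 is large.\<close>
    have N1: "\<bar>s\<bar> \<le> 2 * ?N\<^sup>2"
      using gnorm_ge_nth[of 1 n ?g] n3 by (simp add: snd_gmul snd_ginv numeral_2_eq_2)
    have N: "sqrt t / 2 \<le> ?N"
    proof (cases "s \<ge> t / 2")
      case True
      then have "(sqrt t / 2)\<^sup>2 \<le> ?N\<^sup>2" using N1 t by (simp add: power_divide)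
      then show ?thesis by (rule power2_le_imp_le) simp
    next
      case False
      have "sqrt t \<le> t" using t by (simp add: real_le_lsqrt power2_eq_square mult_le_cancel_left1)
      then show ?thesis using False N0 by linarith
    qed
    have tp: "sqrt t / 2 > 0" using t by simp
    have "\<bar>lpos x (t + sqrt t / 2) - lpos x t\<bar> = gdist n (F (x \<odot> e2 t)) (F (x \<odot> e2 (t + sqrt t / 2)))"
      by (rule line_dist[symmetric])
    also have "\<dots> \<le> \<eta> 1 * gdist n (F (x \<odot> e2 t)) (F (x' \<odot> e2 s))"
    proof (rule qs_le)
      show "0 < gdist n (x \<odot> e2 t) (x' \<odot> e2 s)" unfolding dN using N tp by linarith
      have "gdist n (x \<odot> e2 t) (x \<odot> e2 (t + sqrt t / 2)) = sqrt t / 2" using tp by (simp add: gdist_e2)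
      then show "gdist n (x \<odot> e2 t) (x \<odot> e2 (t + sqrt t / 2)) \<le> 1 * gdist n (x \<odot> e2 t) (x' \<odot> e2 s)"
        unfolding dN using N by linarith
    qed
    also have "\<dots> \<le> \<eta> 1 * (C * (1 + sqrt \<bar>lpos x t\<bar>))"
      using img eta1_ge_1 by (intro mult_left_mono) auto
    finally show "\<bar>lpos x (t + sqrt t / 2) - lpos x t\<bar> \<le> \<eta> 1 * C * (1 + sqrt \<bar>lpos x t\<bar>)"
      by (simp only: mult.assoc)
  qed
qed

text \<open>By \<open>lpos_step_sqrt\<close> the square root of the position grows by a bounded
  amount whenever sqrt t does so by a fixed amount; hence the growth is at most linear. At the times
  (k/6)^2 one step is at most sqrt t / 2, and k >= 6 ensures t >= 1.\<close>

lemma lpos_quadratic: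
  obtains K where "K > 0" "\<And>j::nat. j \<ge> 1 \<Longrightarrow> \<bar>lpos x (real (j\<^sup>2))\<bar> \<le> K * real (j\<^sup>2)"
proof -
  obtain C where C: "C > 0" "\<And>t. t \<ge> 1 \<Longrightarrow> \<bar>lpos x (t + sqrt t / 2) - lpos x t\<bar> \<le> C * (1 + sqrt \<bar>lpos x t\<bar>)"
    using lpos_step_sqrt by blast
  define L where "L = 1 + C + \<bar>lpos x 1\<bar>"
  have L: "L \<ge> 1" "C \<le> L" "\<bar>lpos x 1\<bar> \<le> L" using C by (auto simp: L_def)
  have main: "\<bar>lpos x ((real k / 6)\<^sup>2)\<bar> \<le> (L * real k)\<^sup>2" if "k \<ge> 6" for k
    using that
  proof (induction k rule: dec_induct)
    case base
    have "L * 1 \<le> L * L" using L by (intro mult_left_mono) auto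
    then have "\<bar>lpos x 1\<bar> \<le> 36 * (L * L)" using L by linarith
    then show ?case by (simp add: power2_eq_square)
  next
    case (step k)
    define a where "a = (real k / 6)\<^sup>2"
    have k6: "real k \<ge> 6" using step.hyps by simp
    have a1: "a \<ge> 1" unfolding a_def using k6 by (simp add: one_le_power)
    have sa: "sqrt a = real k / 6" using k6 by (simp add: a_def)
    have next_le: "(real (Suc k) / 6)\<^sup>2 \<le> a + sqrt a / 2"
      unfolding sa using k6 by (simp add: a_def power2_eq_square field_simps)
    have a_le: "a \<le> (real (Suc k) / 6)\<^sup>2" unfolding a_def by (intro power_mono) auto
    have "\<bar>lpos x ((real (Suc k) / 6)\<^sup>2) - lpos x a\<bar> \<le> \<bar>lpos x (a + sqrt a / 2) - lpos x a\<bar>"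
      by (rule lpos_mono) (use next_le a_le in auto)
    also have "\<dots> \<le> C * (1 + sqrt \<bar>lpos x a\<bar>)" by (rule C(2)[OF a1])
    also have "\<dots> \<le> L * (L + L * real k)"
    proof -
      have "sqrt \<bar>lpos x a\<bar> \<le> sqrt ((L * real k)\<^sup>2)"
        using step.IH by (simp only: real_sqrt_le_iff a_def)
      also have "\<dots> = L * real k" using L by (simp add: abs_mult)
      finally show ?thesis using L C by (intro mult_mono) auto
    qed
    finally have "\<bar>lpos x ((real (Suc k) / 6)\<^sup>2)\<bar> \<le> (L * real k)\<^sup>2 + L * (L + L * real k)"
      using step.IH unfolding a_def by linarith
    also have "\<dots> \<le> (L * real (Suc k))\<^sup>2"
      using L by (simp add: power2_eq_square algebra_simps)
    finally show ?case .
  qed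
  show ?thesis
  proof (rule that[of "(6 * L)\<^sup>2"])
    show "0 < (6 * L)\<^sup>2" using L by simp
    fix j :: nat assume "j \<ge> 1"
    then show "\<bar>lpos x (real (j\<^sup>2))\<bar> \<le> (6 * L)\<^sup>2 * real (j\<^sup>2)"
      using main[of "6 * j"] by (simp add: power_mult_distrib)
  qed
qed

text \<open>Unit steps longer than 2K from some time on would add up, by monotonicity, to more than
  the linear bound with constant K allows.\<close>

lemma lpos_slow_steps:
  obtains C where "\<And>T. \<exists>t\<ge>T. \<bar>lpos x (t + 1) - lpos x t\<bar> \<le> C"
proof -
  obtain K where K: "K > 0" "\<And>j::nat. j \<ge> 1 \<Longrightarrow> \<bar>lpos x (real (j\<^sup>2))\<bar> \<le> K * real (j\<^sup>2)"
    using lpos_quadratic by blast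
  have "\<exists>t\<ge>T. \<bar>lpos x (t + 1) - lpos x t\<bar> \<le> 2 * K" for T
  proof (rule ccontr)
    assume neg: "\<not> ?thesis"
    obtain N :: nat where N: "T \<le> real N" using real_arch_simple by blast
    have sum: "2 * K * real m \<le> \<bar>lpos x (real (N + m)) - lpos x (real N)\<bar>" for m
    proof (induction m)
      case (Suc m)
      have "2 * K < \<bar>lpos x (real (N + m) + 1) - lpos x (real (N + m))\<bar>"
        using neg[unfolded not_ex, rule_format, of "real (N + m)"] N by auto
      moreover have "\<bar>lpos x (real (N + Suc m)) - lpos x (real N)\<bar> =
          \<bar>lpos x (real (N + m)) - lpos x (real N)\<bar> + \<bar>lpos x (real (N + Suc m)) - lpos x (real (N + m))\<bar>"
        by (rule lpos_add) auto
      ultimately show ?case using Suc by (simp add: algebra_simps)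
    qed simp
    define j where "j = 2 * N + 1"
    have jN: "2 * N < j\<^sup>2" "N \<le> j\<^sup>2" by (auto simp: j_def power2_eq_square)
    have "2 * K * real (j\<^sup>2 - N) \<le> \<bar>lpos x (real (N + (j\<^sup>2 - N))) - lpos x (real N)\<bar>" by (rule sum)
    also have "\<dots> = \<bar>lpos x (real (j\<^sup>2)) - lpos x (real N)\<bar>" using jN by simp
    also have "\<dots> \<le> \<bar>lpos x (real (j\<^sup>2)) - lpos x 0\<bar>" by (rule lpos_mono) (use jN in auto)
    also have "\<dots> \<le> K * real (j\<^sup>2)" using K(2)[of j] by (simp add: j_def)
    finally have "2 * real (j\<^sup>2 - N) \<le> real (j\<^sup>2)" using K(1) by (simp add: mult.assoc mult.left_commute)
    moreover have "real (2 * N) < real (j\<^sup>2)" using jN by (simp only: of_nat_less_iff)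
    ultimately show False using jN by simp
  qed
  then show ?thesis using that by blast
qed

text \<open>
  Non-parallel image lines would diverge, although the images of \<open>x \<odot> e2 t\<close> and \<open>x \<odot> w \<odot> e2 t\<close> stay at
  bounded distance at the times of slow steps.
\<close>

lemma central_parallel:
  assumes w: "w = (0, fps_const y * fps_X ^ (n - 1))"
  shows "fst (F (x \<odot> w)) = fst (F x)"
proof (rule ccontr)
  assume ne: "fst (F (x \<odot> w)) \<noteq> fst (F x)"
  define h where "h = ginv (F x) \<odot> F (x \<odot> w)"
  define \<alpha> where "\<alpha> = fst h"
  have \<alpha>: "\<alpha> \<noteq> 0" using ne by (simp add: \<alpha>_def h_def)
  define r where "r = gnorm n w"
  obtain C where C: "\<And>T. \<exists>t\<ge>T. \<bar>lpos x (t + 1) - lpos x t\<bar> \<le> C" using lpos_slow_steps[of x] by blast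
  define C' where "C' = \<eta> r * C"
  \<comment> \<open>Bounds the position at a time of a slow step, from two coefficients of the
    difference: that of z^1 contains \<alpha> \<phi>' with \<alpha> nonzero, and that of z^0
    contains \<phi>' - \<phi>.\<close>
  define B where "B = (2 * C'\<^sup>2 + \<bar>snd h $ 1\<bar>) / \<bar>\<alpha>\<bar> + C' + \<bar>snd h $ 0\<bar>"
  obtain T where T: "\<And>u. u \<ge> T \<Longrightarrow> B < \<bar>lpos x u\<bar>" using lpos_unbounded by blast
  obtain t where t: "t \<ge> T" "\<bar>lpos x (t + 1) - lpos x t\<bar> \<le> C" using C by blast
  define \<phi> where "\<phi> = lpos x t"
  define \<phi>' where "\<phi>' = lpos (x \<odot> w) t"
  have r: "r \<ge> 0" by (simp add: r_def)
  have comm: "x \<odot> w \<odot> e2 t = x \<odot> e2 t \<odot> w"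
    unfolding w gmul_assoc by (simp add: gmul_snd_commute)
  have "gdist n (F (x \<odot> e2 t)) (F (x \<odot> w \<odot> e2 t)) \<le> \<eta> r * gdist n (F (x \<odot> e2 t)) (F (x \<odot> e2 (t + 1)))"
    by (rule qs_le) (auto simp: gdist_e2 comm r_def)
  also have "\<dots> \<le> C'"
    unfolding line_dist C'_def using t(2) eta_nonneg[OF r] by (rule mult_left_mono)
  also have "gdist n (F (x \<odot> e2 t)) (F (x \<odot> w \<odot> e2 t)) = gnorm n (ginv (e2 \<phi>) \<odot> (h \<odot> e2 \<phi>'))"
    using gdist_cong[OF line_image line_image n1, of x t "x \<odot> w" t]
    by (simp add: gdist_def ginv_gmul gmul_assoc h_def \<phi>_def \<phi>'_def)
  finally have N: "gnorm n (ginv (e2 \<phi>) \<odot> (h \<odot> e2 \<phi>')) \<le> C'" .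
  let ?g = "ginv (e2 \<phi>) \<odot> (h \<odot> e2 \<phi>')"
  have g0: "snd ?g $ 0 = snd h $ 0 + \<phi>' - \<phi>" and g1: "snd ?g $ 1 = snd h $ 1 + \<alpha> * \<phi>'"
    by (simp_all add: snd_gmul snd_ginv \<alpha>_def)
  have b0: "\<bar>snd h $ 0 + \<phi>' - \<phi>\<bar> \<le> C'" using gnorm_ge_snd_0[of ?g n] N unfolding g0 by linarith
  have "\<bar>snd h $ 1 + \<alpha> * \<phi>'\<bar> \<le> real (Suc 1) * gnorm n ?g ^ Suc 1"
    unfolding g1[symmetric] by (rule gnorm_ge_nth) (use n3 in simp)
  also have "\<dots> \<le> 2 * C'\<^sup>2" using power_mono[OF N, of 2] by (simp add: numeral_2_eq_2)
  finally have "\<bar>\<alpha>\<bar> * \<bar>\<phi>'\<bar> \<le> 2 * C'\<^sup>2 + \<bar>snd h $ 1\<bar>" unfolding abs_mult[symmetric] by linarith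
  then have "\<bar>\<phi>'\<bar> \<le> (2 * C'\<^sup>2 + \<bar>snd h $ 1\<bar>) / \<bar>\<alpha>\<bar>" using \<alpha> by (simp add: pos_le_divide_eq mult.commute)
  then have "\<bar>\<phi>\<bar> \<le> B" using b0 unfolding B_def by linarith
  then show False using T[OF t(1)] by (simp add: \<phi>_def)
qed

text \<open>Parallel image lines have distance exactly \<open>D\<close>, attained from every point
  of the first, so points with equal parameter have images at a distance between \<open>D\<close>
  and \<eta>(1) \<open>D\<close>. Comparing such a pair with a step of length r, at the same
  distance in the source, costs one more \<eta>(1) in either direction.\<close>

lemma step_scale:
  assumes r: "r > 0"
  obtains D where "D > 0" "\<And>t. D / \<eta> 1 \<le> \<bar>lpos x (t + r) - lpos x t\<bar>"
    "\<And>t. \<bar>lpos x (t + r) - lpos x t\<bar> \<le> (\<eta> 1)\<^sup>2 * D"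
proof -
  let ?H = "\<eta> 1"
  have H: "?H \<ge> 1" by (rule eta1_ge_1)
  \<comment> \<open>c z^(n-1) has norm |c|^(1/n), so the coefficient r^n gives a central element of
    norm r.\<close>
  define w :: model where "w = (0, fps_const (r ^ n) * fps_X ^ (n - 1))"
  have wn: "gnorm n w = r"
  proof -
    have "gnorm n w = \<bar>r ^ n\<bar> powr (1 / real n)" unfolding w_def by (rule gnorm_cpt) (use n3 in simp)
    also have "\<dots> = (r powr real n) powr (1 / real n)" using r by (simp add: powr_realpow)
    also have "\<dots> = r" using r n3 by (simp add: powr_powr)
    finally show ?thesis .
  qed
  define P where "P = snd (ginv (F x) \<odot> F (x \<odot> w))"
  have fz: "ginv (F x) \<odot> F (x \<odot> w) = (0, P)"
    using central_parallel[OF w_def, of x] by (simp add: P_def prod_eq_iff)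
  define D where "D = (\<Sum>k=1..<n. \<bar>P $ k\<bar> powr (1 / real (Suc k)))"
  have dist: "gdist n (F (x \<odot> e2 t)) (F (x \<odot> w \<odot> e2 t')) = \<bar>P $ 0 + lpos (x \<odot> w) t' - lpos x t\<bar> + D" for t t'
  proof -
    have "gdist n (F (x \<odot> e2 t)) (F (x \<odot> w \<odot> e2 t')) = gnorm n (ginv (e2 (lpos x t)) \<odot> ((0, P) \<odot> e2 (lpos (x \<odot> w) t')))"
      using gdist_cong[OF line_image line_image n1, of x t "x \<odot> w" t']
      by (simp add: gdist_def ginv_gmul gmul_assoc flip: fz)
    also have "ginv (e2 (lpos x t)) \<odot> ((0, P) \<odot> e2 (lpos (x \<odot> w) t')) = (0, P + fps_const (lpos (x \<odot> w) t' - lpos x t))"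
      by (simp add: gmul_def ginv_def flip: fps_const_sub)
    also have "gnorm n \<dots> = \<bar>P $ 0 + lpos (x \<odot> w) t' - lpos x t\<bar> + D"
      unfolding gnorm_snd D_def by (intro arg_cong2[of _ _ _ _ "(+)"] sum.cong) auto
    finally show ?thesis .
  qed
  have dom: "gdist n (x \<odot> e2 t) (x \<odot> w \<odot> e2 t') = \<bar>t' - t\<bar> + r" for t t'
  proof -
    have "gdist n (x \<odot> e2 t) (x \<odot> w \<odot> e2 t') = gnorm n (0, fps_const (r ^ n) * fps_X ^ (n - 1) + fps_const (t' - t))"
      by (simp add: gdist_def ginv_gmul gmul_assoc) (simp add: gmul_def ginv_def w_def add_diff_eq flip: fps_const_sub fps_const_neg)
    also have "\<dots> = \<bar>t' - t\<bar> + (\<Sum>k=1..<n. \<bar>(fps_const (r ^ n) * fps_X ^ (n - 1)) $ k\<bar> powr (1 / real (Suc k)))"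
      unfolding gnorm_snd using n3 by (intro arg_cong2[of _ _ _ _ "(+)"] sum.cong) (auto simp: fps_X_power_nth)
    also have "(\<Sum>k=1..<n. \<bar>(fps_const (r ^ n) * fps_X ^ (n - 1)) $ k\<bar> powr (1 / real (Suc k))) = r"
      using wn n3 unfolding w_def gnorm_snd by (simp add: fps_X_power_nth)
    finally show ?thesis .
  qed
  have near: "\<exists>t'. gdist n (F (x \<odot> e2 t)) (F (x \<odot> w \<odot> e2 t')) = D" for t
  proof -
    obtain t' where "lpos (x \<odot> w) t' = lpos x t - P $ 0" using line_onto by blast
    then show ?thesis by (intro exI[of _ t']) (simp add: dist)
  qed
  have D: "D > 0"
  proof -
    obtain t' where t': "gdist n (F (x \<odot> e2 0)) (F (x \<odot> w \<odot> e2 t')) = D" using near by blast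
    have "gdist n (x \<odot> e2 0) (x \<odot> w \<odot> e2 t') > 0" unfolding dom using r by simp
    from pos[OF this] show ?thesis unfolding t' .
  qed
  have up: "gdist n (F (x \<odot> e2 t)) (F (x \<odot> w \<odot> e2 t)) \<le> ?H * D" for t
  proof -
    obtain t' where t': "gdist n (F (x \<odot> e2 t)) (F (x \<odot> w \<odot> e2 t')) = D" using near by blast
    have "gdist n (F (x \<odot> e2 t)) (F (x \<odot> w \<odot> e2 t)) \<le> ?H * gdist n (F (x \<odot> e2 t)) (F (x \<odot> w \<odot> e2 t'))"
      by (rule qs_le) (use r in \<open>auto simp: dom simp del: gdist_left\<close>)
    then show ?thesis unfolding t' .
  qed
  have lo: "D \<le> gdist n (F (x \<odot> e2 t)) (F (x \<odot> w \<odot> e2 t))" for t by (simp add: dist)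
  have sd: "gdist n (x \<odot> e2 t) (x \<odot> e2 (t + r)) = r" for t using r by (simp add: gdist_e2)
  show ?thesis
  proof (rule that[OF D])
    fix t
    have "gdist n (F (x \<odot> e2 t)) (F (x \<odot> w \<odot> e2 t)) \<le> ?H * gdist n (F (x \<odot> e2 t)) (F (x \<odot> e2 (t + r)))"
      by (rule qs_le) (use r in \<open>auto simp: dom sd simp del: gdist_left\<close>)
    then have "D \<le> ?H * \<bar>lpos x (t + r) - lpos x t\<bar>" using lo[of t] unfolding line_dist by linarith
    then show "D / ?H \<le> \<bar>lpos x (t + r) - lpos x t\<bar>" using H by (simp add: divide_le_eq mult.commute)
    have "gdist n (F (x \<odot> e2 t)) (F (x \<odot> e2 (t + r))) \<le> ?H * gdist n (F (x \<odot> e2 t)) (F (x \<odot> w \<odot> e2 t))"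
      by (rule qs_le) (use r in \<open>auto simp: dom sd simp del: gdist_left\<close>)
    also have "\<dots> \<le> ?H * (?H * D)" using up[of t] H by (intro mult_left_mono) auto
    finally show "\<bar>lpos x (t + r) - lpos x t\<bar> \<le> ?H\<^sup>2 * D"
      unfolding line_dist by (simp add: power2_eq_square mult.assoc)
  qed
qed

lemma lpos_multiple:
  assumes "r > 0" "\<And>t. lo \<le> \<bar>lpos x (t + r) - lpos x t\<bar>" "\<And>t. \<bar>lpos x (t + r) - lpos x t\<bar> \<le> hi"
  shows "real m * lo \<le> \<bar>lpos x (real m * r)\<bar> \<and> \<bar>lpos x (real m * r)\<bar> \<le> real m * hi"
proof (induction m)
  case (Suc m)
  have e: "real (Suc m) * r = real m * r + r" by (simp add: algebra_simps)
  have "\<bar>lpos x (real (Suc m) * r) - lpos x 0\<bar> =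
      \<bar>lpos x (real m * r) - lpos x 0\<bar> + \<bar>lpos x (real (Suc m) * r) - lpos x (real m * r)\<bar>"
    by (rule lpos_add) (use assms(1) in \<open>auto simp: e\<close>)
  then show ?case using Suc assms(2,3)[of "real m * r"] unfolding e by (simp add: algebra_simps)
qed simp

lemma lpos_linear:
  assumes r: "r > 0" and lo: "lo > 0" "\<And>t. lo \<le> \<bar>lpos x (t + r) - lpos x t\<bar>"
    and hi: "\<And>t. \<bar>lpos x (t + r) - lpos x t\<bar> \<le> hi" and t: "t > 0"
  shows "(1 / r - 1 / t) * lo \<le> \<bar>lpos x t\<bar> / t" "\<bar>lpos x t\<bar> / t \<le> (1 / r + 1 / t) * hi"
proof -
  define q where "q = nat \<lfloor>t / r\<rfloor>"
  have "0 \<le> \<lfloor>t / r\<rfloor>" using r t by simp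
  then have q: "real q \<le> t / r" "t / r \<le> real q + 1" unfolding q_def by linarith+
  have hi0: "hi \<ge> 0" using order_trans[OF abs_ge_zero hi] .
  have "(t / r - 1) * lo \<le> real q * lo" using q lo by (intro mult_right_mono) auto
  also have "\<dots> \<le> \<bar>lpos x (real q * r)\<bar>" using lpos_multiple[OF r lo(2) hi] by simp
  also have "\<dots> \<le> \<bar>lpos x t\<bar>"
    by (rule lpos_abs_mono) (use r q in \<open>auto simp: pos_le_divide_eq\<close>)
  also have "(t / r - 1) * lo = (1 / r - 1 / t) * lo * t" using t by (simp add: algebra_simps)
  finally show "(1 / r - 1 / t) * lo \<le> \<bar>lpos x t\<bar> / t" unfolding pos_le_divide_eq[OF t] .
  have "\<bar>lpos x t\<bar> \<le> \<bar>lpos x (real (Suc q) * r)\<bar>"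
    by (rule lpos_abs_mono) (use r t q in \<open>auto simp: pos_divide_le_eq add.commute\<close>)
  also have "\<dots> \<le> real (Suc q) * hi" using lpos_multiple[OF r lo(2) hi] by blast
  also have "\<dots> \<le> (t / r + 1) * hi" using q hi0 by (intro mult_right_mono) auto
  also have "(t / r + 1) * hi = (1 / r + 1 / t) * hi * t" using t by (simp add: algebra_simps)
  finally show "\<bar>lpos x t\<bar> / t \<le> (1 / r + 1 / t) * hi" unfolding pos_divide_le_eq[OF t] .
qed

text \<open>Quasisymmetry with centre \<open>e2 t\<close>: the other line is at distance O(1 + sqrt
  t) by \<open>conj_bound\<close>, the identity at distance t, so the argument of \<eta> tends to
  0.\<close>

lemma lines_diverge_sublinearly:
  obtains C c where "C > 0" "\<And>t. t > 0 \<Longrightarrow>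
    \<bar>\<bar>lpos x t\<bar> - \<bar>lpos gone t\<bar>\<bar> \<le> c + \<eta> (C * (1 + sqrt t) / t) * \<bar>lpos gone t\<bar>"
proof -
  obtain C where C: "C > 0" "\<And>t. gnorm n (ginv (e2 t) \<odot> (x \<odot> e2 t)) \<le> C * (1 + sqrt \<bar>t\<bar>)"
    using conj_bound[OF n1] by blast
  define c where "c = \<bar>snd (F x) $ 0 - snd (F gone) $ 0\<bar>"
  have "\<bar>\<bar>lpos x t\<bar> - \<bar>lpos gone t\<bar>\<bar> \<le> c + \<eta> (C * (1 + sqrt t) / t) * \<bar>lpos gone t\<bar>" if t: "t > 0" for t
  proof -
    let ?a = "e2 t" and ?b = "x \<odot> e2 t"
    have "\<bar>(snd (F x) $ 0 + lpos x t) - (snd (F gone) $ 0 + lpos gone t)\<bar>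
        \<le> gdist n (F ?a) (F ?b)"
      using gdist_ge_snd_0[of "F ?b" "F ?a" n] by (simp add: lpos_def)
    also have "\<dots> \<le> \<eta> (C * (1 + sqrt t) / t) * gdist n (F ?a) (F gone)"
    proof (rule qs_le)
      have d: "gdist n ?a gone = t" using t gdist_e2[of n t 0] by (simp add: gone_def)
      show "0 < gdist n ?a gone" using t d by simp
      show "gdist n ?a ?b \<le> C * (1 + sqrt t) / t * gdist n ?a gone"
        unfolding d using C(2)[of t] t by (simp add: gdist_def)
    qed
    also have "gdist n (F ?a) (F gone) = \<bar>lpos gone t\<bar>"
      using line_dist[of gone t 0] unfolding e2_0 by simp
    finally show ?thesis unfolding c_def by linarith
  qed
  with C(1) show ?thesis by (rule that)
qed

lemma common_speed:
  obtains s where "s > 0" "\<And>x r. r > 0 \<Longrightarrow> s * r / \<eta> 1 ^ 3 \<le> \<bar>lpos x r\<bar>"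
    "\<And>x r. r > 0 \<Longrightarrow> \<bar>lpos x r\<bar> \<le> \<eta> 1 ^ 3 * (s * r)"
proof -
  let ?H = "\<eta> 1"
  have H: "?H \<ge> 1" by (rule eta1_ge_1)
  obtain D1 where D1: "D1 > 0" "\<And>t. D1 / ?H \<le> \<bar>lpos gone (t + 1) - lpos gone t\<bar>"
      "\<And>t. \<bar>lpos gone (t + 1) - lpos gone t\<bar> \<le> ?H\<^sup>2 * D1"
    using step_scale[of 1 gone] by auto
  \<comment> \<open>Mean speeds of the line through the identity. They stay in a compact interval,
    and the one subsequence of times extracted from them serves for all lines.\<close>
  define a where "a m = \<bar>lpos gone (real (Suc m))\<bar> / real (Suc m)" for m
  have a: "a m \<in> {D1 / ?H .. ?H\<^sup>2 * D1}" for m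
    using lpos_multiple[OF _ D1(2,3), of "Suc m"] unfolding a_def
    by (simp add: pos_le_divide_eq pos_divide_le_eq mult.commute del: of_nat_Suc)
  obtain s k where s: "s \<in> {D1 / ?H .. ?H\<^sup>2 * D1}" and k: "strict_mono k" and lim: "(a \<circ> k) \<longlonglongrightarrow> s"
    using seq_compactE[OF compact_imp_seq_compact[OF compact_Icc]] a by metis
  have "D1 / ?H > 0" using D1(1) H by simp
  then have s0: "s > 0" using s by (simp only: atLeastAtMost_iff) linarith
  define T where "T j = real (Suc (k j))" for j
  have T0: "T j > 0" for j by (simp add: T_def)
  have Tinf: "filterlim T at_top sequentially"
    unfolding T_def
    by (rule filterlim_compose[OF filterlim_real_sequentially])
       (rule filterlim_compose[OF filterlim_Suc filterlim_subseq[OF k]])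
  have T1: "(\<lambda>j. c / T j) \<longlonglongrightarrow> 0" for c
    by (rule tendsto_divide_0[OF tendsto_const filterlim_at_top_imp_at_infinity[OF Tinf]])
  have aT: "(\<lambda>j. \<bar>lpos gone (T j)\<bar> / T j) \<longlonglongrightarrow> s" using lim by (simp add: o_def a_def T_def)
  have bounds: "D / ?H / r \<le> s \<and> s \<le> ?H\<^sup>2 * D / r"
    if r: "r > 0" and D: "D > 0" "\<And>t. D / \<eta> 1 \<le> \<bar>lpos x (t + r) - lpos x t\<bar>"
      "\<And>t. \<bar>lpos x (t + r) - lpos x t\<bar> \<le> (\<eta> 1)\<^sup>2 * D" for x r D
  proof -
    obtain C c where C: "C > 0" "\<And>t. t > 0 \<Longrightarrow>
        \<bar>\<bar>lpos x t\<bar> - \<bar>lpos gone t\<bar>\<bar> \<le> c + \<eta> (C * (1 + sqrt t) / t) * \<bar>lpos gone t\<bar>"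
      using lines_diverge_sublinearly by blast
    define E where "E j = \<eta> (C * (1 + sqrt (T j)) / T j)" for j
    have E: "E \<longlonglongrightarrow> 0"
    proof (rule LIMSEQ_I)
      fix e :: real assume "e > 0"
      then obtain d where d: "d > 0" "\<eta> d < e" using eta_lim by blast
      have "(\<lambda>j. C * (inverse (T j) + inverse (sqrt (T j)))) \<longlonglongrightarrow> C * (0 + 0)"
        by (intro tendsto_mult tendsto_add tendsto_const tendsto_inverse_0_at_top Tinf
              filterlim_compose[OF sqrt_at_top Tinf])
      moreover have "C * (inverse (T j) + inverse (sqrt (T j))) = C * (1 + sqrt (T j)) / T j" for j
      proof -
        have "sqrt (T j) * sqrt (T j) = T j" using T0[of j] by simp
        then have "inverse (sqrt (T j)) = sqrt (T j) / T j" using T0[of j] by (simp add: field_simps)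
        then show ?thesis by (simp add: divide_inverse distrib_left distrib_right)
      qed
      ultimately have "(\<lambda>j. C * (1 + sqrt (T j)) / T j) \<longlonglongrightarrow> 0" by simp
      then have "eventually (\<lambda>j. C * (1 + sqrt (T j)) / T j < d) sequentially"
        using d(1) by (rule order_tendstoD(2))
      moreover have "norm (E j - 0) < e" if "C * (1 + sqrt (T j)) / T j < d" for j
      proof -
        have p: "0 \<le> C * (1 + sqrt (T j)) / T j" using C(1) T0[of j] by simp
        have "E j \<le> \<eta> d" unfolding E_def by (rule eta_mono[OF p]) (use that in simp)
        moreover have "0 \<le> E j" unfolding E_def by (rule eta_nonneg[OF p])
        ultimately show ?thesis using d(2) by simp
      qed
      ultimately show "\<exists>N. \<forall>j\<ge>N. norm (E j - 0) < e"
        unfolding eventually_sequentially by blast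
    qed
    have near: "\<bar>\<bar>lpos x (T j)\<bar> / T j - \<bar>lpos gone (T j)\<bar> / T j\<bar> \<le> c / T j + E j * (\<bar>lpos gone (T j)\<bar> / T j)" for j
    proof -
      have "\<bar>\<bar>lpos x (T j)\<bar> / T j - \<bar>lpos gone (T j)\<bar> / T j\<bar> = \<bar>\<bar>lpos x (T j)\<bar> - \<bar>lpos gone (T j)\<bar>\<bar> / T j"
        using T0[of j] by (simp flip: diff_divide_distrib)
      also have "\<dots> \<le> (c + E j * \<bar>lpos gone (T j)\<bar>) / T j"
        unfolding E_def by (rule divide_right_mono[OF C(2)]) (use T0[of j] in auto)
      finally show ?thesis by (simp add: add_divide_distrib)
    qed
    have "(\<lambda>j. c / T j + E j * (\<bar>lpos gone (T j)\<bar> / T j)) \<longlonglongrightarrow> 0 + 0 * s"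
      by (intro tendsto_add tendsto_mult T1 E aT)
    then have "(\<lambda>j. c / T j + E j * (\<bar>lpos gone (T j)\<bar> / T j)) \<longlonglongrightarrow> 0" by simp
    then have "(\<lambda>j. \<bar>lpos x (T j)\<bar> / T j - \<bar>lpos gone (T j)\<bar> / T j) \<longlonglongrightarrow> 0"
      by (rule Lim_null_comparison[rotated]) (use near in simp)
    from tendsto_add[OF this aT] have xT: "(\<lambda>j. \<bar>lpos x (T j)\<bar> / T j) \<longlonglongrightarrow> s" by simp
    have lin: "(1 / r - 1 / T j) * (D / ?H) \<le> \<bar>lpos x (T j)\<bar> / T j"
        "\<bar>lpos x (T j)\<bar> / T j \<le> (1 / r + 1 / T j) * (?H\<^sup>2 * D)" for j
      using lpos_linear[OF r _ D(2,3) T0[of j]] D(1) H by auto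
    have "(\<lambda>j. (1 / r - 1 / T j) * (D / ?H)) \<longlonglongrightarrow> (1 / r - 0) * (D / ?H)"
      by (intro tendsto_mult tendsto_diff tendsto_const T1)
    from LIMSEQ_le[OF this xT] have "(1 / r - 0) * (D / ?H) \<le> s" using lin(1) by blast
    moreover have "(\<lambda>j. (1 / r + 1 / T j) * (?H\<^sup>2 * D)) \<longlonglongrightarrow> (1 / r + 0) * (?H\<^sup>2 * D)"
      by (intro tendsto_mult tendsto_add tendsto_const T1)
    from LIMSEQ_le[OF xT this] have "s \<le> (1 / r + 0) * (?H\<^sup>2 * D)" using lin(2) by blast
    ultimately show ?thesis by (simp add: mult.commute)
  qed
  \<comment> \<open>With H = \<eta>(1), the limit gives D <= H s r and s r <= H^2 D; inserted into
    the step bounds D / H and H^2 D, each yields a third power of H.\<close>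
  have main: "s * r / ?H ^ 3 \<le> \<bar>lpos x r\<bar> \<and> \<bar>lpos x r\<bar> \<le> ?H ^ 3 * (s * r)" if r: "r > 0" for x r
  proof -
    obtain D where D: "D > 0" "\<And>t. D / \<eta> 1 \<le> \<bar>lpos x (t + r) - lpos x t\<bar>"
      "\<And>t. \<bar>lpos x (t + r) - lpos x t\<bar> \<le> (\<eta> 1)\<^sup>2 * D"
      using step_scale[OF r, of x] by blast
    have b: "D \<le> ?H * (s * r)" "s * r \<le> ?H\<^sup>2 * D"
      using bounds[OF r D] r H by (simp_all add: pos_divide_le_eq pos_le_divide_eq mult_ac)
    have l: "D / ?H \<le> \<bar>lpos x r\<bar>" "\<bar>lpos x r\<bar> \<le> ?H\<^sup>2 * D" using D(2,3)[of 0] by simp_all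
    have "s * r / ?H ^ 3 \<le> ?H\<^sup>2 * D / ?H ^ 3" using b(2) H by (intro divide_right_mono) auto
    also have "\<dots> = D / ?H" using H by (simp add: power2_eq_square power3_eq_cube)
    finally have "s * r / ?H ^ 3 \<le> \<bar>lpos x r\<bar>" using l(1) by simp
    moreover have "?H\<^sup>2 * D \<le> ?H\<^sup>2 * (?H * (s * r))" using b(1) by (intro mult_left_mono) auto
    then have "\<bar>lpos x r\<bar> \<le> ?H ^ 3 * (s * r)"
      using l(2) by (simp add: power2_eq_square power3_eq_cube mult.assoc)
    ultimately show ?thesis ..
  qed
  show ?thesis by (rule that[OF s0]) (use main in blast)+
qed

theorem bilipschitz:
  obtains s where "s > 0" "\<And>x y. s / \<eta> 1 ^ 4 * gdist n x y \<le> gdist n (F x) (F y)"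
    "\<And>x y. gdist n (F x) (F y) \<le> s * \<eta> 1 ^ 4 * gdist n x y"
proof -
  let ?H = "\<eta> 1"
  have H: "?H \<ge> 1" by (rule eta1_ge_1)
  obtain s where s: "s > 0" "\<And>x r. r > 0 \<Longrightarrow> s * r / ?H ^ 3 \<le> \<bar>lpos x r\<bar>"
    "\<And>x r. r > 0 \<Longrightarrow> \<bar>lpos x r\<bar> \<le> ?H ^ 3 * (s * r)"
    using common_speed by blast
  have main: "s / ?H ^ 4 * gdist n x y \<le> gdist n (F x) (F y) \<and> gdist n (F x) (F y) \<le> s * ?H ^ 4 * gdist n x y" for x y
  proof (cases "gdist n x y = 0")
    case True
    then show ?thesis using F_cong[OF True] by simp
  next
    case False
    define r where "r = gdist n x y"
    have r: "r > 0" using False gdist_nonneg[of n x y] unfolding r_def by linarith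
    let ?z = "x \<odot> e2 r"
    have dz: "gdist n x ?z = r" using r by (simp add: gdist_def)
    have Fz: "gdist n (F x) (F ?z) = \<bar>lpos x r\<bar>" using line_dist[of x 0 r] unfolding e2_0 by simp
    have 1: "gdist n (F x) (F y) \<le> ?H * gdist n (F x) (F ?z)"
      by (rule qs_le) (use r dz in \<open>simp_all add: r_def\<close>)
    have 2: "gdist n (F x) (F ?z) \<le> ?H * gdist n (F x) (F y)"
      by (rule qs_le) (use r dz in \<open>simp_all add: r_def\<close>)
    have "s / ?H ^ 4 * r = s * r / ?H ^ 3 / ?H" by (simp add: power_numeral_reduce)
    also have "\<dots> \<le> (?H * gdist n (F x) (F y)) / ?H"
      using s(2)[OF r, of x] 2 H unfolding Fz by (intro divide_right_mono) auto
    also have "\<dots> = gdist n (F x) (F y)" using H by simp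
    finally have lo: "s / ?H ^ 4 * r \<le> gdist n (F x) (F y)" .
    have "?H * gdist n (F x) (F ?z) \<le> ?H * (?H ^ 3 * (s * r))"
      unfolding Fz using s(3)[OF r, of x] H by (intro mult_left_mono) auto
    also have "\<dots> = s * ?H ^ 4 * r" by (simp add: power_numeral_reduce)
    finally show ?thesis using lo 1 unfolding r_def by linarith
  qed
  show ?thesis by (rule that[OF s(1)]) (use main in blast)+
qed

end

section \<open>Inverse maps and the exponential chart\<close>

text \<open>A continuous injection of the half line is monotone; a decreasing one would have its
  maximum at 0 and could not be onto.\<close>

lemma halfline_homeomorphism:
  fixes \<eta> \<theta> :: "real \<Rightarrow> real"
  assumes h: "homeomorphism {0..} {0..} \<eta> \<theta>"
  shows "\<eta> 0 = 0" "strict_mono_on {0..} \<eta>"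
proof -
  have img: "\<eta> ` {0..} = {0..}" and inj: "inj_on \<eta> {0..}" and cont: "continuous_on {0..} \<eta>"
    using h by (auto simp: homeomorphism_def intro: inj_on_inverseI)
  have "\<not> strict_antimono_on {0..} \<eta>"
  proof
    assume anti: "strict_antimono_on {0..} \<eta>"
    have "\<eta> 0 \<in> {0..}" using img by blast
    then have "\<eta> 0 + 1 \<in> \<eta> ` {0..}" unfolding img by simp
    then obtain x where x: "x \<ge> 0" "\<eta> x = \<eta> 0 + 1" by force
    then have "x > 0" using le_less by fastforce
    then show False using monotone_onD[OF anti, of 0 x] x by simp
  qed
  then show mono: "strict_mono_on {0..} \<eta>"
    using injective_eq_monotone_map[of "{0..}" \<eta>] inj cont by (simp add: is_interval_ci)
  obtain x where x: "x \<ge> 0" "\<eta> x = 0" using img by (metis atLeast_iff imageE order_refl)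
  show "\<eta> 0 = 0"
  proof (cases "x = 0")
    case False
    then have "\<eta> 0 < 0" using strict_mono_onD[OF mono, of 0 x] x by simp
    moreover have "\<eta> 0 \<in> {0..}" using img by blast
    ultimately show ?thesis by simp
  qed (use x in simp)
qed

text \<open>The classical gauge of the inverse of a quasisymmetric map, with \<theta> standing for
  the inverse function of \<eta>.\<close>

definition inverse_gauge :: "(real \<Rightarrow> real) \<Rightarrow> real \<Rightarrow> real" where
  "inverse_gauge \<theta> t = (if t = 0 then 0 else 1 / \<theta> (1 / t))"

context qs_map
begin

definition qs_inverse :: "model \<Rightarrow> model" where
  "qs_inverse y = (SOME x. gdist n (F x) y = 0)"

lemma F_qs_inverse: "gdist n (F (qs_inverse y)) y = 0"
  unfolding qs_inverse_def by (rule someI_ex[OF onto])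

lemma qs_inverse_F: "gdist n (qs_inverse (F x)) x = 0"
  using pos[of "qs_inverse (F x)" x] F_qs_inverse[of "F x"] gdist_nonneg[of n "qs_inverse (F x)" x] by linarith

lemma gdist_F_qs_inverse: "gdist n (F (qs_inverse x)) (F (qs_inverse y)) = gdist n x y"
  by (rule gdist_cong[OF F_qs_inverse F_qs_inverse n1])

text \<open>The inequality for \<open>F\<close> is used with the roles of \<open>y\<close> and
  \<open>z\<close> exchanged; the monotone function \<theta> then solves it for the quotient of the
  distances in the source.\<close>

lemma qs_map_inverse:
  assumes h: "homeomorphism {0..} {0..} \<eta> \<theta>"
  shows "qs_map n (inverse_gauge \<theta>) qs_inverse"
proof -
  note \<theta> = halfline_homeomorphism[OF homeomorphism_symD[OF h]]
  have inv: "\<theta> t \<ge> 0" "\<eta> (\<theta> t) = t" "\<theta> (\<eta> t) = t" "\<eta> t \<ge> 0" if "t \<ge> 0" for t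
    using h that by (auto simp: homeomorphism_def)
  have \<theta>_pos: "\<theta> t > 0" if "t > 0" for t
    using strict_mono_onD[OF \<theta>(2), of 0 t] that \<theta>(1) by simp
  have \<theta>_le: "\<theta> s \<le> \<theta> t" if "0 \<le> s" "s \<le> t" for s t
    using strict_mono_onD[OF \<theta>(2), of s t] that by (cases "s = t") auto
  show ?thesis
  proof
    show "n \<ge> 3" by (rule n3)
    show "0 \<le> inverse_gauge \<theta> t" if "0 \<le> t" for t
      using inv(1)[of "1 / t"] that by (simp add: inverse_gauge_def)
    show "inverse_gauge \<theta> s \<le> inverse_gauge \<theta> t" if "0 \<le> s" "s \<le> t" for s t
    proof (cases "s = 0")
      case True
      then show ?thesis using inv(1)[of "1 / t"] that by (simp add: inverse_gauge_def)
    next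
      case False
      then have "\<theta> (1 / t) \<le> \<theta> (1 / s)" "\<theta> (1 / t) > 0"
        using that by (auto intro!: \<theta>_le \<theta>_pos simp: frac_le)
      then show ?thesis using False that by (simp add: inverse_gauge_def frac_le)
    qed
    show "\<exists>d>0. inverse_gauge \<theta> d < e" if e: "0 < e" for e
    proof -
      let ?b = "1 / e + 1"
      have b: "?b > 0" using e by (simp add: add_pos_pos)
      have \<eta>b: "\<eta> ?b > 0"
        using inv(4)[of ?b] inv(3)[of ?b] \<theta>(1) b by (cases "\<eta> ?b = 0") auto
      have "inverse_gauge \<theta> (1 / \<eta> ?b) = 1 / ?b"
        using \<eta>b inv(3)[of ?b] b by (simp add: inverse_gauge_def)
      also have "\<dots> < e" using e b by (simp add: pos_divide_less_eq distrib_left)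
      finally show ?thesis using \<eta>b by (intro exI[of _ "1 / \<eta> ?b"]) simp
    qed
    fix x y z
    let ?x = "qs_inverse x" and ?y = "qs_inverse y" and ?z = "qs_inverse z"
    show pz: "gdist n ?x ?z > 0" if "gdist n x z > 0"
      using that F_cong[of ?x ?z] gdist_nonneg[of n ?x ?z] gdist_F_qs_inverse[of x z] by linarith
    show "gdist n ?x ?y \<le> inverse_gauge \<theta> (gdist n x y / gdist n x z) * gdist n ?x ?z"
      if xz: "gdist n x z > 0"
    proof (cases "gdist n ?x ?y = 0")
      case True
      have "gdist n x y = 0" using F_cong[OF True] by (simp add: gdist_F_qs_inverse)
      then show ?thesis using True by (simp add: inverse_gauge_def)
    next
      case False
      then have xy': "gdist n ?x ?y > 0" using gdist_nonneg[of n ?x ?y] by linarith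
      have xy: "gdist n x y > 0" using pos[OF xy'] by (simp add: gdist_F_qs_inverse)
      have "gdist n x z \<le> \<eta> (gdist n ?x ?z / gdist n ?x ?y) * gdist n x y"
        using qs[OF xy', of ?z] by (simp add: gdist_F_qs_inverse)
      then have "gdist n x z / gdist n x y \<le> \<eta> (gdist n ?x ?z / gdist n ?x ?y)"
        using xy by (simp add: pos_divide_le_eq)
      then have "\<theta> (gdist n x z / gdist n x y) \<le> \<theta> (\<eta> (gdist n ?x ?z / gdist n ?x ?y))"
        by (intro \<theta>_le) auto
      also have "\<dots> = gdist n ?x ?z / gdist n ?x ?y" by (intro inv) simp
      finally have "\<theta> (gdist n x z / gdist n x y) * gdist n ?x ?y \<le> gdist n ?x ?z"
        using xy' by (simp add: pos_le_divide_eq)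
      moreover have "\<theta> (gdist n x z / gdist n x y) > 0" using xz xy by (intro \<theta>_pos) simp
      ultimately have "gdist n ?x ?y \<le> gdist n ?x ?z / \<theta> (gdist n x z / gdist n x y)"
        by (simp add: pos_le_divide_eq mult.commute)
      then show ?thesis using xz xy by (simp add: inverse_gauge_def)
    qed
    show "\<exists>y. gdist n (qs_inverse y) x = 0" using qs_inverse_F by blast
  qed
qed

text \<open>The inverse is itself a \<open>qs_map\<close>, so it takes the line through
  \<open>F x\<close> into the line through \<open>x\<close>; every point of the former is thus the
  image of a point of the latter.\<close>

lemma qs_lines_of_homeomorphism:
  assumes h: "homeomorphism {0..} {0..} \<eta> \<theta>"
  shows "qs_lines n \<eta> F"
proof (unfold_locales)
  interpret G: qs_map n "inverse_gauge \<theta>" qs_inverse by (rule qs_map_inverse[OF h])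
  fix x s
  let ?y = "F x \<odot> e2 s" and ?t = "G.lpos (F x) s"
  have "gdist n (qs_inverse ?y) (qs_inverse (F x) \<odot> e2 ?t) = 0" by (rule G.line_image)
  moreover have "gdist n (qs_inverse (F x) \<odot> e2 ?t) (x \<odot> e2 ?t) = 0"
    using qs_inverse_F[of x] by (simp add: gdist_0_iff[OF n1] snd_gmul)
  ultimately have "gdist n (qs_inverse ?y) (x \<odot> e2 ?t) = 0" by (rule gdist_0_trans[OF _ _ n1])
  then have "gdist n (F (qs_inverse ?y)) (F (x \<odot> e2 ?t)) = 0" by (rule F_cong)
  then have "gdist n ?y (F x \<odot> e2 (lpos x ?t)) = 0"
    using gdist_cong[OF F_qs_inverse line_image n1, of ?y x ?t] by simp
  then show "\<exists>t. lpos x t = s" by (intro exI[of _ ?t]) (simp add: gdist_e2)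
qed

end

section \<open>Transfer to the group in exponential coordinates\<close>

definition to_model :: "nat \<Rightarrow> (nat \<Rightarrow> real) \<Rightarrow> model" where
  "to_model n x = (x 1, phi (x 1) * vec_fps n x)"

definition from_model :: "nat \<Rightarrow> model \<Rightarrow> nat \<Rightarrow> real" where
  "from_model n g = (\<lambda>i. if i = 1 then fst g else if i \<in> {2..n+1} then hlog g $ (i - 2) else 0)"

lemma from_model_filiform [simp]: "from_model n g \<in> filiform n"
  by (auto simp: from_model_def filiform_def)

lemma fst_to_model: "fst (to_model n x) = x 1"
  by (simp add: to_model_def)

lemma hlog_to_model: "hlog (to_model n x) = vec_fps n x"
  by (simp add: hlog_def to_model_def inverse_mult_eq_1 flip: mult.assoc)

lemma from_model_to_model: "x \<in> filiform n \<Longrightarrow> from_model n (to_model n x) = x"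
  by (rule ext) (auto simp: from_model_def hlog_to_model filiform_def fst_to_model simp del: add_2_eq_Suc')

lemma to_model_from_model:
  assumes "n \<ge> 1"
  shows "gdist n (to_model n (from_model n g)) g = 0"
  unfolding gdist_0_iff[OF assms]
proof (intro conjI allI impI)
  show "fst (to_model n (from_model n g)) = fst g" by (simp add: to_model_def from_model_def)
  fix k assume k: "k < n"
  have "(phi (fst g) * vec_fps n (from_model n g)) $ k = (phi (fst g) * hlog g) $ k"
    unfolding fps_mult_nth using k by (intro sum.cong) (auto simp: from_model_def)
  then show "snd (to_model n (from_model n g)) $ k = snd g $ k"
    by (simp add: phi_hlog to_model_def from_model_def)
qed

lemma from_model_cong:
  assumes "gdist n g h = 0" "n \<ge> 1"
  shows "from_model n g = from_model n h"
proof -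
  note * = assms(1)[unfolded gdist_0_iff[OF assms(2)]]
  have "hlog g $ k = hlog h $ k" if "k < n" for k
    unfolding hlog_def fps_mult_nth using * that by (intro sum.cong) auto
  then show ?thesis using * by (auto simp: from_model_def fun_eq_iff)
qed

lemma to_model_minus: "to_model n (\<lambda>i. - x i) = ginv (to_model n x)"
proof -
  have "vec_fps n (\<lambda>i. - x i) = - vec_fps n x" by (rule fps_ext) simp
  then show ?thesis by (simp add: to_model_def ginv_def phi_minus mult.assoc)
qed

text \<open>Here Dynkin's series meets the model: by \<open>bch_coord\<close> the coordinates of the
  Baker--Campbell--Hausdorff product are the coefficients of \<open>hlog\<close> of the model
  product.\<close>

lemma hom_dist_eq_gdist:
  assumes "n \<ge> 1"
  shows "hom_dist n x y = gdist n (to_model n x) (to_model n y)"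
proof -
  let ?b = "bch n (\<lambda>i. - x i) y"
  let ?g = "ginv (to_model n x) \<odot> to_model n y"
  have g: "?g = to_model n (\<lambda>i. - x i) \<odot> to_model n y" by (simp only: to_model_minus)
  have b1: "?b 1 = fst ?g"
    unfolding g by (simp only: bch_coord_1[OF assms] fst_gmul) (simp add: to_model_def)
  have b: "?b (j + 2) = hlog ?g $ j" if "j < n" for j
    unfolding bch_coord[OF that] g hlog_def by (simp add: to_model_def gmul_def)
  have "?b 2 = snd ?g $ 0" using b[of 0] assms by (simp add: hlog_nth_0 numeral_2_eq_2)
  moreover have "(\<Sum>i=3..n+1. \<bar>?b i\<bar> powr (1 / (real i - 1))) =
      (\<Sum>k=1..<n. \<bar>?b (k + 2)\<bar> powr (1 / (real (k + 2) - 1)))"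
    by (rule sum.reindex_bij_witness[of _ "\<lambda>k. k + 2" "\<lambda>i. i - 2"])
       (auto simp del: add_2_eq_Suc')
  then have "(\<Sum>i=3..n+1. \<bar>?b i\<bar> powr (1 / (real i - 1))) =
      (\<Sum>k=1..<n. \<bar>hlog ?g $ k\<bar> powr (1 / real (Suc k)))"
    by (simp add: b del: add_2_eq_Suc')
  ultimately show ?thesis
    unfolding hom_dist_def hom_norm_def gdist_def gnorm_def b1 by simp
qed

lemma hom_dist_from_model:
  assumes "n \<ge> 1"
  shows "hom_dist n (from_model n g) (from_model n h) = gdist n g h"
  unfolding hom_dist_eq_gdist[OF assms]
  by (rule gdist_cong[OF to_model_from_model to_model_from_model]) fact+

lemma hom_dist_pos:
  assumes "x \<in> filiform n" "y \<in> filiform n" "x \<noteq> y" "n \<ge> 1"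
  shows "hom_dist n x y > 0"
proof -
  have "gdist n (to_model n x) (to_model n y) \<noteq> 0"
    using from_model_cong[of n "to_model n x" "to_model n y"] assms by (auto simp: from_model_to_model)
  then show ?thesis
    unfolding hom_dist_eq_gdist[OF assms(4)] using gdist_nonneg[of n "to_model n x" "to_model n y"] by linarith
qed

text \<open>The definition concerns three distinct points, whereas \<open>qs_map\<close> also admits
  \<open>y = x\<close> and \<open>y = z\<close>. The case \<open>y = z\<close> needs \<eta>(1) >= 1,
  which comes from a point with two others at equal distance: both quotients of the image distances
  are at most \<eta>(1), and one of them is at least 1.\<close>

lemma quasisymmetric_qs_map:
  assumes n: "n \<ge> 3" and h: "homeomorphism {0..} {0..} \<eta> \<theta>"
    and qs: "quasisymmetric \<eta> (filiform n) (hom_dist n) (filiform n) (hom_dist n) F"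
  shows "qs_map n \<eta> (\<lambda>g. to_model n (F (from_model n g)))"
proof -
  have n1: "n \<ge> 1" using n by simp
  obtain G where G: "homeomorphism (filiform n) (filiform n) F G" using qs by (auto simp: quasisymmetric_def)
  have Fim: "F x \<in> filiform n" if "x \<in> filiform n" for x using G that by (auto simp: homeomorphism_def)
  have Finj: "F x = F y \<longleftrightarrow> x = y" if "x \<in> filiform n" "y \<in> filiform n" for x y
    using G that by (metis homeomorphism_apply1)
  have d: "hom_dist n (F (from_model n g)) (F (from_model n h)) =
      gdist n (to_model n (F (from_model n g))) (to_model n (F (from_model n h)))" for g h
    by (rule hom_dist_eq_gdist[OF n1])
  let ?P = "from_model n"
  have distinct: "?P g \<noteq> ?P h" if "gdist n g h > 0" for g h
  proof
    assume "?P g = ?P h"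
    then show False using that hom_dist_from_model[OF n1, of g h]
      by (simp add: hom_dist_eq_gdist[OF n1] gdist_self[OF n1])
  qed
  have pos: "hom_dist n (F (?P g)) (F (?P h)) > 0" if "?P g \<noteq> ?P h" for g h
    by (rule hom_dist_pos) (use that n1 Fim Finj in auto)
  have quot: "hom_dist n (F (?P x)) (F (?P y)) / hom_dist n (F (?P x)) (F (?P z)) \<le> \<eta> (gdist n x y / gdist n x z)"
    if "?P x \<noteq> ?P y" "?P y \<noteq> ?P z" "?P x \<noteq> ?P z" for x y z
    using qs that unfolding quasisymmetric_def by (auto simp flip: hom_dist_from_model[OF n1])
  have \<eta>1: "\<eta> 1 \<ge> 1"
  proof -
    let ?x = "?P gone" and ?y = "?P (e2 1)" and ?z = "?P (e2 (- 1))"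
    let ?a = "hom_dist n (F ?x) (F ?y)" and ?b = "hom_dist n (F ?x) (F ?z)"
    have D: "?x \<noteq> ?y" "?y \<noteq> ?z" "?x \<noteq> ?z" by (rule distinct, simp add: gdist_e2 del: fps_const_1_eq_1 fps_const_neg)+
    have "?a / ?b \<le> \<eta> 1" "?b / ?a \<le> \<eta> 1"
      using quot[OF D] quot[OF D(3) D(2)[symmetric] D(1)] by (simp_all add: gdist_e2)
    moreover have "?a > 0" "?b > 0" using D by (auto intro: pos)
    ultimately show ?thesis
      using le_divide_eq_1_pos[of ?b ?a] le_divide_eq_1_pos[of ?a ?b] by linarith
  qed
  note \<eta> = halfline_homeomorphism[OF h]
  have nonneg: "\<eta> t \<ge> 0" if "t \<ge> 0" for t using h that by (auto simp: homeomorphism_def)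
  show ?thesis
  proof
    show "n \<ge> 3" by fact
    show "0 \<le> \<eta> t" if "0 \<le> t" for t by (rule nonneg[OF that])
    show "\<eta> s \<le> \<eta> t" if "0 \<le> s" "s \<le> t" for s t
      using strict_mono_onD[OF \<eta>(2), of s t] that by (cases "s = t") auto
    show "\<exists>d>0. \<eta> d < e" if e: "0 < e" for e
    proof -
      note inv = homeomorphism_symD[OF h]
      have "\<theta> (e / 2) > 0"
        using strict_mono_onD[OF halfline_homeomorphism(2)[OF inv], of 0 "e / 2"]
          halfline_homeomorphism(1)[OF inv] e by simp
      moreover have "\<eta> (\<theta> (e / 2)) = e / 2" using h e by (auto simp: homeomorphism_def)
      ultimately show ?thesis using e by (intro exI[of _ "\<theta> (e / 2)"]) simp
    qed
    fix x y z :: model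
    show "gdist n (to_model n (F (?P x))) (to_model n (F (?P y)))
        \<le> \<eta> (gdist n x y / gdist n x z) * gdist n (to_model n (F (?P x))) (to_model n (F (?P z)))"
      if xz: "gdist n x z > 0"
    proof (cases "?P x = ?P y")
      case True
      then show ?thesis using nonneg[of "gdist n x y / gdist n x z"] by (simp add: gdist_self[OF n1])
    next
      case False
      have p: "hom_dist n (F (?P x)) (F (?P z)) > 0" by (rule pos[OF distinct[OF xz]])
      show ?thesis
      proof (cases "?P y = ?P z")
        case True
        then have "gdist n x y = gdist n x z" by (simp flip: hom_dist_from_model[OF n1])
        then show ?thesis
          using True xz mult_right_mono[OF \<eta>1 gdist_nonneg[of n "to_model n (F (?P x))" "to_model n (F (?P z))"]]
          by simp
      next
        case yz: False
        show ?thesis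
          using quot[OF False yz distinct[OF xz]] p unfolding pos_divide_le_eq[OF p] by (simp only: d)
      qed
    qed
    show "gdist n (to_model n (F (?P x))) (to_model n (F (?P z))) > 0" if "gdist n x z > 0"
      using pos[OF distinct[OF that]] by (simp only: d)
    show "\<exists>x. gdist n (to_model n (F (?P x))) y = 0"
    proof -
      obtain v where v: "v \<in> filiform n" "F v = ?P y"
        using G from_model_filiform[of n y] by (metis homeomorphism_apply2 homeomorphism_image2 imageI)
      then have "to_model n (F (?P (to_model n v))) = to_model n (?P y)" by (simp add: from_model_to_model)
      then show ?thesis using to_model_from_model[OF n1, of y] by metis
    qed
  qed
qed

theorem lemma3p11:
  fixes n :: nat and \<eta> :: "real \<Rightarrow> real" and F :: "(nat \<Rightarrow> real) \<Rightarrow> (nat \<Rightarrow> real)"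
  assumes "n \<ge> 3"
    and "\<exists>\<theta>. homeomorphism {0..} {0..} \<eta> \<theta>"
    and "quasisymmetric \<eta> (filiform n) (hom_dist n) (filiform n) (hom_dist n) F"
  shows "\<exists>C>0. quasi_similarity (2 * \<eta> 1 ^ 4) C
           (filiform n) (hom_dist n) (filiform n) (hom_dist n) F"
proof -
  have n1: "n \<ge> 1" using assms(1) by simp
  obtain \<theta> where h: "homeomorphism {0..} {0..} \<eta> \<theta>" using assms(2) by blast
  let ?F = "\<lambda>g. to_model n (F (from_model n g))"
  interpret qs_map n \<eta> ?F by (rule quasisymmetric_qs_map[OF assms(1) h assms(3)])
  interpret qs_lines n \<eta> ?F by (rule qs_lines_of_homeomorphism[OF h])
  obtain s where s: "s > 0" "\<And>x y. s / \<eta> 1 ^ 4 * gdist n x y \<le> gdist n (?F x) (?F y)"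
    "\<And>x y. gdist n (?F x) (?F y) \<le> s * \<eta> 1 ^ 4 * gdist n x y"
    using bilipschitz by blast
  have H: "\<eta> 1 ^ 4 \<ge> 1" using eta1_ge_1 by (rule one_le_power)
  have "s / (2 * \<eta> 1 ^ 4) * hom_dist n x y \<le> hom_dist n (F x) (F y) \<and>
      hom_dist n (F x) (F y) \<le> s * (2 * \<eta> 1 ^ 4) * hom_dist n x y"
    if xy: "x \<in> filiform n" "y \<in> filiform n" for x y
  proof -
    let ?d = "hom_dist n x y"
    have d: "?d \<ge> 0" by (simp add: hom_dist_eq_gdist[OF n1])
    have b: "s / \<eta> 1 ^ 4 * ?d \<le> hom_dist n (F x) (F y)" "hom_dist n (F x) (F y) \<le> s * \<eta> 1 ^ 4 * ?d"
      using s(2,3)[of "to_model n x" "to_model n y"] xy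
      by (simp_all add: hom_dist_eq_gdist[OF n1] from_model_to_model)
    have "s / (2 * \<eta> 1 ^ 4) * ?d \<le> s / \<eta> 1 ^ 4 * ?d"
      using s(1) H d by (intro mult_right_mono divide_left_mono) auto
    moreover have "s * \<eta> 1 ^ 4 * ?d \<le> s * (2 * \<eta> 1 ^ 4) * ?d"
      using s(1) H d by (intro mult_right_mono mult_left_mono) auto
    ultimately show ?thesis using b by linarith
  qed
  moreover obtain G where "homeomorphism (filiform n) (filiform n) F G"
    using assms(3) by (auto simp: quasisymmetric_def)
  then have "bij_betw F (filiform n) (filiform n)"
    by (metis bij_betw_def homeomorphism_def inj_on_inverseI)
  ultimately have "quasi_similarity (2 * \<eta> 1 ^ 4) s (filiform n) (hom_dist n) (filiform n) (hom_dist n) F"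
    unfolding quasi_similarity_def using s(1) H by auto
  then show ?thesis using s(1) by blast
qed

end
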